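(* Let $p$ be a prime and let $\mathbb{M}\colon (\mathbf{gpd}^{\mathrm{f}})^{\mathrm{op}}\to\mathbf{Add}$ be a $p$-monadic Mackey $2$-functor. Then, for any finite group $G$ and any $p$-Sylow subgroup $S$ of $G$, there is an equivalence of categories $$\mathbb{M}(G)\;\cong\;\operatorname*{bilim}_{\hat{\mathcal T}_S(G)^{\mathrm{op}}}\ \mathbb{M}\circ\mathbb{U},$$ where $\hat{\mathcal T}_S(G)$ is the extended transporter $2$-category of $G$, $\mathbb{U}\colon\hat{\mathcal T}_S(G)\to\mathbf{gpd}^{\mathrm{f}}$ is its forgetful $2$-functor, and the bilimit is the pseudo bilimit taken in the $2$-category of categories.
   Context: **2-categories.** "$2$-category" and "$2$-functor" mean the strict notions. A $(2,1)$-category is a $2$-category all of whose $2$-morphisms are invertible. The opposite $\mathbf{C}^{\mathrm{op}}$ of a $2$-category reverses $1$-morphisms only: $\mathbf{C}^{\mathrm{op}}(A,B)=\mathbf{C}(B,A)$. $\mathbf{Cat}$ is the $2$-category of small categories; $\mathbf{Add}$ is the $2$-category of small additive categories. $\mathbf{gpd}^{\mathrm{f}}$ is the $(2,1)$-category of finite groupoids, faithful functors and natural transformations; finite groups are viewed as one-object groupoids. $[\mathbf{A},\mathbf{B}]$ is the $2$-category of pseudofunctors, pseudonatural transformations and modifications, and $\Delta T$ is the constant $2$-functor with value $T$. **Bilimits.** A (pseudo) bilimit of a $2$-functor $\mathbb{D}\colon\mathbf{I}\to\mathbf{C}$ is an object $L$ of $\mathbf{C}$ with equivalences $\mathbf{C}(T,L)\cong[\mathbf{I},\mathbf{C}](\Delta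 T,\mathbb{D})$ pseudonatural in $T$. It is unique up to equivalence and denoted $\operatorname{bilim}_{\mathbf{I}}\mathbb{D}$. A $2$-pullback of $f\colon a\to c$ and $g\colon b\to c$ is a bilimit $(f|g)$ of this cospan; it comes with projections $q_1\colon (f|g)\to a$, $q_2\colon (f|g)\to b$ and an invertible $2$-morphism $\lambda\colon f q_1\Rightarrow g q_2$. (In $\mathbf{gpd}^{\mathrm{f}}$ it can be realized by the iso-comma groupoid.) **Extended transporter category.** Let $G$ be a finite group, $S$ a $p$-Sylow subgroup, $i\colon S\to G$ the inclusion. $\hat{\mathcal T}_S(G)$ is the $(2,1)$-category with: - objects: pairs $(P,j_P)$ of a finite groupoid $P$ and a faithful functor $j_P\colon P\to S$; - $1$-morphisms $(P,j_P)\to(Q,j_Q)$: pairs $(a,\alpha)$ of a faithful functor $a\colon P\to Q$ and a $2$-morphism $\alpha\colon i j_Q a\Rightarrow i j_P$ in $\mathbf{gpd}^{\mathrm{f}}$; - $2$-morphisms $(a,\alpha)\Rightarrow(b,\beta)$: $2$-morphisms $\zeta\colon a\Rightarrow b$ in $\mathbf{gpd}^{\mathrm{f}}$ with $\beta\circ(i j_Q\zeta)=\alpha$; - compositions induced by pasting; in particular $(b,\beta)\circ(a,\alpha)=(ba,\ \alpha\circ\beta a)$. The forgetful $2$-functor $\mathbb{U}\colon\hat{\mathcal T}_S(G)\to\mathbf{gpd}^{\mathrm{f}}$ sends $(P,j_P)\mapsto P$, $(a,\alpha)\mapsto a$, $\zeta\mapsto\zeta$. The diagram $\mathbb{M}\circ\mathbb{U}$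 is defined on $\hat{\mathcal T}_S(G)^{\mathrm{op}}$. **Mackey $2$-functors.** For a $2$-functor $\mathbb{M}$ on $(\mathbf{gpd}^{\mathrm{f}})^{\mathrm{op}}$ write $f^*=\mathbb{M}(f)$ and $\alpha^*=\mathbb{M}(\alpha)$. A Mackey $2$-functor is a $2$-functor $\mathbb{M}\colon(\mathbf{gpd}^{\mathrm{f}})^{\mathrm{op}}\to\mathbf{Add}$ such that: 1. (Additivity) for the canonical inclusions $i_G\colon G\to G\sqcup H$, $i_H\colon H\to G\sqcup H$ into a coproduct of groupoids, $(i_G^*,i_H^* )\colon\mathbb{M}(G\sqcup H)\to\mathbb{M}(G)\times\mathbb{M}(H)$ is an equivalence; 2. for every $1$-morphism $f$ of $\mathbf{gpd}^{\mathrm{f}}$, $f^*$ has a left adjoint $f_!$ and a right adjoint $f_*$; 3. (Beck–Chevalley) for every $2$-pullback $(f|g)$ in $\mathbf{gpd}^{\mathrm{f}}$ of $1$-morphisms $f\colon a\to c$ and $g\colon b\to c$, with projections $q_1\colon (f|g)\to a$, $q_2\colon (f|g)\to b$ and invertible $2$-morphism $\lambda\colon f q_1\Rightarrow g q_2$, the mate $\lambda_!\colon q_{2!}q_1^*\Rightarrow g^*f_!$ of $\lambda^*\colon q_1^*f^*\Rightarrow q_2^*g^*$, i.e. the composite $q_{2!}q_1^*\Rightarrow q_{2!}q_1^*f^*f_!\xrightarrow{\lambda^*}q_{2!}q_2^*g^*f_!\Rightarrow g^*f_!$ (unit of $f_!\dashv f^*$, $\lambda^*$, counit of $q_{2!}\dashv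 q_2^*$), and the mate $(\lambda^{-1})_*\colon g^*f_*\Rightarrow q_{2*}q_1^*$ of $(\lambda^{-1})^*$, i.e. the composite $g^*f_*\Rightarrow q_{2*}q_2^*g^*f_*\Rightarrow q_{2*}q_1^*f^*f_*\Rightarrow q_{2*}q_1^*$, are both invertible; 4. (Ambidexterity) for every $1$-morphism $f$, $f_!\simeq f_*$. A Mackey $2$-functor $\mathbb{M}$ is *$p$-monadic* if for every inclusion of (finite) groups $k\colon H\to K$ with index $[K:H]$ coprime to $p$, the canonical comparison functor $\mathbb{M}(K)\to\mathbb{M}(H)^{\mathsf T}$, $x\mapsto(k^*x,\,k^*\epsilon_x)$, is an equivalence, where $\mathsf T=k^*k_!$ is the monad induced by the adjunction $k_!\dashv k^*$ with counit $\epsilon$, and $\mathbb{M}(H)^{\mathsf T}$ is the Eilenberg–Moore category of $\mathsf T$-algebras. *)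

theory Defs
  imports
    "HOL-Algebra.Sylow"
    "HOL-Library.FuncSet"
    "HOL-Library.Infinite_Typeclass"
begin

section \<open>Small categories, functors and natural transformations\<close>

text \<open>
  A small category has its objects and arrows in two types, which play the role of the universe.
  \<open>Comp C g f\<close> is the composite ``g after f''.  The fields are constrained on the carriers only.
\<close>

record ('o, 'm) cat =
  Obj :: "'o set"
  Arr :: "'m set"
  Dom :: "'m \<Rightarrow> 'o"
  Cod :: "'m \<Rightarrow> 'o"
  Ident :: "'o \<Rightarrow> 'm"
  Comp :: "'m \<Rightarrow> 'm \<Rightarrow> 'm"

definition homs :: "('o, 'm) cat \<Rightarrow> 'o \<Rightarrow> 'o \<Rightarrow> 'm set" where
  "homs C x y = {f \<in> Arr C. Dom C f = x \<and> Cod C f = y}"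

locale category =
  fixes C :: "('o, 'm) cat"
  assumes Dom_Obj: "f \<in> Arr C \<Longrightarrow> Dom C f \<in> Obj C"
    and Cod_Obj: "f \<in> Arr C \<Longrightarrow> Cod C f \<in> Obj C"
    and Ident_homs: "x \<in> Obj C \<Longrightarrow> Ident C x \<in> homs C x x"
    and Comp_homs: "f \<in> homs C x y \<Longrightarrow> g \<in> homs C y z \<Longrightarrow> Comp C g f \<in> homs C x z"
    and Comp_Ident_right: "f \<in> homs C x y \<Longrightarrow> Comp C f (Ident C x) = f"
    and Comp_Ident_left: "f \<in> homs C x y \<Longrightarrow> Comp C (Ident C y) f = f"
    and Comp_assoc: "f \<in> homs C w x \<Longrightarrow> g \<in> homs C x y \<Longrightarrow> h \<in> homs C y z \<Longrightarrow>
      Comp C h (Comp C g f) = Comp C (Comp C h g) f"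

definition iso_arrow :: "('o, 'm) cat \<Rightarrow> 'm \<Rightarrow> bool" where
  "iso_arrow C f \<longleftrightarrow> f \<in> Arr C \<and>
    (\<exists>g \<in> homs C (Cod C f) (Dom C f).
      Comp C g f = Ident C (Dom C f) \<and> Comp C f g = Ident C (Cod C f))"

text \<open>
  Functors and natural transformations carry their source and target, and their action is
  \<^const>\<open>extensional\<close>, so that the equations between them in strict 2-categories are plain HOL
  equalities.
\<close>

record ('o, 'm, 'p, 'n) cfunctor =
  fdom :: "('o, 'm) cat"
  fcod :: "('p, 'n) cat"
  fob :: "'o \<Rightarrow> 'p"
  far :: "'m \<Rightarrow> 'n"

locale is_functor =
  fixes F :: "('o, 'm, 'p, 'n) cfunctor"
  assumes dom_category: "category (fdom F)"
    and cod_category: "category (fcod F)"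
    and fob_extensional: "fob F \<in> extensional (Obj (fdom F))"
    and far_extensional: "far F \<in> extensional (Arr (fdom F))"
    and fob_Obj: "x \<in> Obj (fdom F) \<Longrightarrow> fob F x \<in> Obj (fcod F)"
    and far_homs: "f \<in> homs (fdom F) x y \<Longrightarrow> far F f \<in> homs (fcod F) (fob F x) (fob F y)"
    and far_Ident: "x \<in> Obj (fdom F) \<Longrightarrow> far F (Ident (fdom F) x) = Ident (fcod F) (fob F x)"
    and far_Comp: "f \<in> homs (fdom F) x y \<Longrightarrow> g \<in> homs (fdom F) y z \<Longrightarrow>
      far F (Comp (fdom F) g f) = Comp (fcod F) (far F g) (far F f)"

definition incl_functor :: "('o, 'm) cat \<Rightarrow> ('o, 'm) cat \<Rightarrow> ('o, 'm, 'o, 'm) cfunctor" where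
  "incl_functor A B =
    \<lparr>fdom = A, fcod = B, fob = (\<lambda>x\<in>Obj A. x), far = (\<lambda>f\<in>Arr A. f)\<rparr>"

definition id_functor :: "('o, 'm) cat \<Rightarrow> ('o, 'm, 'o, 'm) cfunctor" where
  "id_functor A = incl_functor A A"

definition functor_comp ::
    "('p, 'n, 'q, 'r) cfunctor \<Rightarrow> ('o, 'm, 'p, 'n) cfunctor \<Rightarrow> ('o, 'm, 'q, 'r) cfunctor" where
  "functor_comp G F =
    \<lparr>fdom = fdom F, fcod = fcod G,
     fob = (\<lambda>x\<in>Obj (fdom F). fob G (fob F x)),
     far = (\<lambda>f\<in>Arr (fdom F). far G (far F f))\<rparr>"

definition faithful_functor :: "('o, 'm, 'p, 'n) cfunctor \<Rightarrow> bool" where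
  "faithful_functor F \<longleftrightarrow> is_functor F \<and>
    (\<forall>x\<in>Obj (fdom F). \<forall>y\<in>Obj (fdom F). inj_on (far F) (homs (fdom F) x y))"

record ('o, 'm, 'p, 'n) ntrans =
  ntdom :: "('o, 'm, 'p, 'n) cfunctor"
  ntcod :: "('o, 'm, 'p, 'n) cfunctor"
  ntc :: "'o \<Rightarrow> 'n"

locale is_ntrans =
  fixes \<tau> :: "('o, 'm, 'p, 'n) ntrans"
  assumes ntdom_functor: "is_functor (ntdom \<tau>)"
    and ntcod_functor: "is_functor (ntcod \<tau>)"
    and parallel_dom: "fdom (ntcod \<tau>) = fdom (ntdom \<tau>)"
    and parallel_cod: "fcod (ntcod \<tau>) = fcod (ntdom \<tau>)"
    and ntc_extensional: "ntc \<tau> \<in> extensional (Obj (fdom (ntdom \<tau>)))"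
    and ntc_homs: "x \<in> Obj (fdom (ntdom \<tau>)) \<Longrightarrow>
      ntc \<tau> x \<in> homs (fcod (ntdom \<tau>)) (fob (ntdom \<tau>) x) (fob (ntcod \<tau>) x)"
    and ntc_natural: "f \<in> homs (fdom (ntdom \<tau>)) x y \<Longrightarrow>
      Comp (fcod (ntdom \<tau>)) (ntc \<tau> y) (far (ntdom \<tau>) f) =
      Comp (fcod (ntdom \<tau>)) (far (ntcod \<tau>) f) (ntc \<tau> x)"

definition id_nt :: "('o, 'm, 'p, 'n) cfunctor \<Rightarrow> ('o, 'm, 'p, 'n) ntrans" where
  "id_nt F = \<lparr>ntdom = F, ntcod = F, ntc = (\<lambda>x\<in>Obj (fdom F). Ident (fcod F) (fob F x))\<rparr>"

definition vcomp ::
    "('o, 'm, 'p, 'n) ntrans \<Rightarrow> ('o, 'm, 'p, 'n) ntrans \<Rightarrow> ('o, 'm, 'p, 'n) ntrans" where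
  "vcomp \<sigma> \<tau> =
    \<lparr>ntdom = ntdom \<tau>, ntcod = ntcod \<sigma>,
     ntc = (\<lambda>x\<in>Obj (fdom (ntdom \<tau>)). Comp (fcod (ntdom \<tau>)) (ntc \<sigma> x) (ntc \<tau> x))\<rparr>"

definition hcomp ::
    "('p, 'n, 'q, 'r) ntrans \<Rightarrow> ('o, 'm, 'p, 'n) ntrans \<Rightarrow> ('o, 'm, 'q, 'r) ntrans" where
  "hcomp \<sigma> \<tau> =
    \<lparr>ntdom = functor_comp (ntdom \<sigma>) (ntdom \<tau>), ntcod = functor_comp (ntcod \<sigma>) (ntcod \<tau>),
     ntc = (\<lambda>x\<in>Obj (fdom (ntdom \<tau>)).
       Comp (fcod (ntdom \<sigma>)) (ntc \<sigma> (fob (ntcod \<tau>) x)) (far (ntdom \<sigma>) (ntc \<tau> x)))\<rparr>"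

definition whisker_left ::
    "('p, 'n, 'q, 'r) cfunctor \<Rightarrow> ('o, 'm, 'p, 'n) ntrans \<Rightarrow> ('o, 'm, 'q, 'r) ntrans" where
  "whisker_left G \<tau> = hcomp (id_nt G) \<tau>"

definition whisker_right ::
    "('p, 'n, 'q, 'r) ntrans \<Rightarrow> ('o, 'm, 'p, 'n) cfunctor \<Rightarrow> ('o, 'm, 'q, 'r) ntrans" where
  "whisker_right \<sigma> F = hcomp \<sigma> (id_nt F)"

definition natural_iso :: "('o, 'm, 'p, 'n) ntrans \<Rightarrow> bool" where
  "natural_iso \<tau> \<longleftrightarrow> is_ntrans \<tau> \<and>
    (\<forall>x\<in>Obj (fdom (ntdom \<tau>)). iso_arrow (fcod (ntdom \<tau>)) (ntc \<tau> x))"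

definition isomorphic_functors ::
    "('o, 'm, 'p, 'n) cfunctor \<Rightarrow> ('o, 'm, 'p, 'n) cfunctor \<Rightarrow> bool" where
  "isomorphic_functors F G \<longleftrightarrow> (\<exists>\<tau>. natural_iso \<tau> \<and> ntdom \<tau> = F \<and> ntcod \<tau> = G)"

definition is_equivalence :: "('o, 'm, 'p, 'n) cfunctor \<Rightarrow> bool" where
  "is_equivalence F \<longleftrightarrow> is_functor F \<and>
    (\<exists>G. is_functor G \<and> fdom G = fcod F \<and> fcod G = fdom F \<and>
      isomorphic_functors (functor_comp G F) (id_functor (fdom F)) \<and>
      isomorphic_functors (functor_comp F G) (id_functor (fcod F)))"

definition equivalent_categories :: "('o, 'm) cat \<Rightarrow> ('p, 'n) cat \<Rightarrow> bool" where
  "equivalent_categories A B \<longleftrightarrow> (\<exists>F. is_equivalence F \<and> fdom F = A \<and> fcod F = B)"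

text \<open>An adjunction \<open>L \<stileturn> R\<close> with unit \<open>\<eta>\<close> and counit \<open>\<epsilon>\<close>.\<close>

locale adjunction =
  fixes L :: "('o, 'm, 'p, 'n) cfunctor" and R :: "('p, 'n, 'o, 'm) cfunctor"
    and \<eta> :: "('o, 'm, 'o, 'm) ntrans" and \<epsilon> :: "('p, 'n, 'p, 'n) ntrans"
  assumes left_functor: "is_functor L"
    and right_functor: "is_functor R"
    and fdom_right: "fdom R = fcod L"
    and fcod_right: "fcod R = fdom L"
    and unit_ntrans: "is_ntrans \<eta>"
    and unit_dom: "ntdom \<eta> = id_functor (fdom L)"
    and unit_cod: "ntcod \<eta> = functor_comp R L"
    and counit_ntrans: "is_ntrans \<epsilon>"
    and counit_dom: "ntdom \<epsilon> = functor_comp L R"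
    and counit_cod: "ntcod \<epsilon> = id_functor (fcod L)"
    and triangle_left: "vcomp (whisker_right \<epsilon> L) (whisker_left L \<eta>) = id_nt L"
    and triangle_right: "vcomp (whisker_left R \<epsilon>) (whisker_right \<eta> R) = id_nt R"

definition prod_cat :: "('o, 'm) cat \<Rightarrow> ('p, 'n) cat \<Rightarrow> ('o \<times> 'p, 'm \<times> 'n) cat" where
  "prod_cat A B =
    \<lparr>Obj = Obj A \<times> Obj B, Arr = Arr A \<times> Arr B,
     Dom = map_prod (Dom A) (Dom B), Cod = map_prod (Cod A) (Cod B),
     Ident = map_prod (Ident A) (Ident B),
     Comp = (\<lambda>g f. (Comp A (fst g) (fst f), Comp B (snd g) (snd f)))\<rparr>"

definition pair_functor ::
    "('o, 'm, 'p, 'n) cfunctor \<Rightarrow> ('o, 'm, 'q, 'r) cfunctor \<Rightarrow>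
     ('o, 'm, 'p \<times> 'q, 'n \<times> 'r) cfunctor" where
  "pair_functor F G =
    \<lparr>fdom = fdom F, fcod = prod_cat (fcod F) (fcod G),
     fob = (\<lambda>x\<in>Obj (fdom F). (fob F x, fob G x)),
     far = (\<lambda>f\<in>Arr (fdom F). (far F f, far G f))\<rparr>"


section \<open>Algebras over a monad\<close>

text \<open>
  Arrows of the Eilenberg--Moore category are triples (source algebra, target algebra, underlying
  arrow), so that they determine their source and target.
\<close>

definition em_cat ::
    "('o, 'm, 'o, 'm) cfunctor \<Rightarrow> ('o, 'm, 'o, 'm) ntrans \<Rightarrow> ('o, 'm, 'o, 'm) ntrans \<Rightarrow>
     ('o \<times> 'm, ('o \<times> 'm) \<times> ('o \<times> 'm) \<times> 'm) cat" where
  "em_cat T \<eta> \<mu> =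
    (let A = fdom T;
         algs = {(x, a). x \<in> Obj A \<and> a \<in> homs A (fob T x) x \<and>
           Comp A a (ntc \<eta> x) = Ident A x \<and>
           Comp A a (far T a) = Comp A a (ntc \<mu> x)}
     in \<lparr>Obj = algs,
         Arr = {((x, a), (y, b), h). (x, a) \<in> algs \<and> (y, b) \<in> algs \<and> h \<in> homs A x y \<and>
           Comp A h a = Comp A b (far T h)},
         Dom = (\<lambda>(X, Y, h). X), Cod = (\<lambda>(X, Y, h). Y),
         Ident = (\<lambda>X. (X, X, Ident A (fst X))),
         Comp = (\<lambda>(Y', Z, k) (X, Y, h). (X, Z, Comp A k h))\<rparr>)"

text \<open>
  For \<open>L \<stileturn> R\<close> the comparison functor goes from the domain of \<open>R\<close> to the algebras of the monad
  \<open>(R L, \<eta>, R \<epsilon> L)\<close>.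
\<close>

definition em_comparison ::
    "('o, 'm, 'p, 'n) cfunctor \<Rightarrow> ('p, 'n, 'o, 'm) cfunctor \<Rightarrow>
     ('o, 'm, 'o, 'm) ntrans \<Rightarrow> ('p, 'n, 'p, 'n) ntrans \<Rightarrow>
     ('p, 'n, 'o \<times> 'm, ('o \<times> 'm) \<times> ('o \<times> 'm) \<times> 'm) cfunctor" where
  "em_comparison L R \<eta> \<epsilon> =
    (let K = (\<lambda>x. (fob R x, far R (ntc \<epsilon> x)))
     in \<lparr>fdom = fdom R,
         fcod = em_cat (functor_comp R L) \<eta> (whisker_left R (whisker_right \<epsilon> L)),
         fob = (\<lambda>x\<in>Obj (fdom R). K x),
         far = (\<lambda>h\<in>Arr (fdom R). (K (Dom (fdom R) h), K (Cod (fdom R) h), far R h))\<rparr>)"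


section \<open>Additive categories\<close>

definition preadditive :: "('o, 'm) cat \<Rightarrow> ('m \<Rightarrow> 'm \<Rightarrow> 'm) \<Rightarrow> ('o \<Rightarrow> 'o \<Rightarrow> 'm) \<Rightarrow> bool" where
  "preadditive C add zer \<longleftrightarrow>
    (\<forall>x\<in>Obj C. \<forall>y\<in>Obj C. comm_group \<lparr>carrier = homs C x y, monoid.mult = add, one = zer x y\<rparr>) \<and>
    (\<forall>x y z f f' g. f \<in> homs C x y \<longrightarrow> f' \<in> homs C x y \<longrightarrow> g \<in> homs C y z \<longrightarrow>
      Comp C g (add f f') = add (Comp C g f) (Comp C g f')) \<and>
    (\<forall>x y z f g g'. f \<in> homs C x y \<longrightarrow> g \<in> homs C y z \<longrightarrow> g' \<in> homs C y z \<longrightarrow>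
      Comp C (add g g') f = add (Comp C g f) (Comp C g' f))"

definition zero_object :: "('o, 'm) cat \<Rightarrow> 'o \<Rightarrow> bool" where
  "zero_object C z \<longleftrightarrow> z \<in> Obj C \<and>
    (\<forall>x\<in>Obj C. (\<exists>!f. f \<in> homs C x z) \<and> (\<exists>!f. f \<in> homs C z x))"

definition has_biproducts :: "('o, 'm) cat \<Rightarrow> ('m \<Rightarrow> 'm \<Rightarrow> 'm) \<Rightarrow> ('o \<Rightarrow> 'o \<Rightarrow> 'm) \<Rightarrow> bool" where
  "has_biproducts C add zer \<longleftrightarrow>
    (\<forall>x\<in>Obj C. \<forall>y\<in>Obj C. \<exists>b\<in>Obj C.
      \<exists>i\<^sub>1\<in>homs C x b. \<exists>i\<^sub>2\<in>homs C y b. \<exists>p\<^sub>1\<in>homs C b x. \<exists>p\<^sub>2\<in>homs C b y.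
        Comp C p\<^sub>1 i\<^sub>1 = Ident C x \<and> Comp C p\<^sub>2 i\<^sub>2 = Ident C y \<and>
        Comp C p\<^sub>2 i\<^sub>1 = zer x y \<and> Comp C p\<^sub>1 i\<^sub>2 = zer y x \<and>
        add (Comp C i\<^sub>1 p\<^sub>1) (Comp C i\<^sub>2 p\<^sub>2) = Ident C b)"

text \<open>
  The enrichment of an additive category over abelian groups is determined by the underlying
  category, so additivity is a property of a category, and the universal quantifier over the
  enrichments in the definition of additive functors ranges over a single one on each side.
\<close>

definition additive_category :: "('o, 'm) cat \<Rightarrow> bool" where
  "additive_category C \<longleftrightarrow> category C \<and> (\<exists>z. zero_object C z) \<and>
    (\<exists>add zer. preadditive C add zer \<and> has_biproducts C add zer)"

definition additive_functor :: "('o, 'm, 'p, 'n) cfunctor \<Rightarrow> bool" where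
  "additive_functor F \<longleftrightarrow>
    is_functor F \<and> additive_category (fdom F) \<and> additive_category (fcod F) \<and>
    (\<forall>add zer add' zer'. preadditive (fdom F) add zer \<longrightarrow> preadditive (fcod F) add' zer' \<longrightarrow>
      (\<forall>x y. \<forall>f\<in>homs (fdom F) x y. \<forall>g\<in>homs (fdom F) x y.
        far F (add f g) = add' (far F f) (far F g)))"


section \<open>Strict 2-categories and 2-functors\<close>

record ('o, 'a, 'c) twocat =
  Ob :: "'o set"
  One :: "'a set"
  Two :: "'c set"
  Src :: "'a \<Rightarrow> 'o"
  Tgt :: "'a \<Rightarrow> 'o"
  Dom2 :: "'c \<Rightarrow> 'a"
  Cod2 :: "'c \<Rightarrow> 'a"
  Id1 :: "'o \<Rightarrow> 'a"
  Id2 :: "'a \<Rightarrow> 'c"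
  Comp1 :: "'a \<Rightarrow> 'a \<Rightarrow> 'a"
  VComp :: "'c \<Rightarrow> 'c \<Rightarrow> 'c"
  HComp :: "'c \<Rightarrow> 'c \<Rightarrow> 'c"

definition hom_cat :: "('o, 'a, 'c) twocat \<Rightarrow> 'o \<Rightarrow> 'o \<Rightarrow> ('a, 'c) cat" where
  "hom_cat C A B =
    \<lparr>Obj = {f \<in> One C. Src C f = A \<and> Tgt C f = B},
     Arr = {\<alpha> \<in> Two C. Src C (Dom2 C \<alpha>) = A \<and> Tgt C (Dom2 C \<alpha>) = B},
     Dom = Dom2 C, Cod = Cod2 C, Ident = Id2 C, Comp = VComp C\<rparr>"

definition cells1 :: "('o, 'a, 'c) twocat \<Rightarrow> 'o \<Rightarrow> 'o \<Rightarrow> 'a set" where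
  "cells1 C A B = {f \<in> One C. Src C f = A \<and> Tgt C f = B}"

definition cells2 :: "('o, 'a, 'c) twocat \<Rightarrow> 'a \<Rightarrow> 'a \<Rightarrow> 'c set" where
  "cells2 C f g = {\<alpha> \<in> Two C. Dom2 C \<alpha> = f \<and> Cod2 C \<alpha> = g}"

text \<open>
  The constructions below do not assume this predicate; they are meant for 2-categories in this
  sense.
\<close>

locale two_category =
  fixes C :: "('o, 'a, 'c) twocat"
  assumes Src_Ob: "f \<in> One C \<Longrightarrow> Src C f \<in> Ob C"
    and Tgt_Ob: "f \<in> One C \<Longrightarrow> Tgt C f \<in> Ob C"
    and Dom2_One: "\<alpha> \<in> Two C \<Longrightarrow> Dom2 C \<alpha> \<in> One C"
    and parallel: "\<alpha> \<in> Two C \<Longrightarrow> Cod2 C \<alpha> \<in> cells1 C (Src C (Dom2 C \<alpha>)) (Tgt C (Dom2 C \<alpha>))"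
    and hom_category: "A \<in> Ob C \<Longrightarrow> B \<in> Ob C \<Longrightarrow> category (hom_cat C A B)"
    and Id1_cells1: "A \<in> Ob C \<Longrightarrow> Id1 C A \<in> cells1 C A A"
    and Comp1_cells1: "f \<in> cells1 C A B \<Longrightarrow> g \<in> cells1 C B D \<Longrightarrow> Comp1 C g f \<in> cells1 C A D"
    and Comp1_Id1_right: "f \<in> cells1 C A B \<Longrightarrow> Comp1 C f (Id1 C A) = f"
    and Comp1_Id1_left: "f \<in> cells1 C A B \<Longrightarrow> Comp1 C (Id1 C B) f = f"
    and Comp1_assoc: "f \<in> cells1 C A B \<Longrightarrow> g \<in> cells1 C B D \<Longrightarrow> h \<in> cells1 C D E \<Longrightarrow>
      Comp1 C h (Comp1 C g f) = Comp1 C (Comp1 C h g) f"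
    and HComp_cells2: "f \<in> cells1 C A B \<Longrightarrow> g \<in> cells1 C B D \<Longrightarrow>
      \<alpha> \<in> cells2 C f f' \<Longrightarrow> \<beta> \<in> cells2 C g g' \<Longrightarrow>
      HComp C \<beta> \<alpha> \<in> cells2 C (Comp1 C g f) (Comp1 C g' f')"
    and HComp_Id2: "f \<in> cells1 C A B \<Longrightarrow> g \<in> cells1 C B D \<Longrightarrow>
      HComp C (Id2 C g) (Id2 C f) = Id2 C (Comp1 C g f)"
    and interchange: "f \<in> cells1 C A B \<Longrightarrow> g \<in> cells1 C B D \<Longrightarrow>
      \<alpha> \<in> cells2 C f f' \<Longrightarrow> \<alpha>' \<in> cells2 C f' f'' \<Longrightarrow>
      \<beta> \<in> cells2 C g g' \<Longrightarrow> \<beta>' \<in> cells2 C g' g'' \<Longrightarrow>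
      HComp C (VComp C \<beta>' \<beta>) (VComp C \<alpha>' \<alpha>) = VComp C (HComp C \<beta>' \<alpha>') (HComp C \<beta> \<alpha>)"
    and HComp_Id1_right: "f \<in> cells1 C A B \<Longrightarrow> \<alpha> \<in> cells2 C f f' \<Longrightarrow>
      HComp C \<alpha> (Id2 C (Id1 C A)) = \<alpha>"
    and HComp_Id1_left: "f \<in> cells1 C A B \<Longrightarrow> \<alpha> \<in> cells2 C f f' \<Longrightarrow>
      HComp C (Id2 C (Id1 C B)) \<alpha> = \<alpha>"
    and HComp_assoc: "f \<in> cells1 C A B \<Longrightarrow> g \<in> cells1 C B D \<Longrightarrow> h \<in> cells1 C D E \<Longrightarrow>
      \<alpha> \<in> cells2 C f f' \<Longrightarrow> \<beta> \<in> cells2 C g g' \<Longrightarrow> \<gamma> \<in> cells2 C h h' \<Longrightarrow>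
      HComp C \<gamma> (HComp C \<beta> \<alpha>) = HComp C (HComp C \<gamma> \<beta>) \<alpha>"

definition iso2 :: "('o, 'a, 'c) twocat \<Rightarrow> 'c \<Rightarrow> bool" where
  "iso2 C \<alpha> \<longleftrightarrow> iso_arrow (hom_cat C (Src C (Dom2 C \<alpha>)) (Tgt C (Dom2 C \<alpha>))) \<alpha>"

definition inverse2 :: "('o, 'a, 'c) twocat \<Rightarrow> 'c \<Rightarrow> 'c \<Rightarrow> bool" where
  "inverse2 C \<alpha> \<beta> \<longleftrightarrow> \<alpha> \<in> Two C \<and> \<beta> \<in> cells2 C (Cod2 C \<alpha>) (Dom2 C \<alpha>) \<and>
    VComp C \<beta> \<alpha> = Id2 C (Dom2 C \<alpha>) \<and> VComp C \<alpha> \<beta> = Id2 C (Cod2 C \<alpha>)"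

text \<open>The opposite reverses 1-cells only.\<close>

definition op2 :: "('o, 'a, 'c) twocat \<Rightarrow> ('o, 'a, 'c) twocat" where
  "op2 C = C\<lparr>Src := Tgt C, Tgt := Src C,
     Comp1 := (\<lambda>g f. Comp1 C f g), HComp := (\<lambda>\<beta> \<alpha>. HComp C \<alpha> \<beta>)\<rparr>"

definition locally_full_sub ::
    "('o, 'a, 'c) twocat \<Rightarrow> 'o set \<Rightarrow> 'a set \<Rightarrow> ('o, 'a, 'c) twocat" where
  "locally_full_sub C obs ones = C\<lparr>Ob := obs, One := ones,
     Two := {\<alpha> \<in> Two C. Dom2 C \<alpha> \<in> ones \<and> Cod2 C \<alpha> \<in> ones}\<rparr>"

record ('o, 'a, 'c, 'p, 'b, 'd) twofun =
  F0 :: "'o \<Rightarrow> 'p"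
  F1 :: "'a \<Rightarrow> 'b"
  F2 :: "'c \<Rightarrow> 'd"

locale two_functor =
  fixes C :: "('o, 'a, 'c) twocat" and D :: "('p, 'b, 'd) twocat"
    and F :: "('o, 'a, 'c, 'p, 'b, 'd) twofun"
  assumes F0_Ob: "A \<in> Ob C \<Longrightarrow> F0 F A \<in> Ob D"
    and F1_cells1: "f \<in> cells1 C A B \<Longrightarrow> F1 F f \<in> cells1 D (F0 F A) (F0 F B)"
    and F2_cells2: "\<alpha> \<in> cells2 C f g \<Longrightarrow> F2 F \<alpha> \<in> cells2 D (F1 F f) (F1 F g)"
    and F1_Id1: "A \<in> Ob C \<Longrightarrow> F1 F (Id1 C A) = Id1 D (F0 F A)"
    and F1_Comp1: "f \<in> cells1 C A B \<Longrightarrow> g \<in> cells1 C B E \<Longrightarrow>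
      F1 F (Comp1 C g f) = Comp1 D (F1 F g) (F1 F f)"
    and F2_Id2: "f \<in> One C \<Longrightarrow> F2 F (Id2 C f) = Id2 D (F1 F f)"
    and F2_VComp: "\<alpha> \<in> cells2 C f g \<Longrightarrow> \<beta> \<in> cells2 C g h \<Longrightarrow>
      F2 F (VComp C \<beta> \<alpha>) = VComp D (F2 F \<beta>) (F2 F \<alpha>)"
    and F2_HComp: "\<alpha> \<in> cells2 C f f' \<Longrightarrow> \<beta> \<in> cells2 C g g' \<Longrightarrow>
      f \<in> cells1 C A B \<Longrightarrow> g \<in> cells1 C B E \<Longrightarrow>
      F2 F (HComp C \<beta> \<alpha>) = HComp D (F2 F \<beta>) (F2 F \<alpha>)"

definition twofun_comp ::
    "('p, 'b, 'd, 'q, 'e, 'f) twofun \<Rightarrow> ('o, 'a, 'c, 'p, 'b, 'd) twofun \<Rightarrow>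
     ('o, 'a, 'c, 'q, 'e, 'f) twofun" where
  "twofun_comp G F = \<lparr>F0 = F0 G \<circ> F0 F, F1 = F1 G \<circ> F1 F, F2 = F2 G \<circ> F2 F\<rparr>"

definition const_twofun :: "('p, 'b, 'd) twocat \<Rightarrow> 'p \<Rightarrow> ('o, 'a, 'c, 'p, 'b, 'd) twofun" where
  "const_twofun D T = \<lparr>F0 = (\<lambda>_. T), F1 = (\<lambda>_. Id1 D T), F2 = (\<lambda>_. Id2 D (Id1 D T))\<rparr>"

definition Cat2 ::
    "(('o, 'm) cat, ('o, 'm, 'o, 'm) cfunctor, ('o, 'm, 'o, 'm) ntrans) twocat" where
  "Cat2 =
    \<lparr>Ob = {A. category A}, One = {F. is_functor F}, Two = {\<tau>. is_ntrans \<tau>},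
     Src = fdom, Tgt = fcod, Dom2 = ntdom, Cod2 = ntcod,
     Id1 = id_functor, Id2 = id_nt, Comp1 = functor_comp, VComp = vcomp, HComp = hcomp\<rparr>"

definition Add2 ::
    "(('o, 'm) cat, ('o, 'm, 'o, 'm) cfunctor, ('o, 'm, 'o, 'm) ntrans) twocat" where
  "Add2 = locally_full_sub Cat2 {A. additive_category A} {F. additive_functor F}"


section \<open>Pseudonatural transformations and modifications\<close>

text \<open>
  A pseudonatural transformation \<open>\<sigma>\<close> from \<open>F\<close> to \<open>G\<close> has components \<open>ps1 \<sigma> A : F A \<rightarrow> G A\<close> and
  invertible structure 2-cells \<open>ps2 \<sigma> f : (G f) (ps1 \<sigma> A) \<Rightarrow> (ps1 \<sigma> B) (F f)\<close> for \<open>f : A \<rightarrow> B\<close>.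
\<close>

record ('i, 'ia, 'a, 'c) psnat =
  ps1 :: "'i \<Rightarrow> 'a"
  ps2 :: "'ia \<Rightarrow> 'c"

locale is_psnat =
  fixes I :: "('i, 'ia, 'ic) twocat" and C :: "('o, 'a, 'c) twocat"
    and F G :: "('i, 'ia, 'ic, 'o, 'a, 'c) twofun"
    and \<sigma> :: "('i, 'ia, 'a, 'c) psnat"
  assumes ps1_extensional: "ps1 \<sigma> \<in> extensional (Ob I)"
    and ps2_extensional: "ps2 \<sigma> \<in> extensional (One I)"
    and ps1_cells1: "A \<in> Ob I \<Longrightarrow> ps1 \<sigma> A \<in> cells1 C (F0 F A) (F0 G A)"
    and ps2_cells2: "f \<in> cells1 I A B \<Longrightarrow>
      ps2 \<sigma> f \<in> cells2 C (Comp1 C (F1 G f) (ps1 \<sigma> A)) (Comp1 C (ps1 \<sigma> B) (F1 F f))"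
    and ps2_iso2: "f \<in> One I \<Longrightarrow> iso2 C (ps2 \<sigma> f)"
    and ps2_natural: "f \<in> cells1 I A B \<Longrightarrow> \<theta> \<in> cells2 I f f' \<Longrightarrow>
      VComp C (ps2 \<sigma> f') (HComp C (F2 G \<theta>) (Id2 C (ps1 \<sigma> A))) =
      VComp C (HComp C (Id2 C (ps1 \<sigma> B)) (F2 F \<theta>)) (ps2 \<sigma> f)"
    and ps2_Id1: "A \<in> Ob I \<Longrightarrow> ps2 \<sigma> (Id1 I A) = Id2 C (ps1 \<sigma> A)"
    and ps2_Comp1: "f \<in> cells1 I A B \<Longrightarrow> g \<in> cells1 I B E \<Longrightarrow>
      ps2 \<sigma> (Comp1 I g f) =
      VComp C (HComp C (ps2 \<sigma> g) (Id2 C (F1 F f))) (HComp C (Id2 C (F1 G g)) (ps2 \<sigma> f))"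

record ('i, 'ia, 'a, 'c) modif =
  mdom :: "('i, 'ia, 'a, 'c) psnat"
  mcod :: "('i, 'ia, 'a, 'c) psnat"
  mc :: "'i \<Rightarrow> 'c"

locale is_modif =
  fixes I :: "('i, 'ia, 'ic) twocat" and C :: "('o, 'a, 'c) twocat"
    and F G :: "('i, 'ia, 'ic, 'o, 'a, 'c) twofun"
    and \<Gamma> :: "('i, 'ia, 'a, 'c) modif"
  assumes mdom_psnat: "is_psnat I C F G (mdom \<Gamma>)"
    and mcod_psnat: "is_psnat I C F G (mcod \<Gamma>)"
    and mc_extensional: "mc \<Gamma> \<in> extensional (Ob I)"
    and mc_cells2: "A \<in> Ob I \<Longrightarrow> mc \<Gamma> A \<in> cells2 C (ps1 (mdom \<Gamma>) A) (ps1 (mcod \<Gamma>) A)"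
    and mc_natural: "f \<in> cells1 I A B \<Longrightarrow>
      VComp C (ps2 (mcod \<Gamma>) f) (HComp C (Id2 C (F1 G f)) (mc \<Gamma> A)) =
      VComp C (HComp C (mc \<Gamma> B) (Id2 C (F1 F f))) (ps2 (mdom \<Gamma>) f)"

text \<open>The hom category \<open>[I, C](F, G)\<close> between strict 2-functors.\<close>

definition psnat_cat ::
    "('i, 'ia, 'ic) twocat \<Rightarrow> ('o, 'a, 'c) twocat \<Rightarrow>
     ('i, 'ia, 'ic, 'o, 'a, 'c) twofun \<Rightarrow> ('i, 'ia, 'ic, 'o, 'a, 'c) twofun \<Rightarrow>
     (('i, 'ia, 'a, 'c) psnat, ('i, 'ia, 'a, 'c) modif) cat" where
  "psnat_cat I C F G =
    \<lparr>Obj = {\<sigma>. is_psnat I C F G \<sigma>}, Arr = {\<Gamma>. is_modif I C F G \<Gamma>},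
     Dom = mdom, Cod = mcod,
     Ident = (\<lambda>\<sigma>. \<lparr>mdom = \<sigma>, mcod = \<sigma>, mc = (\<lambda>A\<in>Ob I. Id2 C (ps1 \<sigma> A))\<rparr>),
     Comp = (\<lambda>\<Delta> \<Gamma>. \<lparr>mdom = mdom \<Gamma>, mcod = mcod \<Delta>,
       mc = (\<lambda>A\<in>Ob I. VComp C (mc \<Delta> A) (mc \<Gamma> A))\<rparr>)\<rparr>"

text \<open>
  The action of 1-cells \<open>h : T' \<rightarrow> T\<close> and of 2-cells \<open>\<theta> : h \<Rightarrow> h'\<close> on the categories
  \<open>[I, C](\<Delta> T, D)\<close>, by precomposition with \<open>\<Delta> h\<close> and \<open>\<Delta> \<theta>\<close>.
\<close>

definition psnat_pre ::
    "('i, 'ia, 'ic) twocat \<Rightarrow> ('o, 'a, 'c) twocat \<Rightarrow> 'a \<Rightarrow>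
     ('i, 'ia, 'a, 'c) psnat \<Rightarrow> ('i, 'ia, 'a, 'c) psnat" where
  "psnat_pre I C h \<sigma> =
    \<lparr>ps1 = (\<lambda>A\<in>Ob I. Comp1 C (ps1 \<sigma> A) h),
     ps2 = (\<lambda>f\<in>One I. HComp C (ps2 \<sigma> f) (Id2 C h))\<rparr>"

definition modif_pre ::
    "('i, 'ia, 'ic) twocat \<Rightarrow> ('o, 'a, 'c) twocat \<Rightarrow> 'a \<Rightarrow>
     ('i, 'ia, 'a, 'c) modif \<Rightarrow> ('i, 'ia, 'a, 'c) modif" where
  "modif_pre I C h \<Gamma> =
    \<lparr>mdom = psnat_pre I C h (mdom \<Gamma>), mcod = psnat_pre I C h (mcod \<Gamma>),
     mc = (\<lambda>A\<in>Ob I. HComp C (mc \<Gamma> A) (Id2 C h))\<rparr>"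

definition psnat_pre2 ::
    "('i, 'ia, 'ic) twocat \<Rightarrow> ('o, 'a, 'c) twocat \<Rightarrow> 'c \<Rightarrow>
     ('i, 'ia, 'a, 'c) psnat \<Rightarrow> ('i, 'ia, 'a, 'c) modif" where
  "psnat_pre2 I C \<theta> \<sigma> =
    \<lparr>mdom = psnat_pre I C (Dom2 C \<theta>) \<sigma>, mcod = psnat_pre I C (Cod2 C \<theta>) \<sigma>,
     mc = (\<lambda>A\<in>Ob I. HComp C (Id2 C (ps1 \<sigma> A)) \<theta>)\<rparr>"


section \<open>Bilimits\<close>

text \<open>
  \<open>\<Phi> T\<close> is an equivalence from \<open>C(T, L)\<close> to \<open>[I, C](\<Delta> T, D)\<close>, and the invertible modifications
  \<open>\<Psi> h u : (\<Phi> T u) (\<Delta> h) \<Rightarrow> \<Phi> T' (u h)\<close>, for \<open>h : T' \<rightarrow> T\<close> and \<open>u : T \<rightarrow> L\<close>, are the structure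
  cells making \<open>\<Phi>\<close> pseudonatural in \<open>T\<close>.  This is written out because the two sides have
  different HOL types and so are not values of 2-functors into one and the same 2-category.
\<close>

locale bilimit_rep =
  fixes C :: "('o, 'a, 'c) twocat" and I :: "('i, 'ia, 'ic) twocat"
    and D :: "('i, 'ia, 'ic, 'o, 'a, 'c) twofun" and L :: 'o
    and \<Phi> :: "'o \<Rightarrow> ('a, 'c, ('i, 'ia, 'a, 'c) psnat, ('i, 'ia, 'a, 'c) modif) cfunctor"
    and \<Psi> :: "'a \<Rightarrow> 'a \<Rightarrow> ('i, 'ia, 'a, 'c) modif"
  assumes L_Ob: "L \<in> Ob C"
    and \<Phi>_equivalence: "T \<in> Ob C \<Longrightarrow> is_equivalence (\<Phi> T)"
    and \<Phi>_dom: "T \<in> Ob C \<Longrightarrow> fdom (\<Phi> T) = hom_cat C T L"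
    and \<Phi>_cod: "T \<in> Ob C \<Longrightarrow> fcod (\<Phi> T) = psnat_cat I C (const_twofun C T) D"
    and \<Psi>_homs: "h \<in> cells1 C T' T \<Longrightarrow> u \<in> cells1 C T L \<Longrightarrow>
      \<Psi> h u \<in> homs (psnat_cat I C (const_twofun C T') D)
        (psnat_pre I C h (fob (\<Phi> T) u)) (fob (\<Phi> T') (Comp1 C u h))"
    and \<Psi>_iso: "h \<in> cells1 C T' T \<Longrightarrow> u \<in> cells1 C T L \<Longrightarrow>
      iso_arrow (psnat_cat I C (const_twofun C T') D) (\<Psi> h u)"
    and \<Psi>_natural_left: "h \<in> cells1 C T' T \<Longrightarrow> u \<in> cells1 C T L \<Longrightarrow> \<omega> \<in> cells2 C u v \<Longrightarrow>
      Comp (psnat_cat I C (const_twofun C T') D) (\<Psi> h v) (modif_pre I C h (far (\<Phi> T) \<omega>)) =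
      Comp (psnat_cat I C (const_twofun C T') D) (far (\<Phi> T') (HComp C \<omega> (Id2 C h))) (\<Psi> h u)"
    and \<Psi>_natural_right: "h \<in> cells1 C T' T \<Longrightarrow> u \<in> cells1 C T L \<Longrightarrow> \<theta> \<in> cells2 C h h' \<Longrightarrow>
      Comp (psnat_cat I C (const_twofun C T') D) (\<Psi> h' u) (psnat_pre2 I C \<theta> (fob (\<Phi> T) u)) =
      Comp (psnat_cat I C (const_twofun C T') D) (far (\<Phi> T') (HComp C (Id2 C u) \<theta>)) (\<Psi> h u)"
    and \<Psi>_Id1: "u \<in> cells1 C T L \<Longrightarrow>
      \<Psi> (Id1 C T) u = Ident (psnat_cat I C (const_twofun C T) D) (fob (\<Phi> T) u)"
    and \<Psi>_Comp1: "k \<in> cells1 C T'' T' \<Longrightarrow> h \<in> cells1 C T' T \<Longrightarrow> u \<in> cells1 C T L \<Longrightarrow>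
      \<Psi> (Comp1 C h k) u = Comp (psnat_cat I C (const_twofun C T'') D)
        (\<Psi> k (Comp1 C u h)) (modif_pre I C k (\<Psi> h u))"

definition is_bilimit ::
    "('o, 'a, 'c) twocat \<Rightarrow> ('i, 'ia, 'ic) twocat \<Rightarrow>
     ('i, 'ia, 'ic, 'o, 'a, 'c) twofun \<Rightarrow> 'o \<Rightarrow> bool" where
  "is_bilimit C I D L \<longleftrightarrow> (\<exists>\<Phi> \<Psi>. bilimit_rep C I D L \<Phi> \<Psi>)"

datatype cospan_ob = LeftFoot | RightFoot | Apex

text \<open>The cospan \<open>LeftFoot \<rightarrow> Apex \<leftarrow> RightFoot\<close>, a poset viewed as a locally discrete 2-category.\<close>

definition cospan :: "(cospan_ob, cospan_ob \<times> cospan_ob, cospan_ob \<times> cospan_ob) twocat" where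
  "cospan =
    \<lparr>Ob = UNIV, One = {(x, y). x = y \<or> y = Apex}, Two = {(x, y). x = y \<or> y = Apex},
     Src = fst, Tgt = snd, Dom2 = id, Cod2 = id, Id1 = (\<lambda>x. (x, x)), Id2 = id,
     Comp1 = (\<lambda>g f. (fst f, snd g)), VComp = (\<lambda>\<beta> \<alpha>. \<alpha>), HComp = (\<lambda>\<beta> \<alpha>. (fst \<alpha>, snd \<beta>))\<rparr>"

definition cospan_diagram ::
    "('o, 'a, 'c) twocat \<Rightarrow> 'a \<Rightarrow> 'a \<Rightarrow>
     (cospan_ob, cospan_ob \<times> cospan_ob, cospan_ob \<times> cospan_ob, 'o, 'a, 'c) twofun" where
  "cospan_diagram C f g =
    (let d0 = case_cospan_ob (Src C f) (Src C g) (Tgt C f);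
         d1 = (\<lambda>(x, y). if x = y then Id1 C (d0 x) else if x = LeftFoot then f else g)
     in \<lparr>F0 = d0, F1 = d1, F2 = Id2 C \<circ> d1\<rparr>)"

text \<open>
  The universal cone \<open>\<pi>\<close> corresponds to the identity of \<open>P\<close>.  Its structure cells go from \<open>f q\<^sub>1\<close>
  and from \<open>g q\<^sub>2\<close> to its component at the apex, and \<open>\<theta>\<close> is the first followed by the inverse of
  the second.
\<close>

definition two_pullback ::
    "('o, 'a, 'c) twocat \<Rightarrow> 'a \<Rightarrow> 'a \<Rightarrow> 'o \<Rightarrow> 'a \<Rightarrow> 'a \<Rightarrow> 'c \<Rightarrow> bool" where
  "two_pullback C f g P q\<^sub>1 q\<^sub>2 \<theta> \<longleftrightarrow>
    f \<in> One C \<and> g \<in> One C \<and> Tgt C f = Tgt C g \<and>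
    (\<exists>\<Phi> \<Psi>. bilimit_rep C cospan (cospan_diagram C f g) P \<Phi> \<Psi> \<and>
      (let \<pi> = fob (\<Phi> P) (Id1 C P) in
        q\<^sub>1 = ps1 \<pi> LeftFoot \<and> q\<^sub>2 = ps1 \<pi> RightFoot \<and>
        \<theta> \<in> cells2 C (Comp1 C f q\<^sub>1) (Comp1 C g q\<^sub>2) \<and>
        VComp C (ps2 \<pi> (RightFoot, Apex)) \<theta> = ps2 \<pi> (LeftFoot, Apex)))"


section \<open>Finite groupoids and Mackey 2-functors\<close>

text \<open>
  The finite groupoids are those with objects and arrows in a fixed type \<open>'u\<close>.  Every finite
  groupoid is isomorphic to one of these as soon as \<open>'u\<close> is infinite.
\<close>

definition groupoid :: "('o, 'm) cat \<Rightarrow> bool" where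
  "groupoid A \<longleftrightarrow> category A \<and> (\<forall>f\<in>Arr A. iso_arrow A f)"

definition finite_groupoid :: "('o, 'm) cat \<Rightarrow> bool" where
  "finite_groupoid A \<longleftrightarrow> groupoid A \<and> finite (Obj A) \<and> finite (Arr A)"

type_synonym 'u gpd = "('u, 'u) cat"
type_synonym 'u gpd1 = "('u, 'u, 'u, 'u) cfunctor"
type_synonym 'u gpd2 = "('u, 'u, 'u, 'u) ntrans"

definition gpdf :: "('u gpd, 'u gpd1, 'u gpd2) twocat" where
  "gpdf = locally_full_sub Cat2 {A. finite_groupoid A}
    {F. faithful_functor F \<and> finite_groupoid (fdom F) \<and> finite_groupoid (fcod F)}"

definition groupoid_coproduct ::
    "'u gpd \<Rightarrow> 'u gpd \<Rightarrow> 'u gpd \<Rightarrow> 'u gpd1 \<Rightarrow> 'u gpd1 \<Rightarrow> bool" where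
  "groupoid_coproduct G H X i j \<longleftrightarrow>
    groupoid G \<and> groupoid H \<and> groupoid X \<and>
    is_functor i \<and> fdom i = G \<and> fcod i = X \<and> is_functor j \<and> fdom j = H \<and> fcod j = X \<and>
    (\<forall>(Y :: 'u gpd) (u :: 'u gpd1) (v :: 'u gpd1).
       groupoid Y \<and> is_functor u \<and> fdom u = G \<and> fcod u = Y \<and>
       is_functor v \<and> fdom v = H \<and> fcod v = Y \<longrightarrow>
       (\<exists>!w :: 'u gpd1. is_functor w \<and> fdom w = X \<and> fcod w = Y \<and>
         functor_comp w i = u \<and> functor_comp w j = v))"

type_synonym ('u, 'o, 'm) gpd_cat_twofun =
  "('u gpd, 'u gpd1, 'u gpd2,
    ('o, 'm) cat, ('o, 'm, 'o, 'm) cfunctor, ('o, 'm, 'o, 'm) ntrans) twofun"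

text \<open>
  Given \<open>\<theta> : f q\<^sub>1 \<Rightarrow> g q\<^sub>2\<close> and its image \<open>l : q\<^sub>1\<^sup>* f\<^sup>* \<Rightarrow> q\<^sub>2\<^sup>* g\<^sup>*\<close>, the mate \<open>q\<^sub>2\<^sub>! q\<^sub>1\<^sup>* \<Rightarrow> g\<^sup>* f\<^sub>!\<close>
  for the unit \<open>\<eta>\<close> of \<open>f\<^sub>! \<stileturn> f\<^sup>*\<close> and the counit \<open>\<epsilon>\<close> of \<open>q\<^sub>2\<^sub>! \<stileturn> q\<^sub>2\<^sup>*\<close>.
\<close>

definition mate_left where
  "mate_left fsh q1st q2sh gst l \<eta> \<epsilon> =
    vcomp (whisker_right \<epsilon> (functor_comp gst fsh))
      (vcomp (whisker_left q2sh (whisker_right l fsh))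
        (whisker_left (functor_comp q2sh q1st) \<eta>))"

text \<open>
  Given the image \<open>l : q\<^sub>2\<^sup>* g\<^sup>* \<Rightarrow> q\<^sub>1\<^sup>* f\<^sup>*\<close> of the inverse of \<open>\<theta>\<close>, the mate \<open>g\<^sup>* f\<^sub>* \<Rightarrow> q\<^sub>2\<^sub>* q\<^sub>1\<^sup>*\<close>
  for the unit \<open>\<eta>\<close> of \<open>q\<^sub>2\<^sup>* \<stileturn> q\<^sub>2\<^sub>*\<close> and the counit \<open>\<epsilon>\<close> of \<open>f\<^sup>* \<stileturn> f\<^sub>*\<close>.
\<close>

definition mate_right where
  "mate_right fr q1st q2r gst l \<eta> \<epsilon> =
    vcomp (whisker_left (functor_comp q2r q1st) \<epsilon>)
      (vcomp (whisker_left q2r (whisker_right l fr))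
        (whisker_right \<eta> (functor_comp gst fr)))"

text \<open>
  Adjoints are unique up to unique isomorphism and exist by assumption, so the conditions that
  involve them quantify over all choices.
\<close>

locale mackey_2functor =
  fixes M :: "('u, 'o, 'm) gpd_cat_twofun"
  assumes two_functor: "two_functor (op2 gpdf) Add2 M"
    and additivity: "finite_groupoid G \<Longrightarrow> finite_groupoid H \<Longrightarrow>
      groupoid_coproduct G H X i j \<Longrightarrow> is_equivalence (pair_functor (F1 M i) (F1 M j))"
    and left_adjoint: "f \<in> One gpdf \<Longrightarrow> \<exists>L \<eta> \<epsilon>. adjunction L (F1 M f) \<eta> \<epsilon>"
    and right_adjoint: "f \<in> One gpdf \<Longrightarrow> \<exists>R \<eta> \<epsilon>. adjunction (F1 M f) R \<eta> \<epsilon>"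
    and beck_chevalley_left: "two_pullback gpdf f g P q\<^sub>1 q\<^sub>2 \<theta> \<Longrightarrow>
      adjunction fsh (F1 M f) \<eta> \<epsilon> \<Longrightarrow> adjunction q2sh (F1 M q\<^sub>2) \<eta>' \<epsilon>' \<Longrightarrow>
      natural_iso (mate_left fsh (F1 M q\<^sub>1) q2sh (F1 M g) (F2 M \<theta>) \<eta> \<epsilon>')"
    and beck_chevalley_right: "two_pullback gpdf f g P q\<^sub>1 q\<^sub>2 \<theta> \<Longrightarrow> inverse2 gpdf \<theta> \<theta>\<^sub>i \<Longrightarrow>
      adjunction (F1 M f) fr \<eta> \<epsilon> \<Longrightarrow> adjunction (F1 M q\<^sub>2) q2r \<eta>' \<epsilon>' \<Longrightarrow>
      natural_iso (mate_right fr (F1 M q\<^sub>1) q2r (F1 M g) (F2 M \<theta>\<^sub>i) \<eta>' \<epsilon>)"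
    and ambidexterity: "f \<in> One gpdf \<Longrightarrow>
      adjunction L (F1 M f) \<eta> \<epsilon> \<Longrightarrow> adjunction (F1 M f) R \<eta>' \<epsilon>' \<Longrightarrow> isomorphic_functors L R"

text \<open>A group as a one-object groupoid, whose object is named by the unit of the group.\<close>

definition BG :: "'u monoid \<Rightarrow> 'u gpd" where
  "BG G = \<lparr>Obj = {\<one>\<^bsub>G\<^esub>}, Arr = carrier G, Dom = (\<lambda>_. \<one>\<^bsub>G\<^esub>), Cod = (\<lambda>_. \<one>\<^bsub>G\<^esub>),
    Ident = (\<lambda>_. \<one>\<^bsub>G\<^esub>), Comp = monoid.mult G\<rparr>"

definition BG_incl :: "'u monoid \<Rightarrow> 'u set \<Rightarrow> 'u gpd1" where
  "BG_incl G H = incl_functor (BG (G\<lparr>carrier := H\<rparr>)) (BG G)"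

definition p_monadic :: "nat \<Rightarrow> ('u, 'o, 'm) gpd_cat_twofun \<Rightarrow> bool" where
  "p_monadic p M \<longleftrightarrow>
    (\<forall>K H. group K \<and> finite (carrier K) \<and> subgroup H K \<and> coprime (card (rcosets\<^bsub>K\<^esub> H)) p \<longrightarrow>
      (\<forall>L \<eta> \<epsilon>. adjunction L (F1 M (BG_incl K H)) \<eta> \<epsilon> \<longrightarrow>
        is_equivalence (em_comparison L (F1 M (BG_incl K H)) \<eta> \<epsilon>)))"

definition sylow_subgroup :: "nat \<Rightarrow> 'u monoid \<Rightarrow> 'u set \<Rightarrow> bool" where
  "sylow_subgroup p G S \<longleftrightarrow> subgroup S G \<and> card S = p ^ multiplicity p (order G)"


section \<open>The extended transporter 2-category\<close>

type_synonym 'u trans0 = "'u gpd \<times> 'u gpd1"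

record 'u trans1 =
  t1_src :: "'u trans0"
  t1_tgt :: "'u trans0"
  t1_fun :: "'u gpd1"
  t1_nat :: "'u gpd2"

record 'u trans2 =
  t2_dom :: "'u trans1"
  t2_cod :: "'u trans1"
  t2_nat :: "'u gpd2"

definition trans_Ob :: "'u monoid \<Rightarrow> 'u set \<Rightarrow> 'u trans0 set" where
  "trans_Ob G S = {(P, j). finite_groupoid P \<and> j \<in> cells1 gpdf P (BG (G\<lparr>carrier := S\<rparr>))}"

definition trans_One :: "'u monoid \<Rightarrow> 'u set \<Rightarrow> 'u trans1 set" where
  "trans_One G S = {t. t1_src t \<in> trans_Ob G S \<and> t1_tgt t \<in> trans_Ob G S \<and>
    t1_fun t \<in> cells1 gpdf (fst (t1_src t)) (fst (t1_tgt t)) \<and>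
    t1_nat t \<in> cells2 gpdf
      (functor_comp (BG_incl G S) (functor_comp (snd (t1_tgt t)) (t1_fun t)))
      (functor_comp (BG_incl G S) (snd (t1_src t)))}"

definition trans_Two :: "'u monoid \<Rightarrow> 'u set \<Rightarrow> 'u trans2 set" where
  "trans_Two G S = {z. t2_dom z \<in> trans_One G S \<and> t2_cod z \<in> trans_One G S \<and>
    t1_src (t2_cod z) = t1_src (t2_dom z) \<and> t1_tgt (t2_cod z) = t1_tgt (t2_dom z) \<and>
    t2_nat z \<in> cells2 gpdf (t1_fun (t2_dom z)) (t1_fun (t2_cod z)) \<and>
    vcomp (t1_nat (t2_cod z))
      (whisker_left (functor_comp (BG_incl G S) (snd (t1_tgt (t2_dom z)))) (t2_nat z)) =
    t1_nat (t2_dom z)}"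

definition trans_Comp1 :: "'u trans1 \<Rightarrow> 'u trans1 \<Rightarrow> 'u trans1" where
  "trans_Comp1 t s = \<lparr>t1_src = t1_src s, t1_tgt = t1_tgt t, t1_fun = functor_comp (t1_fun t) (t1_fun s),
    t1_nat = vcomp (t1_nat s) (whisker_right (t1_nat t) (t1_fun s))\<rparr>"

definition transporter :: "'u monoid \<Rightarrow> 'u set \<Rightarrow> ('u trans0, 'u trans1, 'u trans2) twocat" where
  "transporter G S =
    \<lparr>Ob = trans_Ob G S, One = trans_One G S, Two = trans_Two G S,
     Src = t1_src, Tgt = t1_tgt, Dom2 = t2_dom, Cod2 = t2_cod,
     Id1 = (\<lambda>X. \<lparr>t1_src = X, t1_tgt = X, t1_fun = id_functor (fst X),
       t1_nat = id_nt (functor_comp (BG_incl G S) (snd X))\<rparr>),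
     Id2 = (\<lambda>t. \<lparr>t2_dom = t, t2_cod = t, t2_nat = id_nt (t1_fun t)\<rparr>),
     Comp1 = trans_Comp1,
     VComp = (\<lambda>z w. \<lparr>t2_dom = t2_dom w, t2_cod = t2_cod z, t2_nat = vcomp (t2_nat z) (t2_nat w)\<rparr>),
     HComp = (\<lambda>z w. \<lparr>t2_dom = trans_Comp1 (t2_dom z) (t2_dom w),
       t2_cod = trans_Comp1 (t2_cod z) (t2_cod w), t2_nat = hcomp (t2_nat z) (t2_nat w)\<rparr>)\<rparr>"

definition transporter_forget ::
    "('u trans0, 'u trans1, 'u trans2, 'u gpd, 'u gpd1, 'u gpd2) twofun" where
  "transporter_forget = \<lparr>F0 = fst, F1 = t1_fun, F2 = t2_nat\<rparr>"

end

theory Submission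
  imports Defs
begin

text \<open>
  Write \<open>i : S \<rightarrow> G\<close> for the inclusion of the Sylow subgroup.  The bilimit is \<open>M(G)\<close> itself.  Its
  universal pseudocone restricts along \<open>i j\<close> at the object \<open>(P, j)\<close> and has the structure cell
  \<open>\<alpha>\<^sup>*\<close> at the 1-morphism \<open>(a, \<alpha>)\<close>.  What has to be shown is that, for every small category \<open>T\<close>,
  composition with this cone is an equivalence from functors \<open>T \<rightarrow> M(G)\<close> to pseudocones with
  vertex \<open>T\<close> (\<open>bilimitI\<close>).  This is a statement about descent along \<open>i\<close>.

  \<^emph>\<open>Cones are descent data.\<close>  Let \<open>x\<close> be the value of a cone at the object \<open>(S, id)\<close>.  A pair of
  faithful functors \<open>b, j : P \<rightarrow> S\<close> with a 2-cell \<open>\<beta> : i b \<Rightarrow> i j\<close> gives two 1-morphisms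
  \<open>(b, \<beta>), (j, id) : (P, j) \<rightarrow> (S, id)\<close>, and comparing the structure cells of the cone at them gives
  a transition isomorphism \<open>\<psi>\<^sub>\<beta> : b\<^sup>* x \<rightarrow> j\<^sup>* x\<close>.  These satisfy the unit and cocycle conditions and
  are compatible with pulling back along \<open>c : P' \<rightarrow> P\<close> (\<open>transition_descent\<close>).  Conversely the cell
  at \<open>(j, id)\<close> identifies the value of the cone at \<open>(P, j)\<close> with \<open>j\<^sup>* x\<close>, so that the descent datum
  determines the cone (\<open>leg_compatible\<close>).

  \<^emph>\<open>Descent data are algebras.\<close>  Let \<open>i\<^sub>!\<close> be left adjoint to \<open>i\<^sup>*\<close>.  For a 2-pullback of \<open>i\<close> and
  \<open>g\<close> with projections \<open>r\<^sub>1, r\<^sub>2\<close> the Beck--Chevalley condition says that maps \<open>g\<^sup>* i\<^sub>! x \<rightarrow> y\<close> are the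
  same as maps \<open>r\<^sub>1\<^sup>* x \<rightarrow> r\<^sub>2\<^sup>* y\<close> (\<open>beck_chevalley_transpose\<close>).  For \<open>g = i\<close> this turns the transition
  isomorphism over the iso-comma groupoid of \<open>i\<close> with itself into a map \<open>a : i\<^sup>* i\<^sub>! x \<rightarrow> x\<close>.  The
  diagonal of the iso-comma groupoid shows that \<open>a\<close> is unital, and the case where \<open>g\<close> is \<open>i\<close>
  composed with the first projection reduces associativity to the cocycle condition.  The index of
  \<open>S\<close> is prime to \<open>p\<close>, so by \<open>p\<close>-monadicity the algebra \<open>(x, a)\<close> comes from an object of \<open>M(G)\<close>, and
  morphisms of descent data come from unique morphisms of \<open>M(G)\<close> (\<open>descent_effective\<close>,
  \<open>descent_morphism\<close>).

  The 2-pullbacks are iso-comma groupoids.  These satisfy a strict universal property, for 1-cells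
  on the nose and for 2-cells (\<open>pairing_comps\<close>, \<open>lift_cell\<close>), and in any 2-category this property
  implies that they represent pseudocones over the cospan (\<open>two_pullback\<close>).
\<close>

section \<open>Categories, functors and natural transformations\<close>

notation Comp (infixr "\<cdot>\<index>" 70)

lemma homs_iff: "f \<in> homs C x y \<longleftrightarrow> f \<in> Arr C \<and> Dom C f = x \<and> Cod C f = y"
  by (simp add: homs_def)

context category
begin

lemma Ident_Arr [simp]: "x \<in> Obj C \<Longrightarrow> Ident C x \<in> Arr C"
  and Dom_Ident [simp]: "x \<in> Obj C \<Longrightarrow> Dom C (Ident C x) = x"
  and Cod_Ident [simp]: "x \<in> Obj C \<Longrightarrow> Cod C (Ident C x) = x"
  using Ident_homs by (auto simp: homs_iff)

lemma Comp_Arr [simp]: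
    "f \<in> Arr C \<Longrightarrow> g \<in> Arr C \<Longrightarrow> Cod C f = Dom C g \<Longrightarrow> g \<cdot>\<^bsub>C\<^esub> f \<in> Arr C"
  and Dom_Comp [simp]:
    "f \<in> Arr C \<Longrightarrow> g \<in> Arr C \<Longrightarrow> Cod C f = Dom C g \<Longrightarrow> Dom C (g \<cdot>\<^bsub>C\<^esub> f) = Dom C f"
  and Cod_Comp [simp]:
    "f \<in> Arr C \<Longrightarrow> g \<in> Arr C \<Longrightarrow> Cod C f = Dom C g \<Longrightarrow> Cod C (g \<cdot>\<^bsub>C\<^esub> f) = Cod C g"
  using Comp_homs[of f "Dom C f" "Cod C f" g "Cod C g"] by (auto simp: homs_iff)

lemma Comp_Ident [simp]:
    "f \<in> Arr C \<Longrightarrow> Dom C f = x \<Longrightarrow> f \<cdot>\<^bsub>C\<^esub> Ident C x = f"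
    "f \<in> Arr C \<Longrightarrow> Cod C f = x \<Longrightarrow> Ident C x \<cdot>\<^bsub>C\<^esub> f = f"
  using Comp_Ident_right Comp_Ident_left by (auto simp: homs_iff)

lemma assoc:
  "f \<in> Arr C \<Longrightarrow> g \<in> Arr C \<Longrightarrow> h \<in> Arr C \<Longrightarrow> Cod C f = Dom C g \<Longrightarrow> Cod C g = Dom C h \<Longrightarrow>
    (h \<cdot>\<^bsub>C\<^esub> g) \<cdot>\<^bsub>C\<^esub> f = h \<cdot>\<^bsub>C\<^esub> g \<cdot>\<^bsub>C\<^esub> f"
  using Comp_assoc by (auto simp: homs_iff)

lemma Dom_Obj' [simp]: "f \<in> Arr C \<Longrightarrow> Dom C f \<in> Obj C"
  and Cod_Obj' [simp]: "f \<in> Arr C \<Longrightarrow> Cod C f \<in> Obj C"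
  using Dom_Obj Cod_Obj by auto

lemma homs_Obj: "f \<in> homs C x y \<Longrightarrow> x \<in> Obj C \<and> y \<in> Obj C"
  by (auto simp: homs_iff)

end

text \<open>
  Composites are normalized to the right, with typing conditions on \<open>Dom\<close> and \<open>Cod\<close> that the
  simplifier can discharge; this is how diagrams are chased below.
\<close>

lemmas cat_simps = category.Ident_Arr category.Dom_Ident category.Cod_Ident
  category.Comp_Arr category.Dom_Comp category.Cod_Comp category.Comp_Ident
  category.assoc category.Dom_Obj' category.Cod_Obj'

definition inv_arr :: "('o, 'm) cat \<Rightarrow> 'm \<Rightarrow> 'm" where
  "inv_arr C f = (SOME g. g \<in> homs C (Cod C f) (Dom C f) \<and>
      g \<cdot>\<^bsub>C\<^esub> f = Ident C (Dom C f) \<and> f \<cdot>\<^bsub>C\<^esub> g = Ident C (Cod C f))"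

lemma iso_arrowI:
  "f \<in> homs C x y \<Longrightarrow> g \<in> homs C y x \<Longrightarrow> g \<cdot>\<^bsub>C\<^esub> f = Ident C x \<Longrightarrow> f \<cdot>\<^bsub>C\<^esub> g = Ident C y \<Longrightarrow>
    iso_arrow C f"
  by (auto simp: iso_arrow_def homs_iff)

lemma iso_arrow_Arr: "iso_arrow C f \<Longrightarrow> f \<in> Arr C"
  by (simp add: iso_arrow_def)

lemma inv_arr:
  assumes "iso_arrow C f"
  shows "inv_arr C f \<in> Arr C" "Dom C (inv_arr C f) = Cod C f" "Cod C (inv_arr C f) = Dom C f"
    "inv_arr C f \<cdot>\<^bsub>C\<^esub> f = Ident C (Dom C f)" "f \<cdot>\<^bsub>C\<^esub> inv_arr C f = Ident C (Cod C f)"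
proof -
  have "\<exists>g. g \<in> homs C (Cod C f) (Dom C f) \<and>
      g \<cdot>\<^bsub>C\<^esub> f = Ident C (Dom C f) \<and> f \<cdot>\<^bsub>C\<^esub> g = Ident C (Cod C f)"
    using assms by (auto simp: iso_arrow_def)
  from someI_ex[OF this] show "inv_arr C f \<in> Arr C" "Dom C (inv_arr C f) = Cod C f"
    "Cod C (inv_arr C f) = Dom C f"
    "inv_arr C f \<cdot>\<^bsub>C\<^esub> f = Ident C (Dom C f)" "f \<cdot>\<^bsub>C\<^esub> inv_arr C f = Ident C (Cod C f)"
    unfolding inv_arr_def[symmetric] by (auto simp: homs_iff)
qed

context category
begin

lemma inv_arr_Comp:
  assumes "iso_arrow C f" "g \<in> Arr C"
  shows "Cod C g = Dom C f \<Longrightarrow> inv_arr C f \<cdot>\<^bsub>C\<^esub> f \<cdot>\<^bsub>C\<^esub> g = g"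
    and "Cod C g = Cod C f \<Longrightarrow> f \<cdot>\<^bsub>C\<^esub> inv_arr C f \<cdot>\<^bsub>C\<^esub> g = g"
  using assms inv_arr[OF assms(1)] iso_arrow_Arr[OF assms(1)] by (simp_all flip: assoc)

lemma iso_Comp:
  assumes "iso_arrow C f" "iso_arrow C g" "Cod C f = Dom C g"
  shows "iso_arrow C (g \<cdot>\<^bsub>C\<^esub> f)"
  using assms inv_arr[OF assms(1)] inv_arr[OF assms(2)] iso_arrow_Arr[OF assms(1)]
    iso_arrow_Arr[OF assms(2)]
  by (intro iso_arrowI[where g = "inv_arr C f \<cdot>\<^bsub>C\<^esub> inv_arr C g" and x = "Dom C f" and y = "Cod C g"])
    (auto simp: homs_iff assoc inv_arr_Comp)

lemma iso_Ident: "x \<in> Obj C \<Longrightarrow> iso_arrow C (Ident C x)"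
  by (rule iso_arrowI[where g = "Ident C x" and x = x and y = x]) (auto simp: homs_iff)

lemma iso_epi:
  assumes "iso_arrow C f" "g \<in> Arr C" "h \<in> Arr C" "Dom C g = Cod C f" "Dom C h = Cod C f"
    "g \<cdot>\<^bsub>C\<^esub> f = h \<cdot>\<^bsub>C\<^esub> f"
  shows "g = h"
proof -
  have "k = (k \<cdot>\<^bsub>C\<^esub> f) \<cdot>\<^bsub>C\<^esub> inv_arr C f" if "k \<in> Arr C" "Dom C k = Cod C f" for k
    using that assms(1) inv_arr[OF assms(1)] iso_arrow_Arr[OF assms(1)] by (simp add: assoc)
  then show ?thesis
    using assms by metis
qed

lemma iso_mono:
  assumes "iso_arrow C f" "g \<in> Arr C" "h \<in> Arr C" "Cod C g = Dom C f" "Cod C h = Dom C f"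
    "f \<cdot>\<^bsub>C\<^esub> g = f \<cdot>\<^bsub>C\<^esub> h"
  shows "g = h"
  using inv_arr_Comp(1)[of f g] inv_arr_Comp(1)[of f h] assms by metis

end

context is_functor
begin

lemma far_Arr [simp]: "f \<in> Arr (fdom F) \<Longrightarrow> far F f \<in> Arr (fcod F)"
  and Dom_far [simp]: "f \<in> Arr (fdom F) \<Longrightarrow> Dom (fcod F) (far F f) = fob F (Dom (fdom F) f)"
  and Cod_far [simp]: "f \<in> Arr (fdom F) \<Longrightarrow> Cod (fcod F) (far F f) = fob F (Cod (fdom F) f)"
  using far_homs by (auto simp: homs_iff)

lemma far_Comp' [simp]:
  "f \<in> Arr (fdom F) \<Longrightarrow> g \<in> Arr (fdom F) \<Longrightarrow> Cod (fdom F) f = Dom (fdom F) g \<Longrightarrow>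
    far F (g \<cdot>\<^bsub>fdom F\<^esub> f) = far F g \<cdot>\<^bsub>fcod F\<^esub> far F f"
  using far_Comp by (auto simp: homs_iff)

lemma far_iso: "iso_arrow (fdom F) f \<Longrightarrow> iso_arrow (fcod F) (far F f)"
  by (rule iso_arrowI[where g = "far F (inv_arr (fdom F) f)"
        and x = "fob F (Dom (fdom F) f)" and y = "fob F (Cod (fdom F) f)"])
    (auto simp: homs_iff inv_arr iso_arrow_Arr dom_category category.Dom_Obj' category.Cod_Obj'
      far_Ident simp flip: far_Comp')

end

lemma functor_eqI:
  assumes "is_functor F" "is_functor G" "fdom F = fdom G" "fcod F = fcod G"
    "\<And>x. x \<in> Obj (fdom F) \<Longrightarrow> fob F x = fob G x"
    "\<And>f. f \<in> Arr (fdom F) \<Longrightarrow> far F f = far G f"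
  shows "F = G"
proof -
  have "fob F = fob G"
    using assms by (intro extensionalityI[where A = "Obj (fdom F)"])
      (auto dest: is_functor.fob_extensional)
  moreover have "far F = far G"
    using assms by (intro extensionalityI[where A = "Arr (fdom F)"])
      (auto dest: is_functor.far_extensional)
  ultimately show ?thesis using assms by (intro cfunctor.equality) auto
qed

lemma functor_comp_sel [simp]:
  "fdom (functor_comp G F) = fdom F" "fcod (functor_comp G F) = fcod G"
  "x \<in> Obj (fdom F) \<Longrightarrow> fob (functor_comp G F) x = fob G (fob F x)"
  "f \<in> Arr (fdom F) \<Longrightarrow> far (functor_comp G F) f = far G (far F f)"
  by (auto simp: functor_comp_def)

lemma id_functor_sel [simp]:
  "fdom (id_functor A) = A" "fcod (id_functor A) = A"
  "x \<in> Obj A \<Longrightarrow> fob (id_functor A) x = x"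
  "f \<in> Arr A \<Longrightarrow> far (id_functor A) f = f"
  by (auto simp: id_functor_def incl_functor_def)

lemma id_functor [simp, intro]: "category A \<Longrightarrow> is_functor (id_functor A)"
  by (intro is_functor.intro) (auto simp: homs_iff id_functor_def incl_functor_def cat_simps)

lemma functor_comp [simp, intro]:
  assumes "is_functor F" "is_functor G" "fdom G = fcod F"
  shows "is_functor (functor_comp G F)"
proof -
  interpret F: is_functor F by fact
  interpret G: is_functor G by fact
  show ?thesis
    using assms F.dom_category G.cod_category
    by (intro is_functor.intro)
      (auto simp: homs_iff F.fob_Obj G.fob_Obj functor_comp_def F.far_Ident
        G.far_Ident[unfolded assms(3)] G.far_Comp'[unfolded assms(3)] cat_simps)
qed

lemma functor_comp_id [simp]:
  assumes "is_functor F"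
  shows "fdom F = A \<Longrightarrow> functor_comp F (id_functor A) = F"
    "fcod F = B \<Longrightarrow> functor_comp (id_functor B) F = F"
  using assms by (auto intro!: functor_eqI simp: is_functor.dom_category is_functor.cod_category
      is_functor.fob_Obj is_functor.far_Arr)

lemma functor_comp_assoc:
  assumes "is_functor F" "is_functor G" "is_functor H" "fdom G = fcod F" "fdom H = fcod G"
  shows "functor_comp H (functor_comp G F) = functor_comp (functor_comp H G) F"
  using assms by (intro functor_eqI)
    (auto simp: is_functor.fob_Obj is_functor.far_Arr)

context is_ntrans
begin

lemma ntc_Arr [simp]:
    "x \<in> Obj (fdom (ntdom \<tau>)) \<Longrightarrow> ntc \<tau> x \<in> Arr (fcod (ntdom \<tau>))"
  and Dom_ntc [simp]:
    "x \<in> Obj (fdom (ntdom \<tau>)) \<Longrightarrow> Dom (fcod (ntdom \<tau>)) (ntc \<tau> x) = fob (ntdom \<tau>) x"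
  and Cod_ntc [simp]:
    "x \<in> Obj (fdom (ntdom \<tau>)) \<Longrightarrow> Cod (fcod (ntdom \<tau>)) (ntc \<tau> x) = fob (ntcod \<tau>) x"
  using ntc_homs by (auto simp: homs_iff)

lemma natural:
  "f \<in> Arr (fdom (ntdom \<tau>)) \<Longrightarrow> Dom (fdom (ntdom \<tau>)) f = x \<Longrightarrow> Cod (fdom (ntdom \<tau>)) f = y \<Longrightarrow>
    ntc \<tau> y \<cdot>\<^bsub>fcod (ntdom \<tau>)\<^esub> far (ntdom \<tau>) f = far (ntcod \<tau>) f \<cdot>\<^bsub>fcod (ntdom \<tau>)\<^esub> ntc \<tau> x"
  using ntc_natural by (auto simp: homs_iff)

end

lemma ntrans_eqI:
  assumes "is_ntrans \<sigma>" "is_ntrans \<tau>" "ntdom \<sigma> = ntdom \<tau>" "ntcod \<sigma> = ntcod \<tau>"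
    "\<And>x. x \<in> Obj (fdom (ntdom \<sigma>)) \<Longrightarrow> ntc \<sigma> x = ntc \<tau> x"
  shows "\<sigma> = \<tau>"
proof -
  have "ntc \<sigma> = ntc \<tau>"
    using assms by (intro extensionalityI[where A = "Obj (fdom (ntdom \<sigma>))"])
      (auto dest: is_ntrans.ntc_extensional)
  with assms show ?thesis by (intro ntrans.equality) auto
qed

lemma id_nt_sel [simp]: "ntdom (id_nt F) = F" "ntcod (id_nt F) = F"
  "x \<in> Obj (fdom F) \<Longrightarrow> ntc (id_nt F) x = Ident (fcod F) (fob F x)"
  by (auto simp: id_nt_def)

lemma vcomp_sel [simp]: "ntdom (vcomp \<sigma> \<tau>) = ntdom \<tau>" "ntcod (vcomp \<sigma> \<tau>) = ntcod \<sigma>"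
  "x \<in> Obj (fdom (ntdom \<tau>)) \<Longrightarrow> ntc (vcomp \<sigma> \<tau>) x = ntc \<sigma> x \<cdot>\<^bsub>fcod (ntdom \<tau>)\<^esub> ntc \<tau> x"
  by (auto simp: vcomp_def)

lemma hcomp_sel [simp]: "ntdom (hcomp \<sigma> \<tau>) = functor_comp (ntdom \<sigma>) (ntdom \<tau>)"
  "ntcod (hcomp \<sigma> \<tau>) = functor_comp (ntcod \<sigma>) (ntcod \<tau>)"
  "x \<in> Obj (fdom (ntdom \<tau>)) \<Longrightarrow> ntc (hcomp \<sigma> \<tau>) x =
     ntc \<sigma> (fob (ntcod \<tau>) x) \<cdot>\<^bsub>fcod (ntdom \<sigma>)\<^esub> far (ntdom \<sigma>) (ntc \<tau> x)"
  by (auto simp: hcomp_def)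

lemma id_nt [simp, intro]:
  assumes "is_functor F" shows "is_ntrans (id_nt F)"
proof -
  interpret is_functor F by fact
  interpret cod: category "fcod F" by (rule cod_category)
  interpret dom: category "fdom F" by (rule dom_category)
  show ?thesis
    using assms by (intro is_ntrans.intro) (auto simp: homs_iff fob_Obj id_nt_def)
qed

lemma vcomp [simp, intro]:
  assumes "is_ntrans \<sigma>" "is_ntrans \<tau>" "ntdom \<sigma> = ntcod \<tau>"
  shows "is_ntrans (vcomp \<sigma> \<tau>)"
proof -
  interpret s: is_ntrans \<sigma> by fact
  interpret t: is_ntrans \<tau> by fact
  interpret F: is_functor "ntdom \<tau>" by (rule t.ntdom_functor)
  interpret G: is_functor "ntcod \<tau>" by (rule t.ntcod_functor)
  interpret H: is_functor "ntcod \<sigma>" by (rule s.ntcod_functor)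
  interpret cod: category "fcod (ntdom \<tau>)" by (rule F.cod_category)
  interpret dom: category "fdom (ntdom \<tau>)" by (rule F.dom_category)
  note [simp] = t.parallel_dom t.parallel_cod s.parallel_dom s.parallel_cod assms(3)
  have s: "ntc \<sigma> x \<in> Arr (fcod (ntdom \<tau>))" "Dom (fcod (ntdom \<tau>)) (ntc \<sigma> x) = fob (ntcod \<tau>) x"
    "Cod (fcod (ntdom \<tau>)) (ntc \<sigma> x) = fob (ntcod \<sigma>) x" if "x \<in> Obj (fdom (ntdom \<tau>))" for x
    using that s.ntc_Arr[of x] s.Dom_ntc[of x] s.Cod_ntc[of x] by simp_all
  have H: "far (ntcod \<sigma>) f \<in> Arr (fcod (ntdom \<tau>))"
    "Dom (fcod (ntdom \<tau>)) (far (ntcod \<sigma>) f) = fob (ntcod \<sigma>) (Dom (fdom (ntdom \<tau>)) f)"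
     if "f \<in> Arr (fdom (ntdom \<tau>))" for f
    using that H.far_Arr[of f] H.Dom_far[of f] by simp_all
  have G: "far (ntcod \<tau>) f \<in> Arr (fcod (ntdom \<tau>))"
    "Dom (fcod (ntdom \<tau>)) (far (ntcod \<tau>) f) = fob (ntcod \<tau>) (Dom (fdom (ntdom \<tau>)) f)"
    "Cod (fcod (ntdom \<tau>)) (far (ntcod \<tau>) f) = fob (ntcod \<tau>) (Cod (fdom (ntdom \<tau>)) f)"
     if "f \<in> Arr (fdom (ntdom \<tau>))" for f
    using that G.far_Arr[of f] G.Dom_far[of f] G.Cod_far[of f] by simp_all
  have nat: "(ntc \<sigma> y \<cdot>\<^bsub>fcod (ntdom \<tau>)\<^esub> ntc \<tau> y) \<cdot>\<^bsub>fcod (ntdom \<tau>)\<^esub> far (ntdom \<tau>) f =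
       far (ntcod \<sigma>) f \<cdot>\<^bsub>fcod (ntdom \<tau>)\<^esub> ntc \<sigma> x \<cdot>\<^bsub>fcod (ntdom \<tau>)\<^esub> ntc \<tau> x"
    if f: "f \<in> homs (fdom (ntdom \<tau>)) x y" for f x y
  proof -
    have xy: "x \<in> Obj (fdom (ntdom \<tau>))" "y \<in> Obj (fdom (ntdom \<tau>))"
      using dom.homs_Obj[OF f] by auto
    have "(ntc \<sigma> y \<cdot>\<^bsub>fcod (ntdom \<tau>)\<^esub> ntc \<tau> y) \<cdot>\<^bsub>fcod (ntdom \<tau>)\<^esub> far (ntdom \<tau>) f =
      ntc \<sigma> y \<cdot>\<^bsub>fcod (ntdom \<tau>)\<^esub> far (ntcod \<tau>) f \<cdot>\<^bsub>fcod (ntdom \<tau>)\<^esub> ntc \<tau> x"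
      using f xy by (simp add: homs_iff cod.assoc s t.natural)
    also have "\<dots> = (ntc \<sigma> y \<cdot>\<^bsub>fcod (ntdom \<tau>)\<^esub> far (ntcod \<tau>) f) \<cdot>\<^bsub>fcod (ntdom \<tau>)\<^esub> ntc \<tau> x"
      using f xy by (simp add: homs_iff cod.assoc s G)
    also have "\<dots> = (far (ntcod \<sigma>) f \<cdot>\<^bsub>fcod (ntdom \<tau>)\<^esub> ntc \<sigma> x) \<cdot>\<^bsub>fcod (ntdom \<tau>)\<^esub> ntc \<tau> x"
      using f s.natural[of f x y] by (simp add: homs_iff)
    finally show ?thesis
      using f xy by (simp add: homs_iff cod.assoc s H)
  qed
  show ?thesis
    using t.ntdom_functor s.ntcod_functor s nat
    by (intro is_ntrans.intro) (auto simp: homs_iff vcomp_def)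
qed

lemma hcomp [simp, intro]:
  assumes "is_ntrans \<sigma>" "is_ntrans \<tau>" "fdom (ntdom \<sigma>) = fcod (ntdom \<tau>)"
  shows "is_ntrans (hcomp \<sigma> \<tau>)"
proof -
  interpret s: is_ntrans \<sigma> by fact
  interpret t: is_ntrans \<tau> by fact
  interpret F: is_functor "ntdom \<tau>" by (rule t.ntdom_functor)
  interpret G: is_functor "ntcod \<tau>" by (rule t.ntcod_functor)
  interpret H: is_functor "ntdom \<sigma>" by (rule s.ntdom_functor)
  interpret K: is_functor "ntcod \<sigma>" by (rule s.ntcod_functor)
  interpret cod: category "fcod (ntdom \<sigma>)" by (rule H.cod_category)
  interpret dom: category "fdom (ntdom \<tau>)" by (rule F.dom_category)
  note [simp] = t.parallel_dom t.parallel_cod s.parallel_dom s.parallel_cod assms(3)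
  have G: "far (ntcod \<tau>) f \<in> Arr (fcod (ntdom \<tau>))"
    "Dom (fcod (ntdom \<tau>)) (far (ntcod \<tau>) f) = fob (ntcod \<tau>) (Dom (fdom (ntdom \<tau>)) f)"
    "Cod (fcod (ntdom \<tau>)) (far (ntcod \<tau>) f) = fob (ntcod \<tau>) (Cod (fdom (ntdom \<tau>)) f)"
     if "f \<in> Arr (fdom (ntdom \<tau>))" for f
    using that G.far_Arr[of f] G.Dom_far[of f] G.Cod_far[of f] by simp_all
  have H: "far (ntdom \<sigma>) f \<in> Arr (fcod (ntdom \<sigma>))"
    "Dom (fcod (ntdom \<sigma>)) (far (ntdom \<sigma>) f) = fob (ntdom \<sigma>) (Dom (fcod (ntdom \<tau>)) f)"
    "Cod (fcod (ntdom \<sigma>)) (far (ntdom \<sigma>) f) = fob (ntdom \<sigma>) (Cod (fcod (ntdom \<tau>)) f)"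
     if "f \<in> Arr (fcod (ntdom \<tau>))" for f
    using that H.far_Arr[of f] H.Dom_far[of f] H.Cod_far[of f] by simp_all
  have K: "far (ntcod \<sigma>) f \<in> Arr (fcod (ntdom \<sigma>))"
    "Dom (fcod (ntdom \<sigma>)) (far (ntcod \<sigma>) f) = fob (ntcod \<sigma>) (Dom (fcod (ntdom \<tau>)) f)"
    "Cod (fcod (ntdom \<sigma>)) (far (ntcod \<sigma>) f) = fob (ntcod \<sigma>) (Cod (fcod (ntdom \<tau>)) f)"
     if "f \<in> Arr (fcod (ntdom \<tau>))" for f
    using that K.far_Arr[of f] K.Dom_far[of f] K.Cod_far[of f] by simp_all
  have Gob: "fob (ntcod \<tau>) x \<in> Obj (fcod (ntdom \<tau>))" if "x \<in> Obj (fdom (ntdom \<tau>))" for x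
    using that G.fob_Obj[of x] by simp
  have s: "ntc \<sigma> x \<in> Arr (fcod (ntdom \<sigma>))" "Dom (fcod (ntdom \<sigma>)) (ntc \<sigma> x) = fob (ntdom \<sigma>) x"
    "Cod (fcod (ntdom \<sigma>)) (ntc \<sigma> x) = fob (ntcod \<sigma>) x" if "x \<in> Obj (fcod (ntdom \<tau>))" for x
    using that s.ntc_Arr[of x] s.Dom_ntc[of x] s.Cod_ntc[of x] by simp_all
  have nat: "(ntc \<sigma> (fob (ntcod \<tau>) y) \<cdot>\<^bsub>fcod (ntdom \<sigma>)\<^esub> far (ntdom \<sigma>) (ntc \<tau> y)) \<cdot>\<^bsub>fcod (ntdom \<sigma>)\<^esub>
        far (ntdom \<sigma>) (far (ntdom \<tau>) f) =
       far (ntcod \<sigma>) (far (ntcod \<tau>) f) \<cdot>\<^bsub>fcod (ntdom \<sigma>)\<^esub> ntc \<sigma> (fob (ntcod \<tau>) x)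
        \<cdot>\<^bsub>fcod (ntdom \<sigma>)\<^esub> far (ntdom \<sigma>) (ntc \<tau> x)"
    if f: "f \<in> homs (fdom (ntdom \<tau>)) x y" for f x y
  proof -
    have xy: "x \<in> Obj (fdom (ntdom \<tau>))" "y \<in> Obj (fdom (ntdom \<tau>))"
      using dom.homs_Obj[OF f] by auto
    have 1: "far (ntdom \<sigma>) (ntc \<tau> y) \<cdot>\<^bsub>fcod (ntdom \<sigma>)\<^esub> far (ntdom \<sigma>) (far (ntdom \<tau>) f) =
      far (ntdom \<sigma>) (far (ntcod \<tau>) f) \<cdot>\<^bsub>fcod (ntdom \<sigma>)\<^esub> far (ntdom \<sigma>) (ntc \<tau> x)"
      using f xy t.natural[of f x y]
      by (simp add: homs_iff G H.far_Comp'[symmetric] del: H.far_Comp')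
    have 2: "ntc \<sigma> (fob (ntcod \<tau>) y) \<cdot>\<^bsub>fcod (ntdom \<sigma>)\<^esub> far (ntdom \<sigma>) (far (ntcod \<tau>) f) =
      far (ntcod \<sigma>) (far (ntcod \<tau>) f) \<cdot>\<^bsub>fcod (ntdom \<sigma>)\<^esub> ntc \<sigma> (fob (ntcod \<tau>) x)"
      using f xy by (intro s.natural) (simp_all add: homs_iff G)
    have "(ntc \<sigma> (fob (ntcod \<tau>) y) \<cdot>\<^bsub>fcod (ntdom \<sigma>)\<^esub> far (ntdom \<sigma>) (ntc \<tau> y)) \<cdot>\<^bsub>fcod (ntdom \<sigma>)\<^esub>
        far (ntdom \<sigma>) (far (ntdom \<tau>) f) =
      (ntc \<sigma> (fob (ntcod \<tau>) y) \<cdot>\<^bsub>fcod (ntdom \<sigma>)\<^esub> far (ntdom \<sigma>) (far (ntcod \<tau>) f)) \<cdot>\<^bsub>fcod (ntdom \<sigma>)\<^esub>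
        far (ntdom \<sigma>) (ntc \<tau> x)"
      using f xy by (simp add: homs_iff cod.assoc s G H Gob 1)
    then show ?thesis
      unfolding 2 using f xy by (simp add: homs_iff cod.assoc s G H K Gob)
  qed
  show ?thesis
    using F.is_functor_axioms G.is_functor_axioms H.is_functor_axioms K.is_functor_axioms nat
    by (intro is_ntrans.intro) (auto simp: homs_iff hcomp_def s H Gob is_functor.dom_category)
qed

section \<open>Equivalences of categories\<close>

definition fully_faithful :: "('o, 'm, 'p, 'n) cfunctor \<Rightarrow> bool" where
  "fully_faithful F \<longleftrightarrow> (\<forall>x\<in>Obj (fdom F). \<forall>y\<in>Obj (fdom F).
    \<forall>k\<in>homs (fcod F) (fob F x) (fob F y). \<exists>!f. f \<in> homs (fdom F) x y \<and> far F f = k)"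

definition essentially_surjective :: "('o, 'm, 'p, 'n) cfunctor \<Rightarrow> bool" where
  "essentially_surjective F \<longleftrightarrow> (\<forall>y\<in>Obj (fcod F). \<exists>x\<in>Obj (fdom F).
    \<exists>e\<in>homs (fcod F) (fob F x) y. iso_arrow (fcod F) e)"

text \<open>
  The quasi-inverse picks a preimage of each object up to isomorphism; on arrows it conjugates by
  the chosen isomorphisms and lifts along the fully faithful functor.
\<close>

lemma equivalenceI:
  assumes F: "is_functor F" and ff: "fully_faithful F" and es: "essentially_surjective F"
  shows "is_equivalence F"
proof -
  interpret F: is_functor F by fact
  interpret dom: category "fdom F" by (rule F.dom_category)
  interpret cod: category "fcod F" by (rule F.cod_category)
  have "\<forall>y\<in>Obj (fcod F). \<exists>xe. fst xe \<in> Obj (fdom F) \<and>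
      snd xe \<in> homs (fcod F) (fob F (fst xe)) y \<and> iso_arrow (fcod F) (snd xe)"
    using es unfolding essentially_surjective_def by fastforce
  then obtain xe where xe: "\<And>y. y \<in> Obj (fcod F) \<Longrightarrow> fst (xe y) \<in> Obj (fdom F) \<and>
      snd (xe y) \<in> homs (fcod F) (fob F (fst (xe y))) y \<and> iso_arrow (fcod F) (snd (xe y))"
    by metis
  define g where "g y = fst (xe y)" for y
  define e where "e y = snd (xe y)" for y
  have g [simp]: "g y \<in> Obj (fdom F)" and iso [simp]: "iso_arrow (fcod F) (e y)"
    and e [simp]: "e y \<in> Arr (fcod F)" "Dom (fcod F) (e y) = fob F (g y)"
      "Cod (fcod F) (e y) = y" if "y \<in> Obj (fcod F)" for y
    using xe[OF that] by (auto simp: g_def e_def homs_iff)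
  have ie [simp]: "inv_arr (fcod F) (e y) \<in> Arr (fcod F)"
      "Dom (fcod F) (inv_arr (fcod F) (e y)) = y" "Cod (fcod F) (inv_arr (fcod F) (e y)) = fob F (g y)"
      if "y \<in> Obj (fcod F)" for y
    using that inv_arr[OF iso[OF that]] by auto
  define lift where "lift x y k = (THE f. f \<in> homs (fdom F) x y \<and> far F f = k)" for x y k
  have lift: "lift x y k \<in> Arr (fdom F) \<and> Dom (fdom F) (lift x y k) = x \<and>
      Cod (fdom F) (lift x y k) = y \<and> far F (lift x y k) = k"
    if "k \<in> Arr (fcod F)" "Dom (fcod F) k = fob F x" "Cod (fcod F) k = fob F y"
       "x \<in> Obj (fdom F)" "y \<in> Obj (fdom F)" for x y k
  proof -
    have "\<exists>!f. f \<in> homs (fdom F) x y \<and> far F f = k"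
      using ff that unfolding fully_faithful_def by (auto simp: homs_iff)
    from theI'[OF this] show ?thesis unfolding lift_def by (auto simp: homs_iff)
  qed
  have inj: "f = f'" if "f \<in> Arr (fdom F)" "f' \<in> Arr (fdom F)" "Dom (fdom F) f = Dom (fdom F) f'"
    "Cod (fdom F) f = Cod (fdom F) f'" "far F f = far F f'" for f f'
  proof -
    have "\<exists>!h. h \<in> homs (fdom F) (Dom (fdom F) f) (Cod (fdom F) f) \<and> far F h = far F f"
      using ff that unfolding fully_faithful_def by (simp add: homs_iff)
    with that show ?thesis by (auto simp: homs_iff)
  qed
  define conj where "conj k = inv_arr (fcod F) (e (Cod (fcod F) k)) \<cdot>\<^bsub>fcod F\<^esub> k
      \<cdot>\<^bsub>fcod F\<^esub> e (Dom (fcod F) k)" for k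
  have conj: "conj k \<in> Arr (fcod F)" "Dom (fcod F) (conj k) = fob F (g (Dom (fcod F) k))"
     "Cod (fcod F) (conj k) = fob F (g (Cod (fcod F) k))" if "k \<in> Arr (fcod F)" for k
    using that by (simp_all add: conj_def)
  define G where "G = \<lparr>fdom = fcod F, fcod = fdom F, fob = (\<lambda>y\<in>Obj (fcod F). g y),
     far = (\<lambda>k\<in>Arr (fcod F). lift (g (Dom (fcod F) k)) (g (Cod (fcod F) k)) (conj k))\<rparr>"
  have Gsel [simp]: "fdom G = fcod F" "fcod G = fdom F" "y \<in> Obj (fcod F) \<Longrightarrow> fob G y = g y" for y
    by (auto simp: G_def)
  have Gar: "far G k \<in> Arr (fdom F)" "Dom (fdom F) (far G k) = g (Dom (fcod F) k)"
    "Cod (fdom F) (far G k) = g (Cod (fcod F) k)" "far F (far G k) = conj k"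
    if "k \<in> Arr (fcod F)" for k
    using that lift[OF conj[OF that]] by (simp_all add: G_def)
  have G: "is_functor G"
  proof (intro is_functor.intro)
    fix k l x y z
    assume k: "k \<in> homs (fdom G) x y" and l: "l \<in> homs (fdom G) y z"
    then have "x \<in> Obj (fcod F)" "y \<in> Obj (fcod F)" "z \<in> Obj (fcod F)"
      using cod.homs_Obj by auto
    with k l show "far G (l \<cdot>\<^bsub>fdom G\<^esub> k) = far G l \<cdot>\<^bsub>fcod G\<^esub> far G k"
      by (intro inj) (simp_all add: homs_iff Gar conj_def cod.assoc cod.inv_arr_Comp)
  next
    fix x assume "x \<in> Obj (fdom G)"
    then show "far G (Ident (fdom G) x) = Ident (fcod G) (fob G x)"
      by (intro inj) (simp_all add: homs_iff Gar conj_def inv_arr F.far_Ident)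
  qed (auto simp: homs_iff Gar F.dom_category F.cod_category, auto simp: G_def)
  have nat1: "natural_iso \<lparr>ntdom = functor_comp F G, ntcod = id_functor (fcod F),
      ntc = (\<lambda>y\<in>Obj (fcod F). e y)\<rparr>"
    unfolding natural_iso_def using F G
    by (auto intro!: is_ntrans.intro simp: F.cod_category homs_iff Gar conj_def cod.inv_arr_Comp)
  have liso: "iso_arrow (fdom F) f"
    if f: "f \<in> homs (fdom F) x y" "iso_arrow (fcod F) (far F f)" for f x y
  proof -
    let ?g = "lift y x (inv_arr (fcod F) (far F f))"
    have xy: "x \<in> Obj (fdom F)" "y \<in> Obj (fdom F)" using dom.homs_Obj[OF f(1)] by auto
    have g: "?g \<in> Arr (fdom F) \<and> Dom (fdom F) ?g = y \<and>
      Cod (fdom F) ?g = x \<and> far F ?g = inv_arr (fcod F) (far F f)"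
      using f inv_arr[OF f(2)] xy by (intro lift) (auto simp: homs_iff)
    show ?thesis
      using f g xy inv_arr[OF f(2)]
      by (intro iso_arrowI[where g = ?g and x = x and y = y] inj)
        (auto simp: homs_iff F.far_Ident)
  qed
  define u where "u x = lift (g (fob F x)) x (e (fob F x))" for x
  have u: "u x \<in> Arr (fdom F)" "Dom (fdom F) (u x) = g (fob F x)"
      "Cod (fdom F) (u x) = x" "far F (u x) = e (fob F x)" if "x \<in> Obj (fdom F)" for x
    using that lift[of "e (fob F x)" "g (fob F x)" x] by (auto simp: u_def F.fob_Obj)
  define U where "U = \<lparr>ntdom = functor_comp G F, ntcod = id_functor (fdom F),
      ntc = (\<lambda>y\<in>Obj (fdom F). u y)\<rparr>"
  have U: "ntdom U = functor_comp G F" "ntcod U = id_functor (fdom F)"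
    "x \<in> Obj (fdom F) \<Longrightarrow> ntc U x = u x" "ntc U \<in> extensional (Obj (fdom F))" for x
    by (auto simp: U_def)
  have nat2: "natural_iso U"
    unfolding natural_iso_def
  proof (intro conjI ballI)
    show "is_ntrans U"
    proof (intro is_ntrans.intro)
      fix f x y assume "f \<in> homs (fdom (ntdom U)) x y"
      then have f: "f \<in> Arr (fdom F)" "Dom (fdom F) f = x" "Cod (fdom F) f = y"
        "x \<in> Obj (fdom F)" "y \<in> Obj (fdom F)"
        by (auto simp: homs_iff U)
      then have "u y \<cdot>\<^bsub>fdom F\<^esub> far G (far F f) = f \<cdot>\<^bsub>fdom F\<^esub> u x"
        by (intro inj) (auto simp: u Gar conj_def F.fob_Obj cod.inv_arr_Comp)
      with f show "ntc U y \<cdot>\<^bsub>fcod (ntdom U)\<^esub> far (ntdom U) f =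
         far (ntcod U) f \<cdot>\<^bsub>fcod (ntdom U)\<^esub> ntc U x"
        by (simp add: U)
    qed (auto simp: U F G u F.dom_category F.fob_Obj homs_iff)
  next
    fix x assume "x \<in> Obj (fdom (ntdom U))"
    then show "iso_arrow (fcod (ntdom U)) (ntc U x)"
      by (auto intro!: liso[of _ "g (fob F x)" x] simp: homs_iff U u F.fob_Obj)
  qed
  show ?thesis
    unfolding is_equivalence_def isomorphic_functors_def
    using F G nat1 nat2
    by (intro conjI exI[of _ G]) (force simp: U_def)+
qed

lemma natural_isoD:
  assumes "natural_iso \<tau>" "x \<in> Obj (fdom (ntdom \<tau>))"
  shows "iso_arrow (fcod (ntdom \<tau>)) (ntc \<tau> x)"
  using assms by (auto simp: natural_iso_def)

text \<open>
  Conjugation by the isomorphism recovers an arrow from its image under \<open>G F\<close>.  The lemma is used for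
  both functors of an equivalence: fullness follows because a candidate preimage and the given arrow
  agree after the faithful quasi-inverse is applied.
\<close>

lemma iso_identity_faithful:
  assumes F: "is_functor F" and G: "is_functor G" "fdom G = fcod F" "fcod G = fdom F"
    and \<alpha>: "natural_iso \<alpha>" "ntdom \<alpha> = functor_comp G F" "ntcod \<alpha> = id_functor (fdom F)"
    and fg: "f \<in> homs (fdom F) x y" "g \<in> homs (fdom F) x y" "far F f = far F g"
  shows "f = g"
proof -
  interpret F: is_functor F by fact
  interpret dom: category "fdom F" by (rule F.dom_category)
  interpret \<alpha>: is_ntrans \<alpha> using \<alpha> by (simp add: natural_iso_def)
  have x: "x \<in> Obj (fdom F)" using dom.homs_Obj[OF fg(1)] by auto
  have "ntc \<alpha> y \<cdot>\<^bsub>fdom F\<^esub> far G (far F h) = h \<cdot>\<^bsub>fdom F\<^esub> ntc \<alpha> x" if "h \<in> homs (fdom F) x y" for h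
    using \<alpha>.natural[of h x y] that \<alpha> G by (simp add: homs_iff)
  from this[OF fg(1)] this[OF fg(2)] have "f \<cdot>\<^bsub>fdom F\<^esub> ntc \<alpha> x = g \<cdot>\<^bsub>fdom F\<^esub> ntc \<alpha> x"
    using fg by simp
  moreover have "iso_arrow (fdom F) (ntc \<alpha> x)"
    using natural_isoD[OF \<alpha>(1), of x] x \<alpha> G by simp
  ultimately show ?thesis
    using dom.iso_epi[of "ntc \<alpha> x" f g] fg \<alpha>.Cod_ntc[of x] x \<alpha> G by (simp add: homs_iff)
qed

lemma equivalenceD:
  assumes "is_equivalence F"
  shows "is_functor F" "fully_faithful F" "essentially_surjective F"
proof -
  show F: "is_functor F" using assms by (simp add: is_equivalence_def)
  then interpret F: is_functor F .
  interpret dom: category "fdom F" by (rule F.dom_category)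
  interpret cod: category "fcod F" by (rule F.cod_category)
  obtain G \<alpha> \<beta> where G: "is_functor G" "fdom G = fcod F" "fcod G = fdom F"
    and \<alpha>: "natural_iso \<alpha>" "ntdom \<alpha> = functor_comp G F" "ntcod \<alpha> = id_functor (fdom F)"
    and \<beta>: "natural_iso \<beta>" "ntdom \<beta> = functor_comp F G" "ntcod \<beta> = id_functor (fcod F)"
    using assms unfolding is_equivalence_def isomorphic_functors_def by auto
  interpret G: is_functor G by fact
  interpret \<alpha>: is_ntrans \<alpha> using \<alpha> by (simp add: natural_iso_def)
  interpret \<beta>: is_ntrans \<beta> using \<beta> by (simp add: natural_iso_def)
  have a: "ntc \<alpha> x \<in> Arr (fdom F)" "Dom (fdom F) (ntc \<alpha> x) = fob G (fob F x)"
    "Cod (fdom F) (ntc \<alpha> x) = x" "iso_arrow (fdom F) (ntc \<alpha> x)" if "x \<in> Obj (fdom F)" for x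
    using \<alpha>.ntc_Arr[of x] \<alpha>.Dom_ntc[of x] \<alpha>.Cod_ntc[of x] natural_isoD[OF \<alpha>(1), of x] that \<alpha> G
    by simp_all
  have nat: "ntc \<alpha> y \<cdot>\<^bsub>fdom F\<^esub> far G (far F h) = h \<cdot>\<^bsub>fdom F\<^esub> ntc \<alpha> x" if "h \<in> homs (fdom F) x y" for h x y
    using \<alpha>.natural[of h x y] that \<alpha> G by (simp add: homs_iff)
  have Gf: "f = g" if "f \<in> homs (fcod F) x y" "g \<in> homs (fcod F) x y" "far G f = far G g" for f g x y
    using iso_identity_faithful[OF G(1) F, of \<beta> f x y g] that \<beta> G by simp
  have GA: "far G k \<in> Arr (fdom F)" "Dom (fdom F) (far G k) = fob G (Dom (fcod F) k)"
    "Cod (fdom F) (far G k) = fob G (Cod (fcod F) k)" if "k \<in> Arr (fcod F)" for k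
    using that G.far_Arr[of k] G.Dom_far[of k] G.Cod_far[of k] G by simp_all
  show "fully_faithful F"
    unfolding fully_faithful_def
  proof (intro ballI ex_ex1I)
    fix x y k assume xy: "x \<in> Obj (fdom F)" "y \<in> Obj (fdom F)"
      and k: "k \<in> homs (fcod F) (fob F x) (fob F y)"
    let ?f = "ntc \<alpha> y \<cdot>\<^bsub>fdom F\<^esub> far G k \<cdot>\<^bsub>fdom F\<^esub> inv_arr (fdom F) (ntc \<alpha> x)"
    note ai = inv_arr[OF a(4)[OF xy(1)]]
    have f: "?f \<in> homs (fdom F) x y" using xy k a ai by (simp add: homs_iff GA)
    have "ntc \<alpha> y \<cdot>\<^bsub>fdom F\<^esub> far G (far F ?f) = ntc \<alpha> y \<cdot>\<^bsub>fdom F\<^esub> far G k"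
      using nat[OF f] xy k a ai by (simp add: homs_iff GA dom.assoc)
    moreover have "far F ?f \<in> homs (fcod F) (fob F x) (fob F y)" using f by (simp add: F.far_homs)
    ultimately have "far G (far F ?f) = far G k"
      using dom.iso_mono[OF a(4)[OF xy(2)], of "far G (far F ?f)" "far G k"] xy k
      by (simp add: homs_iff GA a)
    then have "far F ?f = k" using f k by (intro Gf) (auto intro: F.far_homs)
    then show "\<exists>f. f \<in> homs (fdom F) x y \<and> far F f = k" using f by blast
  next
    fix x y k f g assume "f \<in> homs (fdom F) x y \<and> far F f = k" "g \<in> homs (fdom F) x y \<and> far F g = k"
    then show "f = g" using iso_identity_faithful[OF F G \<alpha>, of f x y g] by simp
  qed
  show "essentially_surjective F"
    unfolding essentially_surjective_def
  proof
    fix y assume y: "y \<in> Obj (fcod F)"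
    show "\<exists>x\<in>Obj (fdom F). \<exists>e\<in>homs (fcod F) (fob F x) y. iso_arrow (fcod F) e"
      using y G.fob_Obj[of y] natural_isoD[OF \<beta>(1), of y] \<beta>.ntc_homs[of y] \<beta> G
      by (intro bexI[of _ "fob G y"] bexI[of _ "ntc \<beta> y"]) auto
  qed
qed

section \<open>The strict 2-category of categories\<close>

lemma Cat2_sel [simp]: "Ob Cat2 = {A. category A}" "One Cat2 = {F. is_functor F}"
  "Two Cat2 = {\<tau>. is_ntrans \<tau>}" "Src Cat2 = fdom" "Tgt Cat2 = fcod" "Dom2 Cat2 = ntdom"
  "Cod2 Cat2 = ntcod" "Id1 Cat2 = id_functor" "Id2 Cat2 = id_nt" "Comp1 Cat2 = functor_comp"
  "VComp Cat2 = vcomp" "HComp Cat2 = hcomp"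
  by (simp_all add: Cat2_def)

lemma cells1_Cat2: "F \<in> cells1 Cat2 A B \<longleftrightarrow> is_functor F \<and> fdom F = A \<and> fcod F = B"
  by (simp add: cells1_def)

lemma cells2_Cat2: "\<tau> \<in> cells2 Cat2 F G \<longleftrightarrow> is_ntrans \<tau> \<and> ntdom \<tau> = F \<and> ntcod \<tau> = G"
  by (simp add: cells2_def)

text \<open>
  The functors and categories are named by separate variables here, so that a chain of composable
  transformations can be typed over one and the same pair of categories.
\<close>

lemma nt_typing:
  assumes "is_ntrans \<tau>" "ntdom \<tau> = F" "ntcod \<tau> = G" "fdom F = A" "fcod F = B"
  shows "is_functor F" "is_functor G" "fdom G = A" "fcod G = B" "category A" "category B"
    and "x \<in> Obj A \<Longrightarrow> ntc \<tau> x \<in> Arr B"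
    and "x \<in> Obj A \<Longrightarrow> Dom B (ntc \<tau> x) = fob F x"
    and "x \<in> Obj A \<Longrightarrow> Cod B (ntc \<tau> x) = fob G x"
    and "f \<in> Arr A \<Longrightarrow> Dom A f = x \<Longrightarrow> Cod A f = y \<Longrightarrow>
      ntc \<tau> y \<cdot>\<^bsub>B\<^esub> far F f = far G f \<cdot>\<^bsub>B\<^esub> ntc \<tau> x"
  using assms is_ntrans.ntdom_functor is_ntrans.ntcod_functor is_ntrans.parallel_dom
    is_ntrans.parallel_cod is_ntrans.natural[of \<tau> f x y] is_ntrans.ntc_Arr is_ntrans.Dom_ntc is_ntrans.Cod_ntc
  by (auto dest: is_functor.dom_category is_functor.cod_category)

lemma vcomp_assoc:
  assumes "is_ntrans \<alpha>" "is_ntrans \<beta>" "is_ntrans \<gamma>" "ntcod \<alpha> = ntdom \<beta>" "ntcod \<beta> = ntdom \<gamma>"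
  shows "vcomp \<gamma> (vcomp \<beta> \<alpha>) = vcomp (vcomp \<gamma> \<beta>) \<alpha>"
proof -
  note a = nt_typing[OF assms(1) refl refl refl refl, simp]
  note b = nt_typing[OF assms(2) assms(4)[symmetric] refl a(3,4), simp]
  note c = nt_typing[OF assms(3) assms(5)[symmetric] refl b(3,4), simp]
  show ?thesis
    by (rule ntrans_eqI) (simp_all add: assms(1-3) assms(4,5)[symmetric] cat_simps)
qed

lemma vcomp_id:
  assumes "is_ntrans \<alpha>"
  shows "ntdom \<alpha> = F \<Longrightarrow> vcomp \<alpha> (id_nt F) = \<alpha>" "ntcod \<alpha> = F \<Longrightarrow> vcomp (id_nt F) \<alpha> = \<alpha>"
proof -
  note a = nt_typing[OF assms(1) refl refl refl refl, simp]
  show "ntdom \<alpha> = F \<Longrightarrow> vcomp \<alpha> (id_nt F) = \<alpha>" "ntcod \<alpha> = F \<Longrightarrow> vcomp (id_nt F) \<alpha> = \<alpha>"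
    by (auto intro!: ntrans_eqI simp: assms cat_simps is_functor.fob_Obj)
qed

lemma interchange_Cat2:
  assumes "is_ntrans \<alpha>" "is_ntrans \<alpha>'" "ntcod \<alpha> = ntdom \<alpha>'"
    "is_ntrans \<beta>" "is_ntrans \<beta>'" "ntcod \<beta> = ntdom \<beta>'" "fdom (ntdom \<beta>) = fcod (ntdom \<alpha>)"
  shows "hcomp (vcomp \<beta>' \<beta>) (vcomp \<alpha>' \<alpha>) = vcomp (hcomp \<beta>' \<alpha>') (hcomp \<beta> \<alpha>)"
proof (rule ntrans_eqI)
  note a = nt_typing[OF assms(1) refl assms(3) refl refl, simp] and a' = nt_typing[OF assms(2) refl refl refl refl, simp]
    and b = nt_typing[OF assms(4) refl assms(6) refl refl, simp] and b' = nt_typing[OF assms(5) refl refl refl refl, simp]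
  note [simp] = assms(3,6,7)
  have ob: "fob (ntdom \<alpha>) x \<in> Obj (fcod (ntdom \<alpha>))" "fob (ntdom \<alpha>') x \<in> Obj (fcod (ntdom \<alpha>))"
    "fob (ntcod \<alpha>') x \<in> Obj (fcod (ntdom \<alpha>))" if "x \<in> Obj (fdom (ntdom \<alpha>))" for x
    using that is_functor.fob_Obj[OF a(1), of x] is_functor.fob_Obj[OF a'(1), of x]
      is_functor.fob_Obj[OF a'(2), of x] by simp_all
  have k: "ntc \<alpha>' x \<in> Arr (fcod (ntdom \<alpha>))" "Dom (fcod (ntdom \<alpha>)) (ntc \<alpha>' x) = fob (ntdom \<alpha>') x"
    "Cod (fcod (ntdom \<alpha>)) (ntc \<alpha>' x) = fob (ntcod \<alpha>') x"
    if "x \<in> Obj (fdom (ntdom \<alpha>))" for x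
    using that a'(7,8,9)[of x] by simp_all
  have l: "ntc \<beta>' x \<in> Arr (fcod (ntdom \<beta>))" "Dom (fcod (ntdom \<beta>)) (ntc \<beta>' x) = fob (ntdom \<beta>') x"
    "Cod (fcod (ntdom \<beta>)) (ntc \<beta>' x) = fob (ntcod \<beta>') x"
    if "x \<in> Obj (fcod (ntdom \<alpha>))" for x
    using that b'(7,8,9)[of x] by simp_all
  have F: "far (ntdom \<beta>) h \<in> Arr (fcod (ntdom \<beta>))"
    "Dom (fcod (ntdom \<beta>)) (far (ntdom \<beta>) h) = fob (ntdom \<beta>) (Dom (fcod (ntdom \<alpha>)) h)"
    "Cod (fcod (ntdom \<beta>)) (far (ntdom \<beta>) h) = fob (ntdom \<beta>) (Cod (fcod (ntdom \<alpha>)) h)"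
    "far (ntdom \<beta>') h \<in> Arr (fcod (ntdom \<beta>))"
    "Dom (fcod (ntdom \<beta>)) (far (ntdom \<beta>') h) = fob (ntdom \<beta>') (Dom (fcod (ntdom \<alpha>)) h)"
    "Cod (fcod (ntdom \<beta>)) (far (ntdom \<beta>') h) = fob (ntdom \<beta>') (Cod (fcod (ntdom \<alpha>)) h)"
    if "h \<in> Arr (fcod (ntdom \<alpha>))" for h
    using that is_functor.far_Arr[OF b(1), of h] is_functor.Dom_far[OF b(1), of h]
      is_functor.Cod_far[OF b(1), of h] is_functor.far_Arr[OF b'(1), of h]
      is_functor.Dom_far[OF b'(1), of h] is_functor.Cod_far[OF b'(1), of h]
    by simp_all
  interpret category "fcod (ntdom \<beta>)" by simp
  show "is_ntrans (hcomp (vcomp \<beta>' \<beta>) (vcomp \<alpha>' \<alpha>))" "is_ntrans (vcomp (hcomp \<beta>' \<alpha>') (hcomp \<beta> \<alpha>))"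
    using assms by auto
  fix x assume "x \<in> Obj (fdom (ntdom (hcomp (vcomp \<beta>' \<beta>) (vcomp \<alpha>' \<alpha>))))"
  then have x: "x \<in> Obj (fdom (ntdom \<alpha>))" by simp
  have 1: "far (ntdom \<beta>) (ntc \<alpha>' x \<cdot>\<^bsub>fcod (ntdom \<alpha>)\<^esub> ntc \<alpha> x) =
     far (ntdom \<beta>) (ntc \<alpha>' x) \<cdot>\<^bsub>fcod (ntdom \<beta>)\<^esub> far (ntdom \<beta>) (ntc \<alpha> x)"
    using is_functor.far_Comp'[OF b(1), of "ntc \<alpha> x" "ntc \<alpha>' x"] x by (simp add: k)
  have 2: "ntc \<beta> (fob (ntcod \<alpha>') x) \<cdot>\<^bsub>fcod (ntdom \<beta>)\<^esub> far (ntdom \<beta>) (ntc \<alpha>' x) \<cdot>\<^bsub>fcod (ntdom \<beta>)\<^esub> r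
    = far (ntdom \<beta>') (ntc \<alpha>' x) \<cdot>\<^bsub>fcod (ntdom \<beta>)\<^esub> ntc \<beta> (fob (ntdom \<alpha>') x) \<cdot>\<^bsub>fcod (ntdom \<beta>)\<^esub> r"
    if "r \<in> Arr (fcod (ntdom \<beta>))" "Cod (fcod (ntdom \<beta>)) r = fob (ntdom \<beta>) (fob (ntdom \<alpha>') x)" for r
    using b(10)[of "ntc \<alpha>' x" "fob (ntdom \<alpha>') x" "fob (ntcod \<alpha>') x"] x that
    by (simp add: k F ob flip: assoc)
  show "ntc (hcomp (vcomp \<beta>' \<beta>) (vcomp \<alpha>' \<alpha>)) x = ntc (vcomp (hcomp \<beta>' \<alpha>') (hcomp \<beta> \<alpha>)) x"
    using x by (simp add: 1 ob assoc k l F 2)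
qed (use assms in auto)

lemma ntc_whisker_left [simp]:
  assumes "is_functor G" "is_ntrans \<tau>" "fdom G = fcod (ntdom \<tau>)" "x \<in> Obj (fdom (ntdom \<tau>))"
  shows "ntc (hcomp (id_nt G) \<tau>) x = far G (ntc \<tau> x)"
proof -
  note a = nt_typing[OF assms(2) refl refl refl refl, simp]
  show ?thesis
    using assms is_functor.far_Arr[of G "ntc \<tau> x"] is_functor.Cod_far[of G "ntc \<tau> x"]
      is_functor.fob_Obj[OF a(2), of x]
    by (simp add: is_functor.fob_Obj cat_simps is_functor.cod_category)
qed

lemma ntc_whisker_right [simp]:
  assumes "is_functor F" "is_ntrans \<tau>" "fdom (ntdom \<tau>) = fcod F" "x \<in> Obj (fdom F)"
  shows "ntc (hcomp \<tau> (id_nt F)) x = ntc \<tau> (fob F x)"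
proof -
  note a = nt_typing[OF assms(2) refl refl refl refl]
  note b = is_functor.fob_Obj[OF assms(1)]
  show ?thesis
    using assms a(1) a(6) a(7-9)[of "fob F x"] b[of x] is_functor.far_Ident[OF a(1), of "fob F x"]
    by (simp add: cat_simps)
qed

lemma hcomp_assoc:
  assumes "is_ntrans \<alpha>" "is_ntrans \<beta>" "is_ntrans \<gamma>"
    "fdom (ntdom \<beta>) = fcod (ntdom \<alpha>)" "fdom (ntdom \<gamma>) = fcod (ntdom \<beta>)"
  shows "hcomp \<gamma> (hcomp \<beta> \<alpha>) = hcomp (hcomp \<gamma> \<beta>) \<alpha>"
proof (rule ntrans_eqI)
  note a = nt_typing[OF assms(1) refl refl refl refl] and b = nt_typing[OF assms(2) refl refl refl refl]
    and c = nt_typing[OF assms(3) refl refl refl refl]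
  show "is_ntrans (hcomp \<gamma> (hcomp \<beta> \<alpha>))" "is_ntrans (hcomp (hcomp \<gamma> \<beta>) \<alpha>)" using assms by auto
  show "ntdom (hcomp \<gamma> (hcomp \<beta> \<alpha>)) = ntdom (hcomp (hcomp \<gamma> \<beta>) \<alpha>)"
    "ntcod (hcomp \<gamma> (hcomp \<beta> \<alpha>)) = ntcod (hcomp (hcomp \<gamma> \<beta>) \<alpha>)"
    using assms a b c by (auto intro: functor_comp_assoc)
  fix x assume "x \<in> Obj (fdom (ntdom (hcomp \<gamma> (hcomp \<beta> \<alpha>))))"
  then have x: "x \<in> Obj (fdom (ntdom \<alpha>))" by simp
  have y: "fob (ntcod \<alpha>) x \<in> Obj (fdom (ntdom \<beta>))" using is_functor.fob_Obj[OF a(2), of x] a x assms by simp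
  have z: "fob (ntcod \<beta>) (fob (ntcod \<alpha>) x) \<in> Obj (fdom (ntdom \<gamma>))"
    using is_functor.fob_Obj[OF b(2), of "fob (ntcod \<alpha>) x"] y b assms by simp
  have h: "far (ntdom \<beta>) (ntc \<alpha> x) \<in> Arr (fcod (ntdom \<beta>))"
    "Dom (fcod (ntdom \<beta>)) (far (ntdom \<beta>) (ntc \<alpha> x)) = fob (ntdom \<beta>) (fob (ntdom \<alpha>) x)"
    "Cod (fcod (ntdom \<beta>)) (far (ntdom \<beta>) (ntc \<alpha> x)) = fob (ntdom \<beta>) (fob (ntcod \<alpha>) x)"
    using is_functor.far_Arr[OF b(1), of "ntc \<alpha> x"] is_functor.Dom_far[OF b(1), of "ntc \<alpha> x"]
      is_functor.Cod_far[OF b(1), of "ntc \<alpha> x"] a(7-9)[OF x] assms(4) by simp_all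
  have F: "far (ntdom \<gamma>) h \<in> Arr (fcod (ntdom \<gamma>))"
    "Dom (fcod (ntdom \<gamma>)) (far (ntdom \<gamma>) h) = fob (ntdom \<gamma>) (Dom (fcod (ntdom \<beta>)) h)"
    "Cod (fcod (ntdom \<gamma>)) (far (ntdom \<gamma>) h) = fob (ntdom \<gamma>) (Cod (fcod (ntdom \<beta>)) h)"
    if "h \<in> Arr (fcod (ntdom \<beta>))" for h
    using that is_functor.far_Arr[OF c(1), of h] is_functor.Dom_far[OF c(1), of h]
      is_functor.Cod_far[OF c(1), of h] assms(5) by simp_all
  show "ntc (hcomp \<gamma> (hcomp \<beta> \<alpha>)) x = ntc (hcomp (hcomp \<gamma> \<beta>) \<alpha>) x"
    using x y z h b(7-9)[OF y] c(6) c(7-9)[OF z] a b(3) assms(4,5)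
      is_functor.far_Comp'[OF c(1), of "far (ntdom \<beta>) (ntc \<alpha> x)" "ntc \<beta> (fob (ntcod \<alpha>) x)"]
    by (simp add: cat_simps F)
qed

lemma ntrans_functors [simp]:
  assumes "is_ntrans \<tau>"
  shows "is_functor (ntdom \<tau>)" "is_functor (ntcod \<tau>)" "fdom (ntcod \<tau>) = fdom (ntdom \<tau>)"
    "fcod (ntcod \<tau>) = fcod (ntdom \<tau>)"
  using nt_typing[OF assms refl refl refl refl] by auto

lemma locally_full_sub_sel [simp]: "Ob (locally_full_sub C obs ones) = obs"
  "One (locally_full_sub C obs ones) = ones"
  "Two (locally_full_sub C obs ones) = {\<alpha> \<in> Two C. Dom2 C \<alpha> \<in> ones \<and> Cod2 C \<alpha> \<in> ones}"
  "Src (locally_full_sub C obs ones) = Src C" "Tgt (locally_full_sub C obs ones) = Tgt C"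
  "Dom2 (locally_full_sub C obs ones) = Dom2 C" "Cod2 (locally_full_sub C obs ones) = Cod2 C"
  "Id1 (locally_full_sub C obs ones) = Id1 C" "Id2 (locally_full_sub C obs ones) = Id2 C"
  "Comp1 (locally_full_sub C obs ones) = Comp1 C" "VComp (locally_full_sub C obs ones) = VComp C"
  "HComp (locally_full_sub C obs ones) = HComp C"
  by (simp_all add: locally_full_sub_def)

lemma two_category_Cat2: "two_category Cat2"
proof (intro two_category.intro, goal_cases)
  case (5 A B)
  show ?case
    by (intro category.intro) (auto simp: hom_cat_def homs_iff vcomp_id vcomp_assoc)
next
  case (10 f A B g D h E)
  then show ?case by (simp add: cells1_Cat2 functor_comp_assoc)
next
  case (11 f A B g D \<alpha> f' \<beta> g')
  then show ?case by (auto simp: cells1_Cat2 cells2_Cat2)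
next
  case (12 f A B g D)
  then show ?case
    by (auto intro!: ntrans_eqI simp: cells1_Cat2 is_functor.fob_Obj is_functor.far_Ident
       simp del: hcomp_sel(3))
next
  case (13 f A B g D \<alpha> f' \<alpha>' f'' \<beta> g' \<beta>' g'')
  then show ?case by (simp add: cells1_Cat2 cells2_Cat2) (metis interchange_Cat2)
next
  case (14 f A B \<alpha> f')
  then show ?case
    by (auto intro!: ntrans_eqI simp: cells1_Cat2 cells2_Cat2 is_functor.dom_category simp del: hcomp_sel(3))
next
  case (15 f A B \<alpha> f')
  have "ntc \<alpha> x \<in> Arr B" if "x \<in> Obj A" for x
    using 15 that is_ntrans.ntc_Arr[of \<alpha> x] by (auto simp: cells1_Cat2 cells2_Cat2)
  with 15 show ?case
    by (auto intro!: ntrans_eqI simp: cells1_Cat2 cells2_Cat2 is_functor.cod_category simp del: hcomp_sel(3))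
next
  case (16 f A B g D h E \<alpha> f' \<beta> g' \<gamma> h')
  then show ?case by (simp add: cells1_Cat2 cells2_Cat2) (metis hcomp_assoc)
qed (auto simp: cells1_Cat2 is_functor.dom_category is_functor.cod_category)

section \<open>Calculus in a strict 2-category\<close>

lemma hom_cat_sel [simp]: "Obj (hom_cat C A B) = cells1 C A B"
  "\<alpha> \<in> Arr (hom_cat C A B) \<longleftrightarrow> \<alpha> \<in> Two C \<and> Src C (Dom2 C \<alpha>) = A \<and> Tgt C (Dom2 C \<alpha>) = B"
  "Dom (hom_cat C A B) = Dom2 C" "Cod (hom_cat C A B) = Cod2 C" "Ident (hom_cat C A B) = Id2 C"
  "Comp (hom_cat C A B) = VComp C"
  by (auto simp: hom_cat_def cells1_def)

lemma cells1_iff: "f \<in> cells1 C A B \<longleftrightarrow> f \<in> One C \<and> Src C f = A \<and> Tgt C f = B"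
  by (simp add: cells1_def)

lemma cells2_iff: "\<alpha> \<in> cells2 C f g \<longleftrightarrow> \<alpha> \<in> Two C \<and> Dom2 C \<alpha> = f \<and> Cod2 C \<alpha> = g"
  by (simp add: cells2_def)

context two_category
begin

lemma Src_Ob' [simp]: "f \<in> One C \<Longrightarrow> Src C f \<in> Ob C"
  and Tgt_Ob' [simp]: "f \<in> One C \<Longrightarrow> Tgt C f \<in> Ob C"
  and Dom2_One' [simp]: "\<alpha> \<in> Two C \<Longrightarrow> Dom2 C \<alpha> \<in> One C"
  using Src_Ob Tgt_Ob Dom2_One by auto

lemma Cod2_One [simp]: "\<alpha> \<in> Two C \<Longrightarrow> Cod2 C \<alpha> \<in> One C"
  and Src_Cod2 [simp]: "\<alpha> \<in> Two C \<Longrightarrow> Src C (Cod2 C \<alpha>) = Src C (Dom2 C \<alpha>)"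
  and Tgt_Cod2 [simp]: "\<alpha> \<in> Two C \<Longrightarrow> Tgt C (Cod2 C \<alpha>) = Tgt C (Dom2 C \<alpha>)"
  using parallel by (auto simp: cells1_iff)

lemma Id1_typing [simp]: "A \<in> Ob C \<Longrightarrow> Id1 C A \<in> One C"
  "A \<in> Ob C \<Longrightarrow> Src C (Id1 C A) = A" "A \<in> Ob C \<Longrightarrow> Tgt C (Id1 C A) = A"
  using Id1_cells1 by (auto simp: cells1_iff)

lemma Comp1_typing [simp]:
  assumes "f \<in> One C" "g \<in> One C" "Tgt C f = Src C g"
  shows "Comp1 C g f \<in> One C" "Src C (Comp1 C g f) = Src C f" "Tgt C (Comp1 C g f) = Tgt C g"
  using Comp1_cells1[of f "Src C f" "Src C g" g "Tgt C g"] assms by (auto simp: cells1_iff)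

lemma Comp1_Id1 [simp]:
  "f \<in> One C \<Longrightarrow> Src C f = A \<Longrightarrow> Comp1 C f (Id1 C A) = f"
  "f \<in> One C \<Longrightarrow> Tgt C f = A \<Longrightarrow> Comp1 C (Id1 C A) f = f"
  using Comp1_Id1_right Comp1_Id1_left by (auto simp: cells1_iff)

lemma Comp1_assoc' [simp]:
  "f \<in> One C \<Longrightarrow> g \<in> One C \<Longrightarrow> h \<in> One C \<Longrightarrow> Tgt C f = Src C g \<Longrightarrow> Tgt C g = Src C h \<Longrightarrow>
    Comp1 C (Comp1 C h g) f = Comp1 C h (Comp1 C g f)"
  using Comp1_assoc by (auto simp: cells1_iff)

lemma hom_category': "f \<in> One C \<Longrightarrow> category (hom_cat C (Src C f) (Tgt C f))"
  using hom_category by simp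

lemma Id2_typing [simp]:
  assumes "f \<in> One C"
  shows "Id2 C f \<in> Two C" "Dom2 C (Id2 C f) = f" "Cod2 C (Id2 C f) = f"
  using category.Ident_homs[OF hom_category'[OF assms], of f] assms by (auto simp: homs_iff cells1_iff)

lemma VComp_typing [simp]:
  assumes "\<alpha> \<in> Two C" "\<beta> \<in> Two C" "Cod2 C \<alpha> = Dom2 C \<beta>"
  shows "VComp C \<beta> \<alpha> \<in> Two C" "Dom2 C (VComp C \<beta> \<alpha>) = Dom2 C \<alpha>" "Cod2 C (VComp C \<beta> \<alpha>) = Cod2 C \<beta>"
  using category.Comp_Arr[OF hom_category', of "Dom2 C \<alpha>" \<alpha> \<beta>]
    category.Dom_Comp[OF hom_category', of "Dom2 C \<alpha>" \<alpha> \<beta>]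
    category.Cod_Comp[OF hom_category', of "Dom2 C \<alpha>" \<alpha> \<beta>]
    Src_Cod2[OF assms(1)] Tgt_Cod2[OF assms(1)] assms
  by auto

lemma VComp_Id2 [simp]:
  "\<alpha> \<in> Two C \<Longrightarrow> Dom2 C \<alpha> = f \<Longrightarrow> VComp C \<alpha> (Id2 C f) = \<alpha>"
  "\<alpha> \<in> Two C \<Longrightarrow> Cod2 C \<alpha> = f \<Longrightarrow> VComp C (Id2 C f) \<alpha> = \<alpha>"
  using category.Comp_Ident[OF hom_category', of "Dom2 C \<alpha>" \<alpha> f] by auto

lemma VComp_assoc [simp]:
  assumes "\<alpha> \<in> Two C" "\<beta> \<in> Two C" "\<gamma> \<in> Two C" "Cod2 C \<alpha> = Dom2 C \<beta>" "Cod2 C \<beta> = Dom2 C \<gamma>"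
  shows "VComp C (VComp C \<gamma> \<beta>) \<alpha> = VComp C \<gamma> (VComp C \<beta> \<alpha>)"
  using category.assoc[OF hom_category', of "Dom2 C \<alpha>" \<alpha> \<beta> \<gamma>] assms Src_Cod2[OF assms(1)]
    Tgt_Cod2[OF assms(1)] Src_Cod2[OF assms(2)] Tgt_Cod2[OF assms(2)]
  by auto

lemma HComp_typing [simp]:
  assumes "\<alpha> \<in> Two C" "\<beta> \<in> Two C" "Tgt C (Dom2 C \<alpha>) = Src C (Dom2 C \<beta>)"
  shows "HComp C \<beta> \<alpha> \<in> Two C" "Dom2 C (HComp C \<beta> \<alpha>) = Comp1 C (Dom2 C \<beta>) (Dom2 C \<alpha>)"
    "Cod2 C (HComp C \<beta> \<alpha>) = Comp1 C (Cod2 C \<beta>) (Cod2 C \<alpha>)"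
  using HComp_cells2[of "Dom2 C \<alpha>" "Src C (Dom2 C \<alpha>)" "Tgt C (Dom2 C \<alpha>)" "Dom2 C \<beta>" _ \<alpha> "Cod2 C \<alpha>" \<beta> "Cod2 C \<beta>"]
    assms by (auto simp: cells1_iff cells2_iff)

lemma HComp_Id2' [simp]: "f \<in> One C \<Longrightarrow> g \<in> One C \<Longrightarrow> Tgt C f = Src C g \<Longrightarrow>
    HComp C (Id2 C g) (Id2 C f) = Id2 C (Comp1 C g f)"
  using HComp_Id2 by (auto simp: cells1_iff)

lemma HComp_Id1 [simp]:
  "\<alpha> \<in> Two C \<Longrightarrow> Src C (Dom2 C \<alpha>) = A \<Longrightarrow> HComp C \<alpha> (Id2 C (Id1 C A)) = \<alpha>"
  "\<alpha> \<in> Two C \<Longrightarrow> Tgt C (Dom2 C \<alpha>) = A \<Longrightarrow> HComp C (Id2 C (Id1 C A)) \<alpha> = \<alpha>"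
  using HComp_Id1_right[of "Dom2 C \<alpha>"] HComp_Id1_left[of "Dom2 C \<alpha>"]
  by (auto simp: cells1_iff cells2_iff)

lemma HComp_assoc' [simp]:
  assumes "\<alpha> \<in> Two C" "\<beta> \<in> Two C" "\<gamma> \<in> Two C"
    "Tgt C (Dom2 C \<alpha>) = Src C (Dom2 C \<beta>)" "Tgt C (Dom2 C \<beta>) = Src C (Dom2 C \<gamma>)"
  shows "HComp C (HComp C \<gamma> \<beta>) \<alpha> = HComp C \<gamma> (HComp C \<beta> \<alpha>)"
  using HComp_assoc[of "Dom2 C \<alpha>" _ _ "Dom2 C \<beta>" _ "Dom2 C \<gamma>" _ \<alpha> _ \<beta> _ \<gamma>] assms
  by (auto simp: cells1_iff cells2_iff)

lemma interchange':
  assumes "\<alpha> \<in> Two C" "\<alpha>' \<in> Two C" "Cod2 C \<alpha> = Dom2 C \<alpha>'"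
    "\<beta> \<in> Two C" "\<beta>' \<in> Two C" "Cod2 C \<beta> = Dom2 C \<beta>'" "Tgt C (Dom2 C \<alpha>) = Src C (Dom2 C \<beta>)"
  shows "HComp C (VComp C \<beta>' \<beta>) (VComp C \<alpha>' \<alpha>) = VComp C (HComp C \<beta>' \<alpha>') (HComp C \<beta> \<alpha>)"
  using interchange[of "Dom2 C \<alpha>" _ _ "Dom2 C \<beta>" _ \<alpha> _ \<alpha>' _ \<beta> _ \<beta>'] assms
  by (auto simp: cells1_iff cells2_iff)

lemma whisker_left_VComp:
  assumes "\<alpha> \<in> Two C" "\<beta> \<in> Two C" "Cod2 C \<alpha> = Dom2 C \<beta>" "g \<in> One C" "Tgt C (Dom2 C \<alpha>) = Src C g"
  shows "HComp C (Id2 C g) (VComp C \<beta> \<alpha>) = VComp C (HComp C (Id2 C g) \<beta>) (HComp C (Id2 C g) \<alpha>)"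
  using interchange'[of \<alpha> \<beta> "Id2 C g" "Id2 C g"] assms by simp

lemma whisker_right_VComp:
  assumes "\<alpha> \<in> Two C" "\<beta> \<in> Two C" "Cod2 C \<alpha> = Dom2 C \<beta>" "g \<in> One C" "Tgt C g = Src C (Dom2 C \<alpha>)"
  shows "HComp C (VComp C \<beta> \<alpha>) (Id2 C g) = VComp C (HComp C \<beta> (Id2 C g)) (HComp C \<alpha> (Id2 C g))"
  using interchange'[of "Id2 C g" "Id2 C g" \<alpha> \<beta>] assms by simp

lemma whisker_exchange:
  assumes "\<alpha> \<in> Two C" "\<beta> \<in> Two C" "Tgt C (Dom2 C \<alpha>) = Src C (Dom2 C \<beta>)"
    "Dom2 C \<alpha> = f" "Cod2 C \<alpha> = f'" "Dom2 C \<beta> = g" "Cod2 C \<beta> = g'"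
  shows "VComp C (HComp C \<beta> (Id2 C f')) (HComp C (Id2 C g) \<alpha>) = HComp C \<beta> \<alpha>"
    "VComp C (HComp C (Id2 C g') \<alpha>) (HComp C \<beta> (Id2 C f)) = HComp C \<beta> \<alpha>"
  using interchange'[of \<alpha> "Id2 C f'" "Id2 C g" \<beta>] interchange'[of "Id2 C f" \<alpha> \<beta> "Id2 C g'"] assms
  by auto

lemma inverse2_typing:
  assumes "inverse2 C \<alpha> \<beta>"
  shows "\<alpha> \<in> Two C" "\<beta> \<in> Two C" "Dom2 C \<beta> = Cod2 C \<alpha>" "Cod2 C \<beta> = Dom2 C \<alpha>"
    "VComp C \<beta> \<alpha> = Id2 C (Dom2 C \<alpha>)" "VComp C \<alpha> \<beta> = Id2 C (Cod2 C \<alpha>)"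
  using assms by (auto simp: inverse2_def cells2_iff)

lemma inverse2_sym: "inverse2 C \<alpha> \<beta> \<Longrightarrow> inverse2 C \<beta> \<alpha>"
  by (auto simp: inverse2_def cells2_iff)

lemma iso2_iff: "iso2 C \<alpha> \<longleftrightarrow> (\<exists>\<beta>. inverse2 C \<alpha> \<beta>)"
  unfolding iso2_def iso_arrow_def inverse2_def
  by (auto simp: homs_iff cells2_iff)

lemma iso2_Id2: "f \<in> One C \<Longrightarrow> iso2 C (Id2 C f)"
  by (auto simp: iso2_iff inverse2_def cells2_iff intro!: exI[of _ "Id2 C f"])

lemma iso2_VComp:
  assumes "iso2 C \<alpha>" "iso2 C \<beta>" "Cod2 C \<alpha> = Dom2 C \<beta>"
  shows "iso2 C (VComp C \<beta> \<alpha>)"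
proof -
  obtain \<alpha>' \<beta>' where ab: "inverse2 C \<alpha> \<alpha>'" "inverse2 C \<beta> \<beta>'"
    using assms by (auto simp: iso2_iff)
  note [simp] = inverse2_typing[OF ab(1)] inverse2_typing[OF ab(2)] assms(3)
  have 1: "VComp C \<beta>' (VComp C \<beta> \<alpha>) = \<alpha>" "VComp C \<alpha> (VComp C \<alpha>' \<beta>') = \<beta>'"
    by (simp_all flip: VComp_assoc)
  have "inverse2 C (VComp C \<beta> \<alpha>) (VComp C \<alpha>' \<beta>')"
    unfolding inverse2_def by (auto simp: cells2_iff 1)
  then show ?thesis by (auto simp: iso2_iff)
qed

lemma iso2_HComp:
  assumes "iso2 C \<alpha>" "iso2 C \<beta>" "Tgt C (Dom2 C \<alpha>) = Src C (Dom2 C \<beta>)"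
  shows "iso2 C (HComp C \<beta> \<alpha>)"
proof -
  obtain \<alpha>' \<beta>' where ab: "inverse2 C \<alpha> \<alpha>'" "inverse2 C \<beta> \<beta>'"
    using assms by (auto simp: iso2_iff)
  note [simp] = inverse2_typing[OF ab(1)] inverse2_typing[OF ab(2)] assms(3)
  have "inverse2 C (HComp C \<beta> \<alpha>) (HComp C \<beta>' \<alpha>')"
    unfolding inverse2_def by (auto simp: cells2_iff simp flip: interchange')
  then show ?thesis by (auto simp: iso2_iff)
qed

end

lemma two_category_locally_full_sub:
  assumes C: "two_category C" and obs: "obs \<subseteq> Ob C" and ones: "ones \<subseteq> One C"
    and ends: "\<And>f. f \<in> ones \<Longrightarrow> Src C f \<in> obs" "\<And>f. f \<in> ones \<Longrightarrow> Tgt C f \<in> obs"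
    and Id1: "\<And>A. A \<in> obs \<Longrightarrow> Id1 C A \<in> ones"
    and Comp1: "\<And>f g. f \<in> ones \<Longrightarrow> g \<in> ones \<Longrightarrow> Tgt C f = Src C g \<Longrightarrow> Comp1 C g f \<in> ones"
  shows "two_category (locally_full_sub C obs ones)"
proof -
  interpret two_category C by fact
  have sub: "A \<in> obs \<Longrightarrow> A \<in> Ob C" "f \<in> ones \<Longrightarrow> f \<in> One C" for A f using obs ones by auto
  have "category (hom_cat (locally_full_sub C obs ones) A B)" for A B
    by (intro category.intro) (auto simp: homs_iff cells1_iff sub)
  then show ?thesis
    by (intro two_category.intro; (simp only:)?)
      (auto simp: cells1_iff cells2_iff sub ends Id1 Comp1 interchange')
qed

section \<open>Pseudocones and bilimits\<close>

lemma (in two_category) HComp_Id2_Comp1: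
  "f \<in> One C \<Longrightarrow> g \<in> One C \<Longrightarrow> \<alpha> \<in> Two C \<Longrightarrow> Tgt C (Dom2 C \<alpha>) = Src C f \<Longrightarrow> Tgt C f = Src C g \<Longrightarrow>
    HComp C (Id2 C (Comp1 C g f)) \<alpha> = HComp C (Id2 C g) (HComp C (Id2 C f) \<alpha>)"
  using HComp_assoc'[of \<alpha> "Id2 C f" "Id2 C g"] by simp

text \<open>
  A pseudonatural transformation from a constant 2-functor, with the composites with identities of
  the vertex \<open>T\<close> cancelled.
\<close>

definition pseudocone ::
    "('i, 'ia, 'ic) twocat \<Rightarrow> ('o, 'a, 'c) twocat \<Rightarrow> ('i, 'ia, 'ic, 'o, 'a, 'c) twofun \<Rightarrow> 'o \<Rightarrow>
     ('i, 'ia, 'a, 'c) psnat \<Rightarrow> bool" where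
  "pseudocone I C D T \<sigma> \<longleftrightarrow>
    ps1 \<sigma> \<in> extensional (Ob I) \<and> ps2 \<sigma> \<in> extensional (One I) \<and>
    (\<forall>A\<in>Ob I. ps1 \<sigma> A \<in> One C \<and> Src C (ps1 \<sigma> A) = T \<and> Tgt C (ps1 \<sigma> A) = F0 D A) \<and>
    (\<forall>f\<in>One I. ps2 \<sigma> f \<in> Two C \<and> Dom2 C (ps2 \<sigma> f) = Comp1 C (F1 D f) (ps1 \<sigma> (Src I f)) \<and>
      Cod2 C (ps2 \<sigma> f) = ps1 \<sigma> (Tgt I f) \<and> iso2 C (ps2 \<sigma> f)) \<and>
    (\<forall>\<theta>\<in>Two I. Dom2 I \<theta> \<in> One I \<longrightarrow>
      VComp C (ps2 \<sigma> (Cod2 I \<theta>)) (HComp C (F2 D \<theta>) (Id2 C (ps1 \<sigma> (Src I (Dom2 I \<theta>))))) =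
      ps2 \<sigma> (Dom2 I \<theta>)) \<and>
    (\<forall>A\<in>Ob I. ps2 \<sigma> (Id1 I A) = Id2 C (ps1 \<sigma> A)) \<and>
    (\<forall>f\<in>One I. \<forall>g\<in>One I. Tgt I f = Src I g \<longrightarrow>
      ps2 \<sigma> (Comp1 I g f) = VComp C (ps2 \<sigma> g) (HComp C (Id2 C (F1 D g)) (ps2 \<sigma> f)))"

definition pseudocone_map ::
    "('i, 'ia, 'ic) twocat \<Rightarrow> ('o, 'a, 'c) twocat \<Rightarrow> ('i, 'ia, 'ic, 'o, 'a, 'c) twofun \<Rightarrow> 'o \<Rightarrow>
     ('i, 'ia, 'a, 'c) modif \<Rightarrow> bool" where
  "pseudocone_map I C D T \<Gamma> \<longleftrightarrow>
    pseudocone I C D T (mdom \<Gamma>) \<and> pseudocone I C D T (mcod \<Gamma>) \<and> mc \<Gamma> \<in> extensional (Ob I) \<and>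
    (\<forall>A\<in>Ob I. mc \<Gamma> A \<in> Two C \<and> Dom2 C (mc \<Gamma> A) = ps1 (mdom \<Gamma>) A \<and>
      Cod2 C (mc \<Gamma> A) = ps1 (mcod \<Gamma>) A) \<and>
    (\<forall>f\<in>One I. VComp C (ps2 (mcod \<Gamma>) f) (HComp C (Id2 C (F1 D f)) (mc \<Gamma> (Src I f))) =
      VComp C (mc \<Gamma> (Tgt I f)) (ps2 (mdom \<Gamma>) f))"

text \<open>
  The typing of \<open>I\<close> and \<open>D\<close> that makes all composites in the axioms of a pseudocone composable.
\<close>

locale diagram = two_category C for C :: "('o, 'a, 'c) twocat" +
  fixes I :: "('i, 'ia, 'ic) twocat" and D :: "('i, 'ia, 'ic, 'o, 'a, 'c) twofun"
  assumes I_Src [simp]: "f \<in> One I \<Longrightarrow> Src I f \<in> Ob I"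
    and I_Tgt [simp]: "f \<in> One I \<Longrightarrow> Tgt I f \<in> Ob I"
    and I_Id1 [simp]: "A \<in> Ob I \<Longrightarrow> Id1 I A \<in> One I"
      "A \<in> Ob I \<Longrightarrow> Src I (Id1 I A) = A" "A \<in> Ob I \<Longrightarrow> Tgt I (Id1 I A) = A"
    and I_Comp1 [simp]: "f \<in> One I \<Longrightarrow> g \<in> One I \<Longrightarrow> Tgt I f = Src I g \<Longrightarrow> Comp1 I g f \<in> One I"
      "f \<in> One I \<Longrightarrow> g \<in> One I \<Longrightarrow> Tgt I f = Src I g \<Longrightarrow> Src I (Comp1 I g f) = Src I f"
      "f \<in> One I \<Longrightarrow> g \<in> One I \<Longrightarrow> Tgt I f = Src I g \<Longrightarrow> Tgt I (Comp1 I g f) = Tgt I g"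
    and I_Cod2 [simp]: "\<theta> \<in> Two I \<Longrightarrow> Dom2 I \<theta> \<in> One I \<Longrightarrow> Cod2 I \<theta> \<in> One I"
      "\<theta> \<in> Two I \<Longrightarrow> Dom2 I \<theta> \<in> One I \<Longrightarrow> Src I (Cod2 I \<theta>) = Src I (Dom2 I \<theta>)"
      "\<theta> \<in> Two I \<Longrightarrow> Dom2 I \<theta> \<in> One I \<Longrightarrow> Tgt I (Cod2 I \<theta>) = Tgt I (Dom2 I \<theta>)"
    and D0 [simp]: "A \<in> Ob I \<Longrightarrow> F0 D A \<in> Ob C"
    and D1 [simp]: "f \<in> One I \<Longrightarrow> F1 D f \<in> One C" "f \<in> One I \<Longrightarrow> Src C (F1 D f) = F0 D (Src I f)"
      "f \<in> One I \<Longrightarrow> Tgt C (F1 D f) = F0 D (Tgt I f)"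
    and D2 [simp]: "\<theta> \<in> Two I \<Longrightarrow> F2 D \<theta> \<in> Two C" "\<theta> \<in> Two I \<Longrightarrow> Dom2 C (F2 D \<theta>) = F1 D (Dom2 I \<theta>)"
      "\<theta> \<in> Two I \<Longrightarrow> Cod2 C (F2 D \<theta>) = F1 D (Cod2 I \<theta>)"
begin

abbreviation "cones T \<equiv> psnat_cat I C (const_twofun C T) D"

lemma psnat_iff_pseudocone:
  assumes T: "T \<in> Ob C"
  shows "is_psnat I C (const_twofun C T) D \<sigma> \<longleftrightarrow> pseudocone I C D T \<sigma>"
proof
  assume "is_psnat I C (const_twofun C T) D \<sigma>"
  then interpret s: is_psnat I C "const_twofun C T" D \<sigma> .
  have 1 [simp]: "ps1 \<sigma> A \<in> One C" "Src C (ps1 \<sigma> A) = T" "Tgt C (ps1 \<sigma> A) = F0 D A" if "A \<in> Ob I" for A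
    using s.ps1_cells1[OF that] by (auto simp: cells1_iff const_twofun_def)
  have 2 [simp]: "ps2 \<sigma> f \<in> Two C" "Dom2 C (ps2 \<sigma> f) = Comp1 C (F1 D f) (ps1 \<sigma> (Src I f))"
      "Cod2 C (ps2 \<sigma> f) = ps1 \<sigma> (Tgt I f)" if "f \<in> One I" for f
    using s.ps2_cells2[of f "Src I f" "Tgt I f"] that by (auto simp: cells1_iff cells2_iff const_twofun_def)
  have 3: "VComp C (ps2 \<sigma> (Cod2 I \<theta>)) (HComp C (F2 D \<theta>) (Id2 C (ps1 \<sigma> (Src I (Dom2 I \<theta>))))) =
      ps2 \<sigma> (Dom2 I \<theta>)" if "\<theta> \<in> Two I" "Dom2 I \<theta> \<in> One I" for \<theta>
    using s.ps2_natural[of "Dom2 I \<theta>" _ _ \<theta>] that T by (simp add: cells1_iff cells2_iff const_twofun_def)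
  have 4: "ps2 \<sigma> (Comp1 I g f) = VComp C (ps2 \<sigma> g) (HComp C (Id2 C (F1 D g)) (ps2 \<sigma> f))"
    if "f \<in> One I" "g \<in> One I" "Tgt I f = Src I g" for f g
    using s.ps2_Comp1[of f _ _ g] that by (simp add: cells1_iff const_twofun_def)
  show "pseudocone I C D T \<sigma>"
    unfolding pseudocone_def
    using s.ps1_extensional s.ps2_extensional s.ps2_iso2 s.ps2_Id1 3 4 by simp
next
  assume *: "pseudocone I C D T \<sigma>"
  then show "is_psnat I C (const_twofun C T) D \<sigma>"
    using T by (intro is_psnat.intro)
     (auto simp: pseudocone_def cells1_iff cells2_iff const_twofun_def)
qed

lemma modif_iff_pseudocone_map:
  assumes T: "T \<in> Ob C"
  shows "is_modif I C (const_twofun C T) D \<Gamma> \<longleftrightarrow> pseudocone_map I C D T \<Gamma>"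
proof
  assume "is_modif I C (const_twofun C T) D \<Gamma>"
  then interpret s: is_modif I C "const_twofun C T" D \<Gamma> .
  have d: "pseudocone I C D T (mdom \<Gamma>)" and c: "pseudocone I C D T (mcod \<Gamma>)"
    using s.mdom_psnat s.mcod_psnat T by (auto simp: psnat_iff_pseudocone)
  have 1 [simp]: "mc \<Gamma> A \<in> Two C" "Dom2 C (mc \<Gamma> A) = ps1 (mdom \<Gamma>) A" "Cod2 C (mc \<Gamma> A) = ps1 (mcod \<Gamma>) A"
    if "A \<in> Ob I" for A
    using s.mc_cells2[OF that] by (auto simp: cells2_iff)
  have 2: "VComp C (ps2 (mcod \<Gamma>) f) (HComp C (Id2 C (F1 D f)) (mc \<Gamma> (Src I f))) =
      VComp C (mc \<Gamma> (Tgt I f)) (ps2 (mdom \<Gamma>) f)" if "f \<in> One I" for f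
    using s.mc_natural[of f "Src I f" "Tgt I f"] d that by (auto simp: cells1_iff const_twofun_def pseudocone_def)
  show "pseudocone_map I C D T \<Gamma>"
    unfolding pseudocone_map_def using d c s.mc_extensional 2 by simp
next
  assume \<Gamma>: "pseudocone_map I C D T \<Gamma>"
  then have c: "pseudocone I C D T (mdom \<Gamma>)" "pseudocone I C D T (mcod \<Gamma>)"
    by (auto simp: pseudocone_map_def)
  show "is_modif I C (const_twofun C T) D \<Gamma>"
  proof (intro is_modif.intro)
    show "is_psnat I C (const_twofun C T) D (mdom \<Gamma>)" "is_psnat I C (const_twofun C T) D (mcod \<Gamma>)"
      using c T by (auto simp: psnat_iff_pseudocone)
  qed (use \<Gamma> c T in \<open>auto simp: pseudocone_map_def pseudocone_def cells1_iff cells2_iff const_twofun_def\<close>)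
qed

lemma cones_sel [simp]:
  "T \<in> Ob C \<Longrightarrow> \<sigma> \<in> Obj (cones T) \<longleftrightarrow> pseudocone I C D T \<sigma>"
  "T \<in> Ob C \<Longrightarrow> \<Gamma> \<in> Arr (cones T) \<longleftrightarrow> pseudocone_map I C D T \<Gamma>"
  "Dom (cones T) = mdom" "Cod (cones T) = mcod"
  "Ident (cones T) \<sigma> = \<lparr>mdom = \<sigma>, mcod = \<sigma>, mc = (\<lambda>A\<in>Ob I. Id2 C (ps1 \<sigma> A))\<rparr>"
  "Comp (cones T) \<Delta> \<Gamma> = \<lparr>mdom = mdom \<Gamma>, mcod = mcod \<Delta>,
       mc = (\<lambda>A\<in>Ob I. VComp C (mc \<Delta> A) (mc \<Gamma> A))\<rparr>"
  by (auto simp: psnat_cat_def psnat_iff_pseudocone modif_iff_pseudocone_map)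

lemma pseudoconeD:
  assumes "pseudocone I C D T \<sigma>"
  shows "A \<in> Ob I \<Longrightarrow> ps1 \<sigma> A \<in> One C" "A \<in> Ob I \<Longrightarrow> Src C (ps1 \<sigma> A) = T"
    "A \<in> Ob I \<Longrightarrow> Tgt C (ps1 \<sigma> A) = F0 D A"
    "f \<in> One I \<Longrightarrow> ps2 \<sigma> f \<in> Two C"
    "f \<in> One I \<Longrightarrow> Dom2 C (ps2 \<sigma> f) = Comp1 C (F1 D f) (ps1 \<sigma> (Src I f))"
    "f \<in> One I \<Longrightarrow> Cod2 C (ps2 \<sigma> f) = ps1 \<sigma> (Tgt I f)"
    "f \<in> One I \<Longrightarrow> iso2 C (ps2 \<sigma> f)"
    "\<theta> \<in> Two I \<Longrightarrow> Dom2 I \<theta> \<in> One I \<Longrightarrow>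
      VComp C (ps2 \<sigma> (Cod2 I \<theta>)) (HComp C (F2 D \<theta>) (Id2 C (ps1 \<sigma> (Src I (Dom2 I \<theta>))))) =
      ps2 \<sigma> (Dom2 I \<theta>)"
    "A \<in> Ob I \<Longrightarrow> ps2 \<sigma> (Id1 I A) = Id2 C (ps1 \<sigma> A)"
    "f \<in> One I \<Longrightarrow> g \<in> One I \<Longrightarrow> Tgt I f = Src I g \<Longrightarrow>
      ps2 \<sigma> (Comp1 I g f) = VComp C (ps2 \<sigma> g) (HComp C (Id2 C (F1 D g)) (ps2 \<sigma> f))"
    "ps1 \<sigma> \<in> extensional (Ob I)" "ps2 \<sigma> \<in> extensional (One I)"
  using assms by (auto simp: pseudocone_def)

lemma pseudocone_mapD:
  assumes "pseudocone_map I C D T \<Gamma>"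
  shows "pseudocone I C D T (mdom \<Gamma>)" "pseudocone I C D T (mcod \<Gamma>)"
    "A \<in> Ob I \<Longrightarrow> mc \<Gamma> A \<in> Two C" "A \<in> Ob I \<Longrightarrow> Dom2 C (mc \<Gamma> A) = ps1 (mdom \<Gamma>) A"
    "A \<in> Ob I \<Longrightarrow> Cod2 C (mc \<Gamma> A) = ps1 (mcod \<Gamma>) A"
    "f \<in> One I \<Longrightarrow> VComp C (ps2 (mcod \<Gamma>) f) (HComp C (Id2 C (F1 D f)) (mc \<Gamma> (Src I f))) =
      VComp C (mc \<Gamma> (Tgt I f)) (ps2 (mdom \<Gamma>) f)"
    "mc \<Gamma> \<in> extensional (Ob I)"
  using assms by (auto simp: pseudocone_map_def)

lemma modif_eqI:
  assumes "mdom \<Gamma> = mdom \<Delta>" "mcod \<Gamma> = mcod \<Delta>" "mc \<Gamma> \<in> extensional (Ob I)" "mc \<Delta> \<in> extensional (Ob I)"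
    "\<And>A. A \<in> Ob I \<Longrightarrow> mc \<Gamma> A = mc \<Delta> A"
  shows "(\<Gamma> :: ('i, 'ia, 'a, 'c) modif) = \<Delta>"
  using assms by (intro modif.equality extensionalityI[of _ "Ob I"]) auto

lemma pseudocone_map_Comp:
  assumes \<Gamma>: "pseudocone_map I C D T \<Gamma>" and \<Delta>: "pseudocone_map I C D T \<Delta>" and eq: "mcod \<Gamma> = mdom \<Delta>"
  shows "pseudocone_map I C D T (Comp (cones T) \<Delta> \<Gamma>)"
proof -
  note [simp] = pseudocone_mapD(3-5)[OF \<Gamma>] pseudocone_mapD(3-5)[OF \<Delta>]
    pseudoconeD[OF pseudocone_mapD(1)[OF \<Gamma>]] pseudoconeD[OF pseudocone_mapD(1)[OF \<Delta>]]
    pseudoconeD[OF pseudocone_mapD(2)[OF \<Delta>]] eq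
  have "VComp C (ps2 (mcod \<Delta>) f) (HComp C (Id2 C (F1 D f)) (VComp C (mc \<Delta> (Src I f)) (mc \<Gamma> (Src I f)))) =
      VComp C (VComp C (mc \<Delta> (Tgt I f)) (mc \<Gamma> (Tgt I f))) (ps2 (mdom \<Gamma>) f)" if f: "f \<in> One I" for f
  proof -
    have "VComp C (ps2 (mcod \<Delta>) f) (HComp C (Id2 C (F1 D f)) (VComp C (mc \<Delta> (Src I f)) (mc \<Gamma> (Src I f)))) =
      VComp C (VComp C (ps2 (mcod \<Delta>) f) (HComp C (Id2 C (F1 D f)) (mc \<Delta> (Src I f))))
        (HComp C (Id2 C (F1 D f)) (mc \<Gamma> (Src I f)))"
      using f by (simp add: whisker_left_VComp)
    also have "\<dots> = VComp C (mc \<Delta> (Tgt I f)) (VComp C (ps2 (mdom \<Delta>) f)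
        (HComp C (Id2 C (F1 D f)) (mc \<Gamma> (Src I f))))"
      using f by (simp add: pseudocone_mapD(6)[OF \<Delta>])
    also have "\<dots> = VComp C (mc \<Delta> (Tgt I f)) (VComp C (mc \<Gamma> (Tgt I f)) (ps2 (mdom \<Gamma>) f))"
      using f pseudocone_mapD(6)[OF \<Gamma>, of f] by simp
    finally show ?thesis using f by simp
  qed
  then show ?thesis
    using pseudocone_mapD(1,2)[OF \<Gamma>] pseudocone_mapD(1,2)[OF \<Delta>]
    unfolding pseudocone_map_def by simp
qed

lemma pseudocone_map_Ident:
  assumes "pseudocone I C D T \<sigma>"
  shows "pseudocone_map I C D T (Ident (cones T) \<sigma>)"
  unfolding pseudocone_map_def using assms pseudoconeD[OF assms] by simp

lemma category_cones:
  assumes T: "T \<in> Ob C"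
  shows "category (cones T)"
proof (intro category.intro, goal_cases)
  case (7 \<Gamma> \<sigma> \<tau> \<Delta> \<rho> E \<omega>)
  then have m: "pseudocone_map I C D T \<Gamma>" "pseudocone_map I C D T \<Delta>" "pseudocone_map I C D T E"
    "mcod \<Gamma> = mdom \<Delta>" "mcod \<Delta> = mdom E"
    using T by (auto simp: homs_iff)
  then show ?case
    using pseudocone_mapD(3-5)[OF m(1)] pseudocone_mapD(3-5)[OF m(2)] pseudocone_mapD(3-5)[OF m(3)]
    by (auto intro!: modif_eqI)
next
  case (5 \<Gamma> \<sigma> \<tau>)
  then have m: "pseudocone_map I C D T \<Gamma>" using T by (auto simp: homs_iff)
  with 5 show ?case
    using pseudocone_mapD(3-5,7)[OF m] by (auto intro!: modif_eqI simp: homs_iff)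
next
  case (6 \<Gamma> \<sigma> \<tau>)
  then have m: "pseudocone_map I C D T \<Gamma>" using T by (auto simp: homs_iff)
  with 6 show ?case
    using pseudocone_mapD(3-5,7)[OF m] by (auto intro!: modif_eqI simp: homs_iff)
next
  case (4 \<Gamma> \<sigma> \<tau> \<Delta> \<rho>)
  then show ?case using T pseudocone_map_Comp[of T \<Gamma> \<Delta>] by (simp add: homs_iff del: cones_sel(6)) simp
next
  case (3 \<sigma>)
  then show ?case using T pseudocone_map_Ident[of T \<sigma>] by (simp add: homs_iff del: cones_sel(5)) simp
qed (use T in \<open>auto dest: pseudocone_mapD\<close>)

text \<open>
  The inverses of the components again form a modification.
\<close>

lemma iso_cones:
  assumes T: "T \<in> Ob C" and \<Gamma>: "pseudocone_map I C D T \<Gamma>" and iso: "\<And>A. A \<in> Ob I \<Longrightarrow> iso2 C (mc \<Gamma> A)"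
  shows "iso_arrow (cones T) \<Gamma>"
proof -
  have "\<exists>b. A \<in> Ob I \<longrightarrow> inverse2 C (mc \<Gamma> A) b" for A using iso by (auto simp: iso2_iff)
  then obtain b where b: "\<And>A. A \<in> Ob I \<Longrightarrow> inverse2 C (mc \<Gamma> A) (b A)" by metis
  note [simp] = pseudocone_mapD(3-5)[OF \<Gamma>] pseudoconeD[OF pseudocone_mapD(1)[OF \<Gamma>]]
    pseudoconeD[OF pseudocone_mapD(2)[OF \<Gamma>]]
  have b' [simp]: "b A \<in> Two C" "Dom2 C (b A) = ps1 (mcod \<Gamma>) A" "Cod2 C (b A) = ps1 (mdom \<Gamma>) A"
    "VComp C (b A) (mc \<Gamma> A) = Id2 C (ps1 (mdom \<Gamma>) A)" "VComp C (mc \<Gamma> A) (b A) = Id2 C (ps1 (mcod \<Gamma>) A)"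
    if "A \<in> Ob I" for A
    using inverse2_typing[OF b[OF that]] that by simp_all
  let ?b = "\<lparr>mdom = mcod \<Gamma>, mcod = mdom \<Gamma>, mc = (\<lambda>A\<in>Ob I. b A)\<rparr>"
  have "VComp C (ps2 (mdom \<Gamma>) f) (HComp C (Id2 C (F1 D f)) (b (Src I f))) =
        VComp C (b (Tgt I f)) (ps2 (mcod \<Gamma>) f)" if f: "f \<in> One I" for f
  proof -
    have "VComp C (ps2 (mdom \<Gamma>) f) (HComp C (Id2 C (F1 D f)) (b (Src I f))) =
       VComp C (VComp C (b (Tgt I f)) (mc \<Gamma> (Tgt I f)))
         (VComp C (ps2 (mdom \<Gamma>) f) (HComp C (Id2 C (F1 D f)) (b (Src I f))))"
      using f by (simp del: VComp_assoc)
    also have "\<dots> = VComp C (b (Tgt I f)) (VComp C (VComp C (mc \<Gamma> (Tgt I f)) (ps2 (mdom \<Gamma>) f))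
        (HComp C (Id2 C (F1 D f)) (b (Src I f))))"
      using f by (simp del: b'(4,5))
    also have "\<dots> = VComp C (b (Tgt I f)) (VComp C (ps2 (mcod \<Gamma>) f)
        (HComp C (Id2 C (F1 D f)) (VComp C (mc \<Gamma> (Src I f)) (b (Src I f)))))"
      using f by (simp add: whisker_left_VComp flip: pseudocone_mapD(6)[OF \<Gamma>] del: b'(4,5))
    finally show ?thesis using f by simp
  qed
  then have "pseudocone_map I C D T ?b"
    using pseudocone_mapD(1,2)[OF \<Gamma>] unfolding pseudocone_map_def by simp
  then show ?thesis
    using T \<Gamma> by (intro iso_arrowI[where g = ?b and x = "mdom \<Gamma>" and y = "mcod \<Gamma>"])
      (auto simp: homs_iff intro!: modif_eqI)
qed

end

lemma psnat_eqI:
  assumes "ps1 \<sigma> \<in> extensional A" "ps1 \<tau> \<in> extensional A" "\<And>x. x \<in> A \<Longrightarrow> ps1 \<sigma> x = ps1 \<tau> x"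
    "ps2 \<sigma> \<in> extensional B" "ps2 \<tau> \<in> extensional B" "\<And>x. x \<in> B \<Longrightarrow> ps2 \<sigma> x = ps2 \<tau> x"
  shows "(\<sigma> :: ('i, 'ia, 'a, 'c) psnat) = \<tau>"
  using assms by (intro psnat.equality extensionalityI[of _ A] extensionalityI[of _ B]) auto

text \<open>A pseudocone \<open>\<pi>\<close> with vertex \<open>L\<close> induces functors \<open>C(T, L) \<rightarrow> [I, C](\<Delta> T, D)\<close> that are strictly
  natural in \<open>T\<close>, so that \<open>L\<close> is a bilimit as soon as they are equivalences.\<close>

locale pseudocone_over = diagram +
  fixes L and \<pi>
  assumes L [simp]: "L \<in> Ob C" and \<pi>: "pseudocone I C D L \<pi>"
begin

definition induced where
  "induced T = \<lparr>fdom = hom_cat C T L, fcod = cones T,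
     fob = (\<lambda>u\<in>cells1 C T L. psnat_pre I C u \<pi>),
     far = (\<lambda>\<omega>\<in>Arr (hom_cat C T L). psnat_pre2 I C \<omega> \<pi>)\<rparr>"

lemmas pi [simp] = pseudoconeD[OF \<pi>]

text \<open>
  Whiskering with \<open>h\<close> distributes over the vertical composites in the axioms.
\<close>

lemma pseudocone_pre:
  assumes h: "h \<in> cells1 C T' T" and \<sigma>: "pseudocone I C D T \<sigma>"
  shows "pseudocone I C D T' (psnat_pre I C h \<sigma>)"
proof -
  note [simp] = pseudoconeD[OF \<sigma>]
  have h' [simp]: "h \<in> One C" "Src C h = T'" "Tgt C h = T" using h by (auto simp: cells1_iff)
  have "VComp C (HComp C (ps2 \<sigma> (Cod2 I \<theta>)) (Id2 C h))
          (HComp C (F2 D \<theta>) (Id2 C (Comp1 C (ps1 \<sigma> (Src I (Dom2 I \<theta>))) h))) =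
         HComp C (ps2 \<sigma> (Dom2 I \<theta>)) (Id2 C h)" if "\<theta> \<in> Two I" "Dom2 I \<theta> \<in> One I" for \<theta>
    using that pseudoconeD(8)[OF \<sigma>, symmetric, of \<theta>]
    by (simp add: whisker_right_VComp del: pseudoconeD(8)[OF \<sigma>])
  moreover have "HComp C (VComp C (ps2 \<sigma> g) (HComp C (Id2 C (F1 D g)) (ps2 \<sigma> f))) (Id2 C h) =
         VComp C (HComp C (ps2 \<sigma> g) (Id2 C h)) (HComp C (Id2 C (F1 D g)) (HComp C (ps2 \<sigma> f) (Id2 C h)))"
    if "f \<in> One I" "g \<in> One I" "Tgt I f = Src I g" for f g
    using that by (simp add: whisker_right_VComp)
  ultimately show ?thesis
    unfolding pseudocone_def psnat_pre_def
    by (auto simp: iso2_HComp iso2_Id2)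
qed

text \<open>
  Naturality of the induced modification is the interchange law for \<open>\<omega>\<close> and a structure cell.
\<close>

lemma pseudocone_map_pre2:
  assumes "\<omega> \<in> Two C" "Tgt C (Dom2 C \<omega>) = L" "Src C (Dom2 C \<omega>) = T"
  shows "pseudocone_map I C D T (psnat_pre2 I C \<omega> \<pi>)"
proof -
  have "pseudocone I C D T (psnat_pre I C (Dom2 C \<omega>) \<pi>)" "pseudocone I C D T (psnat_pre I C (Cod2 C \<omega>) \<pi>)"
    by (rule pseudocone_pre[OF _ \<pi>]; use assms in \<open>simp add: cells1_iff\<close>)+
  moreover have "VComp C (HComp C (ps2 \<pi> f) (Id2 C (Cod2 C \<omega>)))
        (HComp C (Id2 C (F1 D f)) (HComp C (Id2 C (ps1 \<pi> (Src I f))) \<omega>)) =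
      HComp C (ps2 \<pi> f) \<omega>" if "f \<in> One I" for f
    using that assms by (simp add: whisker_exchange flip: HComp_Id2_Comp1)
  ultimately show ?thesis
    using assms unfolding pseudocone_map_def psnat_pre2_def
    by (auto simp: psnat_pre_def whisker_exchange)
qed

lemma psnat_pre_sel: "ps1 (psnat_pre I C h \<sigma>) = (\<lambda>A\<in>Ob I. Comp1 C (ps1 \<sigma> A) h)"
  "ps2 (psnat_pre I C h \<sigma>) = (\<lambda>f\<in>One I. HComp C (ps2 \<sigma> f) (Id2 C h))"
  by (simp_all add: psnat_pre_def)

lemma psnat_pre2_sel: "mdom (psnat_pre2 I C \<theta> \<sigma>) = psnat_pre I C (Dom2 C \<theta>) \<sigma>"
  "mcod (psnat_pre2 I C \<theta> \<sigma>) = psnat_pre I C (Cod2 C \<theta>) \<sigma>"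
  "mc (psnat_pre2 I C \<theta> \<sigma>) = (\<lambda>A\<in>Ob I. HComp C (Id2 C (ps1 \<sigma> A)) \<theta>)"
  by (simp_all add: psnat_pre2_def)

lemma induced_functor:
  assumes T: "T \<in> Ob C"
  shows "is_functor (induced T)"
proof -
  have *: "pseudocone I C D T (psnat_pre I C u \<pi>)" if "u \<in> cells1 C T L" for u
    by (rule pseudocone_pre[OF that \<pi>])
  show ?thesis
    unfolding induced_def
  proof (intro is_functor.intro; (simp only: cfunctor.simps)?)
    show "category (cones T)" "category (hom_cat C T L)" using T by (auto intro: category_cones hom_category)
  qed (use T * in \<open>auto simp: homs_iff cells1_iff psnat_pre2_sel pseudocone_map_pre2 psnat_pre_sel whisker_left_VComp
    intro!: modif_eqI\<close>)
qed

lemma psnat_pre_pre: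
  assumes "h \<in> cells1 C T' T" "u \<in> cells1 C T L"
  shows "psnat_pre I C h (psnat_pre I C u \<pi>) = psnat_pre I C (Comp1 C u h) \<pi>"
  using assms by (intro psnat_eqI[of _ "Ob I" _ "One I"]) (auto simp: psnat_pre_sel cells1_iff)

theorem bilimitI:
  assumes equiv: "\<And>T. T \<in> Ob C \<Longrightarrow> is_equivalence (induced T)"
  shows "bilimit_rep C I D L induced (\<lambda>h u. Ident (cones (Src C h)) (psnat_pre I C (Comp1 C u h) \<pi>))"
proof -
  have ob: "fob (induced T) u = psnat_pre I C u \<pi>" if "u \<in> cells1 C T L" for T u
    using that by (simp add: induced_def)
  have cl: "cells1 C T T' \<subseteq> {h. h \<in> One C \<and> T \<in> Ob C \<and> T' \<in> Ob C \<and> Src C h = T \<and> Tgt C h = T'}" for T T'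
    by (auto simp: cells1_iff)
  show ?thesis
  proof (intro bilimit_rep.intro, goal_cases)
    case (5 h T' T u)
    then have T: "T' \<in> Ob C" "Src C h = T'" by (auto simp: cells1_iff)
    have "Comp1 C u h \<in> cells1 C T' L" using 5 by (auto simp: cells1_iff)
    then show ?case
      using 5 category.Ident_homs[OF category_cones[OF T(1)], of "psnat_pre I C (Comp1 C u h) \<pi>"] T
      by (simp add: ob psnat_pre_pre pseudocone_pre[OF _ \<pi>] del: cones_sel(5))
  next
    case (6 h T' T u)
    then have T: "T' \<in> Ob C" "Src C h = T'" by (auto simp: cells1_iff)
    have "Comp1 C u h \<in> cells1 C T' L" using 6 by (auto simp: cells1_iff)
    then show ?case
      using category.iso_Ident[OF category_cones[OF T(1)], of "psnat_pre I C (Comp1 C u h) \<pi>"] T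
      by (simp add: pseudocone_pre[OF _ \<pi>] del: cones_sel(5))
  next
    case (7 h T' T u \<omega> v)
    then show ?case
      by (auto intro!: modif_eqI simp: cells1_iff cells2_iff modif_pre_def induced_def psnat_pre2_sel
         psnat_pre_sel psnat_pre_pre)
  next
    case (8 h T' T u \<theta> h')
    then show ?case
      by (auto intro!: modif_eqI restrict_ext simp: cells1_iff cells2_iff modif_pre_def induced_def psnat_pre2_sel
         psnat_pre_sel psnat_pre_pre HComp_Id2_Comp1)
  next
    case (9 u T)
    then show ?case by (auto simp: cells1_iff induced_def)
  next
    case (10 k T'' T' h T u)
    then show ?case
      by (auto intro!: modif_eqI simp: cells1_iff modif_pre_def psnat_pre_sel psnat_pre_pre)
  qed (use equiv in \<open>auto simp: induced_def\<close>)
qed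

end

section \<open>Strict iso-comma squares are 2-pullbacks\<close>

text \<open>
  A square with an invertible 2-cell that is universal among such squares, strictly on 1-cells.
\<close>

locale comma_square = two_category C for C :: "('o, 'a, 'c) twocat" +
  fixes f g q\<^sub>1 q\<^sub>2 :: 'a and P :: 'o and \<theta> :: 'c
  assumes f [simp]: "f \<in> One C" and g [simp]: "g \<in> One C" "Tgt C g = Tgt C f"
    and q\<^sub>1 [simp]: "q\<^sub>1 \<in> One C" "Src C q\<^sub>1 = P" "Tgt C q\<^sub>1 = Src C f"
    and q\<^sub>2 [simp]: "q\<^sub>2 \<in> One C" "Src C q\<^sub>2 = P" "Tgt C q\<^sub>2 = Src C g"
    and \<theta> [simp]: "\<theta> \<in> Two C" "Dom2 C \<theta> = Comp1 C f q\<^sub>1" "Cod2 C \<theta> = Comp1 C g q\<^sub>2"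
    and \<theta>_iso: "iso2 C \<theta>"
    and lift1: "\<And>u\<^sub>1 u\<^sub>2 \<mu>. u\<^sub>1 \<in> One C \<Longrightarrow> u\<^sub>2 \<in> One C \<Longrightarrow> Src C u\<^sub>1 = Src C u\<^sub>2 \<Longrightarrow>
      Tgt C u\<^sub>1 = Src C f \<Longrightarrow> Tgt C u\<^sub>2 = Src C g \<Longrightarrow>
      \<mu> \<in> cells2 C (Comp1 C f u\<^sub>1) (Comp1 C g u\<^sub>2) \<Longrightarrow> iso2 C \<mu> \<Longrightarrow>
      \<exists>u \<in> cells1 C (Src C u\<^sub>1) P. Comp1 C q\<^sub>1 u = u\<^sub>1 \<and> Comp1 C q\<^sub>2 u = u\<^sub>2 \<and> HComp C \<theta> (Id2 C u) = \<mu>"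
    and lift2: "\<And>u v m\<^sub>1 m\<^sub>2. u \<in> One C \<Longrightarrow> v \<in> One C \<Longrightarrow> Src C u = Src C v \<Longrightarrow>
      Tgt C u = P \<Longrightarrow> Tgt C v = P \<Longrightarrow>
      m\<^sub>1 \<in> cells2 C (Comp1 C q\<^sub>1 u) (Comp1 C q\<^sub>1 v) \<Longrightarrow> m\<^sub>2 \<in> cells2 C (Comp1 C q\<^sub>2 u) (Comp1 C q\<^sub>2 v) \<Longrightarrow>
      VComp C (HComp C \<theta> (Id2 C v)) (HComp C (Id2 C f) m\<^sub>1) =
      VComp C (HComp C (Id2 C g) m\<^sub>2) (HComp C \<theta> (Id2 C u)) \<Longrightarrow>
      \<exists>!\<omega>. \<omega> \<in> cells2 C u v \<and> HComp C (Id2 C q\<^sub>1) \<omega> = m\<^sub>1 \<and> HComp C (Id2 C q\<^sub>2) \<omega> = m\<^sub>2"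
begin

lemma cospan_sel [simp]: "Ob cospan = UNIV" "xy \<in> One cospan \<longleftrightarrow> fst xy = snd xy \<or> snd xy = Apex"
  "xy \<in> Two cospan \<longleftrightarrow> fst xy = snd xy \<or> snd xy = Apex"
  "Src cospan = fst" "Tgt cospan = snd" "Dom2 cospan xy = xy" "Cod2 cospan xy = xy" "Id1 cospan x = (x, x)"
  "Id2 cospan xy = xy" "Comp1 cospan zw xy = (fst xy, snd zw)"
  by (auto simp: cospan_def)

abbreviation "D \<equiv> cospan_diagram C f g"

lemma D_sel [simp]: "F0 D LeftFoot = Src C f" "F0 D RightFoot = Src C g" "F0 D Apex = Tgt C f"
  "F1 D (x, x) = Id1 C (F0 D x)" "F1 D (LeftFoot, Apex) = f" "F1 D (RightFoot, Apex) = g"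
  "F2 D xy = Id2 C (F1 D xy)"
  by (auto simp: cospan_diagram_def Let_def)

lemma F0_D [simp]: "F0 D A \<in> Ob C"
  by (cases A) auto

lemma cospan_cases:
  assumes "fst xy = snd xy \<or> snd xy = Apex"
  obtains x where "xy = (x, x)" | "xy = (LeftFoot, Apex)" | "xy = (RightFoot, Apex)"
  using assms by (cases xy; cases "fst xy"; auto)

lemma D_typing:
  assumes "fst xy = snd xy \<or> snd xy = Apex"
  shows "F1 D xy \<in> One C" "Src C (F1 D xy) = F0 D (fst xy)" "Tgt C (F1 D xy) = F0 D (snd xy)"
  by (rule cospan_cases[OF assms]; simp)+

sublocale diagram C cospan D
  by unfold_locales (auto simp: D_typing)

lemma pseudoconeI:
  assumes "\<And>x. ps1 \<sigma> x \<in> One C" "\<And>x. Src C (ps1 \<sigma> x) = T" "\<And>x. Tgt C (ps1 \<sigma> x) = F0 D x"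
    "\<And>x. ps2 \<sigma> (x, x) = Id2 C (ps1 \<sigma> x)" "ps2 \<sigma> \<in> extensional (One cospan)"
    "ps2 \<sigma> (LeftFoot, Apex) \<in> cells2 C (Comp1 C f (ps1 \<sigma> LeftFoot)) (ps1 \<sigma> Apex)"
    "ps2 \<sigma> (RightFoot, Apex) \<in> cells2 C (Comp1 C g (ps1 \<sigma> RightFoot)) (ps1 \<sigma> Apex)"
    "iso2 C (ps2 \<sigma> (LeftFoot, Apex))" "iso2 C (ps2 \<sigma> (RightFoot, Apex))"
  shows "pseudocone cospan C D T \<sigma>"
proof -
  have [simp]: "ps2 \<sigma> xy \<in> Two C" "Dom2 C (ps2 \<sigma> xy) = Comp1 C (F1 D xy) (ps1 \<sigma> (fst xy))"
    "Cod2 C (ps2 \<sigma> xy) = ps1 \<sigma> (snd xy)" "iso2 C (ps2 \<sigma> xy)"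
    if "fst xy = snd xy \<or> snd xy = Apex" for xy
    by (rule cospan_cases[OF that]; use assms in \<open>simp add: cells2_iff iso2_Id2\<close>)+
  have comp: "ps2 \<sigma> (fst xy, snd zw) = VComp C (ps2 \<sigma> zw) (HComp C (Id2 C (F1 D zw)) (ps2 \<sigma> xy))"
    if xy: "fst xy = snd xy \<or> snd xy = Apex" and zw: "fst zw = snd zw \<or> snd zw = Apex"
      and eq: "snd xy = fst zw" for xy zw
    by (rule cospan_cases[OF xy]; rule cospan_cases[OF zw]) (use eq assms in \<open>auto simp: D_typing cells2_iff\<close>)
  show ?thesis
    unfolding pseudocone_def
  proof (intro conjI ballI impI)
    fix h k assume "h \<in> One cospan" "k \<in> One cospan" "Tgt cospan h = Src cospan k"
    then show "ps2 \<sigma> (Comp1 cospan k h) = VComp C (ps2 \<sigma> k) (HComp C (Id2 C (F1 D k)) (ps2 \<sigma> h))"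
      using comp[of h k] by simp
  qed (use assms(1-5) in \<open>simp_all add: D_typing\<close>)
qed

lemma pseudocone_mapI:
  assumes "pseudocone cospan C D T (mdom \<Gamma>)" "pseudocone cospan C D T (mcod \<Gamma>)"
    "\<And>x. mc \<Gamma> x \<in> cells2 C (ps1 (mdom \<Gamma>) x) (ps1 (mcod \<Gamma>) x)"
    "VComp C (ps2 (mcod \<Gamma>) (LeftFoot, Apex)) (HComp C (Id2 C f) (mc \<Gamma> LeftFoot)) =
      VComp C (mc \<Gamma> Apex) (ps2 (mdom \<Gamma>) (LeftFoot, Apex))"
    "VComp C (ps2 (mcod \<Gamma>) (RightFoot, Apex)) (HComp C (Id2 C g) (mc \<Gamma> RightFoot)) =
      VComp C (mc \<Gamma> Apex) (ps2 (mdom \<Gamma>) (RightFoot, Apex))"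
  shows "pseudocone_map cospan C D T \<Gamma>"
proof -
  note 1 [simp] = pseudoconeD(1-3)[OF assms(1)] pseudoconeD(1-3)[OF assms(2)]
  have 2: "ps2 (mdom \<Gamma>) (x, x) = Id2 C (ps1 (mdom \<Gamma>) x)" "ps2 (mcod \<Gamma>) (x, x) = Id2 C (ps1 (mcod \<Gamma>) x)" for x
    using pseudoconeD(9)[OF assms(1), of x] pseudoconeD(9)[OF assms(2), of x] by simp_all
  have "VComp C (ps2 (mcod \<Gamma>) xy) (HComp C (Id2 C (F1 D xy)) (mc \<Gamma> (fst xy))) =
      VComp C (mc \<Gamma> (snd xy)) (ps2 (mdom \<Gamma>) xy)" if "fst xy = snd xy \<or> snd xy = Apex" for xy
    by (rule cospan_cases[OF that]) (use assms(3-5) in \<open>simp_all add: 2 cells2_iff\<close>)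
  then show ?thesis
    unfolding pseudocone_map_def using assms by (auto simp: cells2_iff)
qed

text \<open>The universal cone has \<open>g q\<^sub>2\<close> at the apex, so that its two structure cells are \<open>\<theta>\<close> and an
  identity.\<close>

definition \<pi> where
  "\<pi> = (let s = case_cospan_ob q\<^sub>1 q\<^sub>2 (Comp1 C g q\<^sub>2) in
    \<lparr>ps1 = s, ps2 = (\<lambda>xy\<in>One cospan. if xy = (LeftFoot, Apex) then \<theta> else Id2 C (s (snd xy)))\<rparr>)"

lemma pi_sel [simp]: "ps1 \<pi> LeftFoot = q\<^sub>1" "ps1 \<pi> RightFoot = q\<^sub>2" "ps1 \<pi> Apex = Comp1 C g q\<^sub>2"
  "ps2 \<pi> (LeftFoot, Apex) = \<theta>" "ps2 \<pi> (RightFoot, Apex) = Id2 C (Comp1 C g q\<^sub>2)"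
  "ps2 \<pi> (x, x) = Id2 C (ps1 \<pi> x)"
  by (auto simp: \<pi>_def Let_def)

lemma P_Ob [simp]: "P \<in> Ob C"
  using Src_Ob'[OF q\<^sub>1(1)] by simp

lemma pi_ps1 [simp]: "ps1 \<pi> x \<in> One C" "Src C (ps1 \<pi> x) = P" "Tgt C (ps1 \<pi> x) = F0 D x"
  by (cases x; simp)+

lemma pseudocone_\<pi>: "pseudocone cospan C D P \<pi>"
  by (rule pseudoconeI) (auto simp: cells2_iff \<theta>_iso iso2_Id2, auto simp: \<pi>_def Let_def)

sublocale pseudocone_over C cospan D P \<pi>
  by unfold_locales (auto simp: pseudocone_\<pi>)

text \<open>
  On 2-cells, naturality at the right leg forces the component at the apex, and naturality at the
  left leg is then the compatibility condition of \<open>lift2\<close>.  A pseudocone with legs \<open>u\<^sub>1, u\<^sub>2\<close> and cells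
  \<open>l : f u\<^sub>1 \<Rightarrow> s\<close>, \<open>r : g u\<^sub>2 \<Rightarrow> s\<close> is isomorphic to the one lifted from \<open>r\<^sup>-\<^sup>1 l\<close>, via \<open>r\<close> at the
  apex.
\<close>

lemma equivalence_induced:
  assumes T: "T \<in> Ob C"
  shows "is_equivalence (induced T)"
proof (rule equivalenceI)
  show "is_functor (induced T)" using T by (rule induced_functor)
  have sel: "fob (induced T) u = psnat_pre cospan C u \<pi>" if "u \<in> One C" "Src C u = T" "Tgt C u = P" for u
    using that by (simp add: induced_def cells1_iff)
  show "fully_faithful (induced T)"
    unfolding fully_faithful_def
  proof (intro ballI)
    fix u v \<Gamma> assume uv: "u \<in> Obj (fdom (induced T))" "v \<in> Obj (fdom (induced T))"
      and G: "\<Gamma> \<in> homs (fcod (induced T)) (fob (induced T) u) (fob (induced T) v)"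
    have u [simp]: "u \<in> One C" "Src C u = T" "Tgt C u = P" and v [simp]: "v \<in> One C" "Src C v = T" "Tgt C v = P"
      using uv by (auto simp: induced_def cells1_iff)
    have \<Gamma>: "pseudocone_map cospan C D T \<Gamma>" "mdom \<Gamma> = psnat_pre cospan C u \<pi>" "mcod \<Gamma> = psnat_pre cospan C v \<pi>"
      using G T by (auto simp: homs_iff sel) (auto simp: induced_def)
    have m: "mc \<Gamma> x \<in> Two C" "Dom2 C (mc \<Gamma> x) = Comp1 C (ps1 \<pi> x) u" "Cod2 C (mc \<Gamma> x) = Comp1 C (ps1 \<pi> x) v" for x
      using pseudocone_mapD(3-5)[OF \<Gamma>(1), of x] by (auto simp: \<Gamma> psnat_pre_sel)
    have L: "VComp C (HComp C \<theta> (Id2 C v)) (HComp C (Id2 C f) (mc \<Gamma> LeftFoot)) =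
        VComp C (mc \<Gamma> Apex) (HComp C \<theta> (Id2 C u))"
      using pseudocone_mapD(6)[OF \<Gamma>(1), of "(LeftFoot, Apex)"] by (simp add: \<Gamma> psnat_pre_sel)
    have R: "HComp C (Id2 C g) (mc \<Gamma> RightFoot) = mc \<Gamma> Apex"
      using pseudocone_mapD(6)[OF \<Gamma>(1), of "(RightFoot, Apex)"] by (simp add: \<Gamma> psnat_pre_sel m)
    have ex1: "\<exists>!\<omega>. \<omega> \<in> cells2 C u v \<and> HComp C (Id2 C q\<^sub>1) \<omega> = mc \<Gamma> LeftFoot \<and>
        HComp C (Id2 C q\<^sub>2) \<omega> = mc \<Gamma> RightFoot"
      using L m[of LeftFoot] m[of RightFoot] by (intro lift2) (auto simp: cells2_iff R)
    have iff: "\<omega> \<in> homs (fdom (induced T)) u v \<and> far (induced T) \<omega> = \<Gamma> \<longleftrightarrow>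
      \<omega> \<in> cells2 C u v \<and> HComp C (Id2 C q\<^sub>1) \<omega> = mc \<Gamma> LeftFoot \<and> HComp C (Id2 C q\<^sub>2) \<omega> = mc \<Gamma> RightFoot" for \<omega>
    proof -
      have "HComp C (Id2 C (ps1 \<pi> x)) \<omega> = mc \<Gamma> x"
        if "\<omega> \<in> Two C" "Dom2 C \<omega> = u" "HComp C (Id2 C q\<^sub>1) \<omega> = mc \<Gamma> LeftFoot"
          "HComp C (Id2 C q\<^sub>2) \<omega> = mc \<Gamma> RightFoot" for x
        using that by (cases x) (auto simp: HComp_Id2_Comp1 R)
      then have "psnat_pre2 cospan C \<omega> \<pi> = \<Gamma>"
        if "\<omega> \<in> cells2 C u v" "HComp C (Id2 C q\<^sub>1) \<omega> = mc \<Gamma> LeftFoot"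
          "HComp C (Id2 C q\<^sub>2) \<omega> = mc \<Gamma> RightFoot"
        using that by (intro modif_eqI) (auto simp: psnat_pre2_sel \<Gamma> cells2_iff)
      moreover have "mc (psnat_pre2 cospan C \<omega> \<pi>) LeftFoot = HComp C (Id2 C q\<^sub>1) \<omega>"
          "mc (psnat_pre2 cospan C \<omega> \<pi>) RightFoot = HComp C (Id2 C q\<^sub>2) \<omega>"
        by (auto simp: psnat_pre2_sel)
      moreover have "\<omega> \<in> homs (fdom (induced T)) u v \<longleftrightarrow> \<omega> \<in> cells2 C u v"
        unfolding induced_def homs_iff cells2_iff by simp (insert u v, metis)
      moreover have "far (induced T) \<omega> = psnat_pre2 cospan C \<omega> \<pi>" if "\<omega> \<in> cells2 C u v"
        unfolding induced_def using that u v by (simp add: cells2_iff)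
      ultimately show ?thesis by metis
    qed
    show "\<exists>!\<omega>. \<omega> \<in> homs (fdom (induced T)) u v \<and> far (induced T) \<omega> = \<Gamma>"
      unfolding iff by (rule ex1)
  qed
  show "essentially_surjective (induced T)"
    unfolding essentially_surjective_def
  proof
    fix \<sigma> assume "\<sigma> \<in> Obj (fcod (induced T))"
    then have \<sigma>: "pseudocone cospan C D T \<sigma>" using T by (auto simp: induced_def)
    have s [simp]: "ps1 \<sigma> x \<in> One C" "Src C (ps1 \<sigma> x) = T" "Tgt C (ps1 \<sigma> x) = F0 D x"
      "ps2 \<sigma> (x, x) = Id2 C (ps1 \<sigma> x)" for x
      using pseudoconeD(1-3)[OF \<sigma>, of x] pseudoconeD(9)[OF \<sigma>, of x] by auto
    let ?l = "ps2 \<sigma> (LeftFoot, Apex)" and ?r = "ps2 \<sigma> (RightFoot, Apex)"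
    have l [simp]: "?l \<in> Two C" "Dom2 C ?l = Comp1 C f (ps1 \<sigma> LeftFoot)" "Cod2 C ?l = ps1 \<sigma> Apex" "iso2 C ?l"
      using pseudoconeD(4-7)[OF \<sigma>, of "(LeftFoot, Apex)"] by auto
    have r [simp]: "?r \<in> Two C" "Dom2 C ?r = Comp1 C g (ps1 \<sigma> RightFoot)" "Cod2 C ?r = ps1 \<sigma> Apex" "iso2 C ?r"
      using pseudoconeD(4-7)[OF \<sigma>, of "(RightFoot, Apex)"] by auto
    obtain r' where r': "inverse2 C ?r r'" using r by (auto simp: iso2_iff)
    note r'_typing [simp] = inverse2_typing[OF r']
    have "iso2 C r'" using inverse2_sym[OF r'] by (auto simp: iso2_iff)
    then obtain u where "u \<in> cells1 C T P" and u: "Comp1 C q\<^sub>1 u = ps1 \<sigma> LeftFoot"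
      "Comp1 C q\<^sub>2 u = ps1 \<sigma> RightFoot" "HComp C \<theta> (Id2 C u) = VComp C r' ?l"
      using lift1[of "ps1 \<sigma> LeftFoot" "ps1 \<sigma> RightFoot" "VComp C r' ?l"]
      by (auto simp: cells2_iff iso2_VComp)
    then have u' [simp]: "u \<in> One C" "Src C u = T" "Tgt C u = P" by (auto simp: cells1_iff)
    let ?\<Gamma> = "\<lparr>mdom = psnat_pre cospan C u \<pi>, mcod = \<sigma>,
      mc = case_cospan_ob (Id2 C (ps1 \<sigma> LeftFoot)) (Id2 C (ps1 \<sigma> RightFoot)) ?r\<rparr>"
    have pre: "pseudocone cospan C D T (psnat_pre cospan C u \<pi>)"
      by (rule pseudocone_pre[OF _ pseudocone_\<pi>]) (simp add: cells1_iff)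
    have "VComp C ?r (VComp C r' ?l) = ?l" by (simp flip: VComp_assoc)
    then have \<Gamma>: "pseudocone_map cospan C D T ?\<Gamma>"
      using \<sigma> pre by (intro pseudocone_mapI)
        (auto simp: cells2_iff psnat_pre_sel u split: cospan_ob.split)
    have "iso_arrow (cones T) ?\<Gamma>"
      by (rule iso_cones[OF T \<Gamma>]) (auto simp: iso2_Id2 split: cospan_ob.split)
    then show "\<exists>u\<in>Obj (fdom (induced T)). \<exists>e\<in>homs (fcod (induced T)) (fob (induced T) u) \<sigma>.
        iso_arrow (fcod (induced T)) e"
      using T \<Gamma> by (intro bexI[of _ u] bexI[of _ ?\<Gamma>])
        (auto simp: homs_iff sel, auto simp: induced_def cells1_iff)
  qed
qed

lemma psnat_pre_Id1: "psnat_pre cospan C (Id1 C P) \<pi> = \<pi>"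
  by (rule psnat_eqI[where A = UNIV and B = "One cospan"]) (auto simp: psnat_pre_sel cells1_iff)

theorem two_pullback: "two_pullback C f g P q\<^sub>1 q\<^sub>2 \<theta>"
proof -
  have "fob (induced P) (Id1 C P) = \<pi>"
    by (simp add: induced_def cells1_iff psnat_pre_Id1)
  with bilimitI[OF equivalence_induced] show ?thesis
    unfolding two_pullback_def
    by (intro conjI exI) (auto simp: Let_def cells2_iff)
qed

end

section \<open>The (2,1)-category of finite groupoids\<close>

lemma gpdf_sel [simp]: "Ob gpdf = {A. finite_groupoid A}"
  "F \<in> One gpdf \<longleftrightarrow> faithful_functor F \<and> finite_groupoid (fdom F) \<and> finite_groupoid (fcod F)"
  "\<alpha> \<in> Two gpdf \<longleftrightarrow> is_ntrans \<alpha> \<and> ntdom \<alpha> \<in> One gpdf \<and> ntcod \<alpha> \<in> One gpdf"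
  "Src gpdf = fdom" "Tgt gpdf = fcod" "Dom2 gpdf = ntdom" "Cod2 gpdf = ntcod"
  "Id1 gpdf = id_functor" "Id2 gpdf = id_nt" "Comp1 gpdf = functor_comp" "VComp gpdf = vcomp"
  "HComp gpdf = hcomp"
  by (auto simp: gpdf_def)

lemma finite_groupoid_category: "finite_groupoid A \<Longrightarrow> category A"
  by (simp add: finite_groupoid_def groupoid_def)

lemma faithful_functorD: "faithful_functor F \<Longrightarrow> is_functor F"
  by (simp add: faithful_functor_def)

lemma faithful_functor_inj:
  assumes "faithful_functor F" "k \<in> Arr (fdom F)" "l \<in> Arr (fdom F)"
    "Dom (fdom F) k = Dom (fdom F) l" "Cod (fdom F) k = Cod (fdom F) l" "far F k = far F l"
  shows "k = l"
proof -
  have "category (fdom F)" using assms(1) by (simp add: faithful_functor_def is_functor.dom_category)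
  then have "inj_on (far F) (homs (fdom F) (Dom (fdom F) l) (Cod (fdom F) l))"
    using assms unfolding faithful_functor_def by (simp add: category.Dom_Obj' category.Cod_Obj')
  then show ?thesis
    using assms by (auto simp: homs_iff inj_on_def)
qed

lemma faithful_functorI:
  assumes "is_functor F" "\<And>k l. k \<in> Arr (fdom F) \<Longrightarrow> l \<in> Arr (fdom F) \<Longrightarrow>
    Dom (fdom F) k = Dom (fdom F) l \<Longrightarrow> Cod (fdom F) k = Cod (fdom F) l \<Longrightarrow> far F k = far F l \<Longrightarrow> k = l"
  shows "faithful_functor F"
  using assms unfolding faithful_functor_def inj_on_def by (auto simp: homs_iff)

lemma faithful_id: "category A \<Longrightarrow> faithful_functor (id_functor A)"
  by (intro faithful_functorI) auto

lemma faithful_comp: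
  assumes F: "faithful_functor F" and G: "faithful_functor G" and "fdom G = fcod F"
  shows "faithful_functor (functor_comp G F)"
proof (rule faithful_functorI)
  show "is_functor (functor_comp G F)" by (rule functor_comp[OF faithful_functorD[OF F] faithful_functorD[OF G]]) fact
  fix k l assume kl: "k \<in> Arr (fdom (functor_comp G F))" "l \<in> Arr (fdom (functor_comp G F))"
    "Dom (fdom (functor_comp G F)) k = Dom (fdom (functor_comp G F)) l"
    "Cod (fdom (functor_comp G F)) k = Cod (fdom (functor_comp G F)) l"
    "far (functor_comp G F) k = far (functor_comp G F) l"
  interpret F: is_functor F by (rule faithful_functorD[OF F])
  have "far F k = far F l"
    by (rule faithful_functor_inj[OF G]) (use kl assms in auto)
  then show "k = l" using kl by (intro faithful_functor_inj[OF F]) auto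
qed

text \<open>
  This makes the map into an iso-comma groupoid a 1-cell of \<open>gpdf\<close>: its composite with a projection is
  one.
\<close>

lemma faithful_factor:
  assumes F: "is_functor F" and G: "is_functor G" "fdom G = fcod F" and GF: "faithful_functor (functor_comp G F)"
  shows "faithful_functor F"
proof (rule faithful_functorI[OF F])
  fix k l assume "k \<in> Arr (fdom F)" "l \<in> Arr (fdom F)"
    "Dom (fdom F) k = Dom (fdom F) l" "Cod (fdom F) k = Cod (fdom F) l" "far F k = far F l"
  then show "k = l" using faithful_functor_inj[OF GF, of k l] by simp
qed

lemma two_category_gpdf: "two_category gpdf"
  unfolding gpdf_def
  by (rule two_category_locally_full_sub[OF two_category_Cat2])
    (auto simp: faithful_id faithful_comp finite_groupoid_category faithful_functorD)

interpretation gpdf: two_category gpdf by (rule two_category_gpdf)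

definition inv_nt :: "('o, 'm, 'p, 'n) ntrans \<Rightarrow> ('o, 'm, 'p, 'n) ntrans" where
  "inv_nt \<tau> = \<lparr>ntdom = ntcod \<tau>, ntcod = ntdom \<tau>,
    ntc = (\<lambda>x\<in>Obj (fdom (ntdom \<tau>)). inv_arr (fcod (ntdom \<tau>)) (ntc \<tau> x))\<rparr>"

lemma inv_nt_sel [simp]: "ntdom (inv_nt \<tau>) = ntcod \<tau>" "ntcod (inv_nt \<tau>) = ntdom \<tau>"
  "x \<in> Obj (fdom (ntdom \<tau>)) \<Longrightarrow> ntc (inv_nt \<tau>) x = inv_arr (fcod (ntdom \<tau>)) (ntc \<tau> x)"
  by (auto simp: inv_nt_def)

lemma inv_nt:
  assumes \<tau>: "natural_iso \<tau>"
  shows "is_ntrans (inv_nt \<tau>)" "vcomp (inv_nt \<tau>) \<tau> = id_nt (ntdom \<tau>)"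
    "vcomp \<tau> (inv_nt \<tau>) = id_nt (ntcod \<tau>)"
proof -
  interpret is_ntrans \<tau> using \<tau> by (simp add: natural_iso_def)
  interpret F: is_functor "ntdom \<tau>" by (rule ntdom_functor)
  interpret G: is_functor "ntcod \<tau>" by (rule ntcod_functor)
  interpret cod: category "fcod (ntdom \<tau>)" by (rule F.cod_category)
  interpret dom: category "fdom (ntdom \<tau>)" by (rule F.dom_category)
  have G [simp]: "far (ntcod \<tau>) f \<in> Arr (fcod (ntdom \<tau>))"
    "Dom (fcod (ntdom \<tau>)) (far (ntcod \<tau>) f) = fob (ntcod \<tau>) (Dom (fdom (ntdom \<tau>)) f)"
    "Cod (fcod (ntdom \<tau>)) (far (ntcod \<tau>) f) = fob (ntcod \<tau>) (Cod (fdom (ntdom \<tau>)) f)"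
     if "f \<in> Arr (fdom (ntdom \<tau>))" for f
    using that G.far_Arr[of f] G.Dom_far[of f] G.Cod_far[of f] by (simp_all add: parallel_dom parallel_cod)
  have i: "iso_arrow (fcod (ntdom \<tau>)) (ntc \<tau> x)" if "x \<in> Obj (fdom (ntdom \<tau>))" for x
    using natural_isoD[OF \<tau>] that by simp
  note [simp] = inv_arr[OF i]
  have nat: "inv_arr (fcod (ntdom \<tau>)) (ntc \<tau> y) \<cdot>\<^bsub>fcod (ntdom \<tau>)\<^esub> far (ntcod \<tau>) f =
    far (ntdom \<tau>) f \<cdot>\<^bsub>fcod (ntdom \<tau>)\<^esub> inv_arr (fcod (ntdom \<tau>)) (ntc \<tau> x)"
    if f: "f \<in> homs (fdom (ntdom \<tau>)) x y" for f x y
  proof -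
    have xy: "x \<in> Obj (fdom (ntdom \<tau>))" "y \<in> Obj (fdom (ntdom \<tau>))" using dom.homs_Obj[OF f] by auto
    have n: "far (ntcod \<tau>) f \<cdot>\<^bsub>fcod (ntdom \<tau>)\<^esub> ntc \<tau> x = ntc \<tau> y \<cdot>\<^bsub>fcod (ntdom \<tau>)\<^esub> far (ntdom \<tau>) f"
      using f natural[of f x y] by (simp add: homs_iff)
    show ?thesis
      by (rule cod.iso_epi[OF i[OF xy(1)]])
        (use f xy in \<open>auto simp: homs_iff cod.assoc n cod.inv_arr_Comp[OF i]\<close>)
  qed
  show 1: "is_ntrans (inv_nt \<tau>)"
    using F.is_functor_axioms G.is_functor_axioms nat
    by (intro is_ntrans.intro) (auto simp: parallel_dom parallel_cod homs_iff inv_nt_def)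
  show "vcomp (inv_nt \<tau>) \<tau> = id_nt (ntdom \<tau>)" "vcomp \<tau> (inv_nt \<tau>) = id_nt (ntcod \<tau>)"
    using 1 is_ntrans_axioms by (auto intro!: ntrans_eqI)
qed

lemma gpdf_iso2:
  assumes "\<alpha> \<in> Two gpdf"
  shows "inverse2 gpdf \<alpha> (inv_nt \<alpha>)" "iso2 gpdf \<alpha>"
proof -
  interpret is_ntrans \<alpha> using assms by simp
  have "natural_iso \<alpha>"
    using assms ntc_Arr by (auto simp: natural_iso_def finite_groupoid_def groupoid_def)
  from inv_nt[OF this] show "inverse2 gpdf \<alpha> (inv_nt \<alpha>)"
    using assms by (auto simp: inverse2_def cells2_iff)
  then show "iso2 gpdf \<alpha>" by (auto simp: gpdf.iso2_iff)
qed

section \<open>Iso-comma groupoids\<close>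

text \<open>The iso-comma groupoid has to live in the type \<open>'u\<close> again, so its objects and arrows, which are
  tuples, are encoded in \<open>'u\<close> by an injection.\<close>

definition pair_code :: "'u \<times> 'u \<Rightarrow> 'u" where
  "pair_code = (SOME e. inj e)"

lemma inj_pair_code: "inj (pair_code :: 'u::infinite \<times> 'u \<Rightarrow> 'u)"
proof -
  obtain e :: "'u \<times> 'u \<Rightarrow> 'u" where "bij_betw e (UNIV \<times> UNIV) UNIV"
    using card_of_Times_same_infinite[OF infinite_UNIV[where 'a = 'u]] by (auto simp: card_of_ordIso[symmetric])
  then have "inj e" by (auto simp: bij_betw_def)
  then show ?thesis unfolding pair_code_def by (rule someI[where P = "\<lambda>e. inj e"])
qed

definition code :: "'u \<times> 'u \<times> 'u \<times> 'u \<Rightarrow> 'u" where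
  "code = (\<lambda>(a, b, c, d). pair_code (a, pair_code (b, pair_code (c, d))))"

definition decode :: "'u \<Rightarrow> 'u \<times> 'u \<times> 'u \<times> 'u" where
  "decode = inv_into UNIV code"

lemma inj_code: "inj (code :: 'u::infinite \<times> _ \<Rightarrow> 'u)"
  by (auto simp: inj_def code_def dest: injD[OF inj_pair_code])

lemma decode_code [simp]: "decode (code x :: 'u::infinite) = x"
  by (simp add: decode_def inj_code)

lemma code_eq [simp]: "code x = (code y :: 'u::infinite) \<longleftrightarrow> x = y"
  by (rule inj_eq[OF inj_code])

definition comma_obj :: "'u gpd1 \<Rightarrow> 'u gpd1 \<Rightarrow> 'u set" where
  "comma_obj f g = {code (a, b, c, c) | a b c. a \<in> Obj (fdom f) \<and> b \<in> Obj (fdom g) \<and>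
    c \<in> Arr (fcod f) \<and> Dom (fcod f) c = fob f a \<and> Cod (fcod f) c = fob g b}"

definition comma_arr :: "'u gpd1 \<Rightarrow> 'u gpd1 \<Rightarrow> 'u set" where
  "comma_arr f g = {code (s, t, c, d) | s t c d. s \<in> Arr (fdom f) \<and> t \<in> Arr (fdom g) \<and>
    c \<in> Arr (fcod f) \<and> Dom (fcod f) c = fob f (Dom (fdom f) s) \<and> Cod (fcod f) c = fob g (Dom (fdom g) t) \<and>
    d \<in> Arr (fcod f) \<and> Dom (fcod f) d = fob f (Cod (fdom f) s) \<and> Cod (fcod f) d = fob g (Cod (fdom g) t) \<and>
    d \<cdot>\<^bsub>fcod f\<^esub> far f s = far g t \<cdot>\<^bsub>fcod f\<^esub> c}"

definition isocomma :: "'u gpd1 \<Rightarrow> 'u gpd1 \<Rightarrow> 'u gpd" where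
  "isocomma f g = \<lparr>Obj = comma_obj f g, Arr = comma_arr f g,
     Dom = (\<lambda>z. case decode z of (s, t, c, d) \<Rightarrow> code (Dom (fdom f) s, Dom (fdom g) t, c, c)),
     Cod = (\<lambda>z. case decode z of (s, t, c, d) \<Rightarrow> code (Cod (fdom f) s, Cod (fdom g) t, d, d)),
     Ident = (\<lambda>z. case decode z of (a, b, c, d) \<Rightarrow> code (Ident (fdom f) a, Ident (fdom g) b, c, c)),
     Comp = (\<lambda>z' z. case decode z of (s, t, c, d) \<Rightarrow> case decode z' of (s', t', c', d') \<Rightarrow>
       code (s' \<cdot>\<^bsub>fdom f\<^esub> s, t' \<cdot>\<^bsub>fdom g\<^esub> t, c, d'))\<rparr>"

definition comma_fst :: "'u gpd1 \<Rightarrow> 'u gpd1 \<Rightarrow> 'u gpd1" where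
  "comma_fst f g = \<lparr>fdom = isocomma f g, fcod = fdom f,
     fob = (\<lambda>z\<in>comma_obj f g. fst (decode z)), far = (\<lambda>z\<in>comma_arr f g. fst (decode z))\<rparr>"

definition comma_snd :: "'u gpd1 \<Rightarrow> 'u gpd1 \<Rightarrow> 'u gpd1" where
  "comma_snd f g = \<lparr>fdom = isocomma f g, fcod = fdom g,
     fob = (\<lambda>z\<in>comma_obj f g. fst (snd (decode z))), far = (\<lambda>z\<in>comma_arr f g. fst (snd (decode z)))\<rparr>"

definition comma_cell :: "'u gpd1 \<Rightarrow> 'u gpd1 \<Rightarrow> 'u gpd2" where
  "comma_cell f g = \<lparr>ntdom = functor_comp f (comma_fst f g), ntcod = functor_comp g (comma_snd f g),
     ntc = (\<lambda>z\<in>comma_obj f g. fst (snd (snd (decode z))))\<rparr>"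

locale gpd_cospan =
  fixes f g :: "'u::infinite gpd1"
  assumes f_One: "f \<in> One gpdf" and g_One: "g \<in> One gpdf" and fcod_g [simp]: "fcod g = fcod f"
begin

abbreviation "A \<equiv> fdom f"
abbreviation "B \<equiv> fdom g"
abbreviation "K \<equiv> fcod f"
abbreviation "P \<equiv> isocomma f g"

lemma f: "is_functor f" and g: "is_functor g"
  using f_One g_One by (auto simp: faithful_functorD)

sublocale f: is_functor f by (rule f)
sublocale g: is_functor g by (rule g)
sublocale A: category A by (rule f.dom_category)
sublocale B: category B by (rule g.dom_category)
sublocale K: category K by (rule f.cod_category)

lemma g_typing [simp]: "t \<in> Arr B \<Longrightarrow> far g t \<in> Arr K"
  "t \<in> Arr B \<Longrightarrow> Dom K (far g t) = fob g (Dom B t)" "t \<in> Arr B \<Longrightarrow> Cod K (far g t) = fob g (Cod B t)"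
  "b \<in> Obj B \<Longrightarrow> far g (Ident B b) = Ident K (fob g b)"
  "s \<in> Arr B \<Longrightarrow> t \<in> Arr B \<Longrightarrow> Cod B s = Dom B t \<Longrightarrow> far g (t \<cdot>\<^bsub>B\<^esub> s) = far g t \<cdot>\<^bsub>K\<^esub> far g s"
  using g.far_Arr[of t] g.Dom_far[of t] g.Cod_far[of t] g.far_Ident[of b] g.far_Comp'[of s t] by simp_all

lemma isos: "s \<in> Arr A \<Longrightarrow> iso_arrow A s" "t \<in> Arr B \<Longrightarrow> iso_arrow B t" "c \<in> Arr K \<Longrightarrow> iso_arrow K c"
  using f_One g_One by (auto simp: finite_groupoid_def groupoid_def)

lemma P_sel [simp]: "Obj P = comma_obj f g" "Arr P = comma_arr f g"
  "Dom P (code (s, t, c, d)) = code (Dom A s, Dom B t, c, c)"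
  "Cod P (code (s, t, c, d)) = code (Cod A s, Cod B t, d, d)"
  "Ident P (code (a, b, c, d)) = code (Ident A a, Ident B b, c, c)"
  "Comp P (code (s', t', c', d')) (code (s, t, c, d)) = code (s' \<cdot>\<^bsub>A\<^esub> s, t' \<cdot>\<^bsub>B\<^esub> t, c, d')"
  by (auto simp: isocomma_def)

lemma obj_iff [simp]: "code (a, b, c, d) \<in> comma_obj f g \<longleftrightarrow> a \<in> Obj A \<and> b \<in> Obj B \<and> d = c \<and>
    c \<in> Arr K \<and> Dom K c = fob f a \<and> Cod K c = fob g b"
  by (auto simp: comma_obj_def)

lemma arr_iff [simp]: "code (s, t, c, d) \<in> comma_arr f g \<longleftrightarrow> s \<in> Arr A \<and> t \<in> Arr B \<and>
    c \<in> Arr K \<and> Dom K c = fob f (Dom A s) \<and> Cod K c = fob g (Dom B t) \<and>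
    d \<in> Arr K \<and> Dom K d = fob f (Cod A s) \<and> Cod K d = fob g (Cod B t) \<and>
    d \<cdot>\<^bsub>K\<^esub> far f s = far g t \<cdot>\<^bsub>K\<^esub> c"
  by (auto simp: comma_arr_def)

lemma objE:
  assumes "z \<in> comma_obj f g"
  obtains a b c where "z = code (a, b, c, c)" "a \<in> Obj A" "b \<in> Obj B" "c \<in> Arr K" "Dom K c = fob f a"
    "Cod K c = fob g b"
  using assms by (auto simp: comma_obj_def)

lemma arrE:
  assumes "z \<in> comma_arr f g"
  obtains s t c d where "z = code (s, t, c, d)" "s \<in> Arr A" "t \<in> Arr B"
    "c \<in> Arr K" "Dom K c = fob f (Dom A s)" "Cod K c = fob g (Dom B t)"
    "d \<in> Arr K" "Dom K d = fob f (Cod A s)" "Cod K d = fob g (Cod B t)"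
    "d \<cdot>\<^bsub>K\<^esub> far f s = far g t \<cdot>\<^bsub>K\<^esub> c"
  using assms by (auto simp: comma_arr_def)

lemma comp_cells:
  assumes "d \<cdot>\<^bsub>K\<^esub> far f s = far g t \<cdot>\<^bsub>K\<^esub> c" "e \<cdot>\<^bsub>K\<^esub> far f s' = far g t' \<cdot>\<^bsub>K\<^esub> d"
    "code (s, t, c, d) \<in> comma_arr f g" "code (s', t', d, e) \<in> comma_arr f g"
    "Cod A s = Dom A s'" "Cod B t = Dom B t'"
  shows "e \<cdot>\<^bsub>K\<^esub> far f s' \<cdot>\<^bsub>K\<^esub> far f s = far g t' \<cdot>\<^bsub>K\<^esub> far g t \<cdot>\<^bsub>K\<^esub> c"
proof -
  have "e \<cdot>\<^bsub>K\<^esub> far f s' \<cdot>\<^bsub>K\<^esub> far f s = (e \<cdot>\<^bsub>K\<^esub> far f s') \<cdot>\<^bsub>K\<^esub> far f s"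
    using assms(3-6) by (intro K.assoc[symmetric]) auto
  also have "\<dots> = far g t' \<cdot>\<^bsub>K\<^esub> d \<cdot>\<^bsub>K\<^esub> far f s"
    unfolding assms(2) using assms(3-6) by (intro K.assoc) auto
  finally show ?thesis by (simp only: assms(1))
qed

lemma comp_arr:
  assumes "code (s, t, c, d) \<in> comma_arr f g" "code (s', t', d, e) \<in> comma_arr f g"
    "Cod A s = Dom A s'" "Cod B t = Dom B t'"
  shows "code (s' \<cdot>\<^bsub>A\<^esub> s, t' \<cdot>\<^bsub>B\<^esub> t, c, e) \<in> comma_arr f g"
  using comp_cells[OF _ _ assms] assms by (simp add: K.assoc)

lemma arr_code:
  assumes "z \<in> Arr P"
  obtains s t c d where "z = code (s, t, c, d)" "code (s, t, c, d) \<in> comma_arr f g"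
  using assms that by (auto elim!: arrE)

lemma composableE:
  assumes "z \<in> homs P x y" "z' \<in> homs P y w"
  obtains s t c d s' t' e where "z = code (s, t, c, d)" "z' = code (s', t', d, e)"
    "code (s, t, c, d) \<in> comma_arr f g" "code (s', t', d, e) \<in> comma_arr f g"
    "Cod A s = Dom A s'" "Cod B t = Dom B t'" "x = code (Dom A s, Dom B t, c, c)"
    "w = code (Cod A s', Cod B t', e, e)"
proof -
  have "z \<in> Arr P" "z' \<in> Arr P" using assms by (auto simp: homs_iff)
  obtain s t c d where z: "z = code (s, t, c, d)" "code (s, t, c, d) \<in> comma_arr f g"
    using arr_code[OF \<open>z \<in> Arr P\<close>] .
  obtain s' t' d' e where z': "z' = code (s', t', d', e)" "code (s', t', d', e) \<in> comma_arr f g"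
    using arr_code[OF \<open>z' \<in> Arr P\<close>] .
  have "Cod A s = Dom A s'" "Cod B t = Dom B t'" "d' = d"
    "x = code (Dom A s, Dom B t, c, c)" "w = code (Cod A s', Cod B t', e, e)"
    using assms by (auto simp: homs_iff z(1) z'(1) simp del: arr_iff)
  with z z' that show ?thesis by blast
qed

lemma category_P: "category P"
proof (intro category.intro)
  fix z z' x y w assume "z \<in> homs P x y" "z' \<in> homs P y w"
  then show "z' \<cdot>\<^bsub>P\<^esub> z \<in> homs P x w"
  proof (cases rule: composableE)
    case (1 s t c d s' t' e)
    moreover from 1(3,4) have "s \<in> Arr A" "s' \<in> Arr A" "t \<in> Arr B" "t' \<in> Arr B" by simp_all
    ultimately show ?thesis using comp_arr[OF 1(3-6)] by (simp add: homs_iff del: arr_iff)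
  qed
qed (auto simp: homs_iff A.assoc B.assoc f.far_Ident elim!: arrE objE)

lemma finite_groupoid_P: "finite_groupoid P"
proof -
  have fin: "finite (Obj A)" "finite (Obj B)" "finite (Arr A)" "finite (Arr B)" "finite (Arr K)"
    using f_One g_One by (auto simp: finite_groupoid_def)
  have "comma_obj f g \<subseteq> code ` (Obj A \<times> Obj B \<times> Arr K \<times> Arr K)"
    "comma_arr f g \<subseteq> code ` (Arr A \<times> Arr B \<times> Arr K \<times> Arr K)"
    by (auto simp: comma_obj_def comma_arr_def)
  then have "finite (comma_obj f g)" "finite (comma_arr f g)"
    using fin by (meson finite_SigmaI finite_imageI finite_subset)+
  moreover have "iso_arrow P z" if z: "z \<in> comma_arr f g" for z
  proof -
    obtain s t c d where [simp]: "z = code (s, t, c, d)" using arrE[OF z] .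
    have st [simp]: "s \<in> Arr A" "t \<in> Arr B" and sq: "d \<cdot>\<^bsub>K\<^esub> far f s = far g t \<cdot>\<^bsub>K\<^esub> c"
      and cd [simp]: "c \<in> Arr K" "Dom K c = fob f (Dom A s)" "Cod K c = fob g (Dom B t)"
       "d \<in> Arr K" "Dom K d = fob f (Cod A s)" "Cod K d = fob g (Cod B t)"
      using z by auto
    note si [simp] = inv_arr[OF isos(1)[OF st(1)]] and ti [simp] = inv_arr[OF isos(2)[OF st(2)]]
    have "far g t \<cdot>\<^bsub>K\<^esub> c \<cdot>\<^bsub>K\<^esub> far f (inv_arr A s) = d"
      using arg_cong[OF sq, of "\<lambda>h. h \<cdot>\<^bsub>K\<^esub> far f (inv_arr A s)"]
      by (simp add: f.far_Ident K.assoc flip: f.far_Comp')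
    then have "far g (inv_arr B t) \<cdot>\<^bsub>K\<^esub> d = far g (inv_arr B t) \<cdot>\<^bsub>K\<^esub> far g t \<cdot>\<^bsub>K\<^esub> c \<cdot>\<^bsub>K\<^esub> far f (inv_arr A s)"
      by simp
    also have "\<dots> = (far g (inv_arr B t) \<cdot>\<^bsub>K\<^esub> far g t) \<cdot>\<^bsub>K\<^esub> c \<cdot>\<^bsub>K\<^esub> far f (inv_arr A s)"
      by (simp add: K.assoc)
    also have "\<dots> = c \<cdot>\<^bsub>K\<^esub> far f (inv_arr A s)"
      by (simp flip: g_typing(5))
    finally show ?thesis
      by (intro iso_arrowI[where g = "code (inv_arr A s, inv_arr B t, d, c)" and x = "code (Dom A s, Dom B t, c, c)"
           and y = "code (Cod A s, Cod B t, d, d)"])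
        (auto simp: homs_iff sq)
  qed
  ultimately show ?thesis by (simp add: finite_groupoid_def groupoid_def category_P)
qed

lemma fst_sel [simp]: "fdom (comma_fst f g) = P" "fcod (comma_fst f g) = A"
  "code (a, b, c, d) \<in> comma_obj f g \<Longrightarrow> fob (comma_fst f g) (code (a, b, c, d)) = a"
  "code (s, t, c, d) \<in> comma_arr f g \<Longrightarrow> far (comma_fst f g) (code (s, t, c, d)) = s"
  and snd_sel [simp]: "fdom (comma_snd f g) = P" "fcod (comma_snd f g) = B"
  "code (a, b, c, d) \<in> comma_obj f g \<Longrightarrow> fob (comma_snd f g) (code (a, b, c, d)) = b"
  "code (s, t, c, d) \<in> comma_arr f g \<Longrightarrow> far (comma_snd f g) (code (s, t, c, d)) = t"
  and cell_sel [simp]: "ntdom (comma_cell f g) = functor_comp f (comma_fst f g)"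
  "ntcod (comma_cell f g) = functor_comp g (comma_snd f g)"
  "code (a, b, c, d) \<in> comma_obj f g \<Longrightarrow> ntc (comma_cell f g) (code (a, b, c, d)) = c"
  by (auto simp: comma_fst_def comma_snd_def comma_cell_def simp del: obj_iff arr_iff)

lemma fst_functor: "is_functor (comma_fst f g)"
proof (intro is_functor.intro; (simp add: category_P A.category_axioms)?)
  show "fob (comma_fst f g) \<in> extensional (comma_obj f g)" "far (comma_fst f g) \<in> extensional (comma_arr f g)"
    by (auto simp: comma_fst_def)
  fix z z' x y w assume z: "z \<in> homs P x y" and z': "z' \<in> homs P y w"
  from z z' show "far (comma_fst f g) (z' \<cdot>\<^bsub>P\<^esub> z) = far (comma_fst f g) z' \<cdot>\<^bsub>A\<^esub> far (comma_fst f g) z"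
  proof (cases rule: composableE)
    case (1 s t c d s' t' e)
    with comp_arr[OF 1(3-6)] show ?thesis by (simp del: arr_iff)
  qed
qed (auto simp: homs_iff f.far_Ident elim!: objE arrE)

lemma snd_functor: "is_functor (comma_snd f g)"
proof (intro is_functor.intro; (simp add: category_P B.category_axioms)?)
  show "fob (comma_snd f g) \<in> extensional (comma_obj f g)" "far (comma_snd f g) \<in> extensional (comma_arr f g)"
    by (auto simp: comma_snd_def)
  fix z z' x y w assume z: "z \<in> homs P x y" and z': "z' \<in> homs P y w"
  from z z' show "far (comma_snd f g) (z' \<cdot>\<^bsub>P\<^esub> z) = far (comma_snd f g) z' \<cdot>\<^bsub>B\<^esub> far (comma_snd f g) z"
  proof (cases rule: composableE)
    case (1 s t c d s' t' e)
    with comp_arr[OF 1(3-6)] show ?thesis by (simp del: arr_iff)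
  qed
qed (auto simp: homs_iff f.far_Ident elim!: objE arrE)

lemma cell_ntrans: "is_ntrans (comma_cell f g)"
proof (intro is_ntrans.intro)
  show "ntc (comma_cell f g) \<in> extensional (Obj (fdom (ntdom (comma_cell f g))))"
    by (auto simp: comma_cell_def)
qed (auto simp: homs_iff fst_functor snd_functor f g elim!: objE arrE)

lemma g_cancel:
  assumes "t \<in> Arr B" "t' \<in> Arr B" "Dom B t = Dom B t'" "Cod B t = Cod B t'"
    "c \<in> Arr K" "Cod K c = fob g (Dom B t)" "far g t \<cdot>\<^bsub>K\<^esub> c = far g t' \<cdot>\<^bsub>K\<^esub> c"
  shows "t = t'"
proof -
  have "far g t = far g t'"
    by (rule K.iso_epi[OF isos(3)[of c]]) (use assms in \<open>simp_all\<close>)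
  then show ?thesis
    using faithful_functor_inj[of g t t'] assms g_One by simp
qed

lemma f_cancel:
  assumes "s \<in> Arr A" "s' \<in> Arr A" "Dom A s = Dom A s'" "Cod A s = Cod A s'"
    "c \<in> Arr K" "Dom K c = fob f (Cod A s)" "c \<cdot>\<^bsub>K\<^esub> far f s = c \<cdot>\<^bsub>K\<^esub> far f s'"
  shows "s = s'"
proof -
  have "far f s = far f s'"
    by (rule K.iso_mono[OF isos(3)[of c]]) (use assms in \<open>simp_all\<close>)
  then show ?thesis
    using faithful_functor_inj[of f s s'] assms f_One by simp
qed

text \<open>
  Since \<open>f\<close> and \<open>g\<close> are faithful and all arrows are invertible, the commuting square of an arrow
  determines either of its two components from the other.  Hence both projections are faithful, and
  equations between arrows can be checked after one projection.
\<close>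

lemma arr_determined:
  assumes "k \<in> Arr P" "l \<in> Arr P" "Dom P k = Dom P l" "Cod P k = Cod P l"
    and "far (comma_fst f g) k = far (comma_fst f g) l \<or> far (comma_snd f g) k = far (comma_snd f g) l"
  shows "k = l"
proof -
  obtain s t c d where k: "k = code (s, t, c, d)" "code (s, t, c, d) \<in> comma_arr f g"
    using arr_code[OF assms(1)] .
  obtain s' t' c' d' where l: "l = code (s', t', c', d')" "code (s', t', c', d') \<in> comma_arr f g"
    using arr_code[OF assms(2)] .
  have eq: "Dom A s = Dom A s'" "Cod A s = Cod A s'" "Dom B t = Dom B t'" "Cod B t = Cod B t'"
    "c' = c" "d' = d" "s = s' \<or> t = t'"
    using assms(3-5) k l by (auto simp del: arr_iff)
  have sq: "d \<cdot>\<^bsub>K\<^esub> far f s = far g t \<cdot>\<^bsub>K\<^esub> c" "d \<cdot>\<^bsub>K\<^esub> far f s' = far g t' \<cdot>\<^bsub>K\<^esub> c"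
    and st: "s \<in> Arr A" "s' \<in> Arr A" "t \<in> Arr B" "t' \<in> Arr B"
    and cd: "c \<in> Arr K" "Cod K c = fob g (Dom B t)" "d \<in> Arr K" "Dom K d = fob f (Cod A s)"
    using k(2) l(2) eq(5,6) unfolding arr_iff by blast+
  have "t = t'" if "s = s'"
    using g_cancel[of t t' c] st cd eq sq that by metis
  moreover have "s = s'" if "t = t'"
    using f_cancel[of s s' d] st cd eq sq that by metis
  ultimately show ?thesis using eq k l by auto
qed

lemma fst_faithful: "faithful_functor (comma_fst f g)" and snd_faithful: "faithful_functor (comma_snd f g)"
  by (rule faithful_functorI; use fst_functor snd_functor arr_determined in \<open>simp del: P_sel\<close>)+

lemma obj_eta:
  assumes "z \<in> comma_obj f g"
  shows "z = code (fob (comma_fst f g) z, fob (comma_snd f g) z, ntc (comma_cell f g) z, ntc (comma_cell f g) z)"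
  using assms by (auto elim!: objE)

text \<open>
  The functor into the iso-comma groupoid induced by a square \<open>\<mu> : f u\<^sub>1 \<Rightarrow> g u\<^sub>2\<close>.
\<close>

definition pairing :: "'u gpd1 \<Rightarrow> 'u gpd1 \<Rightarrow> 'u gpd2 \<Rightarrow> 'u gpd1" where
  "pairing u\<^sub>1 u\<^sub>2 \<mu> = \<lparr>fdom = fdom u\<^sub>1, fcod = P,
     fob = (\<lambda>t\<in>Obj (fdom u\<^sub>1). code (fob u\<^sub>1 t, fob u\<^sub>2 t, ntc \<mu> t, ntc \<mu> t)),
     far = (\<lambda>k\<in>Arr (fdom u\<^sub>1). code (far u\<^sub>1 k, far u\<^sub>2 k, ntc \<mu> (Dom (fdom u\<^sub>1) k), ntc \<mu> (Cod (fdom u\<^sub>1) k)))\<rparr>"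

lemma fst_One: "comma_fst f g \<in> One gpdf" and snd_One: "comma_snd f g \<in> One gpdf"
  using fst_faithful snd_faithful f_One g_One finite_groupoid_P by auto

context
  fixes u\<^sub>1 u\<^sub>2 \<mu>
  assumes u: "u\<^sub>1 \<in> One gpdf" "u\<^sub>2 \<in> One gpdf" "fdom u\<^sub>1 = fdom u\<^sub>2" "fcod u\<^sub>1 = A" "fcod u\<^sub>2 = B"
    and \<mu>: "\<mu> \<in> cells2 gpdf (functor_comp f u\<^sub>1) (functor_comp g u\<^sub>2)"
begin

lemma pairing_sel [simp]: "fdom (pairing u\<^sub>1 u\<^sub>2 \<mu>) = fdom u\<^sub>1" "fcod (pairing u\<^sub>1 u\<^sub>2 \<mu>) = P"
  "t \<in> Obj (fdom u\<^sub>1) \<Longrightarrow> fob (pairing u\<^sub>1 u\<^sub>2 \<mu>) t = code (fob u\<^sub>1 t, fob u\<^sub>2 t, ntc \<mu> t, ntc \<mu> t)"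
  "k \<in> Arr (fdom u\<^sub>1) \<Longrightarrow> far (pairing u\<^sub>1 u\<^sub>2 \<mu>) k =
    code (far u\<^sub>1 k, far u\<^sub>2 k, ntc \<mu> (Dom (fdom u\<^sub>1) k), ntc \<mu> (Cod (fdom u\<^sub>1) k))"
  by (auto simp: pairing_def)

lemma u_functor: "is_functor u\<^sub>1" "is_functor u\<^sub>2"
  using u by (auto simp: faithful_functorD)

lemma u_typing [simp]: "t \<in> Obj (fdom u\<^sub>1) \<Longrightarrow> fob u\<^sub>1 t \<in> Obj A" "t \<in> Obj (fdom u\<^sub>1) \<Longrightarrow> fob u\<^sub>2 t \<in> Obj B"
  "k \<in> Arr (fdom u\<^sub>1) \<Longrightarrow> far u\<^sub>1 k \<in> Arr A" "k \<in> Arr (fdom u\<^sub>1) \<Longrightarrow> far u\<^sub>2 k \<in> Arr B"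
  "k \<in> Arr (fdom u\<^sub>1) \<Longrightarrow> Dom A (far u\<^sub>1 k) = fob u\<^sub>1 (Dom (fdom u\<^sub>1) k)"
  "k \<in> Arr (fdom u\<^sub>1) \<Longrightarrow> Cod A (far u\<^sub>1 k) = fob u\<^sub>1 (Cod (fdom u\<^sub>1) k)"
  "k \<in> Arr (fdom u\<^sub>1) \<Longrightarrow> Dom B (far u\<^sub>2 k) = fob u\<^sub>2 (Dom (fdom u\<^sub>1) k)"
  "k \<in> Arr (fdom u\<^sub>1) \<Longrightarrow> Cod B (far u\<^sub>2 k) = fob u\<^sub>2 (Cod (fdom u\<^sub>1) k)"
  using is_functor.fob_Obj[OF u_functor(1), of t] is_functor.fob_Obj[OF u_functor(2), of t]
    is_functor.far_Arr[OF u_functor(1), of k] is_functor.far_Arr[OF u_functor(2), of k]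
    is_functor.Dom_far[OF u_functor(1), of k] is_functor.Dom_far[OF u_functor(2), of k]
    is_functor.Cod_far[OF u_functor(1), of k] is_functor.Cod_far[OF u_functor(2), of k]
  by (simp_all add: u(3)[symmetric] u(4,5))

lemma u_Comp [simp]: "k \<in> Arr (fdom u\<^sub>1) \<Longrightarrow> l \<in> Arr (fdom u\<^sub>1) \<Longrightarrow> Cod (fdom u\<^sub>1) k = Dom (fdom u\<^sub>1) l \<Longrightarrow>
    far u\<^sub>1 (l \<cdot>\<^bsub>fdom u\<^sub>1\<^esub> k) = far u\<^sub>1 l \<cdot>\<^bsub>A\<^esub> far u\<^sub>1 k"
  "k \<in> Arr (fdom u\<^sub>1) \<Longrightarrow> l \<in> Arr (fdom u\<^sub>1) \<Longrightarrow> Cod (fdom u\<^sub>1) k = Dom (fdom u\<^sub>1) l \<Longrightarrow>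
    far u\<^sub>2 (l \<cdot>\<^bsub>fdom u\<^sub>1\<^esub> k) = far u\<^sub>2 l \<cdot>\<^bsub>B\<^esub> far u\<^sub>2 k"
  "t \<in> Obj (fdom u\<^sub>1) \<Longrightarrow> far u\<^sub>1 (Ident (fdom u\<^sub>1) t) = Ident A (fob u\<^sub>1 t)"
  "t \<in> Obj (fdom u\<^sub>1) \<Longrightarrow> far u\<^sub>2 (Ident (fdom u\<^sub>1) t) = Ident B (fob u\<^sub>2 t)"
  using is_functor.far_Comp'[OF u_functor(1), of k l] is_functor.far_Comp'[OF u_functor(2), of k l]
    is_functor.far_Ident[OF u_functor(1), of t] is_functor.far_Ident[OF u_functor(2), of t]
  by (simp_all add: u(3)[symmetric] u(4,5))

lemma mu: "is_ntrans \<mu>" "ntdom \<mu> = functor_comp f u\<^sub>1" "ntcod \<mu> = functor_comp g u\<^sub>2"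
  using \<mu> by (auto simp: cells2_iff)

lemma mu_typing [simp]: "t \<in> Obj (fdom u\<^sub>1) \<Longrightarrow> ntc \<mu> t \<in> Arr K"
  "t \<in> Obj (fdom u\<^sub>1) \<Longrightarrow> Dom K (ntc \<mu> t) = fob f (fob u\<^sub>1 t)"
  "t \<in> Obj (fdom u\<^sub>1) \<Longrightarrow> Cod K (ntc \<mu> t) = fob g (fob u\<^sub>2 t)"
  using nt_typing(7-9)[OF mu refl refl, of t] u by auto

lemma mu_nat: "k \<in> Arr (fdom u\<^sub>1) \<Longrightarrow> ntc \<mu> (Cod (fdom u\<^sub>1) k) \<cdot>\<^bsub>K\<^esub> far f (far u\<^sub>1 k) =
    far g (far u\<^sub>2 k) \<cdot>\<^bsub>K\<^esub> ntc \<mu> (Dom (fdom u\<^sub>1) k)"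
  using nt_typing(10)[OF mu refl refl, of k] u by auto

lemma dom_u: "category (fdom u\<^sub>1)" using is_functor.dom_category[OF u_functor(1)] .

lemma pairing_functor: "is_functor (pairing u\<^sub>1 u\<^sub>2 \<mu>)"
proof (intro is_functor.intro)
  interpret T: category "fdom u\<^sub>1" by (rule dom_u)
  show "fob (pairing u\<^sub>1 u\<^sub>2 \<mu>) \<in> extensional (Obj (fdom (pairing u\<^sub>1 u\<^sub>2 \<mu>)))"
    "far (pairing u\<^sub>1 u\<^sub>2 \<mu>) \<in> extensional (Arr (fdom (pairing u\<^sub>1 u\<^sub>2 \<mu>)))"
    by (auto simp: pairing_def)
  show "category (fdom (pairing u\<^sub>1 u\<^sub>2 \<mu>))" "category (fcod (pairing u\<^sub>1 u\<^sub>2 \<mu>))"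
    using T.category_axioms category_P by simp_all
  fix k x y assume "k \<in> homs (fdom (pairing u\<^sub>1 u\<^sub>2 \<mu>)) x y"
  then have k: "k \<in> Arr (fdom u\<^sub>1)" "Dom (fdom u\<^sub>1) k = x" "Cod (fdom u\<^sub>1) k = y"
    "x \<in> Obj (fdom u\<^sub>1)" "y \<in> Obj (fdom u\<^sub>1)"
    by (auto simp: homs_iff)
  then show "far (pairing u\<^sub>1 u\<^sub>2 \<mu>) k \<in> homs (fcod (pairing u\<^sub>1 u\<^sub>2 \<mu>)) (fob (pairing u\<^sub>1 u\<^sub>2 \<mu>) x)
     (fob (pairing u\<^sub>1 u\<^sub>2 \<mu>) y)"
    using mu_nat[of k] by (simp add: homs_iff)
next
  interpret T: category "fdom u\<^sub>1" by (rule dom_u)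
  fix k l x y z assume "k \<in> homs (fdom (pairing u\<^sub>1 u\<^sub>2 \<mu>)) x y" "l \<in> homs (fdom (pairing u\<^sub>1 u\<^sub>2 \<mu>)) y z"
  then show "far (pairing u\<^sub>1 u\<^sub>2 \<mu>) (l \<cdot>\<^bsub>fdom (pairing u\<^sub>1 u\<^sub>2 \<mu>)\<^esub> k) =
     far (pairing u\<^sub>1 u\<^sub>2 \<mu>) l \<cdot>\<^bsub>fcod (pairing u\<^sub>1 u\<^sub>2 \<mu>)\<^esub> far (pairing u\<^sub>1 u\<^sub>2 \<mu>) k"
    by (auto simp: homs_iff)
qed (use dom_u in \<open>simp_all add: cat_simps\<close>)

lemma pairing_comps: "functor_comp (comma_fst f g) (pairing u\<^sub>1 u\<^sub>2 \<mu>) = u\<^sub>1"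
  "functor_comp (comma_snd f g) (pairing u\<^sub>1 u\<^sub>2 \<mu>) = u\<^sub>2"
  "hcomp (comma_cell f g) (id_nt (pairing u\<^sub>1 u\<^sub>2 \<mu>)) = \<mu>"
proof -
  show 1: "functor_comp (comma_fst f g) (pairing u\<^sub>1 u\<^sub>2 \<mu>) = u\<^sub>1"
    using dom_u by (intro functor_eqI) (auto simp: pairing_functor fst_functor u_functor u cat_simps mu_nat
       simp flip: u(3))
  show 2: "functor_comp (comma_snd f g) (pairing u\<^sub>1 u\<^sub>2 \<mu>) = u\<^sub>2"
    using dom_u by (intro functor_eqI) (auto simp: pairing_functor snd_functor u_functor u(1,2,4,5) cat_simps mu_nat
       simp flip: u(3))
  show "hcomp (comma_cell f g) (id_nt (pairing u\<^sub>1 u\<^sub>2 \<mu>)) = \<mu>"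
    using mu f g fst_functor snd_functor pairing_functor cell_ntrans
    by (intro ntrans_eqI) (auto simp: functor_comp_assoc[symmetric] 1 2 simp del: hcomp_sel(3))
qed

lemma pairing_cells1: "pairing u\<^sub>1 u\<^sub>2 \<mu> \<in> cells1 gpdf (fdom u\<^sub>1) P"
proof -
  have "faithful_functor (functor_comp (comma_fst f g) (pairing u\<^sub>1 u\<^sub>2 \<mu>))"
    using u by (simp add: pairing_comps)
  then show ?thesis
    using faithful_factor[OF pairing_functor fst_functor] u finite_groupoid_P
    by (simp add: cells1_iff)
qed

end

lemma fst_typing [simp]: "z \<in> comma_obj f g \<Longrightarrow> fob (comma_fst f g) z \<in> Obj A"
  "z \<in> comma_obj f g \<Longrightarrow> fob (comma_snd f g) z \<in> Obj B"
  using is_functor.fob_Obj[OF fst_functor, of z] is_functor.fob_Obj[OF snd_functor, of z] by simp_all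

text \<open>
  The component at \<open>t\<close> is the arrow with components \<open>m\<^sub>1 t\<close> and \<open>m\<^sub>2 t\<close>; the equation assumed of
  \<open>m\<^sub>1, m\<^sub>2\<close> says precisely that its square commutes.
\<close>

lemma lift_cell:
  assumes u: "u \<in> One gpdf" "fcod u = P" and v: "v \<in> One gpdf" "fdom v = fdom u" "fcod v = P"
    and m\<^sub>1: "m\<^sub>1 \<in> cells2 gpdf (functor_comp (comma_fst f g) u) (functor_comp (comma_fst f g) v)"
    and m\<^sub>2: "m\<^sub>2 \<in> cells2 gpdf (functor_comp (comma_snd f g) u) (functor_comp (comma_snd f g) v)"
    and eq: "vcomp (hcomp (comma_cell f g) (id_nt v)) (hcomp (id_nt f) m\<^sub>1) =
      vcomp (hcomp (id_nt g) m\<^sub>2) (hcomp (comma_cell f g) (id_nt u))"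
  shows "\<exists>!\<omega>. \<omega> \<in> cells2 gpdf u v \<and> hcomp (id_nt (comma_fst f g)) \<omega> = m\<^sub>1 \<and>
    hcomp (id_nt (comma_snd f g)) \<omega> = m\<^sub>2"
proof -
  let ?T = "fdom u" and ?q = "comma_fst f g" and ?r = "comma_snd f g" and ?\<theta> = "comma_cell f g"
  have uf: "is_functor u" and vf: "is_functor v" using u v by (auto simp: faithful_functorD)
  interpret u: is_functor u by (rule uf)
  interpret v: is_functor v by (rule vf)
  interpret T: category ?T by (rule u.dom_category)
  interpret P: category P by (rule category_P)
  interpret q: is_functor ?q by (rule fst_functor)
  interpret r: is_functor ?r by (rule snd_functor)
  have uv [simp]: "t \<in> Obj ?T \<Longrightarrow> fob u t \<in> comma_obj f g" "t \<in> Obj ?T \<Longrightarrow> fob v t \<in> comma_obj f g" for t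
    using u.fob_Obj[of t] v.fob_Obj[of t] u v by simp_all
  have uva [simp]: "far u k \<in> Arr P" "Dom P (far u k) = fob u (Dom ?T k)" "Cod P (far u k) = fob u (Cod ?T k)"
     "far v k \<in> Arr P" "Dom P (far v k) = fob v (Dom ?T k)" "Cod P (far v k) = fob v (Cod ?T k)"
     if "k \<in> Arr ?T" for k
    using that u.far_Arr[of k] v.far_Arr[of k] u.Dom_far[of k] v.Dom_far[of k] u.Cod_far[of k] v.Cod_far[of k]
      u v by simp_all
  have n1: "is_ntrans m\<^sub>1" "ntdom m\<^sub>1 = functor_comp ?q u" "ntcod m\<^sub>1 = functor_comp ?q v"
    and n2: "is_ntrans m\<^sub>2" "ntdom m\<^sub>2 = functor_comp ?r u" "ntcod m\<^sub>2 = functor_comp ?r v"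
    using m\<^sub>1 m\<^sub>2 by (auto simp: cells2_iff)
  have t1 [simp]: "ntc m\<^sub>1 t \<in> Arr A" "Dom A (ntc m\<^sub>1 t) = fob ?q (fob u t)" "Cod A (ntc m\<^sub>1 t) = fob ?q (fob v t)"
    and t2 [simp]: "ntc m\<^sub>2 t \<in> Arr B" "Dom B (ntc m\<^sub>2 t) = fob ?r (fob u t)" "Cod B (ntc m\<^sub>2 t) = fob ?r (fob v t)"
    if "t \<in> Obj ?T" for t
    using nt_typing(7-9)[OF n1 refl refl, of t] nt_typing(7-9)[OF n2 refl refl, of t] that v(2) by simp_all
  have th [simp]: "ntc ?\<theta> z \<in> Arr K" "Dom K (ntc ?\<theta> z) = fob f (fob ?q z)" "Cod K (ntc ?\<theta> z) = fob g (fob ?r z)"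
    if "z \<in> comma_obj f g" for z
    using nt_typing(7-9)[OF cell_ntrans refl refl refl refl, of z] that by simp_all
  have sq: "ntc ?\<theta> (fob v t) \<cdot>\<^bsub>K\<^esub> far f (ntc m\<^sub>1 t) = far g (ntc m\<^sub>2 t) \<cdot>\<^bsub>K\<^esub> ntc ?\<theta> (fob u t)"
    if t: "t \<in> Obj ?T" for t
  proof -
    have "ntc (vcomp (hcomp ?\<theta> (id_nt v)) (hcomp (id_nt f) m\<^sub>1)) t =
      ntc (vcomp (hcomp (id_nt g) m\<^sub>2) (hcomp ?\<theta> (id_nt u))) t"
      by (simp only: eq)
    then show ?thesis
      using t uf vf u v n1 n2 f g cell_ntrans by (simp del: hcomp_sel(3))
  qed
  define w where "w t = code (ntc m\<^sub>1 t, ntc m\<^sub>2 t, ntc ?\<theta> (fob u t), ntc ?\<theta> (fob v t))" for t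
  have w: "w t \<in> Arr P" "Dom P (w t) = fob u t" "Cod P (w t) = fob v t" "far ?q (w t) = ntc m\<^sub>1 t"
    "far ?r (w t) = ntc m\<^sub>2 t" if "t \<in> Obj ?T" for t
    using that sq[OF that] obj_eta[OF uv(1)[OF that]] obj_eta[OF uv(2)[OF that]] by (simp_all add: w_def)
  have nat: "w t' \<cdot>\<^bsub>P\<^esub> far u k = far v k \<cdot>\<^bsub>P\<^esub> w t"
    if k: "k \<in> Arr ?T" "Dom ?T k = t" "Cod ?T k = t'" for k t t'
  proof (rule arr_determined)
    have t: "t \<in> Obj ?T" "t' \<in> Obj ?T" using k by auto
    then show "w t' \<cdot>\<^bsub>P\<^esub> far u k \<in> Arr P" "far v k \<cdot>\<^bsub>P\<^esub> w t \<in> Arr P"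
      "Dom P (w t' \<cdot>\<^bsub>P\<^esub> far u k) = Dom P (far v k \<cdot>\<^bsub>P\<^esub> w t)"
      "Cod P (w t' \<cdot>\<^bsub>P\<^esub> far u k) = Cod P (far v k \<cdot>\<^bsub>P\<^esub> w t)"
      using k w[OF t(1)] w[OF t(2)] by (simp_all del: P_sel)
    have "far ?q (w t' \<cdot>\<^bsub>P\<^esub> far u k) = ntc m\<^sub>1 t' \<cdot>\<^bsub>A\<^esub> far ?q (far u k)"
      "far ?q (far v k \<cdot>\<^bsub>P\<^esub> w t) = far ?q (far v k) \<cdot>\<^bsub>A\<^esub> ntc m\<^sub>1 t"
      using q.far_Comp'[of "far u k" "w t'"] q.far_Comp'[of "w t" "far v k"] k t w[OF t(1)] w[OF t(2)]
      by (simp_all del: P_sel)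
    then show "far ?q (w t' \<cdot>\<^bsub>P\<^esub> far u k) = far ?q (far v k \<cdot>\<^bsub>P\<^esub> w t) \<or>
       far ?r (w t' \<cdot>\<^bsub>P\<^esub> far u k) = far ?r (far v k \<cdot>\<^bsub>P\<^esub> w t)"
      using nt_typing(10)[OF n1 refl refl, of k t t'] k v by simp
  qed
  let ?\<omega> = "\<lparr>ntdom = u, ntcod = v, ntc = (\<lambda>t\<in>Obj ?T. w t)\<rparr>"
  have "is_ntrans ?\<omega>"
    using uf vf u v w nat by (intro is_ntrans.intro) (auto simp: homs_iff simp del: P_sel)
  moreover have "hcomp (id_nt ?q) ?\<omega> = m\<^sub>1" "hcomp (id_nt ?r) ?\<omega> = m\<^sub>2"
    using calculation n1 n2 u v w fst_functor snd_functor
    by (auto intro!: ntrans_eqI simp del: hcomp_sel(3) P_sel)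
  ultimately have ex: "?\<omega> \<in> cells2 gpdf u v \<and> hcomp (id_nt ?q) ?\<omega> = m\<^sub>1 \<and> hcomp (id_nt ?r) ?\<omega> = m\<^sub>2"
    using u v by (auto simp: cells2_iff)
  show ?thesis
  proof (rule ex1I[where a = ?\<omega>], rule ex)
    fix \<omega> assume \<omega>: "\<omega> \<in> cells2 gpdf u v \<and> hcomp (id_nt ?q) \<omega> = m\<^sub>1 \<and> hcomp (id_nt ?r) \<omega> = m\<^sub>2"
    then have o: "is_ntrans \<omega>" "ntdom \<omega> = u" "ntcod \<omega> = v" by (auto simp: cells2_iff)
    show "\<omega> = ?\<omega>"
    proof (rule ntrans_eqI)
      fix t assume "t \<in> Obj (fdom (ntdom \<omega>))"
      then have t: "t \<in> Obj ?T" using o by simp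
      have "far ?q (ntc \<omega> t) = ntc m\<^sub>1 t"
        using \<omega> ntc_whisker_left[OF fst_functor o(1), of t] o u t by simp
      then have "ntc \<omega> t = w t"
        using w[OF t] nt_typing(7-9)[OF o refl refl, of t] t u arr_determined[of "ntc \<omega> t" "w t"] by simp
      then show "ntc \<omega> t = ntc ?\<omega> t" using t by simp
    qed (use o \<open>is_ntrans ?\<omega>\<close> in auto)
  qed
qed

sublocale square: comma_square gpdf f g "comma_fst f g" "comma_snd f g" P "comma_cell f g"
proof unfold_locales
  have cell: "comma_cell f g \<in> Two gpdf"
    using cell_ntrans fst_One snd_One f_One g_One by (auto simp: faithful_comp)
  then show "comma_cell f g \<in> Two gpdf" "iso2 gpdf (comma_cell f g)"
    by (auto intro: gpdf_iso2)
next
  fix u\<^sub>1 u\<^sub>2 \<mu>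
  assume "u\<^sub>1 \<in> One gpdf" "u\<^sub>2 \<in> One gpdf" "Src gpdf u\<^sub>1 = Src gpdf u\<^sub>2" "Tgt gpdf u\<^sub>1 = Src gpdf f"
    "Tgt gpdf u\<^sub>2 = Src gpdf g" "\<mu> \<in> cells2 gpdf (Comp1 gpdf f u\<^sub>1) (Comp1 gpdf g u\<^sub>2)"
  then have h: "u\<^sub>1 \<in> One gpdf" "u\<^sub>2 \<in> One gpdf" "fdom u\<^sub>1 = fdom u\<^sub>2" "fcod u\<^sub>1 = A" "fcod u\<^sub>2 = B"
    "\<mu> \<in> cells2 gpdf (functor_comp f u\<^sub>1) (functor_comp g u\<^sub>2)"
    by (simp_all only: gpdf_sel(4-12))
  show "\<exists>u\<in>cells1 gpdf (Src gpdf u\<^sub>1) P. Comp1 gpdf (comma_fst f g) u = u\<^sub>1 \<and>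
      Comp1 gpdf (comma_snd f g) u = u\<^sub>2 \<and> HComp gpdf (comma_cell f g) (Id2 gpdf u) = \<mu>"
    unfolding gpdf_sel(4-12) using pairing_cells1[OF h] pairing_comps[OF h] by blast
next
  fix u v m\<^sub>1 m\<^sub>2
  assume h: "u \<in> One gpdf" "v \<in> One gpdf" "Src gpdf u = Src gpdf v" "Tgt gpdf u = P" "Tgt gpdf v = P"
    "m\<^sub>1 \<in> cells2 gpdf (Comp1 gpdf (comma_fst f g) u) (Comp1 gpdf (comma_fst f g) v)"
    "m\<^sub>2 \<in> cells2 gpdf (Comp1 gpdf (comma_snd f g) u) (Comp1 gpdf (comma_snd f g) v)"
    "VComp gpdf (HComp gpdf (comma_cell f g) (Id2 gpdf v)) (HComp gpdf (Id2 gpdf f) m\<^sub>1) =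
     VComp gpdf (HComp gpdf (Id2 gpdf g) m\<^sub>2) (HComp gpdf (comma_cell f g) (Id2 gpdf u))"
  show "\<exists>!\<omega>. \<omega> \<in> cells2 gpdf u v \<and> HComp gpdf (Id2 gpdf (comma_fst f g)) \<omega> = m\<^sub>1 \<and>
      HComp gpdf (Id2 gpdf (comma_snd f g)) \<omega> = m\<^sub>2"
    unfolding gpdf_sel(4-12) by (rule lift_cell) (use h in \<open>simp_all only: gpdf_sel(4-12)\<close>)
qed (use f_One g_One fst_One snd_One in simp_all)

lemmas two_pullback_isocomma = square.two_pullback

end

section \<open>Adjunctions and Mackey 2-functors in components\<close>

context adjunction
begin

sublocale L: is_functor L by (rule left_functor)
sublocale R: is_functor R by (rule right_functor)
sublocale dom: category "fdom L" by (rule L.dom_category)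
sublocale cod: category "fcod L" by (rule L.cod_category)

lemma R_typing [simp]: "y \<in> Obj (fcod L) \<Longrightarrow> fob R y \<in> Obj (fdom L)"
  "h \<in> Arr (fcod L) \<Longrightarrow> far R h \<in> Arr (fdom L)"
  "h \<in> Arr (fcod L) \<Longrightarrow> Dom (fdom L) (far R h) = fob R (Dom (fcod L) h)"
  "h \<in> Arr (fcod L) \<Longrightarrow> Cod (fdom L) (far R h) = fob R (Cod (fcod L) h)"
  "y \<in> Obj (fcod L) \<Longrightarrow> far R (Ident (fcod L) y) = Ident (fdom L) (fob R y)"
  "h \<in> Arr (fcod L) \<Longrightarrow> k \<in> Arr (fcod L) \<Longrightarrow> Cod (fcod L) h = Dom (fcod L) k \<Longrightarrow>
    far R (k \<cdot>\<^bsub>fcod L\<^esub> h) = far R k \<cdot>\<^bsub>fdom L\<^esub> far R h"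
  using R.fob_Obj[of y] R.far_Arr[of h] R.Dom_far[of h] R.Cod_far[of h] R.far_Ident[of y] R.far_Comp'[of h k]
  by (simp_all add: fdom_right fcod_right)

lemma L_typing [simp]: "x \<in> Obj (fdom L) \<Longrightarrow> fob L x \<in> Obj (fcod L)"
  "x \<in> Obj (fdom L) \<Longrightarrow> far L (Ident (fdom L) x) = Ident (fcod L) (fob L x)"
  by (simp_all add: L.fob_Obj L.far_Ident)

lemma unit_typing [simp]:
  assumes "x \<in> Obj (fdom L)"
  shows "ntc \<eta> x \<in> Arr (fdom L)" "Dom (fdom L) (ntc \<eta> x) = x" "Cod (fdom L) (ntc \<eta> x) = fob R (fob L x)"
  using nt_typing(7-9)[OF unit_ntrans unit_dom unit_cod refl refl, of x] assms by simp_all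

lemma counit_typing [simp]:
  assumes "y \<in> Obj (fcod L)"
  shows "ntc \<epsilon> y \<in> Arr (fcod L)" "Dom (fcod L) (ntc \<epsilon> y) = fob L (fob R y)" "Cod (fcod L) (ntc \<epsilon> y) = y"
  using nt_typing(7-9)[OF counit_ntrans counit_dom counit_cod refl refl, of y] assms
  by (simp_all add: fdom_right)

lemma unit_natural:
  assumes "h \<in> Arr (fdom L)" "Dom (fdom L) h = x" "Cod (fdom L) h = x'"
  shows "ntc \<eta> x' \<cdot>\<^bsub>fdom L\<^esub> h = far R (far L h) \<cdot>\<^bsub>fdom L\<^esub> ntc \<eta> x"
  using nt_typing(10)[OF unit_ntrans unit_dom unit_cod refl refl, of h] assms by simp

lemma counit_natural:
  assumes "h \<in> Arr (fcod L)" "Dom (fcod L) h = y" "Cod (fcod L) h = y'"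
  shows "ntc \<epsilon> y' \<cdot>\<^bsub>fcod L\<^esub> far L (far R h) = h \<cdot>\<^bsub>fcod L\<^esub> ntc \<epsilon> y"
  using nt_typing(10)[OF counit_ntrans counit_dom counit_cod refl refl, of h] assms by (simp add: fdom_right)

lemma triangle_left':
  assumes "x \<in> Obj (fdom L)"
  shows "ntc \<epsilon> (fob L x) \<cdot>\<^bsub>fcod L\<^esub> far L (ntc \<eta> x) = Ident (fcod L) (fob L x)"
proof -
  have "ntc (vcomp (whisker_right \<epsilon> L) (whisker_left L \<eta>)) x = ntc (id_nt L) x" by (simp only: triangle_left)
  then show ?thesis
    using assms unit_ntrans counit_ntrans left_functor unit_dom counit_dom fdom_right fcod_right
    by (simp add: whisker_left_def whisker_right_def del: hcomp_sel(3))
qed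

lemma triangle_right':
  assumes "y \<in> Obj (fcod L)"
  shows "far R (ntc \<epsilon> y) \<cdot>\<^bsub>fdom L\<^esub> ntc \<eta> (fob R y) = Ident (fdom L) (fob R y)"
proof -
  have "ntc (vcomp (whisker_left R \<epsilon>) (whisker_right \<eta> R)) y = ntc (id_nt R) y" by (simp only: triangle_right)
  then show ?thesis
    using assms unit_ntrans counit_ntrans right_functor unit_dom counit_dom fdom_right fcod_right
    by (simp add: whisker_left_def whisker_right_def del: hcomp_sel(3))
qed

lemma transpose_unique:
  assumes x: "x \<in> Obj (fdom L)" and w: "w \<in> homs (fdom L) x (fob R y)" and y: "y \<in> Obj (fcod L)"
  shows "\<exists>!v. v \<in> homs (fcod L) (fob L x) y \<and> far R v \<cdot>\<^bsub>fdom L\<^esub> ntc \<eta> x = w"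
proof (rule ex1I[where a = "ntc \<epsilon> y \<cdot>\<^bsub>fcod L\<^esub> far L w"])
  have w' [simp]: "w \<in> Arr (fdom L)" "Dom (fdom L) w = x" "Cod (fdom L) w = fob R y"
    using w by (auto simp: homs_iff)
  have "far R (ntc \<epsilon> y) \<cdot>\<^bsub>fdom L\<^esub> far R (far L w) \<cdot>\<^bsub>fdom L\<^esub> ntc \<eta> x =
      (far R (ntc \<epsilon> y) \<cdot>\<^bsub>fdom L\<^esub> ntc \<eta> (fob R y)) \<cdot>\<^bsub>fdom L\<^esub> w"
    using x y by (simp add: dom.assoc unit_natural[of w])
  then show "ntc \<epsilon> y \<cdot>\<^bsub>fcod L\<^esub> far L w \<in> homs (fcod L) (fob L x) y \<and>
      far R (ntc \<epsilon> y \<cdot>\<^bsub>fcod L\<^esub> far L w) \<cdot>\<^bsub>fdom L\<^esub> ntc \<eta> x = w"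
    using x y by (simp add: homs_iff dom.assoc triangle_right')
next
  fix v assume v: "v \<in> homs (fcod L) (fob L x) y \<and> far R v \<cdot>\<^bsub>fdom L\<^esub> ntc \<eta> x = w"
  then have v' [simp]: "v \<in> Arr (fcod L)" "Dom (fcod L) v = fob L x" "Cod (fcod L) v = y"
    and vw: "w = far R v \<cdot>\<^bsub>fdom L\<^esub> ntc \<eta> x"
    by (auto simp: homs_iff)
  have "ntc \<epsilon> y \<cdot>\<^bsub>fcod L\<^esub> far L w = (ntc \<epsilon> y \<cdot>\<^bsub>fcod L\<^esub> far L (far R v)) \<cdot>\<^bsub>fcod L\<^esub> far L (ntc \<eta> x)"
    using x y by (simp add: vw cod.assoc)
  also have "\<dots> = v \<cdot>\<^bsub>fcod L\<^esub> (ntc \<epsilon> (fob L x) \<cdot>\<^bsub>fcod L\<^esub> far L (ntc \<eta> x))"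
    using x y by (simp add: counit_natural[of v] cod.assoc)
  also have "\<dots> = v" using x by (simp add: triangle_left')
  finally show "v = ntc \<epsilon> y \<cdot>\<^bsub>fcod L\<^esub> far L w" by simp
qed

end

lemma op2_sel [simp]: "Ob (op2 C) = Ob C" "One (op2 C) = One C" "Two (op2 C) = Two C"
  "Src (op2 C) = Tgt C" "Tgt (op2 C) = Src C" "Dom2 (op2 C) = Dom2 C" "Cod2 (op2 C) = Cod2 C"
  "Id1 (op2 C) = Id1 C" "Id2 (op2 C) = Id2 C" "Comp1 (op2 C) g f = Comp1 C f g" "VComp (op2 C) = VComp C"
  "HComp (op2 C) \<beta> \<alpha> = HComp C \<alpha> \<beta>"
  by (simp_all add: op2_def)

lemma Add2_sel [simp]: "Ob Add2 = {A. additive_category A}"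
  "One Add2 = {F. additive_functor F}"
  "Two Add2 = {\<alpha>. is_ntrans \<alpha> \<and> additive_functor (ntdom \<alpha>) \<and> additive_functor (ntcod \<alpha>)}"
  "Src Add2 = fdom" "Tgt Add2 = fcod" "Dom2 Add2 = ntdom" "Cod2 Add2 = ntcod"
  "Id1 Add2 = id_functor" "Id2 Add2 = id_nt" "Comp1 Add2 = functor_comp" "VComp Add2 = vcomp"
  "HComp Add2 = hcomp"
  by (auto simp: Add2_def)

text \<open>
  From here on membership in \<open>gpdf\<close> is used as an atomic fact.
\<close>

declare gpdf_sel(2,3) [simp del]

lemma One_gpdf: "f \<in> One gpdf \<Longrightarrow> is_functor f"
  and One_gpdf_ends: "f \<in> One gpdf \<Longrightarrow> finite_groupoid (fdom f)" "f \<in> One gpdf \<Longrightarrow> finite_groupoid (fcod f)"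
  and Two_gpdf: "\<alpha> \<in> Two gpdf \<Longrightarrow> is_ntrans \<alpha>" "\<alpha> \<in> Two gpdf \<Longrightarrow> ntdom \<alpha> \<in> One gpdf"
    "\<alpha> \<in> Two gpdf \<Longrightarrow> ntcod \<alpha> \<in> One gpdf"
  by (auto simp: gpdf_sel(2,3) faithful_functorD)

context mackey_2functor
begin

interpretation M: two_functor "op2 gpdf" Add2 M by (rule two_functor)

text \<open>
  \<open>ob f\<close> and \<open>ar f\<close> are the restriction functor \<open>f\<^sup>*\<close>, and \<open>tr \<alpha>\<close> is the transformation \<open>\<alpha>\<^sup>*\<close>.
\<close>

abbreviation "ob f x \<equiv> fob (F1 M f) x"
abbreviation "ar f h \<equiv> far (F1 M f) h"
abbreviation "tr \<alpha> x \<equiv> ntc (F2 M \<alpha>) x"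

lemma
  assumes "f \<in> One gpdf"
  shows pull_functor: "is_functor (F1 M f)"
    and pull_ends [simp]: "fdom (F1 M f) = F0 M (fcod f)" "fcod (F1 M f) = F0 M (fdom f)"
  using M.F1_cells1[of f "fcod f" "fdom f"] assms by (auto simp: cells1_iff additive_functor_def)

lemma M_category [simp]: "finite_groupoid A \<Longrightarrow> category (F0 M A)"
  using M.F0_Ob[of A] by (auto simp: additive_category_def)

lemma M_cell: assumes "\<alpha> \<in> Two gpdf"
  shows "is_ntrans (F2 M \<alpha>)" "ntdom (F2 M \<alpha>) = F1 M (ntdom \<alpha>)" "ntcod (F2 M \<alpha>) = F1 M (ntcod \<alpha>)"
  using M.F2_cells2[of \<alpha> "ntdom \<alpha>" "ntcod \<alpha>"] assms by (auto simp: cells2_iff)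

lemma M_id: "finite_groupoid A \<Longrightarrow> F1 M (id_functor A) = id_functor (F0 M A)"
  using M.F1_Id1[of A] by simp

lemma M_comp: "f \<in> One gpdf \<Longrightarrow> g \<in> One gpdf \<Longrightarrow> fdom g = fcod f \<Longrightarrow>
    F1 M (functor_comp g f) = functor_comp (F1 M f) (F1 M g)"
  using M.F1_Comp1[of g "fcod g" "fdom g" f "fdom f"] by (simp add: cells1_iff)

lemma M_id_nt: "f \<in> One gpdf \<Longrightarrow> F2 M (id_nt f) = id_nt (F1 M f)"
  using M.F2_Id2[of f] by simp

lemma M_vcomp: "\<alpha> \<in> Two gpdf \<Longrightarrow> \<beta> \<in> Two gpdf \<Longrightarrow> ntcod \<alpha> = ntdom \<beta> \<Longrightarrow>
    F2 M (vcomp \<beta> \<alpha>) = vcomp (F2 M \<beta>) (F2 M \<alpha>)"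
  using M.F2_VComp[of \<alpha> "ntdom \<alpha>" "ntcod \<alpha>" \<beta> "ntcod \<beta>"] by (simp add: cells2_iff)

lemma M_hcomp: "\<alpha> \<in> Two gpdf \<Longrightarrow> \<beta> \<in> Two gpdf \<Longrightarrow> fcod (ntdom \<alpha>) = fdom (ntdom \<beta>) \<Longrightarrow>
    F2 M (hcomp \<beta> \<alpha>) = hcomp (F2 M \<alpha>) (F2 M \<beta>)"
  using M.F2_HComp[of \<beta> "ntdom \<beta>" "ntcod \<beta>" \<alpha> "ntdom \<alpha>" "ntcod \<alpha>" "fcod (ntdom \<beta>)" "fdom (ntdom \<beta>)" "fdom (ntdom \<alpha>)"]
  by (simp add: cells1_iff cells2_iff Two_gpdf)

lemma ob_in [simp]: "f \<in> One gpdf \<Longrightarrow> fcod f = B \<Longrightarrow> x \<in> Obj (F0 M B) \<Longrightarrow> fdom f = A \<Longrightarrow> ob f x \<in> Obj (F0 M A)"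
  using is_functor.fob_Obj[OF pull_functor] by auto

lemma ar_typing [simp]:
  "f \<in> One gpdf \<Longrightarrow> fcod f = B \<Longrightarrow> h \<in> Arr (F0 M B) \<Longrightarrow> fdom f = A \<Longrightarrow> ar f h \<in> Arr (F0 M A)"
  "f \<in> One gpdf \<Longrightarrow> fcod f = B \<Longrightarrow> h \<in> Arr (F0 M B) \<Longrightarrow> fdom f = A \<Longrightarrow>
    Dom (F0 M A) (ar f h) = ob f (Dom (F0 M B) h)"
  "f \<in> One gpdf \<Longrightarrow> fcod f = B \<Longrightarrow> h \<in> Arr (F0 M B) \<Longrightarrow> fdom f = A \<Longrightarrow>
    Cod (F0 M A) (ar f h) = ob f (Cod (F0 M B) h)"
  using is_functor.far_Arr[OF pull_functor, of f h] is_functor.Dom_far[OF pull_functor, of f h]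
    is_functor.Cod_far[OF pull_functor, of f h] by auto

lemma ar_Ident [simp]: "f \<in> One gpdf \<Longrightarrow> fcod f = B \<Longrightarrow> x \<in> Obj (F0 M B) \<Longrightarrow> fdom f = A \<Longrightarrow>
    ar f (Ident (F0 M B) x) = Ident (F0 M A) (ob f x)"
  using is_functor.far_Ident[OF pull_functor, of f x] by auto

lemma ar_Comp: "f \<in> One gpdf \<Longrightarrow> fcod f = B \<Longrightarrow> fdom f = A \<Longrightarrow> h \<in> Arr (F0 M B) \<Longrightarrow> k \<in> Arr (F0 M B) \<Longrightarrow>
    Cod (F0 M B) h = Dom (F0 M B) k \<Longrightarrow> ar f (k \<cdot>\<^bsub>F0 M B\<^esub> h) = ar f k \<cdot>\<^bsub>F0 M A\<^esub> ar f h"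
  using is_functor.far_Comp'[OF pull_functor, of f h k] by auto

lemma ar_iso: "f \<in> One gpdf \<Longrightarrow> fcod f = B \<Longrightarrow> fdom f = A \<Longrightarrow> iso_arrow (F0 M B) h \<Longrightarrow> iso_arrow (F0 M A) (ar f h)"
  using is_functor.far_iso[OF pull_functor, of f h] by auto

lemma ob_comp: "f \<in> One gpdf \<Longrightarrow> g \<in> One gpdf \<Longrightarrow> fdom g = fcod f \<Longrightarrow> fcod g = B \<Longrightarrow> x \<in> Obj (F0 M B) \<Longrightarrow>
    ob (functor_comp g f) x = ob f (ob g x)"
  by (simp add: M_comp)

lemma ar_comp: "f \<in> One gpdf \<Longrightarrow> g \<in> One gpdf \<Longrightarrow> fdom g = fcod f \<Longrightarrow> fcod g = B \<Longrightarrow> h \<in> Arr (F0 M B) \<Longrightarrow>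
    ar (functor_comp g f) h = ar f (ar g h)"
  by (simp add: M_comp)

lemma tr_typing:
  assumes "\<alpha> \<in> cells2 gpdf f g" "fcod f = B" "fdom f = A" "x \<in> Obj (F0 M B)"
  shows "tr \<alpha> x \<in> Arr (F0 M A)" "Dom (F0 M A) (tr \<alpha> x) = ob f x" "Cod (F0 M A) (tr \<alpha> x) = ob g x"
  using nt_typing(7-9)[OF M_cell refl refl, of \<alpha> x] assms by (auto simp: cells2_iff Two_gpdf)

lemma tr_natural:
  assumes "\<alpha> \<in> cells2 gpdf f g" "fcod f = B" "fdom f = A" "h \<in> Arr (F0 M B)"
    "Dom (F0 M B) h = x" "Cod (F0 M B) h = y"
  shows "tr \<alpha> y \<cdot>\<^bsub>F0 M A\<^esub> ar f h = ar g h \<cdot>\<^bsub>F0 M A\<^esub> tr \<alpha> x"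
  using nt_typing(10)[OF M_cell refl refl, of \<alpha> h x y] assms by (auto simp: cells2_iff Two_gpdf)

lemma tr_id: "f \<in> One gpdf \<Longrightarrow> fcod f = B \<Longrightarrow> fdom f = A \<Longrightarrow> x \<in> Obj (F0 M B) \<Longrightarrow>
    tr (id_nt f) x = Ident (F0 M A) (ob f x)"
  by (simp add: M_id_nt)

lemma tr_vcomp: "\<alpha> \<in> cells2 gpdf f g \<Longrightarrow> \<beta> \<in> cells2 gpdf g h \<Longrightarrow> fcod f = B \<Longrightarrow> fdom f = A \<Longrightarrow>
    x \<in> Obj (F0 M B) \<Longrightarrow> tr (vcomp \<beta> \<alpha>) x = tr \<beta> x \<cdot>\<^bsub>F0 M A\<^esub> tr \<alpha> x"
  by (auto simp: M_vcomp M_cell cells2_iff Two_gpdf)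

lemma tr_whisker_right: "\<alpha> \<in> cells2 gpdf f f' \<Longrightarrow> g \<in> One gpdf \<Longrightarrow> fdom f = fcod g \<Longrightarrow> fcod f = B \<Longrightarrow>
    x \<in> Obj (F0 M B) \<Longrightarrow> tr (hcomp \<alpha> (id_nt g)) x = ar g (tr \<alpha> x)"
  using gpdf.Id2_typing[of g]
  by (auto simp: M_hcomp M_id_nt M_cell cells2_iff Two_gpdf pull_functor simp del: hcomp_sel(3))

text \<open>
  The mate \<open>q\<^sub>2\<^sub>! q\<^sub>1\<^sup>* x \<rightarrow> g\<^sup>* f\<^sub>! x\<close> is the transpose along \<open>q\<^sub>2\<^sub>! \<stileturn> q\<^sub>2\<^sup>*\<close> of the map
  \<open>k : q\<^sub>1\<^sup>* x \<rightarrow> q\<^sub>1\<^sup>* f\<^sup>* f\<^sub>! x \<rightarrow> q\<^sub>2\<^sup>* g\<^sup>* f\<^sub>! x\<close> given by the unit and \<open>\<theta>\<^sup>*\<close>.  Since it is invertible,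
  composing with it and transposing is a bijection from maps \<open>g\<^sup>* f\<^sub>! x \<rightarrow> y\<close> to maps
  \<open>q\<^sub>1\<^sup>* x \<rightarrow> q\<^sub>2\<^sup>* y\<close>, which sends \<open>u\<close> to \<open>q\<^sub>2\<^sup>* u\<close> after \<open>k\<close>.  In this form no left adjoint of
  \<open>q\<^sub>2\<^sup>*\<close> occurs.
\<close>

lemma beck_chevalley_transpose:
  assumes pb: "two_pullback gpdf f g P q\<^sub>1 q\<^sub>2 \<theta>" and adj: "adjunction fsh (F1 M f) \<eta> \<epsilon>"
    and f: "f \<in> One gpdf" and g: "g \<in> One gpdf" "fcod g = fcod f"
    and q\<^sub>1: "q\<^sub>1 \<in> One gpdf" "fdom q\<^sub>1 = P" "fcod q\<^sub>1 = fdom f"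
    and q\<^sub>2: "q\<^sub>2 \<in> One gpdf" "fdom q\<^sub>2 = P" "fcod q\<^sub>2 = fdom g"
    and \<theta>: "\<theta> \<in> cells2 gpdf (functor_comp f q\<^sub>1) (functor_comp g q\<^sub>2)"
    and x: "x \<in> Obj (F0 M (fdom f))" and y: "y \<in> Obj (F0 M (fdom g))"
    and w: "w \<in> homs (F0 M P) (ob q\<^sub>1 x) (ob q\<^sub>2 y)"
  shows "\<exists>!u. u \<in> homs (F0 M (fdom g)) (ob g (fob fsh x)) y \<and>
    ar q\<^sub>2 u \<cdot>\<^bsub>F0 M P\<^esub> tr \<theta> (fob fsh x) \<cdot>\<^bsub>F0 M P\<^esub> ar q\<^sub>1 (ntc \<eta> x) = w"
proof -
  interpret F: adjunction fsh "F1 M f" \<eta> \<epsilon> by (rule adj)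
  obtain q2sh \<eta>' \<epsilon>' where adj': "adjunction q2sh (F1 M q\<^sub>2) \<eta>' \<epsilon>'"
    using left_adjoint[OF q\<^sub>2(1)] by blast
  interpret Q: adjunction q2sh "F1 M q\<^sub>2" \<eta>' \<epsilon>' by (rule adj')
  let ?MP = "F0 M P" and ?MB = "F0 M (fdom g)"
  have F_ends [simp]: "fcod fsh = F0 M (fcod f)" "fdom fsh = F0 M (fdom f)"
    using F.fdom_right F.fcod_right f by simp_all
  have Q_ends [simp]: "fcod q2sh = ?MB" "fdom q2sh = ?MP"
    using Q.fdom_right Q.fcod_right q\<^sub>2 by simp_all
  interpret MP: category ?MP using Q.dom.category_axioms by simp
  interpret MB: category ?MB using Q.cod.category_axioms by simp
  have fx [simp]: "fob fsh x \<in> Obj (F0 M (fcod f))" using F.L_typing(1)[of x] x by simp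
  have \<eta>x [simp]: "ntc \<eta> x \<in> Arr (F0 M (fdom f))" "Dom (F0 M (fdom f)) (ntc \<eta> x) = x"
    "Cod (F0 M (fdom f)) (ntc \<eta> x) = ob f (fob fsh x)"
    using F.unit_typing[of x] x by simp_all
  have q1x [simp]: "ob q\<^sub>1 x \<in> Obj ?MP" using x q\<^sub>1 by simp
  have gfx [simp]: "ob g (fob fsh x) \<in> Obj ?MB" using g by simp
  have \<theta>x [simp]: "tr \<theta> (fob fsh x) \<in> Arr ?MP" "Dom ?MP (tr \<theta> (fob fsh x)) = ob q\<^sub>1 (ob f (fob fsh x))"
    "Cod ?MP (tr \<theta> (fob fsh x)) = ob q\<^sub>2 (ob g (fob fsh x))"
    using tr_typing[OF \<theta> _ _ fx, of P] f g q\<^sub>1 q\<^sub>2 by (simp_all add: ob_comp)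
  define k where "k = tr \<theta> (fob fsh x) \<cdot>\<^bsub>?MP\<^esub> ar q\<^sub>1 (ntc \<eta> x)"
  have k [simp]: "k \<in> Arr ?MP" "Dom ?MP k = ob q\<^sub>1 x" "Cod ?MP k = ob q\<^sub>2 (ob g (fob fsh x))"
    unfolding k_def using q\<^sub>1 by simp_all
  define m where "m = ntc \<epsilon>' (ob g (fob fsh x)) \<cdot>\<^bsub>?MB\<^esub> far q2sh k"
  have m [simp]: "m \<in> Arr ?MB" "Dom ?MB m = fob q2sh (ob q\<^sub>1 x)" "Cod ?MB m = ob g (fob fsh x)"
    unfolding m_def using Q.L.far_Arr[of k] Q.L.Dom_far[of k] Q.L.Cod_far[of k]
      Q.counit_typing[of "ob g (fob fsh x)"] by simp_all
  have iso: "iso_arrow ?MB m"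
  proof -
    note bc = beck_chevalley_left[OF pb adj adj']
    let ?mate = "mate_left fsh (F1 M q\<^sub>1) q2sh (F1 M g) (F2 M \<theta>) \<eta> \<epsilon>'"
    have \<theta>2: "\<theta> \<in> Two gpdf" "ntdom \<theta> = functor_comp f q\<^sub>1" "ntcod \<theta> = functor_comp g q\<^sub>2"
      using \<theta> by (auto simp: cells2_iff)
    have \<theta>M: "is_ntrans (F2 M \<theta>)" "ntdom (F2 M \<theta>) = functor_comp (F1 M q\<^sub>1) (F1 M f)"
      using M_cell[OF \<theta>2(1)] \<theta>2 f q\<^sub>1 by (simp_all add: M_comp)
    have ends: "fdom (ntdom ?mate) = F0 M (fdom f)" "fcod (ntdom ?mate) = ?MB"
      by (simp_all add: mate_left_def whisker_left_def whisker_right_def F.unit_dom)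
    have "ntc ?mate x = ntc \<epsilon>' (ob g (fob fsh x)) \<cdot>\<^bsub>?MB\<^esub> far q2sh (tr \<theta> (fob fsh x)) \<cdot>\<^bsub>?MB\<^esub>
        far q2sh (ar q\<^sub>1 (ntc \<eta> x))"
      using x f g q\<^sub>1 q\<^sub>2 \<theta>M F.unit_ntrans Q.counit_ntrans F.left_functor Q.left_functor pull_functor
      by (simp add: mate_left_def whisker_left_def whisker_right_def F.unit_dom Q.counit_dom
          del: hcomp_sel(3))
    also have "\<dots> = m"
      unfolding m_def k_def using Q.L.far_Comp'[of "ar q\<^sub>1 (ntc \<eta> x)" "tr \<theta> (fob fsh x)"] q\<^sub>1 by simp
    finally show ?thesis
      using natural_isoD[OF bc, of x] ends x by simp
  qed
  have mk: "ar q\<^sub>2 m \<cdot>\<^bsub>?MP\<^esub> ntc \<eta>' (ob q\<^sub>1 x) = k"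
  proof -
    have kq: "far (F1 M q\<^sub>2) (far q2sh k) \<cdot>\<^bsub>?MP\<^esub> ntc \<eta>' (ob q\<^sub>1 x) = ntc \<eta>' (ob q\<^sub>2 (ob g (fob fsh x))) \<cdot>\<^bsub>?MP\<^esub> k"
      using Q.unit_natural[of k] by simp
    have "ar q\<^sub>2 m \<cdot>\<^bsub>?MP\<^esub> ntc \<eta>' (ob q\<^sub>1 x) =
        ar q\<^sub>2 (ntc \<epsilon>' (ob g (fob fsh x))) \<cdot>\<^bsub>?MP\<^esub> ar q\<^sub>2 (far q2sh k) \<cdot>\<^bsub>?MP\<^esub> ntc \<eta>' (ob q\<^sub>1 x)"
      unfolding m_def
      using Q.R_typing(2-4)[of "far q2sh k"] Q.R_typing(2-4)[of "ntc \<epsilon>' (ob g (fob fsh x))"]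
        Q.R_typing(6)[of "far q2sh k" "ntc \<epsilon>' (ob g (fob fsh x))"]
        Q.L.far_Arr[of k] Q.L.Dom_far[of k] Q.L.Cod_far[of k]
        Q.counit_typing[of "ob g (fob fsh x)"] Q.unit_typing[of "ob q\<^sub>1 x"]
      by (simp add: MP.assoc)
    also have "\<dots> = (ar q\<^sub>2 (ntc \<epsilon>' (ob g (fob fsh x))) \<cdot>\<^bsub>?MP\<^esub> ntc \<eta>' (ob q\<^sub>2 (ob g (fob fsh x)))) \<cdot>\<^bsub>?MP\<^esub> k"
      unfolding kq using q\<^sub>2 Q.counit_typing[of "ob g (fob fsh x)"]
        Q.unit_typing[of "ob q\<^sub>2 (ob g (fob fsh x))"]
      by (simp add: MP.assoc)
    also have "\<dots> = k"
      using Q.triangle_right'[of "ob g (fob fsh x)"] by simp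
    finally show ?thesis .
  qed
  have tr: "ar q\<^sub>2 (u \<cdot>\<^bsub>?MB\<^esub> m) \<cdot>\<^bsub>?MP\<^esub> ntc \<eta>' (ob q\<^sub>1 x) = ar q\<^sub>2 u \<cdot>\<^bsub>?MP\<^esub> k"
    if "u \<in> Arr ?MB" "Dom ?MB u = ob g (fob fsh x)" for u
    using that q\<^sub>2 Q.unit_typing[of "ob q\<^sub>1 x"] by (simp add: ar_Comp MP.assoc mk)
  have ex: "\<exists>!v. v \<in> homs ?MB (fob q2sh (ob q\<^sub>1 x)) y \<and> ar q\<^sub>2 v \<cdot>\<^bsub>?MP\<^esub> ntc \<eta>' (ob q\<^sub>1 x) = w"
    using Q.transpose_unique[of "ob q\<^sub>1 x" w y] w y by simp
  then obtain v where v: "v \<in> homs ?MB (fob q2sh (ob q\<^sub>1 x)) y" "ar q\<^sub>2 v \<cdot>\<^bsub>?MP\<^esub> ntc \<eta>' (ob q\<^sub>1 x) = w"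
    by blast
  let ?u = "v \<cdot>\<^bsub>?MB\<^esub> inv_arr ?MB m"
  have u: "?u \<in> homs ?MB (ob g (fob fsh x)) y" "?u \<cdot>\<^bsub>?MB\<^esub> m = v"
    using v inv_arr[OF iso] by (auto simp: homs_iff MB.assoc)
  show ?thesis
    unfolding k_def[symmetric]
  proof (rule ex1I[where a = ?u])
    show "?u \<in> homs ?MB (ob g (fob fsh x)) y \<and> ar q\<^sub>2 ?u \<cdot>\<^bsub>?MP\<^esub> k = w"
      using u tr[of ?u] v by (auto simp: homs_iff)
  next
    fix u' assume u': "u' \<in> homs ?MB (ob g (fob fsh x)) y \<and> ar q\<^sub>2 u' \<cdot>\<^bsub>?MP\<^esub> k = w"
    then have "u' \<cdot>\<^bsub>?MB\<^esub> m \<in> homs ?MB (fob q2sh (ob q\<^sub>1 x)) y \<and>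
        ar q\<^sub>2 (u' \<cdot>\<^bsub>?MB\<^esub> m) \<cdot>\<^bsub>?MP\<^esub> ntc \<eta>' (ob q\<^sub>1 x) = w"
      using tr[of u'] by (auto simp: homs_iff)
    with ex v have "u' \<cdot>\<^bsub>?MB\<^esub> m = v" by blast
    then have "u' \<cdot>\<^bsub>?MB\<^esub> m = ?u \<cdot>\<^bsub>?MB\<^esub> m" using u by simp
    then show "u' = ?u"
      using MB.iso_epi[OF iso, of u' ?u] u' u by (auto simp: homs_iff)
  qed
qed

end

section \<open>Descent along a monadic restriction functor\<close>

locale monadic_restriction = mackey_2functor M
  for M :: "('u::infinite, 'o, 'm) gpd_cat_twofun" +
  fixes i :: "'u gpd1"
  assumes i [simp]: "i \<in> One gpdf"
    and monadic: "\<And>L \<eta> \<epsilon>. adjunction L (F1 M i) \<eta> \<epsilon> \<Longrightarrow> is_equivalence (em_comparison L (F1 M i) \<eta> \<epsilon>)"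
begin

abbreviation "H \<equiv> fdom i"
abbreviation "K \<equiv> fcod i"

text \<open>
  The squares \<open>\<beta> : i b \<Rightarrow> i j\<close> over \<open>i\<close>, that is, the generalized points of the iso-comma groupoid of \<open>i\<close>
  with itself.
\<close>

definition over :: "'u gpd1 \<Rightarrow> 'u gpd1 \<Rightarrow> 'u gpd2 \<Rightarrow> bool" where
  "over b j \<beta> \<longleftrightarrow> b \<in> One gpdf \<and> j \<in> One gpdf \<and> fdom b = fdom j \<and> fcod b = H \<and> fcod j = H \<and>
    \<beta> \<in> cells2 gpdf (functor_comp i b) (functor_comp i j)"

lemma overD: assumes "over b j \<beta>"
  shows "b \<in> One gpdf" "j \<in> One gpdf" "fdom b = fdom j" "fcod b = H" "fcod j = H"
    "\<beta> \<in> cells2 gpdf (functor_comp i b) (functor_comp i j)"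
  using assms by (auto simp: over_def)

lemma comp_One [simp]: "f \<in> One gpdf \<Longrightarrow> g \<in> One gpdf \<Longrightarrow> fdom g = fcod f \<Longrightarrow> functor_comp g f \<in> One gpdf"
  using gpdf.Comp1_typing(1)[of f g] by simp

lemma id_One [simp]: "finite_groupoid A \<Longrightarrow> id_functor A \<in> One gpdf"
  using gpdf.Id1_typing(1)[of A] by simp

lemma assoc_One: "f \<in> One gpdf \<Longrightarrow> g \<in> One gpdf \<Longrightarrow> h \<in> One gpdf \<Longrightarrow> fdom g = fcod f \<Longrightarrow> fdom h = fcod g \<Longrightarrow>
    functor_comp (functor_comp h g) f = functor_comp h (functor_comp g f)"
  using functor_comp_assoc[of f g h] by (simp add: One_gpdf)

lemma id_nt_cells2 [simp]: "f \<in> One gpdf \<Longrightarrow> id_nt f \<in> cells2 gpdf f f"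
  using gpdf.Id2_typing[of f] by (simp add: cells2_iff)

lemma vcomp_cells2: "\<alpha> \<in> cells2 gpdf f g \<Longrightarrow> \<beta> \<in> cells2 gpdf g h \<Longrightarrow> vcomp \<beta> \<alpha> \<in> cells2 gpdf f h"
  using gpdf.VComp_typing[of \<alpha> \<beta>] by (auto simp: cells2_iff)

lemma over_id: "b \<in> One gpdf \<Longrightarrow> fcod b = H \<Longrightarrow> over b b (id_nt (functor_comp i b))"
  by (auto simp: over_def)

lemma over_vcomp: "over b c \<beta> \<Longrightarrow> over c d \<gamma> \<Longrightarrow> over b d (vcomp \<gamma> \<beta>)"
  by (auto simp: over_def vcomp_cells2)

lemma over_pull:
  assumes "over b j \<beta>" "c \<in> One gpdf" "fcod c = fdom b"
  shows "over (functor_comp b c) (functor_comp j c) (hcomp \<beta> (id_nt c))"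
proof -
  note o = overD[OF assms(1)]
  have "hcomp \<beta> (id_nt c) \<in> cells2 gpdf (functor_comp (functor_comp i b) c) (functor_comp (functor_comp i j) c)"
    using gpdf.HComp_typing[of "id_nt c" \<beta>] gpdf.Id2_typing[of c] o(6) assms(2,3) by (auto simp: cells2_iff)
  then show ?thesis using o assms by (auto simp: over_def assoc_One)
qed

text \<open>
  The transition maps are given at all generalized points.  With the universal point alone the
  cocycle condition would have to be stated over a triple iso-comma groupoid.
\<close>

definition descent_datum :: "'o \<Rightarrow> ('u gpd1 \<Rightarrow> 'u gpd1 \<Rightarrow> 'u gpd2 \<Rightarrow> 'm) \<Rightarrow> bool" where
  "descent_datum x \<psi> \<longleftrightarrow> x \<in> Obj (F0 M H) \<and>
    (\<forall>b j \<beta>. over b j \<beta> \<longrightarrow> \<psi> b j \<beta> \<in> homs (F0 M (fdom j)) (ob b x) (ob j x)) \<and>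
    (\<forall>b. b \<in> One gpdf \<longrightarrow> fcod b = H \<longrightarrow>
      \<psi> b b (id_nt (functor_comp i b)) = Ident (F0 M (fdom b)) (ob b x)) \<and>
    (\<forall>b c d \<beta> \<gamma>. over b c \<beta> \<longrightarrow> over c d \<gamma> \<longrightarrow>
      \<psi> b d (vcomp \<gamma> \<beta>) = \<psi> c d \<gamma> \<cdot>\<^bsub>F0 M (fdom d)\<^esub> \<psi> b c \<beta>) \<and>
    (\<forall>b j \<beta> c. over b j \<beta> \<longrightarrow> c \<in> One gpdf \<longrightarrow> fcod c = fdom b \<longrightarrow>
      \<psi> (functor_comp b c) (functor_comp j c) (hcomp \<beta> (id_nt c)) = ar c (\<psi> b j \<beta>))"

lemma fin [simp]: "f \<in> One gpdf \<Longrightarrow> finite_groupoid (fdom f)" "f \<in> One gpdf \<Longrightarrow> finite_groupoid (fcod f)"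
  by (auto simp: One_gpdf_ends)

sublocale ii: gpd_cospan i i
  by unfold_locales simp_all

text \<open>
  For \<open>f = g = i\<close> this equation rewrites a term to itself.
\<close>

declare ii.fcod_g [simp del]

abbreviation "X \<equiv> isocomma i i"
abbreviation "q\<^sub>1 \<equiv> comma_fst i i"
abbreviation "q\<^sub>2 \<equiv> comma_snd i i"
abbreviation "lam \<equiv> comma_cell i i"

lemma over_lam: "over q\<^sub>1 q\<^sub>2 lam"
  using ii.fst_One ii.snd_One ii.square.\<theta> ii.square.q\<^sub>1 ii.square.q\<^sub>2
  by (auto simp: over_def cells2_iff)

lemma over_factor:
  assumes "over b j \<beta>"
  obtains c where "c \<in> One gpdf" "fdom c = fdom j" "fcod c = X" "functor_comp q\<^sub>1 c = b" "functor_comp q\<^sub>2 c = j"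
    "hcomp lam (id_nt c) = \<beta>"
proof
  note o = overD[OF assms]
  note p = ii.pairing_cells1[OF o(1-6)] ii.pairing_comps[OF o(1-6)]
  show "ii.pairing b j \<beta> \<in> One gpdf" "fdom (ii.pairing b j \<beta>) = fdom j" "fcod (ii.pairing b j \<beta>) = X"
    using p(1) o(3) by (simp_all add: cells1_iff)
  show "functor_comp q\<^sub>1 (ii.pairing b j \<beta>) = b" "functor_comp q\<^sub>2 (ii.pairing b j \<beta>) = j"
    "hcomp lam (id_nt (ii.pairing b j \<beta>)) = \<beta>" by (rule p(2), rule p(3), rule p(4))
qed

context
  fixes L \<eta> \<epsilon>
  assumes adj: "adjunction L (F1 M i) \<eta> \<epsilon>"
begin

interpretation A: adjunction L "F1 M i" \<eta> \<epsilon> by (rule adj)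

lemma L_ends: "fcod L = F0 M K" "fdom L = F0 M H"
  by (simp_all only: A.fdom_right[symmetric] A.fcod_right[symmetric] pull_ends[OF i])

interpretation S: category "F0 M H" by (rule M_category, rule fin, rule i)
interpretation G: category "F0 M K" by (rule M_category, rule fin, rule i)

lemma adjoint_typing [simp]: "z \<in> Obj (F0 M H) \<Longrightarrow> fob L z \<in> Obj (F0 M K)"
  "h \<in> Arr (F0 M H) \<Longrightarrow> far L h \<in> Arr (F0 M K)"
  "h \<in> Arr (F0 M H) \<Longrightarrow> Dom (F0 M K) (far L h) = fob L (Dom (F0 M H) h)"
  "h \<in> Arr (F0 M H) \<Longrightarrow> Cod (F0 M K) (far L h) = fob L (Cod (F0 M H) h)"
  "z \<in> Obj (F0 M H) \<Longrightarrow> ntc \<eta> z \<in> Arr (F0 M H)"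
  "z \<in> Obj (F0 M H) \<Longrightarrow> Dom (F0 M H) (ntc \<eta> z) = z"
  "z \<in> Obj (F0 M H) \<Longrightarrow> Cod (F0 M H) (ntc \<eta> z) = ob i (fob L z)"
  "y \<in> Obj (F0 M K) \<Longrightarrow> ntc \<epsilon> y \<in> Arr (F0 M K)"
  "y \<in> Obj (F0 M K) \<Longrightarrow> Dom (F0 M K) (ntc \<epsilon> y) = fob L (ob i y)"
  "y \<in> Obj (F0 M K) \<Longrightarrow> Cod (F0 M K) (ntc \<epsilon> y) = y"
  using A.L_typing(1)[of z] A.L.far_Arr[of h] A.L.Dom_far[of h] A.L.Cod_far[of h] A.unit_typing[of z]
    A.counit_typing[of y] L_ends by simp_all

text \<open>
  The map \<open>b\<^sup>* z \<rightarrow> b\<^sup>* i\<^sup>* i\<^sub>! z \<rightarrow> j\<^sup>* i\<^sup>* i\<^sub>! z\<close>.  A map \<open>u\<close> out of \<open>j\<^sup>* i\<^sup>* i\<^sub>! z\<close> is studied through its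
  composite with \<open>\<kappa>\<close>, which by the Beck--Chevalley condition loses no information at a universal
  point.
\<close>

definition \<kappa> :: "'u gpd1 \<Rightarrow> 'u gpd2 \<Rightarrow> 'o \<Rightarrow> 'm" where
  "\<kappa> b \<beta> z = tr \<beta> (fob L z) \<cdot>\<^bsub>F0 M (fdom b)\<^esub> ar b (ntc \<eta> z)"

lemma over_tr:
  assumes "over b j \<beta>" "y \<in> Obj (F0 M K)"
  shows "tr \<beta> y \<in> Arr (F0 M (fdom j))" "Dom (F0 M (fdom j)) (tr \<beta> y) = ob b (ob i y)"
    "Cod (F0 M (fdom j)) (tr \<beta> y) = ob j (ob i y)"
  using overD[OF assms(1)] assms(2) tr_typing[OF overD(6)[OF assms(1)] _ _ assms(2), of "fdom j"]
  by (auto simp: ob_comp)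

lemma over_tr_natural:
  assumes "over b j \<beta>" "h \<in> Arr (F0 M K)" "Dom (F0 M K) h = y" "Cod (F0 M K) h = y'"
  shows "tr \<beta> y' \<cdot>\<^bsub>F0 M (fdom j)\<^esub> ar b (ar i h) = ar j (ar i h) \<cdot>\<^bsub>F0 M (fdom j)\<^esub> tr \<beta> y"
  using overD[OF assms(1)] assms(2) tr_natural[OF overD(6)[OF assms(1)] _ _ assms(2-4), of "fdom j"]
  by (auto simp: ar_comp)

lemma over_ob [simp]:
  assumes "over b j \<beta>" "z \<in> Obj (F0 M H)"
  shows "ob b z \<in> Obj (F0 M (fdom j))" "ob j z \<in> Obj (F0 M (fdom j))"
  using overD[OF assms(1)] assms(2) by auto

lemma over_ar [simp]:
  assumes "over b j \<beta>" "h \<in> Arr (F0 M H)"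
  shows "ar b h \<in> Arr (F0 M (fdom j))" "Dom (F0 M (fdom j)) (ar b h) = ob b (Dom (F0 M H) h)"
    "Cod (F0 M (fdom j)) (ar b h) = ob b (Cod (F0 M H) h)"
    "ar j h \<in> Arr (F0 M (fdom j))" "Dom (F0 M (fdom j)) (ar j h) = ob j (Dom (F0 M H) h)"
    "Cod (F0 M (fdom j)) (ar j h) = ob j (Cod (F0 M H) h)"
  using overD[OF assms(1)] assms(2) by auto

lemma over_ar_Comp:
  assumes "over b j \<beta>" "h \<in> Arr (F0 M H)" "k \<in> Arr (F0 M H)" "Cod (F0 M H) h = Dom (F0 M H) k"
  shows "ar b (k \<cdot>\<^bsub>F0 M H\<^esub> h) = ar b k \<cdot>\<^bsub>F0 M (fdom j)\<^esub> ar b h"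
    "ar j (k \<cdot>\<^bsub>F0 M H\<^esub> h) = ar j k \<cdot>\<^bsub>F0 M (fdom j)\<^esub> ar j h"
  using overD[OF assms(1)] assms by (auto simp: ar_Comp)

lemma over_category: "over b j \<beta> \<Longrightarrow> category (F0 M (fdom j))"
  using overD by simp

lemma \<kappa>_typing:
  assumes "over b j \<beta>" "z \<in> Obj (F0 M H)"
  shows "\<kappa> b \<beta> z \<in> Arr (F0 M (fdom j))" "Dom (F0 M (fdom j)) (\<kappa> b \<beta> z) = ob b z"
    "Cod (F0 M (fdom j)) (\<kappa> b \<beta> z) = ob j (ob i (fob L z))"
  using over_category[OF assms(1)] overD(3)[OF assms(1)] over_tr[OF assms(1), of "fob L z"] assms
  by (simp_all add: \<kappa>_def category.Comp_Arr category.Dom_Comp category.Cod_Comp)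

lemma \<kappa>_natural:
  assumes o: "over b j \<beta>" and h: "h \<in> Arr (F0 M H)" "Dom (F0 M H) h = z" "Cod (F0 M H) h = z'"
  shows "\<kappa> b \<beta> z' \<cdot>\<^bsub>F0 M (fdom j)\<^esub> ar b h = ar j (ar i (far L h)) \<cdot>\<^bsub>F0 M (fdom j)\<^esub> \<kappa> b \<beta> z"
proof -
  interpret P: category "F0 M (fdom j)" by (rule over_category[OF o])
  have z: "z \<in> Obj (F0 M H)" "z' \<in> Obj (F0 M H)" using h by auto
  have nat: "ntc \<eta> z' \<cdot>\<^bsub>F0 M H\<^esub> h = ar i (far L h) \<cdot>\<^bsub>F0 M H\<^esub> ntc \<eta> z"
    using A.unit_natural[of h z z'] h L_ends by simp
  have "\<kappa> b \<beta> z' \<cdot>\<^bsub>F0 M (fdom j)\<^esub> ar b h = tr \<beta> (fob L z') \<cdot>\<^bsub>F0 M (fdom j)\<^esub> ar b (ntc \<eta> z' \<cdot>\<^bsub>F0 M H\<^esub> h)"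
    using o h z over_tr[OF o, of "fob L z'"] overD(3)[OF o]
    by (simp add: \<kappa>_def P.assoc over_ar_Comp[OF o])
  also have "\<dots> = (tr \<beta> (fob L z') \<cdot>\<^bsub>F0 M (fdom j)\<^esub> ar b (ar i (far L h))) \<cdot>\<^bsub>F0 M (fdom j)\<^esub> ar b (ntc \<eta> z)"
    unfolding nat using o h z over_tr[OF o, of "fob L z'"] by (simp add: P.assoc over_ar_Comp[OF o])
  also have "\<dots> = ar j (ar i (far L h)) \<cdot>\<^bsub>F0 M (fdom j)\<^esub> \<kappa> b \<beta> z"
    using o h z over_tr[OF o, of "fob L z"] overD(3)[OF o]
    by (simp add: over_tr_natural[OF o, of "far L h"] \<kappa>_def P.assoc)
  finally show ?thesis .
qed

text \<open>
  By a triangle identity the algebra structure \<open>i\<^sup>* \<epsilon>\<close> on \<open>i\<^sup>* y\<close> corresponds to the canonical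
  transition maps \<open>\<beta>\<^sup>*\<close> of \<open>i\<^sup>* y\<close>.
\<close>

lemma \<kappa>_counit:
  assumes o: "over b j \<beta>" and y: "y \<in> Obj (F0 M K)"
  shows "ar j (ar i (ntc \<epsilon> y)) \<cdot>\<^bsub>F0 M (fdom j)\<^esub> \<kappa> b \<beta> (ob i y) = tr \<beta> y"
proof -
  interpret P: category "F0 M (fdom j)" by (rule over_category[OF o])
  have iy [simp]: "ob i y \<in> Obj (F0 M H)" using y by simp
  have "ar j (ar i (ntc \<epsilon> y)) \<cdot>\<^bsub>F0 M (fdom j)\<^esub> \<kappa> b \<beta> (ob i y) =
     (ar j (ar i (ntc \<epsilon> y)) \<cdot>\<^bsub>F0 M (fdom j)\<^esub> tr \<beta> (fob L (ob i y))) \<cdot>\<^bsub>F0 M (fdom j)\<^esub> ar b (ntc \<eta> (ob i y))"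
    using o y over_tr[OF o, of "fob L (ob i y)"] overD(3)[OF o] by (simp add: \<kappa>_def P.assoc)
  also have "\<dots> = tr \<beta> y \<cdot>\<^bsub>F0 M (fdom j)\<^esub> ar b (ar i (ntc \<epsilon> y) \<cdot>\<^bsub>F0 M H\<^esub> ntc \<eta> (ob i y))"
    using o y over_tr[OF o, of y]
    by (simp add: over_tr_natural[OF o, of "ntc \<epsilon> y", symmetric] P.assoc over_ar_Comp[OF o])
  also have "\<dots> = tr \<beta> y \<cdot>\<^bsub>F0 M (fdom j)\<^esub> ar b (Ident (F0 M H) (ob i y))"
    using A.triangle_right'[of y] y L_ends by simp
  also have "\<dots> = tr \<beta> y"
    using over_tr[OF o y] overD[OF o] by simp
  finally show ?thesis .
qed

lemma \<kappa>_bij: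
  assumes g: "g \<in> One gpdf" "fcod g = K" and z: "z \<in> Obj (F0 M H)" and y: "y \<in> Obj (F0 M (fdom g))"
    and w: "w \<in> homs (F0 M (isocomma i g)) (ob (comma_fst i g) z) (ob (comma_snd i g) y)"
  shows "\<exists>!u. u \<in> homs (F0 M (fdom g)) (ob g (fob L z)) y \<and>
    ar (comma_snd i g) u \<cdot>\<^bsub>F0 M (isocomma i g)\<^esub> \<kappa> (comma_fst i g) (comma_cell i g) z = w"
proof -
  interpret ig: gpd_cospan i g by unfold_locales (use g in auto)
  show ?thesis
    unfolding \<kappa>_def ig.fst_sel(1)
    using beck_chevalley_transpose[OF ig.two_pullback_isocomma adj i g(1) g(2) ig.fst_One _ _ ig.snd_One _ _ _ z y w]
      ig.square.\<theta> by (simp add: cells2_iff)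
qed

lemma \<kappa>_eqI:
  assumes g: "g \<in> One gpdf" "fcod g = K" and z: "z \<in> Obj (F0 M H)" and y: "y \<in> Obj (F0 M (fdom g))"
    and u: "u \<in> homs (F0 M (fdom g)) (ob g (fob L z)) y" and v: "v \<in> homs (F0 M (fdom g)) (ob g (fob L z)) y"
    and eq: "ar (comma_snd i g) u \<cdot>\<^bsub>F0 M (isocomma i g)\<^esub> \<kappa> (comma_fst i g) (comma_cell i g) z =
      ar (comma_snd i g) v \<cdot>\<^bsub>F0 M (isocomma i g)\<^esub> \<kappa> (comma_fst i g) (comma_cell i g) z"
  shows "u = v"
proof -
  interpret ig: gpd_cospan i g by unfold_locales (use g in auto)
  interpret P: category "F0 M (isocomma i g)" by (simp add: ig.finite_groupoid_P)
  have 1: "comma_cell i g \<in> cells2 gpdf (functor_comp i (comma_fst i g)) (functor_comp g (comma_snd i g))"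
    using ig.square.\<theta> by (simp add: cells2_iff)
  have "\<kappa> (comma_fst i g) (comma_cell i g) z \<in> homs (F0 M (isocomma i g)) (ob (comma_fst i g) z)
      (ob (comma_snd i g) (ob g (fob L z)))"
    using z g tr_typing[OF 1, of K "isocomma i g" "fob L z"] ig.fst_One ig.snd_One
    by (simp add: homs_iff \<kappa>_def ob_comp)
  then have "ar (comma_snd i g) v \<cdot>\<^bsub>F0 M (isocomma i g)\<^esub> \<kappa> (comma_fst i g) (comma_cell i g) z
      \<in> homs (F0 M (isocomma i g)) (ob (comma_fst i g) z) (ob (comma_snd i g) y)"
    using v ig.snd_One by (auto simp: homs_iff)
  from \<kappa>_bij[OF g z y this] u v eq show ?thesis by blast
qed

abbreviation "em \<equiv> em_comparison L (F1 M i) \<eta> \<epsilon>"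

lemma em_fdom [simp]: "fdom em = F0 M K"
  by (simp add: em_comparison_def Let_def)

lemma em_fob: "y \<in> Obj (F0 M K) \<Longrightarrow> fob em y = (ob i y, ar i (ntc \<epsilon> y))"
  by (simp add: em_comparison_def Let_def)

lemma em_far: "h \<in> homs (F0 M K) y y' \<Longrightarrow>
    far em h = ((ob i y, ar i (ntc \<epsilon> y)), (ob i y', ar i (ntc \<epsilon> y')), ar i h)"
  by (auto simp add: em_comparison_def Let_def homs_iff)

lemma em_mult: "z \<in> Obj (F0 M H) \<Longrightarrow>
    ntc (whisker_left (F1 M i) (whisker_right \<epsilon> L)) z = ar i (ntc \<epsilon> (fob L z))"
  using A.counit_ntrans A.counit_dom A.left_functor L_ends pull_functor[OF i]
  by (simp add: whisker_left_def whisker_right_def del: hcomp_sel(3))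

lemma em_Obj: "(z, a) \<in> Obj (fcod em) \<longleftrightarrow> z \<in> Obj (F0 M H) \<and> a \<in> homs (F0 M H) (ob i (fob L z)) z \<and>
    a \<cdot>\<^bsub>F0 M H\<^esub> ntc \<eta> z = Ident (F0 M H) z \<and>
    a \<cdot>\<^bsub>F0 M H\<^esub> ar i (far L a) = a \<cdot>\<^bsub>F0 M H\<^esub> ar i (ntc \<epsilon> (fob L z))"
  by (auto simp: em_comparison_def em_cat_def Let_def em_mult L_ends homs_iff)

lemma em_homs: "(X', Y', h) \<in> homs (fcod em) (z, a) (z', a') \<longleftrightarrow> X' = (z, a) \<and> Y' = (z', a') \<and>
    (z, a) \<in> Obj (fcod em) \<and> (z', a') \<in> Obj (fcod em) \<and> h \<in> homs (F0 M H) z z' \<and>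
    h \<cdot>\<^bsub>F0 M H\<^esub> a = a' \<cdot>\<^bsub>F0 M H\<^esub> ar i (far L h)"
  by (auto simp: em_comparison_def em_cat_def Let_def L_ends homs_iff)

lemma em_iso:
  assumes "iso_arrow (fcod em) ((z, a), (z', a'), h)"
  shows "iso_arrow (F0 M H) h"
proof -
  have *: "Dom (fcod em) (U, V, k) = U" "Cod (fcod em) (U, V, k) = V"
    "Comp (fcod em) (V, W, l) (U, V, k) = (U, W, l \<cdot>\<^bsub>F0 M H\<^esub> k)"
    "Ident (fcod em) U = (U, U, Ident (F0 M H) (fst U))" for U V W k l
    by (auto simp: em_comparison_def em_cat_def Let_def L_ends)
  obtain k where k: "k \<in> homs (fcod em) (z', a') (z, a)"
    "Comp (fcod em) k ((z, a), (z', a'), h) = Ident (fcod em) (z, a)"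
    "Comp (fcod em) ((z, a), (z', a'), h) k = Ident (fcod em) (z', a')"
    and h: "((z, a), (z', a'), h) \<in> homs (fcod em) (z, a) (z', a')"
    using assms unfolding iso_arrow_def by (auto simp: * homs_iff)
  obtain U V l where kl: "k = (U, V, l)" by (cases k) auto
  show ?thesis
    using k h unfolding kl by (intro iso_arrowI[where g = l and x = z and y = z']) (auto simp: em_homs *)
qed

text \<open>
  The two sides of the algebra condition for \<open>h\<close> have the same composite with \<open>\<kappa>\<close> at the universal
  point.  So \<open>h\<close> is a map of algebras, and the comparison functor is fully faithful.
\<close>

lemma descent_morphism_adj:
  assumes y: "y \<in> Obj (F0 M K)" "y' \<in> Obj (F0 M K)" and h: "h \<in> homs (F0 M H) (ob i y) (ob i y')"
    and desc: "ar q\<^sub>2 h \<cdot>\<^bsub>F0 M X\<^esub> tr lam y = tr lam y' \<cdot>\<^bsub>F0 M X\<^esub> ar q\<^sub>1 h"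
  shows "\<exists>!h\<^sub>0. h\<^sub>0 \<in> homs (F0 M K) y y' \<and> ar i h\<^sub>0 = h"
proof -
  note E = equivalenceD[OF monadic[OF adj]]
  interpret E: is_functor em by (rule E(1))
  interpret X: category "F0 M X" by (simp add: ii.finite_groupoid_P)
  have h' [simp]: "h \<in> Arr (F0 M H)" "Dom (F0 M H) h = ob i y" "Cod (F0 M H) h = ob i y'"
    using h by (auto simp: homs_iff)
  have iy [simp]: "ob i y \<in> Obj (F0 M H)" "ob i y' \<in> Obj (F0 M H)" using y by auto
  have X [simp]: "fdom q\<^sub>2 = X" by simp
  note o = over_lam
  note oa = over_ar[OF o, unfolded X] and oc = over_ar_Comp[OF o, unfolded X] and k = \<kappa>_typing[OF o, unfolded X]
    and kc = \<kappa>_counit[OF o, unfolded X] and kn = \<kappa>_natural[OF o, unfolded X]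
  have alg: "h \<cdot>\<^bsub>F0 M H\<^esub> ar i (ntc \<epsilon> y) = ar i (ntc \<epsilon> y') \<cdot>\<^bsub>F0 M H\<^esub> ar i (far L h)"
  proof (rule \<kappa>_eqI[where g = i and z = "ob i y" and y = "ob i y'"])
    have "ar q\<^sub>2 (h \<cdot>\<^bsub>F0 M H\<^esub> ar i (ntc \<epsilon> y)) \<cdot>\<^bsub>F0 M X\<^esub> \<kappa> q\<^sub>1 lam (ob i y) = ar q\<^sub>2 h \<cdot>\<^bsub>F0 M X\<^esub> tr lam y"
      using y k by (simp add: oc oa X.assoc kc)
    also have "\<dots> = (ar q\<^sub>2 (ar i (ntc \<epsilon> y')) \<cdot>\<^bsub>F0 M X\<^esub> \<kappa> q\<^sub>1 lam (ob i y')) \<cdot>\<^bsub>F0 M X\<^esub> ar q\<^sub>1 h"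
      using y by (simp add: desc kc)
    also have "\<dots> = ar q\<^sub>2 (ar i (ntc \<epsilon> y') \<cdot>\<^bsub>F0 M H\<^esub> ar i (far L h)) \<cdot>\<^bsub>F0 M X\<^esub> \<kappa> q\<^sub>1 lam (ob i y)"
      using y k by (simp add: X.assoc oa oc kn[OF h'])
    finally show "ar q\<^sub>2 (h \<cdot>\<^bsub>F0 M H\<^esub> ar i (ntc \<epsilon> y)) \<cdot>\<^bsub>F0 M X\<^esub> \<kappa> q\<^sub>1 lam (ob i y) =
        ar q\<^sub>2 (ar i (ntc \<epsilon> y') \<cdot>\<^bsub>F0 M H\<^esub> ar i (far L h)) \<cdot>\<^bsub>F0 M X\<^esub> \<kappa> q\<^sub>1 lam (ob i y)" .
  qed (use y in \<open>auto simp: homs_iff\<close>)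
  have ob: "(ob i y, ar i (ntc \<epsilon> y)) \<in> Obj (fcod em)" "(ob i y', ar i (ntc \<epsilon> y')) \<in> Obj (fcod em)"
    using E.fob_Obj[of y] E.fob_Obj[of y'] y by (simp_all add: em_fob)
  let ?k = "((ob i y, ar i (ntc \<epsilon> y)), (ob i y', ar i (ntc \<epsilon> y')), h)"
  have "?k \<in> homs (fcod em) (fob em y) (fob em y')"
    using y ob h alg by (simp add: em_fob em_homs)
  then have "\<exists>!h\<^sub>0. h\<^sub>0 \<in> homs (F0 M K) y y' \<and> far em h\<^sub>0 = ?k"
    using E(2) y unfolding fully_faithful_def by simp
  then show ?thesis
    using em_far by (simp cong: conj_cong)
qed

text \<open>
  The transition map at the universal point is \<open>q\<^sub>2\<^sup>* a\<close> after \<open>\<kappa>\<close> for a unique \<open>a : i\<^sup>* i\<^sub>! x \<rightarrow> x\<close>.  Every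
  other point factors through the universal one, so the same formula computes all transition
  maps; evaluating it at suitable points shows that \<open>a\<close> is an algebra structure.
\<close>

lemma descent_effective_adj:
  assumes "descent_datum x \<psi>"
  shows "\<exists>y\<in>Obj (F0 M K). \<exists>h\<in>homs (F0 M H) (ob i y) x. iso_arrow (F0 M H) h \<and>
    (\<forall>b j \<beta>. over b j \<beta> \<longrightarrow> \<psi> b j \<beta> \<cdot>\<^bsub>F0 M (fdom j)\<^esub> ar b h = ar j h \<cdot>\<^bsub>F0 M (fdom j)\<^esub> tr \<beta> y)"
proof -
  note E = equivalenceD[OF monadic[OF adj]]
  interpret E: is_functor em by (rule E(1))
  interpret X: category "F0 M X" by (simp add: ii.finite_groupoid_P)
  have x [simp]: "x \<in> Obj (F0 M H)"
    and \<psi>_homs: "\<And>b j \<beta>. over b j \<beta> \<Longrightarrow> \<psi> b j \<beta> \<in> homs (F0 M (fdom j)) (ob b x) (ob j x)"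
    and \<psi>_id: "\<And>b. b \<in> One gpdf \<Longrightarrow> fcod b = H \<Longrightarrow>
      \<psi> b b (id_nt (functor_comp i b)) = Ident (F0 M (fdom b)) (ob b x)"
    and \<psi>_comp: "\<And>b c d \<beta> \<gamma>. over b c \<beta> \<Longrightarrow> over c d \<gamma> \<Longrightarrow>
      \<psi> b d (vcomp \<gamma> \<beta>) = \<psi> c d \<gamma> \<cdot>\<^bsub>F0 M (fdom d)\<^esub> \<psi> b c \<beta>"
    and \<psi>_pull: "\<And>b j \<beta> c. over b j \<beta> \<Longrightarrow> c \<in> One gpdf \<Longrightarrow> fcod c = fdom b \<Longrightarrow>
      \<psi> (functor_comp b c) (functor_comp j c) (hcomp \<beta> (id_nt c)) = ar c (\<psi> b j \<beta>)"
    using assms unfolding descent_datum_def by blast+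
  have Xs [simp]: "fdom q\<^sub>2 = X" "fdom q\<^sub>1 = X" "fcod q\<^sub>1 = H" "fcod q\<^sub>2 = H" by simp_all
  have "\<exists>!a. a \<in> homs (F0 M H) (ob i (fob L x)) x \<and>
      ar q\<^sub>2 a \<cdot>\<^bsub>F0 M X\<^esub> \<kappa> q\<^sub>1 lam x = \<psi> q\<^sub>1 q\<^sub>2 lam"
    using \<psi>_homs[OF over_lam] by (intro \<kappa>_bij) auto
  then obtain a where a: "a \<in> homs (F0 M H) (ob i (fob L x)) x"
    and a\<psi>: "ar q\<^sub>2 a \<cdot>\<^bsub>F0 M X\<^esub> \<kappa> q\<^sub>1 lam x = \<psi> q\<^sub>1 q\<^sub>2 lam" by blast
  have a' [simp]: "a \<in> Arr (F0 M H)" "Dom (F0 M H) a = ob i (fob L x)" "Cod (F0 M H) a = x"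
    using a by (auto simp: homs_iff)
  have univ: "ar j a \<cdot>\<^bsub>F0 M (fdom j)\<^esub> \<kappa> b \<beta> x = \<psi> b j \<beta>" if o: "over b j \<beta>" for b j \<beta>
  proof -
    obtain c where c: "c \<in> One gpdf" "fdom c = fdom j" "fcod c = X" "functor_comp q\<^sub>1 c = b"
      "functor_comp q\<^sub>2 c = j" "hcomp lam (id_nt c) = \<beta>"
      using over_factor[OF o] .
    note q = overD[OF over_lam]
    have "\<psi> b j \<beta> = ar c (\<psi> q\<^sub>1 q\<^sub>2 lam)"
      using \<psi>_pull[OF over_lam c(1)] c by simp
    also have "\<dots> = ar c (ar q\<^sub>2 a) \<cdot>\<^bsub>F0 M (fdom j)\<^esub> ar c (tr lam (fob L x)) \<cdot>\<^bsub>F0 M (fdom j)\<^esub> ar c (ar q\<^sub>1 (ntc \<eta> x))"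
      unfolding a\<psi>[symmetric] using c(1-3) q over_tr[OF over_lam, of "fob L x"]
      by (simp add: \<kappa>_def ar_Comp)
    also have "ar c (ar q\<^sub>2 a) = ar j a"
      using ar_comp[of c q\<^sub>2 H a] c q by simp
    also have "ar c (ar q\<^sub>1 (ntc \<eta> x)) = ar b (ntc \<eta> x)"
      using ar_comp[of c q\<^sub>1 H "ntc \<eta> x"] c q by simp
    also have "ar c (tr lam (fob L x)) = tr \<beta> (fob L x)"
      using tr_whisker_right[OF q(6) c(1), of K "fob L x"] c q by simp
    finally show ?thesis
      using overD[OF o] by (simp add: \<kappa>_def)
  qed
  \<comment> \<open>Evaluate at the diagonal point, where the transition map is an identity.\<close>
  have unit: "a \<cdot>\<^bsub>F0 M H\<^esub> ntc \<eta> x = Ident (F0 M H) x"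
  proof -
    let ?d = "id_functor H"
    have d: "?d \<in> One gpdf" "fcod ?d = H" "functor_comp i ?d = i" by (simp_all add: One_gpdf)
    then have o: "over ?d ?d (id_nt i)" using over_id[of ?d] by simp
    have id: "ar ?d h = h" if "h \<in> Arr (F0 M H)" for h using that by (simp add: M_id)
    have "\<psi> ?d ?d (id_nt i) = Ident (F0 M H) x"
      using \<psi>_id[OF d(1,2)] d by (simp add: M_id)
    then show ?thesis
      using univ[OF o] by (simp add: id \<kappa>_def tr_id)
  qed
  \<comment> \<open>Both sides are maps out of \<open>(i q\<^sub>1)\<^sup>* i\<^sub>! x\<close>, so they are compared over the iso-comma groupoid of \<open>i\<close> and \<open>i q\<^sub>1\<close>.\<close>
  have cocycle: "\<psi> q\<^sub>1 q\<^sub>2 lam \<cdot>\<^bsub>F0 M X\<^esub> ar q\<^sub>1 a = ar q\<^sub>2 a \<cdot>\<^bsub>F0 M X\<^esub> tr lam (fob L x)"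
  proof (rule \<kappa>_eqI[where g = "functor_comp i q\<^sub>1" and z = x and y = "ob q\<^sub>2 x"])
    let ?g = "functor_comp i q\<^sub>1"
    note q = overD[OF over_lam]
    interpret ig: gpd_cospan i ?g by unfold_locales (use q in auto)
    let ?Z = "isocomma i ?g" and ?r1 = "comma_fst i ?g" and ?r2 = "comma_snd i ?g" and ?rho = "comma_cell i ?g"
    interpret Z: category "F0 M ?Z" by (simp add: ig.finite_groupoid_P)
    have r: "?r1 \<in> One gpdf" "?r2 \<in> One gpdf" "fdom ?r1 = ?Z" "fdom ?r2 = ?Z" "fcod ?r1 = H" "fcod ?r2 = X"
      using ig.fst_One ig.snd_One by simp_all
    \<comment> \<open>The points \<open>o1\<close> and \<open>o2\<close> compose, and the cocycle condition for them is the claim.\<close>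
    have o1: "over ?r1 (functor_comp q\<^sub>1 ?r2) ?rho"
      using ig.square.\<theta> r q by (simp add: over_def cells2_iff assoc_One)
    have o2: "over (functor_comp q\<^sub>1 ?r2) (functor_comp q\<^sub>2 ?r2) (hcomp lam (id_nt ?r2))"
      using over_pull[OF over_lam r(2)] r by simp
    note o3 = over_vcomp[OF o1 o2]
    have t1: "ar ?r2 (\<psi> q\<^sub>1 q\<^sub>2 lam \<cdot>\<^bsub>F0 M X\<^esub> ar q\<^sub>1 a) \<cdot>\<^bsub>F0 M ?Z\<^esub> \<kappa> ?r1 ?rho x =
        ar ?r2 (\<psi> q\<^sub>1 q\<^sub>2 lam) \<cdot>\<^bsub>F0 M ?Z\<^esub> ar (functor_comp q\<^sub>1 ?r2) a \<cdot>\<^bsub>F0 M ?Z\<^esub> \<kappa> ?r1 ?rho x"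
      using r q \<psi>_homs[OF over_lam] \<kappa>_typing[OF o1 x]
      by (simp add: ar_Comp ar_comp homs_iff Z.assoc ob_comp)
    have t2: "ar ?r2 (ar q\<^sub>2 a \<cdot>\<^bsub>F0 M X\<^esub> tr lam (fob L x)) \<cdot>\<^bsub>F0 M ?Z\<^esub> \<kappa> ?r1 ?rho x =
        ar (functor_comp q\<^sub>2 ?r2) a \<cdot>\<^bsub>F0 M ?Z\<^esub> \<kappa> ?r1 (vcomp (hcomp lam (id_nt ?r2)) ?rho) x"
    proof -
      have "tr (hcomp lam (id_nt ?r2)) (fob L x) = ar ?r2 (tr lam (fob L x))"
        using tr_whisker_right[OF q(6) r(2), of K "fob L x"] r by simp
      moreover have "tr (vcomp (hcomp lam (id_nt ?r2)) ?rho) (fob L x) =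
          tr (hcomp lam (id_nt ?r2)) (fob L x) \<cdot>\<^bsub>F0 M ?Z\<^esub> tr ?rho (fob L x)"
        using tr_vcomp[OF overD(6)[OF o1] overD(6)[OF o2], of K ?Z "fob L x"] r q by simp
      ultimately show ?thesis
        using r q over_tr[OF over_lam, of "fob L x"] over_tr[OF o1, of "fob L x"] over_ar[OF o1, of "ntc \<eta> x"]
        by (simp add: \<kappa>_def ar_Comp ar_comp Z.assoc ob_comp)
    qed
    have "ar ?r2 (\<psi> q\<^sub>1 q\<^sub>2 lam \<cdot>\<^bsub>F0 M X\<^esub> ar q\<^sub>1 a) \<cdot>\<^bsub>F0 M ?Z\<^esub> \<kappa> ?r1 ?rho x =
        \<psi> (functor_comp q\<^sub>1 ?r2) (functor_comp q\<^sub>2 ?r2) (hcomp lam (id_nt ?r2)) \<cdot>\<^bsub>F0 M ?Z\<^esub>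
        \<psi> ?r1 (functor_comp q\<^sub>1 ?r2) ?rho"
      unfolding t1 using univ[OF o1] \<psi>_pull[OF over_lam r(2)] r by simp
    also have "\<dots> = \<psi> ?r1 (functor_comp q\<^sub>2 ?r2) (vcomp (hcomp lam (id_nt ?r2)) ?rho)"
      using \<psi>_comp[OF o1 o2] r by simp
    also have "\<dots> = ar ?r2 (ar q\<^sub>2 a \<cdot>\<^bsub>F0 M X\<^esub> tr lam (fob L x)) \<cdot>\<^bsub>F0 M ?Z\<^esub> \<kappa> ?r1 ?rho x"
      unfolding t2 using univ[OF o3] r by simp
    finally show "ar ?r2 (\<psi> q\<^sub>1 q\<^sub>2 lam \<cdot>\<^bsub>F0 M X\<^esub> ar q\<^sub>1 a) \<cdot>\<^bsub>F0 M ?Z\<^esub> \<kappa> ?r1 ?rho x =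
       ar ?r2 (ar q\<^sub>2 a \<cdot>\<^bsub>F0 M X\<^esub> tr lam (fob L x)) \<cdot>\<^bsub>F0 M ?Z\<^esub> \<kappa> ?r1 ?rho x" .
  qed (use overD[OF over_lam] \<psi>_homs[OF over_lam] over_tr[OF over_lam, of "fob L x"] in
     \<open>auto simp: homs_iff ob_comp\<close>)
  note oa = over_ar[OF over_lam, unfolded Xs] and oc = over_ar_Comp[OF over_lam, unfolded Xs]
    and k = \<kappa>_typing[OF over_lam, unfolded Xs] and kc = \<kappa>_counit[OF over_lam, unfolded Xs]
    and kn = \<kappa>_natural[OF over_lam, unfolded Xs]
  \<comment> \<open>By naturality of \<open>\<kappa>\<close> and \<open>\<kappa>_counit\<close>, associativity transposes to the two sides of \<open>cocycle\<close>.\<close>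
  have assoc: "a \<cdot>\<^bsub>F0 M H\<^esub> ar i (far L a) = a \<cdot>\<^bsub>F0 M H\<^esub> ar i (ntc \<epsilon> (fob L x))"
  proof (rule \<kappa>_eqI[where g = i and z = "ob i (fob L x)" and y = x])
    have "ar q\<^sub>2 (a \<cdot>\<^bsub>F0 M H\<^esub> ar i (far L a)) \<cdot>\<^bsub>F0 M X\<^esub> \<kappa> q\<^sub>1 lam (ob i (fob L x)) =
      (ar q\<^sub>2 a \<cdot>\<^bsub>F0 M X\<^esub> \<kappa> q\<^sub>1 lam x) \<cdot>\<^bsub>F0 M X\<^esub> ar q\<^sub>1 a"
      using k by (simp add: oc oa X.assoc kn[OF a'])
    also have "\<dots> = ar q\<^sub>2 (a \<cdot>\<^bsub>F0 M H\<^esub> ar i (ntc \<epsilon> (fob L x))) \<cdot>\<^bsub>F0 M X\<^esub> \<kappa> q\<^sub>1 lam (ob i (fob L x))"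
      unfolding a\<psi> cocycle using k by (simp add: oc oa X.assoc kc)
    finally show "ar q\<^sub>2 (a \<cdot>\<^bsub>F0 M H\<^esub> ar i (far L a)) \<cdot>\<^bsub>F0 M X\<^esub> \<kappa> q\<^sub>1 lam (ob i (fob L x)) =
      ar q\<^sub>2 (a \<cdot>\<^bsub>F0 M H\<^esub> ar i (ntc \<epsilon> (fob L x))) \<cdot>\<^bsub>F0 M X\<^esub> \<kappa> q\<^sub>1 lam (ob i (fob L x))" .
  qed (auto simp: homs_iff)
  have alg: "(x, a) \<in> Obj (fcod em)"
    using a unit assoc by (simp add: em_Obj)
  then obtain y e where y: "y \<in> Obj (F0 M K)" and e: "e \<in> homs (fcod em) (fob em y) (x, a)"
    and iso: "iso_arrow (fcod em) e"
    using E(3) unfolding essentially_surjective_def em_fdom by blast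
  obtain U V h where eh: "e = (U, V, h)" by (cases e) auto
  have UV: "U = (ob i y, ar i (ntc \<epsilon> y))" "V = (x, a)" and h: "h \<in> homs (F0 M H) (ob i y) x"
    and ha: "h \<cdot>\<^bsub>F0 M H\<^esub> ar i (ntc \<epsilon> y) = a \<cdot>\<^bsub>F0 M H\<^esub> ar i (far L h)"
    using e y unfolding eh em_fob[OF y] em_homs by auto
  have hiso: "iso_arrow (F0 M H) h"
    using iso unfolding eh UV by (rule em_iso)
  have h' [simp]: "h \<in> Arr (F0 M H)" "Dom (F0 M H) h = ob i y" "Cod (F0 M H) h = x"
    using h by (auto simp: homs_iff)
  have "\<psi> b j \<beta> \<cdot>\<^bsub>F0 M (fdom j)\<^esub> ar b h = ar j h \<cdot>\<^bsub>F0 M (fdom j)\<^esub> tr \<beta> y" if o: "over b j \<beta>" for b j \<beta>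
  proof -
    interpret P: category "F0 M (fdom j)" by (rule over_category[OF o])
    have iy [simp]: "ob i y \<in> Obj (F0 M H)" using y by simp
    have "\<psi> b j \<beta> \<cdot>\<^bsub>F0 M (fdom j)\<^esub> ar b h = (ar j a \<cdot>\<^bsub>F0 M (fdom j)\<^esub> \<kappa> b \<beta> x) \<cdot>\<^bsub>F0 M (fdom j)\<^esub> ar b h"
      by (simp add: univ[OF o])
    also have "\<dots> = ar j (a \<cdot>\<^bsub>F0 M H\<^esub> ar i (far L h)) \<cdot>\<^bsub>F0 M (fdom j)\<^esub> \<kappa> b \<beta> (ob i y)"
      using o \<kappa>_typing[OF o] by (simp add: P.assoc \<kappa>_natural[OF o h'] over_ar_Comp[OF o] over_ar[OF o])
    also have "\<dots> = ar j h \<cdot>\<^bsub>F0 M (fdom j)\<^esub> ar j (ar i (ntc \<epsilon> y)) \<cdot>\<^bsub>F0 M (fdom j)\<^esub> \<kappa> b \<beta> (ob i y)"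
      unfolding ha[symmetric] using o y \<kappa>_typing[OF o] by (simp add: P.assoc over_ar_Comp[OF o] over_ar[OF o])
    finally show ?thesis by (simp add: \<kappa>_counit[OF o y])
  qed
  with y h hiso show ?thesis by blast
qed

end

lemma descent_morphism:
  assumes "y \<in> Obj (F0 M K)" "y' \<in> Obj (F0 M K)" "h \<in> homs (F0 M H) (ob i y) (ob i y')"
    and "ar q\<^sub>2 h \<cdot>\<^bsub>F0 M X\<^esub> tr lam y = tr lam y' \<cdot>\<^bsub>F0 M X\<^esub> ar q\<^sub>1 h"
  shows "\<exists>!h\<^sub>0. h\<^sub>0 \<in> homs (F0 M K) y y' \<and> ar i h\<^sub>0 = h"
  using left_adjoint[OF i] descent_morphism_adj[OF _ assms] by blast

lemma descent_effective:
  assumes "descent_datum x \<psi>"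
  shows "\<exists>y\<in>Obj (F0 M K). \<exists>h\<in>homs (F0 M H) (ob i y) x. iso_arrow (F0 M H) h \<and>
    (\<forall>b j \<beta>. over b j \<beta> \<longrightarrow> \<psi> b j \<beta> \<cdot>\<^bsub>F0 M (fdom j)\<^esub> ar b h = ar j h \<cdot>\<^bsub>F0 M (fdom j)\<^esub> tr \<beta> y)"
  using left_adjoint[OF i] descent_effective_adj[OF _ assms] by blast

end

section \<open>Cones over the extended transporter category\<close>

locale transporter_restriction = monadic_restriction M "BG_incl G S"
  for M :: "('u::infinite, 'o, 'm) gpd_cat_twofun" and G S
begin

abbreviation "i \<equiv> BG_incl G S"
abbreviation "I \<equiv> op2 (transporter G S)"
abbreviation "MU \<equiv> twofun_comp M transporter_forget"

lemma BG_incl_ends: "BG (G\<lparr>carrier := S\<rparr>) = fdom i" "BG G = fcod i"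
  by (simp_all add: BG_incl_def incl_functor_def)

lemma trans_Ob_iff: "A \<in> trans_Ob G S \<longleftrightarrow> snd A \<in> One gpdf \<and> fdom (snd A) = fst A \<and> fcod (snd A) = H"
  by (cases A) (auto simp: trans_Ob_def cells1_iff BG_incl_ends One_gpdf_ends)

lemma trans_One_iff: "s \<in> trans_One G S \<longleftrightarrow> t1_src s \<in> trans_Ob G S \<and> t1_tgt s \<in> trans_Ob G S \<and>
    t1_fun s \<in> One gpdf \<and> fdom (t1_fun s) = fst (t1_src s) \<and> fcod (t1_fun s) = fst (t1_tgt s) \<and>
    over (functor_comp (snd (t1_tgt s)) (t1_fun s)) (snd (t1_src s)) (t1_nat s)"
  by (auto simp: trans_One_def cells1_iff over_def trans_Ob_iff)

lemma trans_ObD: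
  assumes "A \<in> trans_Ob G S"
  shows "snd A \<in> One gpdf" "fdom (snd A) = fst A" "fcod (snd A) = H" "finite_groupoid (fst A)"
    "functor_comp i (snd A) \<in> One gpdf"
  using assms One_gpdf_ends(1)[of "snd A"] by (auto simp: trans_Ob_iff)

lemma trans_OneD:
  assumes "s \<in> trans_One G S"
  shows "t1_src s \<in> trans_Ob G S" "t1_tgt s \<in> trans_Ob G S" "t1_fun s \<in> One gpdf"
    "fdom (t1_fun s) = fst (t1_src s)" "fcod (t1_fun s) = fst (t1_tgt s)"
    "over (functor_comp (snd (t1_tgt s)) (t1_fun s)) (snd (t1_src s)) (t1_nat s)"
    "t1_nat s \<in> Two gpdf" "ntdom (t1_nat s) = functor_comp i (functor_comp (snd (t1_tgt s)) (t1_fun s))"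
    "ntcod (t1_nat s) = functor_comp i (snd (t1_src s))"
  using assms by (auto simp: trans_One_iff over_def cells2_iff)

lemma trans_Comp1_sel [simp]: "t1_src (trans_Comp1 t s) = t1_src s" "t1_tgt (trans_Comp1 t s) = t1_tgt t"
  "t1_fun (trans_Comp1 t s) = functor_comp (t1_fun t) (t1_fun s)"
  "t1_nat (trans_Comp1 t s) = vcomp (t1_nat s) (hcomp (t1_nat t) (id_nt (t1_fun s)))"
  by (simp_all add: trans_Comp1_def whisker_right_def)

lemma trans_Comp1_One:
  assumes s: "s \<in> trans_One G S" and t: "t \<in> trans_One G S" and eq: "t1_tgt s = t1_src t"
  shows "trans_Comp1 t s \<in> trans_One G S"
proof -
  note sD = trans_OneD[OF s] and tD = trans_OneD[OF t]
  note sO = trans_ObD[OF sD(1)] and tO = trans_ObD[OF tD(1)] and tT = trans_ObD[OF tD(2)]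
  have "over (functor_comp (functor_comp (snd (t1_tgt t)) (t1_fun t)) (t1_fun s))
      (functor_comp (snd (t1_src t)) (t1_fun s)) (hcomp (t1_nat t) (id_nt (t1_fun s)))"
    using sD tD tT eq by (intro over_pull) auto
  from over_vcomp[OF this] sD(6)
  have "over (functor_comp (functor_comp (snd (t1_tgt t)) (t1_fun t)) (t1_fun s)) (snd (t1_src s))
      (t1_nat (trans_Comp1 t s))"
    by (simp add: eq)
  then show ?thesis
    using sD tD tT eq by (simp add: trans_One_iff assoc_One)
qed

lemma transporter_sel [simp]: "Ob (transporter G S) = trans_Ob G S" "One (transporter G S) = trans_One G S"
  "Two (transporter G S) = trans_Two G S" "Src (transporter G S) = t1_src" "Tgt (transporter G S) = t1_tgt"
  "Dom2 (transporter G S) = t2_dom" "Cod2 (transporter G S) = t2_cod"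
  "Comp1 (transporter G S) t s = trans_Comp1 t s"
  "Id1 (transporter G S) A =
    \<lparr>t1_src = A, t1_tgt = A, t1_fun = id_functor (fst A), t1_nat = id_nt (functor_comp i (snd A))\<rparr>"
  by (simp_all add: transporter_def)

lemma MU_sel [simp]: "F0 MU A = F0 M (fst A)" "F1 MU s = F1 M (t1_fun s)" "F2 MU z = F2 M (t2_nat z)"
  by (simp_all add: twofun_comp_def transporter_forget_def)

lemma trans_Two_iff: "z \<in> trans_Two G S \<longleftrightarrow> t2_dom z \<in> trans_One G S \<and> t2_cod z \<in> trans_One G S \<and>
    t1_src (t2_cod z) = t1_src (t2_dom z) \<and> t1_tgt (t2_cod z) = t1_tgt (t2_dom z) \<and>
    t2_nat z \<in> cells2 gpdf (t1_fun (t2_dom z)) (t1_fun (t2_cod z)) \<and>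
    vcomp (t1_nat (t2_cod z)) (hcomp (id_nt (functor_comp i (snd (t1_tgt (t2_dom z))))) (t2_nat z)) =
      t1_nat (t2_dom z)"
  by (simp add: trans_Two_def whisker_left_def)

lemma Id1_trans_One:
  assumes "A \<in> trans_Ob G S"
  shows "\<lparr>t1_src = A, t1_tgt = A, t1_fun = id_functor (fst A), t1_nat = id_nt (functor_comp i (snd A))\<rparr>
    \<in> trans_One G S"
  using trans_ObD[OF assms] assms over_id[of "snd A"] by (simp add: trans_One_iff One_gpdf)

text \<open>
  Passing to the opposite 2-category exchanges source and target, so the structure cell of a cone at
  \<open>s\<close> goes from the restriction of its value at \<open>t1_tgt s\<close> to its value at \<open>t1_src s\<close>.
\<close>

sublocale cones: diagram Cat2 I MU
proof (intro diagram.intro diagram_axioms.intro two_category_Cat2, goal_cases)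
  case (3 A)
  then show ?case using Id1_trans_One by simp
qed (auto simp: trans_OneD trans_Comp1_One trans_Two_iff trans_ObD pull_functor M_cell cells2_iff)

lemma iso2_M:
  assumes \<alpha>: "\<alpha> \<in> Two gpdf"
  shows "iso2 Cat2 (F2 M \<alpha>)"
proof -
  interpret Cat2: two_category Cat2 by (rule two_category_Cat2)
  note inv = gpdf.inverse2_typing[OF gpdf_iso2(1)[OF \<alpha>], simplified]
  have "inverse2 Cat2 (F2 M \<alpha>) (F2 M (inv_nt \<alpha>))"
    unfolding inverse2_def cells2_iff
    using inv M_cell[OF \<alpha>] M_cell[OF inv(2)] Two_gpdf[OF \<alpha>]
    by (simp add: M_vcomp[symmetric] M_id_nt)
  then show ?thesis by (auto simp: Cat2.iso2_iff)
qed

definition \<pi> where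
  "\<pi> = \<lparr>ps1 = (\<lambda>A\<in>trans_Ob G S. F1 M (functor_comp i (snd A))),
    ps2 = (\<lambda>s\<in>trans_One G S. F2 M (t1_nat s))\<rparr>"

lemma pi_sel [simp]: "A \<in> trans_Ob G S \<Longrightarrow> ps1 \<pi> A = F1 M (functor_comp i (snd A))"
  "s \<in> trans_One G S \<Longrightarrow> ps2 \<pi> s = F2 M (t1_nat s)"
  by (simp_all add: \<pi>_def)

lemma pseudocone_\<pi>: "pseudocone I Cat2 MU (F0 M K) \<pi>"
  unfolding pseudocone_def
proof (intro conjI ballI impI)
  fix A assume "A \<in> Ob I"
  then have A: "A \<in> trans_Ob G S" by simp
  note AD = trans_ObD[OF A]
  show "ps1 \<pi> A \<in> One Cat2" "Src Cat2 (ps1 \<pi> A) = F0 M K" "Tgt Cat2 (ps1 \<pi> A) = F0 MU A"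
    using A AD by (simp_all add: pull_functor)
  show "ps2 \<pi> (Id1 I A) = Id2 Cat2 (ps1 \<pi> A)"
    using A AD Id1_trans_One[OF A] by (simp add: M_id_nt)
next
  fix s assume "s \<in> One I"
  then have s: "s \<in> trans_One G S" by simp
  note sD = trans_OneD[OF s] and T = trans_ObD[OF trans_OneD(2)[OF s]]
  show "ps2 \<pi> s \<in> Two Cat2" "iso2 Cat2 (ps2 \<pi> s)" "Cod2 Cat2 (ps2 \<pi> s) = ps1 \<pi> (Tgt I s)"
    using s sD M_cell iso2_M by simp_all
  have "functor_comp i (functor_comp (snd (t1_tgt s)) (t1_fun s)) = functor_comp (functor_comp i (snd (t1_tgt s))) (t1_fun s)"
    using sD T by (simp add: assoc_One)
  then show "Dom2 Cat2 (ps2 \<pi> s) = Comp1 Cat2 (F1 MU s) (ps1 \<pi> (Src I s))"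
    using s sD M_cell T by (simp add: M_comp)
next
  fix z assume "z \<in> Two I"
  then have z: "z \<in> trans_Two G S" by simp
  let ?s = "t2_dom z" and ?t = "t2_cod z" and ?k = "functor_comp i (snd (t1_tgt (t2_dom z)))"
  have zD: "?s \<in> trans_One G S" "?t \<in> trans_One G S" "t1_tgt ?t = t1_tgt ?s" "t2_nat z \<in> Two gpdf"
     "ntdom (t2_nat z) = t1_fun ?s" "ntcod (t2_nat z) = t1_fun ?t"
     and eq: "t1_nat ?s = vcomp (t1_nat ?t) (hcomp (id_nt ?k) (t2_nat z))"
    using z by (auto simp: trans_Two_iff cells2_iff)
  note T = trans_ObD[OF trans_OneD(2)[OF zD(1)]] and sD = trans_OneD[OF zD(1)] and tD = trans_OneD[OF zD(2)]
  have k: "id_nt ?k \<in> Two gpdf" "fdom ?k = fst (t1_tgt ?s)" using gpdf.Id2_typing(1)[of ?k] T by simp_all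
  have "hcomp (id_nt ?k) (t2_nat z) \<in> Two gpdf"
    using gpdf.HComp_typing(1)[of "t2_nat z" "id_nt ?k"] zD k T sD by simp
  moreover have "ntcod (hcomp (id_nt ?k) (t2_nat z)) = ntdom (t1_nat ?t)"
    using zD tD T assoc_One[of "t1_fun ?t" "snd (t1_tgt ?s)" i] by simp
  ultimately have "F2 M (t1_nat ?s) = vcomp (F2 M (t1_nat ?t)) (hcomp (F2 M (t2_nat z)) (id_nt (F1 M ?k)))"
    unfolding eq using zD tD T k sD by (simp add: M_vcomp M_hcomp M_id_nt)
  then show "VComp Cat2 (ps2 \<pi> (Cod2 I z)) (HComp Cat2 (F2 MU z) (Id2 Cat2 (ps1 \<pi> (Src I (Dom2 I z))))) =
      ps2 \<pi> (Dom2 I z)"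
    using zD T sD by simp
next
  fix s t assume "s \<in> One I" "t \<in> One I" "Tgt I s = Src I t"
  then have s: "s \<in> trans_One G S" and t: "t \<in> trans_One G S" and eq: "t1_src s = t1_tgt t" by simp_all
  note sD = trans_OneD[OF s] and tD = trans_OneD[OF t] and T = trans_ObD[OF trans_OneD(1)[OF s]]
  have k: "id_nt (t1_fun t) \<in> Two gpdf" using gpdf.Id2_typing(1)[of "t1_fun t"] tD by simp
  have "hcomp (t1_nat s) (id_nt (t1_fun t)) \<in> Two gpdf"
    using gpdf.HComp_typing(1)[of "id_nt (t1_fun t)" "t1_nat s"] sD tD k eq overD[OF sD(6)] trans_ObD[OF sD(1)]
    by simp
  moreover have "ntcod (hcomp (t1_nat s) (id_nt (t1_fun t))) = ntdom (t1_nat t)"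
    using sD tD T eq assoc_One[of "t1_fun t" "snd (t1_src s)" i] by simp
  ultimately have "F2 M (t1_nat (trans_Comp1 s t)) =
      vcomp (F2 M (t1_nat t)) (hcomp (id_nt (F1 M (t1_fun t))) (F2 M (t1_nat s)))"
    using sD tD T k eq overD[OF sD(6)] trans_ObD[OF sD(1)] by (simp add: M_vcomp M_hcomp M_id_nt)
  then show "ps2 \<pi> (Comp1 I t s) = VComp Cat2 (ps2 \<pi> t) (HComp Cat2 (Id2 Cat2 (F1 MU t)) (ps2 \<pi> s))"
    using s t trans_Comp1_One[OF t s] eq by simp
qed (simp_all add: \<pi>_def)

sublocale cones: pseudocone_over Cat2 I MU "F0 M K" \<pi>
  by unfold_locales (simp_all add: pseudocone_\<pi>)

section \<open>Descent data from cones\<close>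

text \<open>
  The object \<open>(S, id)\<close>.  Every object \<open>(P, j)\<close> has a distinguished 1-morphism to it, its leg \<open>(j, id)\<close>.
\<close>

definition base :: "'u trans0" where "base = (H, id_functor H)"

lemma base_sel [simp]: "fst base = H" "snd base = id_functor H"
  by (simp_all add: base_def)

lemma base_Ob [simp]: "base \<in> trans_Ob G S"
  by (simp add: trans_Ob_iff)

text \<open>
  The 1-morphism \<open>(b, \<beta>) : (P, j) \<rightarrow> (S, id)\<close>.
\<close>

definition point :: "'u gpd1 \<Rightarrow> 'u gpd1 \<Rightarrow> 'u gpd2 \<Rightarrow> 'u trans1" where
  "point b j \<beta> = \<lparr>t1_src = (fdom j, j), t1_tgt = base, t1_fun = b, t1_nat = \<beta>\<rparr>"

lemma point_sel [simp]: "t1_src (point b j \<beta>) = (fdom j, j)" "t1_tgt (point b j \<beta>) = base"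
  "t1_fun (point b j \<beta>) = b" "t1_nat (point b j \<beta>) = \<beta>"
  by (simp_all add: point_def)

lemma point_One: "over b j \<beta> \<Longrightarrow> point b j \<beta> \<in> trans_One G S"
  by (auto simp: trans_One_iff trans_Ob_iff overD One_gpdf)

abbreviation "leg j \<equiv> point j j (id_nt (functor_comp i j))"

lemma leg_One: "j \<in> One gpdf \<Longrightarrow> fcod j = H \<Longrightarrow> leg j \<in> trans_One G S"
  by (intro point_One over_id)

lemma point_Comp:
  assumes s: "s \<in> trans_One G S"
  shows "trans_Comp1 (point b (snd (t1_tgt s)) \<beta>) s =
    point (functor_comp b (t1_fun s)) (snd (t1_src s)) (vcomp (t1_nat s) (hcomp \<beta> (id_nt (t1_fun s))))"
  using trans_OneD(1)[OF s] by (simp add: trans_Comp1_def point_def whisker_right_def trans_Ob_iff prod_eq_iff)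

text \<open>
  The cell of a cone at an arbitrary 1-morphism \<open>(a, \<alpha>) : (P, j) \<rightarrow> (Q, k)\<close> is thus determined by its
  cells at two 1-morphisms into \<open>(S, id)\<close>, namely \<open>(k a, \<alpha>)\<close> and the leg of \<open>(Q, k)\<close>.
\<close>

lemma leg_Comp:
  assumes s: "s \<in> trans_One G S"
  shows "trans_Comp1 (leg (snd (t1_tgt s))) s =
    point (functor_comp (snd (t1_tgt s)) (t1_fun s)) (snd (t1_src s)) (t1_nat s)"
proof -
  note sD = trans_OneD[OF s] and T = trans_ObD[OF trans_OneD(2)[OF s]]
  have "hcomp (id_nt (functor_comp i (snd (t1_tgt s)))) (id_nt (t1_fun s)) =
      id_nt (functor_comp i (functor_comp (snd (t1_tgt s)) (t1_fun s)))"
    using gpdf.HComp_Id2'[of "t1_fun s" "functor_comp i (snd (t1_tgt s))"] sD T by (simp add: assoc_One)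
  then show ?thesis
    using gpdf.VComp_Id2(1)[of "t1_nat s"] sD T by (simp add: point_Comp[OF s])
qed

text \<open>
  What a pseudocone with vertex \<open>T\<close> gives at an object of \<open>T\<close>.
\<close>

definition pointwise_cone :: "('u trans0 \<Rightarrow> 'o) \<Rightarrow> ('u trans1 \<Rightarrow> 'm) \<Rightarrow> bool" where
  "pointwise_cone x \<phi> \<longleftrightarrow>
    (\<forall>A\<in>trans_Ob G S. x A \<in> Obj (F0 M (fst A))) \<and>
    (\<forall>s\<in>trans_One G S. \<phi> s \<in> homs (F0 M (fst (t1_src s))) (ob (t1_fun s) (x (t1_tgt s))) (x (t1_src s)) \<and>
      iso_arrow (F0 M (fst (t1_src s))) (\<phi> s)) \<and>
    (\<forall>s\<in>trans_One G S. \<forall>t\<in>trans_One G S. t1_tgt s = t1_src t \<longrightarrow>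
      \<phi> (trans_Comp1 t s) = \<phi> s \<cdot>\<^bsub>F0 M (fst (t1_src s))\<^esub> ar (t1_fun s) (\<phi> t))"

definition transition :: "('u trans1 \<Rightarrow> 'm) \<Rightarrow> 'u gpd1 \<Rightarrow> 'u gpd1 \<Rightarrow> 'u gpd2 \<Rightarrow> 'm" where
  "transition \<phi> b j \<beta> = inv_arr (F0 M (fdom j)) (\<phi> (leg j)) \<cdot>\<^bsub>F0 M (fdom j)\<^esub> \<phi> (point b j \<beta>)"

context
  fixes x \<phi> assumes cone: "pointwise_cone x \<phi>"
begin

lemma x_Obj: "A \<in> trans_Ob G S \<Longrightarrow> x A \<in> Obj (F0 M (fst A))"
  using cone by (simp add: pointwise_cone_def)

lemma \<phi>_typing:
  assumes "s \<in> trans_One G S"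
  shows "\<phi> s \<in> Arr (F0 M (fst (t1_src s)))" "Dom (F0 M (fst (t1_src s))) (\<phi> s) = ob (t1_fun s) (x (t1_tgt s))"
    "Cod (F0 M (fst (t1_src s))) (\<phi> s) = x (t1_src s)" "iso_arrow (F0 M (fst (t1_src s))) (\<phi> s)"
  using cone assms unfolding pointwise_cone_def by (auto simp: homs_iff)

lemma \<phi>_point:
  assumes "over b j \<beta>"
  shows "\<phi> (point b j \<beta>) \<in> Arr (F0 M (fdom j))" "Dom (F0 M (fdom j)) (\<phi> (point b j \<beta>)) = ob b (x base)"
    "Cod (F0 M (fdom j)) (\<phi> (point b j \<beta>)) = x (fdom j, j)" "iso_arrow (F0 M (fdom j)) (\<phi> (point b j \<beta>))"
  using \<phi>_typing[OF point_One[OF assms]] by simp_all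

lemmas \<phi>_leg = \<phi>_point[OF over_id]

lemma \<phi>_Comp:
  assumes "s \<in> trans_One G S" "t \<in> trans_One G S" "t1_tgt s = t1_src t"
  shows "\<phi> (trans_Comp1 t s) = \<phi> s \<cdot>\<^bsub>F0 M (fst (t1_src s))\<^esub> ar (t1_fun s) (\<phi> t)"
  using cone assms unfolding pointwise_cone_def by blast

lemma \<phi>_point_Comp:
  assumes s: "s \<in> trans_One G S" and o: "over b (snd (t1_tgt s)) \<beta>"
  shows "\<phi> (point (functor_comp b (t1_fun s)) (snd (t1_src s)) (vcomp (t1_nat s) (hcomp \<beta> (id_nt (t1_fun s))))) =
    \<phi> s \<cdot>\<^bsub>F0 M (fst (t1_src s))\<^esub> ar (t1_fun s) (\<phi> (point b (snd (t1_tgt s)) \<beta>))"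
  using \<phi>_Comp[OF s point_One[OF o]] trans_OneD(2)[OF s] by (simp add: point_Comp[OF s] trans_Ob_iff prod_eq_iff)

lemma \<phi>_leg_Comp:
  assumes s: "s \<in> trans_One G S"
  shows "\<phi> (point (functor_comp (snd (t1_tgt s)) (t1_fun s)) (snd (t1_src s)) (t1_nat s)) =
    \<phi> s \<cdot>\<^bsub>F0 M (fst (t1_src s))\<^esub> ar (t1_fun s) (\<phi> (leg (snd (t1_tgt s))))"
  using \<phi>_Comp[OF s leg_One[of "snd (t1_tgt s)"]] trans_OneD(2)[OF s]
  by (simp add: leg_Comp[OF s] trans_Ob_iff prod_eq_iff)

lemma transition_typing:
  assumes o: "over b j \<beta>"
  shows "transition \<phi> b j \<beta> \<in> Arr (F0 M (fdom j))" "Dom (F0 M (fdom j)) (transition \<phi> b j \<beta>) = ob b (x base)"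
    "Cod (F0 M (fdom j)) (transition \<phi> b j \<beta>) = ob j (x base)"
    "\<phi> (leg j) \<cdot>\<^bsub>F0 M (fdom j)\<^esub> transition \<phi> b j \<beta> = \<phi> (point b j \<beta>)"
proof -
  note oD = overD[OF o]
  interpret P: category "F0 M (fdom j)" using oD by simp
  note l = \<phi>_leg[OF oD(2,5)] and p = \<phi>_point[OF o]
  note li = inv_arr[OF l(4)]
  show "transition \<phi> b j \<beta> \<in> Arr (F0 M (fdom j))" "Dom (F0 M (fdom j)) (transition \<phi> b j \<beta>) = ob b (x base)"
    "Cod (F0 M (fdom j)) (transition \<phi> b j \<beta>) = ob j (x base)"
    "\<phi> (leg j) \<cdot>\<^bsub>F0 M (fdom j)\<^esub> transition \<phi> b j \<beta> = \<phi> (point b j \<beta>)"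
    using l p li P.inv_arr_Comp(2)[OF l(4), of "\<phi> (point b j \<beta>)"] by (simp_all add: transition_def)
qed

lemma transition_eqI:
  assumes o: "over b j \<beta>" and "h \<in> Arr (F0 M (fdom j))" "Cod (F0 M (fdom j)) h = ob j (x base)"
    "\<phi> (leg j) \<cdot>\<^bsub>F0 M (fdom j)\<^esub> h = \<phi> (point b j \<beta>)"
  shows "transition \<phi> b j \<beta> = h"
proof -
  note oD = overD[OF o]
  interpret P: category "F0 M (fdom j)" using oD by simp
  note l = \<phi>_leg[OF oD(2,5)]
  show ?thesis
    by (rule P.iso_mono[OF l(4)]) (use assms l transition_typing[OF o] in simp_all)
qed

text \<open>Each of the axioms of a descent datum comes from composing with a suitable 1-morphism of the
  transporter category: \<open>(id, \<gamma>)\<close> for the cocycle condition and \<open>(c, id)\<close> for pulling back along \<open>c\<close>.\<close>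

lemma transition_descent: "descent_datum (x base) (transition \<phi>)"
  unfolding descent_datum_def
proof (intro conjI allI impI)
  show "x base \<in> Obj (F0 M H)" using x_Obj[OF base_Ob] by simp
next
  fix b j \<beta> assume "over b j \<beta>"
  then show "transition \<phi> b j \<beta> \<in> homs (F0 M (fdom j)) (ob b (x base)) (ob j (x base))"
    using transition_typing by (simp add: homs_iff)
next
  fix b assume b: "b \<in> One gpdf" "fcod b = H"
  have "x base \<in> Obj (F0 M H)" using x_Obj[OF base_Ob] by simp
  with b show "transition \<phi> b b (id_nt (functor_comp i b)) = Ident (F0 M (fdom b)) (ob b (x base))"
    using \<phi>_leg[OF b] inv_arr[OF \<phi>_leg(4)[OF b]] by (simp add: transition_def)
next
  fix b c d \<beta> \<gamma> assume o: "over b c \<beta>" "over c d \<gamma>"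
  note bD = overD[OF o(1)] and dD = overD[OF o(2)]
  interpret P: category "F0 M (fdom d)" using dD by simp
  let ?s = "\<lparr>t1_src = (fdom d, d), t1_tgt = (fdom c, c), t1_fun = id_functor (fdom d), t1_nat = \<gamma>\<rparr>"
  have s: "?s \<in> trans_One G S"
    using o bD dD by (simp add: trans_One_iff trans_Ob_iff One_gpdf)
  have id: "functor_comp b (id_functor (fdom d)) = b" "functor_comp c (id_functor (fdom d)) = c"
    "hcomp \<beta> (id_nt (id_functor (fdom d))) = \<beta>"
    using bD dD gpdf.HComp_Id1(1)[of \<beta> "fdom d"] by (auto simp: One_gpdf cells2_iff)
  have ar_id: "ar (id_functor (fdom d)) h = h" if "h \<in> Arr (F0 M (fdom d))" for h
    using that dD by (simp add: M_id)
  have 1: "\<phi> (point b d (vcomp \<gamma> \<beta>)) = \<phi> ?s \<cdot>\<^bsub>F0 M (fdom d)\<^esub> \<phi> (point b c \<beta>)"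
    using \<phi>_point_Comp[OF s, of b \<beta>] o id \<phi>_point[OF o(1)] dD by (simp add: ar_id)
  have 2: "\<phi> (point c d \<gamma>) = \<phi> ?s \<cdot>\<^bsub>F0 M (fdom d)\<^esub> \<phi> (leg c)"
    using \<phi>_leg_Comp[OF s] id \<phi>_leg[OF bD(2,5)] dD by (simp add: ar_id)
  have xc: "x (fdom d, c) \<in> Obj (F0 M (fdom d))"
    using x_Obj[of "(fdom d, c)"] bD dD by (simp add: trans_Ob_iff)
  have "\<phi> (leg d) \<cdot>\<^bsub>F0 M (fdom d)\<^esub> transition \<phi> c d \<gamma> \<cdot>\<^bsub>F0 M (fdom d)\<^esub> transition \<phi> b c \<beta> =
     (\<phi> (leg d) \<cdot>\<^bsub>F0 M (fdom d)\<^esub> transition \<phi> c d \<gamma>) \<cdot>\<^bsub>F0 M (fdom d)\<^esub> transition \<phi> b c \<beta>"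
    using transition_typing(1-3)[OF o(1)] transition_typing(1-3)[OF o(2)] \<phi>_leg[OF dD(2,5)] dD
    by (simp add: P.assoc)
  also have "\<dots> = \<phi> ?s \<cdot>\<^bsub>F0 M (fdom d)\<^esub> \<phi> (leg c) \<cdot>\<^bsub>F0 M (fdom d)\<^esub> transition \<phi> b c \<beta>"
    using transition_typing(4)[OF o(2)] transition_typing(1-3)[OF o(1)] \<phi>_leg[OF bD(2,5)] \<phi>_typing[OF s] dD
    by (simp add: 2 P.assoc M_id xc)
  also have "\<dots> = \<phi> (point b d (vcomp \<gamma> \<beta>))"
    using transition_typing(4)[OF o(1)] dD by (simp add: 1)
  finally show "transition \<phi> b d (vcomp \<gamma> \<beta>) = transition \<phi> c d \<gamma> \<cdot>\<^bsub>F0 M (fdom d)\<^esub> transition \<phi> b c \<beta>"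
    using transition_typing[OF o(1)] transition_typing[OF o(2)] dD
    by (intro transition_eqI[OF over_vcomp[OF o]]) simp_all
next
  fix b j \<beta> c assume o: "over b j \<beta>" and c: "c \<in> One gpdf" "fcod c = fdom b"
  note oD = overD[OF o]
  interpret P: category "F0 M (fdom c)" using c by simp
  note o' = over_pull[OF o c]
  let ?s = "\<lparr>t1_src = (fdom c, functor_comp j c), t1_tgt = (fdom j, j), t1_fun = c,
    t1_nat = id_nt (functor_comp i (functor_comp j c))\<rparr>"
  have s: "?s \<in> trans_One G S"
    using over_id[of "functor_comp j c"] oD c by (simp add: trans_One_iff trans_Ob_iff)
  note b' = overD[OF o']
  have id: "vcomp (id_nt (functor_comp i (functor_comp j c))) (hcomp \<beta> (id_nt c)) = hcomp \<beta> (id_nt c)"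
    using b'(6) gpdf.VComp_Id2(2)[of "hcomp \<beta> (id_nt c)"] by (simp add: cells2_iff)
  have 1: "\<phi> (point (functor_comp b c) (functor_comp j c) (hcomp \<beta> (id_nt c))) =
      \<phi> ?s \<cdot>\<^bsub>F0 M (fdom c)\<^esub> ar c (\<phi> (point b j \<beta>))"
    using \<phi>_point_Comp[OF s, of b \<beta>] o id by simp
  have 2: "\<phi> (leg (functor_comp j c)) = \<phi> ?s \<cdot>\<^bsub>F0 M (fdom c)\<^esub> ar c (\<phi> (leg j))"
    using \<phi>_leg_Comp[OF s] by simp
  have "\<phi> (leg (functor_comp j c)) \<cdot>\<^bsub>F0 M (fdom c)\<^esub> ar c (transition \<phi> b j \<beta>) =
      \<phi> ?s \<cdot>\<^bsub>F0 M (fdom c)\<^esub> ar c (\<phi> (leg j) \<cdot>\<^bsub>F0 M (fdom j)\<^esub> transition \<phi> b j \<beta>)"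
    unfolding 2 using \<phi>_typing[OF s] \<phi>_leg[OF oD(2,5)] transition_typing(1-3)[OF o] c oD
    by (simp add: ar_Comp P.assoc)
  also have "\<dots> = \<phi> (point (functor_comp b c) (functor_comp j c) (hcomp \<beta> (id_nt c)))"
    using transition_typing(4)[OF o] by (simp add: 1)
  finally show "transition \<phi> (functor_comp b c) (functor_comp j c) (hcomp \<beta> (id_nt c)) = ar c (transition \<phi> b j \<beta>)"
    using transition_typing[OF o] c oD x_Obj[OF base_Ob]
    by (intro transition_eqI[OF o']) (simp_all add: ob_comp)
qed

lemma pointwise_cone_effective:
  obtains y h where "y \<in> Obj (F0 M K)" "h \<in> homs (F0 M H) (ob i y) (x base)" "iso_arrow (F0 M H) h"
    "\<And>b j \<beta>. over b j \<beta> \<Longrightarrow> transition \<phi> b j \<beta> \<cdot>\<^bsub>F0 M (fdom j)\<^esub> ar b h = ar j h \<cdot>\<^bsub>F0 M (fdom j)\<^esub> tr \<beta> y"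
  using descent_effective[OF transition_descent] by blast

text \<open>
  The isomorphisms \<open>j\<^sup>* i\<^sup>* y \<rightarrow> j\<^sup>* x \<rightarrow> x\<^sub>P\<close> built from \<open>h\<close> and the legs form an isomorphism of cones: by
  \<open>leg_Comp\<close> the condition at \<open>(a, \<alpha>)\<close> is the compatibility of \<open>h\<close> with the transition map at \<open>(k a, \<alpha>)\<close>.
\<close>

lemma leg_compatible:
  assumes h: "h \<in> homs (F0 M H) (ob i y) (x base)" and y: "y \<in> Obj (F0 M K)"
    and desc: "\<And>b j \<beta>. over b j \<beta> \<Longrightarrow>
      transition \<phi> b j \<beta> \<cdot>\<^bsub>F0 M (fdom j)\<^esub> ar b h = ar j h \<cdot>\<^bsub>F0 M (fdom j)\<^esub> tr \<beta> y"
    and s: "s \<in> trans_One G S"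
  shows "\<phi> s \<cdot>\<^bsub>F0 M (fst (t1_src s))\<^esub> ar (t1_fun s) (\<phi> (leg (snd (t1_tgt s))) \<cdot>\<^bsub>F0 M (fst (t1_tgt s))\<^esub> ar (snd (t1_tgt s)) h) =
    (\<phi> (leg (snd (t1_src s))) \<cdot>\<^bsub>F0 M (fst (t1_src s))\<^esub> ar (snd (t1_src s)) h) \<cdot>\<^bsub>F0 M (fst (t1_src s))\<^esub> tr (t1_nat s) y"
proof -
  note sD = trans_OneD[OF s] and A = trans_ObD[OF trans_OneD(1)[OF s]] and B = trans_ObD[OF trans_OneD(2)[OF s]]
  let ?j = "snd (t1_src s)" and ?k = "snd (t1_tgt s)" and ?a = "t1_fun s" and ?P = "F0 M (fst (t1_src s))"
  interpret P: category ?P using A by simp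
  have h' [simp]: "h \<in> Arr (F0 M H)" "Dom (F0 M H) h = ob i y" "Cod (F0 M H) h = x base"
    using h by (auto simp: homs_iff)
  have fj: "fdom ?j = fst (t1_src s)" using A by simp
  note o = sD(6)
  note t = transition_typing[OF o, unfolded fj] and l = \<phi>_leg[OF A(1,3), unfolded fj] and lk = \<phi>_leg[OF B(1,3), unfolded B(2)]
  have x0: "x base \<in> Obj (F0 M H)" using x_Obj[OF base_Ob] by simp
  have "\<phi> s \<cdot>\<^bsub>?P\<^esub> ar ?a (\<phi> (leg ?k) \<cdot>\<^bsub>F0 M (fst (t1_tgt s))\<^esub> ar ?k h) =
      (\<phi> s \<cdot>\<^bsub>?P\<^esub> ar ?a (\<phi> (leg ?k))) \<cdot>\<^bsub>?P\<^esub> ar (functor_comp ?k ?a) h"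
    using \<phi>_typing[OF s] lk sD(3-5) B A x0
    by (simp add: ar_Comp ar_comp P.assoc)
  also have "\<dots> = \<phi> (leg ?j) \<cdot>\<^bsub>?P\<^esub> transition \<phi> (functor_comp ?k ?a) ?j (t1_nat s) \<cdot>\<^bsub>?P\<^esub> ar (functor_comp ?k ?a) h"
    unfolding \<phi>_leg_Comp[OF s, symmetric] t(4)[symmetric] using t(1-3) l sD(3-5) A B x0
    by (simp add: P.assoc ar_comp ob_comp)
  also have "\<dots> = \<phi> (leg ?j) \<cdot>\<^bsub>?P\<^esub> ar ?j h \<cdot>\<^bsub>?P\<^esub> tr (t1_nat s) y"
    using desc[OF o] fj by simp
  also have "\<dots> = (\<phi> (leg ?j) \<cdot>\<^bsub>?P\<^esub> ar ?j h) \<cdot>\<^bsub>?P\<^esub> tr (t1_nat s) y"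
    using l A tr_typing[OF overD(6)[OF o], of K "fst (t1_src s)" y] y B sD(3-5) by (simp add: P.assoc ob_comp)
  finally show ?thesis .
qed

end

end

section \<open>Functors into \<open>M(G)\<close> and cones\<close>
lemma iso2_Cat2_component:
  assumes "iso2 Cat2 \<tau>" "x \<in> Obj (fdom (ntdom \<tau>))"
  shows "iso_arrow (fcod (ntdom \<tau>)) (ntc \<tau> x)"
proof -
  interpret two_category Cat2 by (rule two_category_Cat2)
  obtain \<rho> where \<rho>: "inverse2 Cat2 \<tau> \<rho>" using assms(1) by (auto simp: iso2_iff)
  note r = inverse2_typing[OF \<rho>, simplified]
  have nt: "is_ntrans \<tau>" "is_ntrans \<rho>" using r by auto
  have "ntc (vcomp \<rho> \<tau>) x = ntc (id_nt (ntdom \<tau>)) x" "ntc (vcomp \<tau> \<rho>) x = ntc (id_nt (ntcod \<tau>)) x"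
    using r by simp_all
  then have "ntc \<rho> x \<cdot>\<^bsub>fcod (ntdom \<tau>)\<^esub> ntc \<tau> x = Ident (fcod (ntdom \<tau>)) (fob (ntdom \<tau>) x)"
    "ntc \<tau> x \<cdot>\<^bsub>fcod (ntdom \<tau>)\<^esub> ntc \<rho> x = Ident (fcod (ntdom \<tau>)) (fob (ntcod \<tau>) x)"
    using assms(2) r(3) nt by simp_all
  then show ?thesis
    using assms(2) r(3,4) nt nt_typing(7-9)[of \<tau> _ _ _ _ x, OF _ refl refl refl refl]
      nt_typing(7-9)[of \<rho> _ _ _ _ x, OF _ refl refl refl refl]
    by (intro iso_arrowI[where g = "ntc \<rho> x" and x = "fob (ntdom \<tau>) x" and y = "fob (ntcod \<tau>) x"])
      (auto simp: homs_iff)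
qed

lemma natural_iso_iso2:
  assumes "natural_iso \<tau>"
  shows "iso2 Cat2 \<tau>"
proof -
  interpret two_category Cat2 by (rule two_category_Cat2)
  have "inverse2 Cat2 \<tau> (inv_nt \<tau>)"
    using inv_nt[OF assms] assms by (simp add: inverse2_def cells2_iff natural_iso_def)
  then show ?thesis by (auto simp: iso2_iff)
qed

context transporter_restriction
begin

lemma lam_natural:
  assumes "h \<in> homs (F0 M K) y y'"
  shows "ar q\<^sub>2 (ar i h) \<cdot>\<^bsub>F0 M X\<^esub> tr lam y = tr lam y' \<cdot>\<^bsub>F0 M X\<^esub> ar q\<^sub>1 (ar i h)"
  using tr_natural[OF overD(6)[OF over_lam], of K X h y y'] assms overD[OF over_lam]
  by (auto simp: homs_iff ar_comp)

text \<open>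
  Restrictions of morphisms are compatible with the canonical transition maps, so uniqueness in
  \<open>descent_morphism\<close> applies.
\<close>

lemma restriction_faithful:
  assumes h: "h \<in> homs (F0 M K) y y'" "k \<in> homs (F0 M K) y y'" and eq: "ar i h = ar i k"
  shows "h = k"
proof -
  have "category (F0 M K)" by simp
  then have y: "y \<in> Obj (F0 M K)" "y' \<in> Obj (F0 M K)" using category.homs_Obj[OF _ h(1)] by auto
  have "ar i h \<in> homs (F0 M H) (ob i y) (ob i y')" using h by (auto simp: homs_iff)
  from descent_morphism[OF y this lam_natural[OF h(1)]] show ?thesis using h eq by metis
qed

context
  fixes T :: "('o, 'm) cat"
  assumes T: "category T"
begin

interpretation T: category T by (rule T)

lemma cone_component:
  assumes \<sigma>: "pseudocone I Cat2 MU T \<sigma>" and A: "A \<in> trans_Ob G S"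
  shows "is_functor (ps1 \<sigma> A)" "fdom (ps1 \<sigma> A) = T" "fcod (ps1 \<sigma> A) = F0 M (fst A)"
    "t \<in> Obj T \<Longrightarrow> fob (ps1 \<sigma> A) t \<in> Obj (F0 M (fst A))"
    "k \<in> Arr T \<Longrightarrow> far (ps1 \<sigma> A) k \<in> Arr (F0 M (fst A))"
    "k \<in> Arr T \<Longrightarrow> Dom (F0 M (fst A)) (far (ps1 \<sigma> A) k) = fob (ps1 \<sigma> A) (Dom T k)"
    "k \<in> Arr T \<Longrightarrow> Cod (F0 M (fst A)) (far (ps1 \<sigma> A) k) = fob (ps1 \<sigma> A) (Cod T k)"
proof -
  show *: "is_functor (ps1 \<sigma> A)" "fdom (ps1 \<sigma> A) = T" "fcod (ps1 \<sigma> A) = F0 M (fst A)"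
    using cones.pseudoconeD(1-3)[OF \<sigma>, of A] A by auto
  show "t \<in> Obj T \<Longrightarrow> fob (ps1 \<sigma> A) t \<in> Obj (F0 M (fst A))"
    "k \<in> Arr T \<Longrightarrow> far (ps1 \<sigma> A) k \<in> Arr (F0 M (fst A))"
    "k \<in> Arr T \<Longrightarrow> Dom (F0 M (fst A)) (far (ps1 \<sigma> A) k) = fob (ps1 \<sigma> A) (Dom T k)"
    "k \<in> Arr T \<Longrightarrow> Cod (F0 M (fst A)) (far (ps1 \<sigma> A) k) = fob (ps1 \<sigma> A) (Cod T k)"
    using is_functor.fob_Obj[OF *(1), of t] is_functor.far_Arr[OF *(1), of k]
      is_functor.Dom_far[OF *(1), of k] is_functor.Cod_far[OF *(1), of k] * by simp_all
qed

lemma cone_cell: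
  assumes \<sigma>: "pseudocone I Cat2 MU T \<sigma>" and s: "s \<in> trans_One G S"
  shows "is_ntrans (ps2 \<sigma> s)" "ntdom (ps2 \<sigma> s) = functor_comp (F1 M (t1_fun s)) (ps1 \<sigma> (t1_tgt s))"
    "ntcod (ps2 \<sigma> s) = ps1 \<sigma> (t1_src s)"
    "t \<in> Obj T \<Longrightarrow> ntc (ps2 \<sigma> s) t \<in> Arr (F0 M (fst (t1_src s)))"
    "t \<in> Obj T \<Longrightarrow> Dom (F0 M (fst (t1_src s))) (ntc (ps2 \<sigma> s) t) = ob (t1_fun s) (fob (ps1 \<sigma> (t1_tgt s)) t)"
    "t \<in> Obj T \<Longrightarrow> Cod (F0 M (fst (t1_src s))) (ntc (ps2 \<sigma> s) t) = fob (ps1 \<sigma> (t1_src s)) t"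
    "t \<in> Obj T \<Longrightarrow> iso_arrow (F0 M (fst (t1_src s))) (ntc (ps2 \<sigma> s) t)"
    "k \<in> homs T t t' \<Longrightarrow> ntc (ps2 \<sigma> s) t' \<cdot>\<^bsub>F0 M (fst (t1_src s))\<^esub> ar (t1_fun s) (far (ps1 \<sigma> (t1_tgt s)) k) =
      far (ps1 \<sigma> (t1_src s)) k \<cdot>\<^bsub>F0 M (fst (t1_src s))\<^esub> ntc (ps2 \<sigma> s) t"
proof -
  note sD = trans_OneD[OF s]
  note c = cone_component[OF \<sigma> sD(1)] cone_component[OF \<sigma> sD(2)]
  show *: "is_ntrans (ps2 \<sigma> s)" "ntdom (ps2 \<sigma> s) = functor_comp (F1 M (t1_fun s)) (ps1 \<sigma> (t1_tgt s))"
    "ntcod (ps2 \<sigma> s) = ps1 \<sigma> (t1_src s)"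
    using cones.pseudoconeD(4-6)[OF \<sigma>, of s] s by simp_all
  have ends: "fdom (ntdom (ps2 \<sigma> s)) = T" "fcod (ntdom (ps2 \<sigma> s)) = F0 M (fst (t1_src s))"
    using * c sD by simp_all
  note n = nt_typing(7-10)[OF *(1) refl refl ends]
  show "t \<in> Obj T \<Longrightarrow> ntc (ps2 \<sigma> s) t \<in> Arr (F0 M (fst (t1_src s)))"
    "t \<in> Obj T \<Longrightarrow> Dom (F0 M (fst (t1_src s))) (ntc (ps2 \<sigma> s) t) = ob (t1_fun s) (fob (ps1 \<sigma> (t1_tgt s)) t)"
    "t \<in> Obj T \<Longrightarrow> Cod (F0 M (fst (t1_src s))) (ntc (ps2 \<sigma> s) t) = fob (ps1 \<sigma> (t1_src s)) t"
    using n(1-3)[of t] * c by simp_all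
  show "t \<in> Obj T \<Longrightarrow> iso_arrow (F0 M (fst (t1_src s))) (ntc (ps2 \<sigma> s) t)"
    using iso2_Cat2_component[of "ps2 \<sigma> s" t] cones.pseudoconeD(7)[OF \<sigma>, of s] s ends by simp
  show "k \<in> homs T t t' \<Longrightarrow> ntc (ps2 \<sigma> s) t' \<cdot>\<^bsub>F0 M (fst (t1_src s))\<^esub> ar (t1_fun s) (far (ps1 \<sigma> (t1_tgt s)) k) =
      far (ps1 \<sigma> (t1_src s)) k \<cdot>\<^bsub>F0 M (fst (t1_src s))\<^esub> ntc (ps2 \<sigma> s) t"
    using n(4)[of k t t'] * c by (simp add: homs_iff)
qed

lemma cone_pointwise:
  assumes \<sigma>: "pseudocone I Cat2 MU T \<sigma>" and t: "t \<in> Obj T"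
  shows "pointwise_cone (\<lambda>A. fob (ps1 \<sigma> A) t) (\<lambda>s. ntc (ps2 \<sigma> s) t)"
  unfolding pointwise_cone_def
proof (intro conjI ballI impI)
  fix A assume "A \<in> trans_Ob G S"
  then show "fob (ps1 \<sigma> A) t \<in> Obj (F0 M (fst A))" using cone_component[OF \<sigma>] t by blast
next
  fix s assume s: "s \<in> trans_One G S"
  show "ntc (ps2 \<sigma> s) t \<in> homs (F0 M (fst (t1_src s))) (ob (t1_fun s) (fob (ps1 \<sigma> (t1_tgt s)) t))
      (fob (ps1 \<sigma> (t1_src s)) t)" "iso_arrow (F0 M (fst (t1_src s))) (ntc (ps2 \<sigma> s) t)"
    using cone_cell(4-7)[OF \<sigma> s t] by (simp_all add: homs_iff)
next
  fix s r assume s: "s \<in> trans_One G S" and r: "r \<in> trans_One G S" and eq: "t1_tgt s = t1_src r"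
  note sD = trans_OneD[OF s] and rD = trans_OneD[OF r]
  have "ps2 \<sigma> (trans_Comp1 r s) = vcomp (ps2 \<sigma> s) (hcomp (id_nt (F1 M (t1_fun s))) (ps2 \<sigma> r))"
    using cones.pseudoconeD(10)[OF \<sigma>, of r s] s r eq by simp
  then show "ntc (ps2 \<sigma> (trans_Comp1 r s)) t =
      ntc (ps2 \<sigma> s) t \<cdot>\<^bsub>F0 M (fst (t1_src s))\<^esub> ar (t1_fun s) (ntc (ps2 \<sigma> r) t)"
    using cone_cell[OF \<sigma> s] cone_cell[OF \<sigma> r] cone_component[OF \<sigma> rD(2)] t sD rD eq pull_functor
    by (simp del: hcomp_sel(3))
qed

lemma cone_map_component:
  assumes \<Gamma>: "pseudocone_map I Cat2 MU T \<Gamma>"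
  shows "A \<in> trans_Ob G S \<Longrightarrow> is_ntrans (mc \<Gamma> A)" "A \<in> trans_Ob G S \<Longrightarrow> ntdom (mc \<Gamma> A) = ps1 (mdom \<Gamma>) A"
    "A \<in> trans_Ob G S \<Longrightarrow> ntcod (mc \<Gamma> A) = ps1 (mcod \<Gamma>) A"
    "A \<in> trans_Ob G S \<Longrightarrow> t \<in> Obj T \<Longrightarrow>
      ntc (mc \<Gamma> A) t \<in> homs (F0 M (fst A)) (fob (ps1 (mdom \<Gamma>) A) t) (fob (ps1 (mcod \<Gamma>) A) t)"
    "A \<in> trans_Ob G S \<Longrightarrow> k \<in> homs T t t' \<Longrightarrow> ntc (mc \<Gamma> A) t' \<cdot>\<^bsub>F0 M (fst A)\<^esub> far (ps1 (mdom \<Gamma>) A) k =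
      far (ps1 (mcod \<Gamma>) A) k \<cdot>\<^bsub>F0 M (fst A)\<^esub> ntc (mc \<Gamma> A) t"
    "s \<in> trans_One G S \<Longrightarrow> t \<in> Obj T \<Longrightarrow>
      ntc (ps2 (mcod \<Gamma>) s) t \<cdot>\<^bsub>F0 M (fst (t1_src s))\<^esub> ar (t1_fun s) (ntc (mc \<Gamma> (t1_tgt s)) t) =
      ntc (mc \<Gamma> (t1_src s)) t \<cdot>\<^bsub>F0 M (fst (t1_src s))\<^esub> ntc (ps2 (mdom \<Gamma>) s) t"
proof -
  note d = cones.pseudocone_mapD(1)[OF \<Gamma>] and c = cones.pseudocone_mapD(2)[OF \<Gamma>]
  show *: "is_ntrans (mc \<Gamma> A)" "ntdom (mc \<Gamma> A) = ps1 (mdom \<Gamma>) A" "ntcod (mc \<Gamma> A) = ps1 (mcod \<Gamma>) A"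
    if "A \<in> trans_Ob G S" for A
    using cones.pseudocone_mapD(3-5)[OF \<Gamma>, of A] that by simp_all
  show "A \<in> trans_Ob G S \<Longrightarrow> t \<in> Obj T \<Longrightarrow>
      ntc (mc \<Gamma> A) t \<in> homs (F0 M (fst A)) (fob (ps1 (mdom \<Gamma>) A) t) (fob (ps1 (mcod \<Gamma>) A) t)"
    using nt_typing(7-9)[OF *(1) refl refl refl refl, of A t] * cone_component[OF d, of A] by (simp add: homs_iff)
  show "A \<in> trans_Ob G S \<Longrightarrow> k \<in> homs T t t' \<Longrightarrow> ntc (mc \<Gamma> A) t' \<cdot>\<^bsub>F0 M (fst A)\<^esub> far (ps1 (mdom \<Gamma>) A) k =
      far (ps1 (mcod \<Gamma>) A) k \<cdot>\<^bsub>F0 M (fst A)\<^esub> ntc (mc \<Gamma> A) t"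
    using nt_typing(10)[OF *(1) refl refl refl refl, of A k t t'] * cone_component[OF d, of A] by (simp add: homs_iff)
  show "ntc (ps2 (mcod \<Gamma>) s) t \<cdot>\<^bsub>F0 M (fst (t1_src s))\<^esub> ar (t1_fun s) (ntc (mc \<Gamma> (t1_tgt s)) t) =
      ntc (mc \<Gamma> (t1_src s)) t \<cdot>\<^bsub>F0 M (fst (t1_src s))\<^esub> ntc (ps2 (mdom \<Gamma>) s) t"
    if s: "s \<in> trans_One G S" and t: "t \<in> Obj T"
  proof -
    note sD = trans_OneD[OF s]
    have "ntc (vcomp (ps2 (mcod \<Gamma>) s) (hcomp (id_nt (F1 M (t1_fun s))) (mc \<Gamma> (t1_tgt s)))) t =
        ntc (vcomp (mc \<Gamma> (t1_src s)) (ps2 (mdom \<Gamma>) s)) t"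
      using cones.pseudocone_mapD(6)[OF \<Gamma>, of s] s by simp
    then show ?thesis
      using t sD *[OF sD(1)] *[OF sD(2)] cone_component[OF d sD(1)] cone_component[OF d sD(2)]
        cone_cell[OF d s] cone_cell[OF c s] pull_functor
      by (simp del: hcomp_sel(3))
  qed
qed

lemma pre_component:
  assumes u: "is_functor u" "fdom u = T" "fcod u = F0 M K"
  shows "pseudocone I Cat2 MU T (psnat_pre I Cat2 u \<pi>)"
    "A \<in> trans_Ob G S \<Longrightarrow> t \<in> Obj T \<Longrightarrow> fob (ps1 (psnat_pre I Cat2 u \<pi>) A) t = ob (snd A) (ob i (fob u t))"
    "A \<in> trans_Ob G S \<Longrightarrow> k \<in> Arr T \<Longrightarrow> far (ps1 (psnat_pre I Cat2 u \<pi>) A) k = ar (snd A) (ar i (far u k))"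
    "s \<in> trans_One G S \<Longrightarrow> t \<in> Obj T \<Longrightarrow> ntc (ps2 (psnat_pre I Cat2 u \<pi>) s) t = tr (t1_nat s) (fob u t)"
proof -
  show "pseudocone I Cat2 MU T (psnat_pre I Cat2 u \<pi>)"
    using u by (intro cones.pseudocone_pre[OF _ pseudocone_\<pi>]) (simp add: cells1_iff)
  have ft: "fob u t \<in> Obj (F0 M K)" if "t \<in> Obj T" for t using is_functor.fob_Obj[OF u(1), of t] that u by simp
  have fk: "far u k \<in> Arr (F0 M K)" if "k \<in> Arr T" for k using is_functor.far_Arr[OF u(1), of k] that u by simp
  show "A \<in> trans_Ob G S \<Longrightarrow> t \<in> Obj T \<Longrightarrow> fob (ps1 (psnat_pre I Cat2 u \<pi>) A) t = ob (snd A) (ob i (fob u t))"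
    using u ft trans_ObD[of A] by (simp add: cones.psnat_pre_sel ob_comp)
  show "A \<in> trans_Ob G S \<Longrightarrow> k \<in> Arr T \<Longrightarrow> far (ps1 (psnat_pre I Cat2 u \<pi>) A) k = ar (snd A) (ar i (far u k))"
    using u fk trans_ObD[of A] by (simp add: cones.psnat_pre_sel ar_comp)
  show "ntc (ps2 (psnat_pre I Cat2 u \<pi>) s) t = tr (t1_nat s) (fob u t)" if s: "s \<in> trans_One G S" and t: "t \<in> Obj T"
  proof -
    note sD = trans_OneD[OF s] and B = trans_ObD[OF trans_OneD(2)[OF s]]
    show ?thesis using s t u sD M_cell[OF sD(7)] B by (simp add: cones.psnat_pre_sel del: hcomp_sel(3))
  qed
qed

lemma induced_sel: "fdom (cones.induced T) = hom_cat Cat2 T (F0 M K)" "fcod (cones.induced T) = cones.cones T"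
  by (simp_all add: cones.induced_def)

text \<open>
  Naturality at the legs shows that a map of cones is determined by its component \<open>h\<close> at \<open>(S, id)\<close>,
  and naturality at the universal point says that each \<open>h t\<close> is compatible with transition maps.  So
  each \<open>h t\<close> comes from a unique morphism of \<open>M(G)\<close>.
\<close>

lemma induced_fully_faithful: "fully_faithful (cones.induced T)"
  unfolding fully_faithful_def
proof (intro ballI)
  fix u v \<Gamma> assume uv: "u \<in> Obj (fdom (cones.induced T))" "v \<in> Obj (fdom (cones.induced T))"
    and G: "\<Gamma> \<in> homs (fcod (cones.induced T)) (fob (cones.induced T) u) (fob (cones.induced T) v)"
  have u: "is_functor u" "fdom u = T" "fcod u = F0 M K" and v: "is_functor v" "fdom v = T" "fcod v = F0 M K"
    using uv by (auto simp: induced_sel cells1_iff)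
  have \<Gamma>: "pseudocone_map I Cat2 MU T \<Gamma>" "mdom \<Gamma> = psnat_pre I Cat2 u \<pi>" "mcod \<Gamma> = psnat_pre I Cat2 v \<pi>"
    using G T u v by (auto simp: homs_iff induced_sel) (auto simp: cones.induced_def cells1_iff)
  note pu = pre_component[OF u] and pv = pre_component[OF v]
  note m = cone_map_component[OF \<Gamma>(1), unfolded \<Gamma>(2,3)]
  have ut: "fob u t \<in> Obj (F0 M K)" "fob v t \<in> Obj (F0 M K)" if "t \<in> Obj T" for t
    using is_functor.fob_Obj[OF u(1), of t] is_functor.fob_Obj[OF v(1), of t] that u v by simp_all
  have uk: "far u k \<in> homs (F0 M K) (fob u t) (fob u t')" "far v k \<in> homs (F0 M K) (fob v t) (fob v t')"
    if "k \<in> homs T t t'" for k t t'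
    using is_functor.far_homs[OF u(1), of k] is_functor.far_homs[OF v(1), of k] that u v by simp_all
  define h where "h t = ntc (mc \<Gamma> base) t" for t
  have id: "ob (id_functor H) x = x" "ar (id_functor H) k = k" if "x \<in> Obj (F0 M H)" "k \<in> Arr (F0 M H)" for x k
    using that by (simp_all add: M_id)
  have idob: "ob (id_functor H) (ob i y) = ob i y" if "y \<in> Obj (F0 M K)" for y
    using that by (simp add: M_id)
  have h: "h t \<in> homs (F0 M H) (ob i (fob u t)) (ob i (fob v t))" if "t \<in> Obj T" for t
    using m(4)[OF base_Ob that] that ut[OF that] by (simp add: h_def pu pv idob)
  have h_point: "tr \<beta> (fob v t) \<cdot>\<^bsub>F0 M (fdom j)\<^esub> ar b (h t) = ntc (mc \<Gamma> (fdom j, j)) t \<cdot>\<^bsub>F0 M (fdom j)\<^esub> tr \<beta> (fob u t)"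
    if o: "over b j \<beta>" and t: "t \<in> Obj T" for b j \<beta> t
    using m(6)[OF point_One[OF o] t] point_One[OF o] t by (simp add: h_def pu pv)
  have comp: "ntc (mc \<Gamma> A) t = ar (snd A) (h t)" if A: "A \<in> trans_Ob G S" and t: "t \<in> Obj T" for A t
  proof -
    note AD = trans_ObD[OF A]
    interpret P: category "F0 M (fst A)" using AD by simp
    have "(fdom (snd A), snd A) = A" using AD by (simp add: prod_eq_iff)
    then show ?thesis
      using h_point[OF over_id[OF AD(1,3)] t] AD ut[OF t] h[OF t] m(4)[OF A t] A t
      by (simp add: tr_id pu pv homs_iff ob_comp)
  qed
  have ex: "\<exists>!h\<^sub>0. h\<^sub>0 \<in> homs (F0 M K) (fob u t) (fob v t) \<and> ar i h\<^sub>0 = h t" if t: "t \<in> Obj T" for t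
  proof (rule descent_morphism[OF ut[OF t] h[OF t]])
    note l = overD[OF over_lam]
    have "(X, q\<^sub>2) \<in> trans_Ob G S" using l by (simp add: trans_Ob_iff)
    then show "ar q\<^sub>2 (h t) \<cdot>\<^bsub>F0 M X\<^esub> tr lam (fob u t) = tr lam (fob v t) \<cdot>\<^bsub>F0 M X\<^esub> ar q\<^sub>1 (h t)"
      using h_point[OF over_lam t] comp[of "(X, q\<^sub>2)" t] t by simp
  qed
  define w where "w t = (THE h\<^sub>0. h\<^sub>0 \<in> homs (F0 M K) (fob u t) (fob v t) \<and> ar i h\<^sub>0 = h t)" for t
  have w: "w t \<in> homs (F0 M K) (fob u t) (fob v t)" "ar i (w t) = h t" if "t \<in> Obj T" for t
    using theI'[OF ex[OF that]] by (auto simp: w_def)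
  interpret MG: category "F0 M K" by simp
  have nat: "w t' \<cdot>\<^bsub>F0 M K\<^esub> far u k = far v k \<cdot>\<^bsub>F0 M K\<^esub> w t" if k: "k \<in> homs T t t'" for k t t'
  proof (rule restriction_faithful)
    have t: "t \<in> Obj T" "t' \<in> Obj T" using T.homs_Obj[OF k] by auto
    show "w t' \<cdot>\<^bsub>F0 M K\<^esub> far u k \<in> homs (F0 M K) (fob u t) (fob v t')"
      "far v k \<cdot>\<^bsub>F0 M K\<^esub> w t \<in> homs (F0 M K) (fob u t) (fob v t')"
      using w[OF t(1)] w[OF t(2)] uk[OF k] by (auto simp: homs_iff)
    have "h t' \<cdot>\<^bsub>F0 M H\<^esub> ar i (far u k) = ar i (far v k) \<cdot>\<^bsub>F0 M H\<^esub> h t"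
      using m(5)[OF base_Ob k] uk[OF k] k by (simp add: pu pv h_def homs_iff M_id)
    then show "ar i (w t' \<cdot>\<^bsub>F0 M K\<^esub> far u k) = ar i (far v k \<cdot>\<^bsub>F0 M K\<^esub> w t)"
      using w[OF t(1)] w[OF t(2)] uk[OF k] by (simp add: homs_iff ar_Comp)
  qed
  let ?\<omega> = "\<lparr>ntdom = u, ntcod = v, ntc = (\<lambda>t\<in>Obj T. w t)\<rparr>"
  have \<omega>: "is_ntrans ?\<omega>"
  proof (intro is_ntrans.intro)
    fix k t t' assume k: "k \<in> homs (fdom (ntdom ?\<omega>)) t t'"
    then have "k \<in> homs T t t'" using u by simp
    moreover from T.homs_Obj[OF this] have "t \<in> Obj T" "t' \<in> Obj T" by auto
    ultimately show "ntc ?\<omega> t' \<cdot>\<^bsub>fcod (ntdom ?\<omega>)\<^esub> far (ntdom ?\<omega>) k = far (ntcod ?\<omega>) k \<cdot>\<^bsub>fcod (ntdom ?\<omega>)\<^esub> ntc ?\<omega> t"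
      using nat[of k t t'] u by simp
  qed (use u v w in auto)
  have far: "far (cones.induced T) \<xi> = psnat_pre2 I Cat2 \<xi> \<pi>" if "is_ntrans \<xi>" "ntdom \<xi> = u" for \<xi>
    using that u by (simp add: cones.induced_def)
  have pre2: "ntc (mc (psnat_pre2 I Cat2 \<xi> \<pi>) A) t = ar (snd A) (ar i (ntc \<xi> t))"
    if x: "is_ntrans \<xi>" "ntdom \<xi> = u" "ntcod \<xi> = v" and A: "A \<in> trans_Ob G S" and t: "t \<in> Obj T" for \<xi> A t
    using that u trans_ObD[OF A] nt_typing(7)[OF x refl refl, of t]
    by (simp add: cones.psnat_pre2_sel pull_functor ar_comp del: hcomp_sel(3))
  have eq: "psnat_pre2 I Cat2 \<xi> \<pi> = \<Gamma>"
    if x: "is_ntrans \<xi>" "ntdom \<xi> = u" "ntcod \<xi> = v" and e: "\<And>t. t \<in> Obj T \<Longrightarrow> ar i (ntc \<xi> t) = h t" for \<xi>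
  proof (rule cones.modif_eqI)
    show "mdom (psnat_pre2 I Cat2 \<xi> \<pi>) = mdom \<Gamma>" "mcod (psnat_pre2 I Cat2 \<xi> \<pi>) = mcod \<Gamma>"
      using x \<Gamma> by (simp_all add: cones.psnat_pre2_sel)
    show "mc (psnat_pre2 I Cat2 \<xi> \<pi>) \<in> extensional (Ob I)" "mc \<Gamma> \<in> extensional (Ob I)"
      using cones.pseudocone_mapD(7)[OF \<Gamma>(1)] by (simp_all add: cones.psnat_pre2_sel)
    have pm: "pseudocone_map I Cat2 MU T (psnat_pre2 I Cat2 \<xi> \<pi>)"
      using x u by (intro cones.pseudocone_map_pre2) simp_all
    fix A assume "A \<in> Ob I"
    then have A: "A \<in> trans_Ob G S" by simp
    show "mc (psnat_pre2 I Cat2 \<xi> \<pi>) A = mc \<Gamma> A"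
    proof (rule ntrans_eqI)
      show "is_ntrans (mc (psnat_pre2 I Cat2 \<xi> \<pi>) A)" "is_ntrans (mc \<Gamma> A)"
        using cone_map_component(1)[OF pm A] m(1)[OF A] by auto
      show "ntdom (mc (psnat_pre2 I Cat2 \<xi> \<pi>) A) = ntdom (mc \<Gamma> A)"
        "ntcod (mc (psnat_pre2 I Cat2 \<xi> \<pi>) A) = ntcod (mc \<Gamma> A)"
        using cone_map_component(2,3)[OF pm A] m(2,3)[OF A] x \<Gamma> by (simp_all add: cones.psnat_pre2_sel)
      fix t assume "t \<in> Obj (fdom (ntdom (mc (psnat_pre2 I Cat2 \<xi> \<pi>) A)))"
      then have "t \<in> Obj T"
        using cone_map_component(2)[OF pm A] cone_component(2)[OF pu(1) A] x by (simp add: cones.psnat_pre2_sel)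
      then show "ntc (mc (psnat_pre2 I Cat2 \<xi> \<pi>) A) t = ntc (mc \<Gamma> A) t"
        using pre2[OF x A] comp[OF A] e by simp
    qed
  qed
  show "\<exists>!\<omega>. \<omega> \<in> homs (fdom (cones.induced T)) u v \<and> far (cones.induced T) \<omega> = \<Gamma>"
  proof (rule ex1I[where a = ?\<omega>])
    have "psnat_pre2 I Cat2 ?\<omega> \<pi> = \<Gamma>" using \<omega> w by (intro eq) simp_all
    then show "?\<omega> \<in> homs (fdom (cones.induced T)) u v \<and> far (cones.induced T) ?\<omega> = \<Gamma>"
      using \<omega> u v far[of ?\<omega>] by (simp add: homs_iff induced_sel)
  next
    fix \<xi> assume "\<xi> \<in> homs (fdom (cones.induced T)) u v \<and> far (cones.induced T) \<xi> = \<Gamma>"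
    then have x: "is_ntrans \<xi>" "ntdom \<xi> = u" "ntcod \<xi> = v" and e: "psnat_pre2 I Cat2 \<xi> \<pi> = \<Gamma>"
      using far[of \<xi>] by (auto simp: homs_iff induced_sel)
    show "\<xi> = ?\<omega>"
    proof (rule ntrans_eqI)
      fix t assume "t \<in> Obj (fdom (ntdom \<xi>))"
      then have t: "t \<in> Obj T" using x u by simp
      have xt: "ntc \<xi> t \<in> homs (F0 M K) (fob u t) (fob v t)"
        using nt_typing(7-9)[OF x refl refl, of t] t u by (simp add: homs_iff)
      then have "ar i (ntc \<xi> t) \<in> Arr (F0 M H)" by (simp add: homs_iff)
      then have "ar i (ntc \<xi> t) = h t"
        using pre2[OF x base_Ob t] e by (simp add: h_def M_id)
      with ex[OF t] w[OF t] xt have "ntc \<xi> t = w t" by blast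
      then show "ntc \<xi> t = ntc ?\<omega> t" using t by simp
    qed (use x \<omega> in simp_all)
  qed
qed

text \<open>
  Both sides agree after composing with the structure cell at the leg of \<open>j\<close>, which is invertible and
  natural in \<open>T\<close>.
\<close>

lemma transition_natural:
  assumes \<sigma>: "pseudocone I Cat2 MU T \<sigma>" and k: "k \<in> homs T t t'" and o: "over b j \<beta>"
  shows "transition (\<lambda>s. ntc (ps2 \<sigma> s) t') b j \<beta> \<cdot>\<^bsub>F0 M (fdom j)\<^esub> ar b (far (ps1 \<sigma> base) k) =
    ar j (far (ps1 \<sigma> base) k) \<cdot>\<^bsub>F0 M (fdom j)\<^esub> transition (\<lambda>s. ntc (ps2 \<sigma> s) t) b j \<beta>"
proof -
  note oD = overD[OF o]
  interpret P: category "F0 M (fdom j)" using oD by simp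
  have t: "t \<in> Obj T" "t' \<in> Obj T" using T.homs_Obj[OF k] by auto
  have k' [simp]: "k \<in> Arr T" "Dom T k = t" "Cod T k = t'" using k by (auto simp: homs_iff)
  let ?\<phi> = "\<lambda>s. ntc (ps2 \<sigma> s) t" and ?\<phi>' = "\<lambda>s. ntc (ps2 \<sigma> s) t'" and ?\<sigma>k = "far (ps1 \<sigma> base) k"
  note c = cone_pointwise[OF \<sigma> t(1)] and c' = cone_pointwise[OF \<sigma> t(2)]
  note tr1 = transition_typing[OF c o] and tr2 = transition_typing[OF c' o]
  note l1 = \<phi>_leg[OF c oD(2,5)] and l2 = \<phi>_leg[OF c' oD(2,5)]
  note s0k = cone_component(5-7)[OF \<sigma> base_Ob k'(1), simplified]
  have jA: "(fdom j, j) \<in> trans_Ob G S" using oD by (simp add: trans_Ob_iff)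
  note jk = cone_component(5-7)[OF \<sigma> jA k'(1), simplified]
  have nat: "?\<phi>' (point b' j \<beta>') \<cdot>\<^bsub>F0 M (fdom j)\<^esub> ar b' ?\<sigma>k = far (ps1 \<sigma> (fdom j, j)) k \<cdot>\<^bsub>F0 M (fdom j)\<^esub> ?\<phi> (point b' j \<beta>')"
    if "over b' j \<beta>'" for b' \<beta>'
    using cone_cell(8)[OF \<sigma> point_One[OF that] k] by simp
  show ?thesis
  proof (rule P.iso_mono[OF l2(4)])
    have "?\<phi>' (leg j) \<cdot>\<^bsub>F0 M (fdom j)\<^esub> transition ?\<phi>' b j \<beta> \<cdot>\<^bsub>F0 M (fdom j)\<^esub> ar b ?\<sigma>k =
        (?\<phi>' (leg j) \<cdot>\<^bsub>F0 M (fdom j)\<^esub> transition ?\<phi>' b j \<beta>) \<cdot>\<^bsub>F0 M (fdom j)\<^esub> ar b ?\<sigma>k"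
      using tr2(1-3) l2 oD s0k by (simp add: P.assoc)
    also have "\<dots> = far (ps1 \<sigma> (fdom j, j)) k \<cdot>\<^bsub>F0 M (fdom j)\<^esub> ?\<phi> (leg j) \<cdot>\<^bsub>F0 M (fdom j)\<^esub> transition ?\<phi> b j \<beta>"
      unfolding tr2(4) nat[OF o] tr1(4) ..
    also have "\<dots> = (?\<phi>' (leg j) \<cdot>\<^bsub>F0 M (fdom j)\<^esub> ar j ?\<sigma>k) \<cdot>\<^bsub>F0 M (fdom j)\<^esub> transition ?\<phi> b j \<beta>"
      unfolding nat[OF over_id[OF oD(2,5)]] using tr1(1-3) l1 jk by (simp add: P.assoc)
    also have "\<dots> = ?\<phi>' (leg j) \<cdot>\<^bsub>F0 M (fdom j)\<^esub> ar j ?\<sigma>k \<cdot>\<^bsub>F0 M (fdom j)\<^esub> transition ?\<phi> b j \<beta>"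
      using tr1(1-3) l2 s0k oD by (simp add: P.assoc)
    finally show "?\<phi>' (leg j) \<cdot>\<^bsub>F0 M (fdom j)\<^esub> transition ?\<phi>' b j \<beta> \<cdot>\<^bsub>F0 M (fdom j)\<^esub> ar b ?\<sigma>k =
        ?\<phi>' (leg j) \<cdot>\<^bsub>F0 M (fdom j)\<^esub> ar j ?\<sigma>k \<cdot>\<^bsub>F0 M (fdom j)\<^esub> transition ?\<phi> b j \<beta>" .
  qed (use tr1(1-3) tr2(1-3) l2 s0k oD in simp_all)
qed

text \<open>
  Effective descent gives \<open>y t\<close> in \<open>M(G)\<close> and \<open>h t : i\<^sup>* (y t) \<cong> x t\<close> for each object \<open>t\<close> of \<open>T\<close>.  On arrows the
  required functor \<open>u\<close> is the lift of the conjugate \<open>g k\<close> of \<open>\<sigma> k\<close> by these isomorphisms.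
\<close>

lemma induced_essentially_surjective: "essentially_surjective (cones.induced T)"
  unfolding essentially_surjective_def
proof
  fix \<sigma> assume "\<sigma> \<in> Obj (fcod (cones.induced T))"
  then have \<sigma>: "pseudocone I Cat2 MU T \<sigma>" using T by (simp add: induced_sel)
  let ?\<phi> = "\<lambda>t s. ntc (ps2 \<sigma> s) t"
  note s0c = cone_component[OF \<sigma> base_Ob, simplified]
  have "\<exists>y h. y \<in> Obj (F0 M K) \<and> h \<in> homs (F0 M H) (ob i y) (fob (ps1 \<sigma> base) t) \<and> iso_arrow (F0 M H) h \<and>
    (\<forall>b j \<beta>. over b j \<beta> \<longrightarrow> transition (?\<phi> t) b j \<beta> \<cdot>\<^bsub>F0 M (fdom j)\<^esub> ar b h = ar j h \<cdot>\<^bsub>F0 M (fdom j)\<^esub> tr \<beta> y)"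
    if "t \<in> Obj T" for t
    using pointwise_cone_effective[OF cone_pointwise[OF \<sigma> that]] by metis
  then obtain y h where y [simp]: "\<And>t. t \<in> Obj T \<Longrightarrow> y t \<in> Obj (F0 M K)"
    and h: "\<And>t. t \<in> Obj T \<Longrightarrow> h t \<in> homs (F0 M H) (ob i (y t)) (fob (ps1 \<sigma> base) t)"
    and iso: "\<And>t. t \<in> Obj T \<Longrightarrow> iso_arrow (F0 M H) (h t)"
    and desc: "\<And>t b j \<beta>. t \<in> Obj T \<Longrightarrow> over b j \<beta> \<Longrightarrow>
      transition (?\<phi> t) b j \<beta> \<cdot>\<^bsub>F0 M (fdom j)\<^esub> ar b (h t) = ar j (h t) \<cdot>\<^bsub>F0 M (fdom j)\<^esub> tr \<beta> (y t)"
    by metis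
  interpret MS: category "F0 M H" by simp
  interpret MG: category "F0 M K" by simp
  have h' [simp]: "h t \<in> Arr (F0 M H)" "Dom (F0 M H) (h t) = ob i (y t)" "Cod (F0 M H) (h t) = fob (ps1 \<sigma> base) t"
    if "t \<in> Obj T" for t using h[OF that] by (auto simp: homs_iff)
  define g where "g k = inv_arr (F0 M H) (h (Cod T k)) \<cdot>\<^bsub>F0 M H\<^esub> far (ps1 \<sigma> base) k \<cdot>\<^bsub>F0 M H\<^esub> h (Dom T k)" for k
  have g: "g k \<in> homs (F0 M H) (ob i (y t)) (ob i (y t'))"
    "h t' \<cdot>\<^bsub>F0 M H\<^esub> g k = far (ps1 \<sigma> base) k \<cdot>\<^bsub>F0 M H\<^esub> h t" if k: "k \<in> homs T t t'" for k t t'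
  proof -
    have t: "t \<in> Obj T" "t' \<in> Obj T" and k': "k \<in> Arr T" "Dom T k = t" "Cod T k = t'"
      using T.homs_Obj[OF k] k by (auto simp: homs_iff)
    show "g k \<in> homs (F0 M H) (ob i (y t)) (ob i (y t'))"
      "h t' \<cdot>\<^bsub>F0 M H\<^esub> g k = far (ps1 \<sigma> base) k \<cdot>\<^bsub>F0 M H\<^esub> h t"
      using t k' s0c inv_arr[OF iso[OF t(2)]] MS.inv_arr_Comp(2)[OF iso[OF t(2)]]
      by (simp_all add: g_def homs_iff)
  qed
  have ex: "\<exists>!h\<^sub>0. h\<^sub>0 \<in> homs (F0 M K) (y t) (y t') \<and> ar i h\<^sub>0 = g k" if k: "k \<in> homs T t t'" for k t t'
  proof (rule descent_morphism[OF _ _ g(1)[OF k]])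
    have t: "t \<in> Obj T" "t' \<in> Obj T" using T.homs_Obj[OF k] by auto
    then show "y t \<in> Obj (F0 M K)" "y t' \<in> Obj (F0 M K)" by auto
    have k' [simp]: "k \<in> Arr T" "Dom T k = t" "Cod T k = t'" using k by (auto simp: homs_iff)
    note o = over_lam
    note l = overD[OF o]
    have X [simp]: "fdom q\<^sub>2 = X" "fdom q\<^sub>1 = X" by simp_all
    interpret X: category "F0 M X" by (simp add: ii.finite_groupoid_P)
    note tr1 = transition_typing(1-3)[OF cone_pointwise[OF \<sigma> t(1)] o, unfolded X]
      and tr2 = transition_typing(1-3)[OF cone_pointwise[OF \<sigma> t(2)] o, unfolded X]
    note nat = transition_natural[OF \<sigma> k o, unfolded X]
    note d1 = desc[OF t(1) o, unfolded X] and d2 = desc[OF t(2) o, unfolded X]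
    note lam1 = tr_typing[OF l(6), of K X "y t"] and lam2 = tr_typing[OF l(6), of K X "y t'"]
    have gk [simp]: "g k \<in> Arr (F0 M H)" "Dom (F0 M H) (g k) = ob i (y t)" "Cod (F0 M H) (g k) = ob i (y t')"
      using g(1)[OF k] by (auto simp: homs_iff)
    let ?\<sigma>k = "far (ps1 \<sigma> base) k"
    let ?tr = "transition (?\<phi> t) q\<^sub>1 q\<^sub>2 lam" and ?tr' = "transition (?\<phi> t') q\<^sub>1 q\<^sub>2 lam"
    have s: "?\<sigma>k \<in> Arr (F0 M H)" "Dom (F0 M H) ?\<sigma>k = fob (ps1 \<sigma> base) t" "Cod (F0 M H) ?\<sigma>k = fob (ps1 \<sigma> base) t'"
      using s0c(5-7)[of k] by simp_all
    have q: "ar q\<^sub>2 (h t') \<cdot>\<^bsub>F0 M X\<^esub> ar q\<^sub>2 (g k) = ar q\<^sub>2 ?\<sigma>k \<cdot>\<^bsub>F0 M X\<^esub> ar q\<^sub>2 (h t)"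
      "ar q\<^sub>1 (h t') \<cdot>\<^bsub>F0 M X\<^esub> ar q\<^sub>1 (g k) = ar q\<^sub>1 ?\<sigma>k \<cdot>\<^bsub>F0 M X\<^esub> ar q\<^sub>1 (h t)"
      using g(2)[OF k] s t l by (simp_all flip: ar_Comp)
    show "ar q\<^sub>2 (g k) \<cdot>\<^bsub>F0 M X\<^esub> tr lam (y t) = tr lam (y t') \<cdot>\<^bsub>F0 M X\<^esub> ar q\<^sub>1 (g k)"
    proof (rule X.iso_mono[OF ar_iso[OF l(2) l(5) X(1) iso[OF t(2)]]])
      have "ar q\<^sub>2 (h t') \<cdot>\<^bsub>F0 M X\<^esub> ar q\<^sub>2 (g k) \<cdot>\<^bsub>F0 M X\<^esub> tr lam (y t) =
          (ar q\<^sub>2 (h t') \<cdot>\<^bsub>F0 M X\<^esub> ar q\<^sub>2 (g k)) \<cdot>\<^bsub>F0 M X\<^esub> tr lam (y t)"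
        using lam1 t l by (simp add: X.assoc ob_comp)
      also have "\<dots> = ar q\<^sub>2 ?\<sigma>k \<cdot>\<^bsub>F0 M X\<^esub> ar q\<^sub>2 (h t) \<cdot>\<^bsub>F0 M X\<^esub> tr lam (y t)"
        unfolding q using lam1 t l s by (simp add: X.assoc ob_comp)
      also have "\<dots> = (ar q\<^sub>2 ?\<sigma>k \<cdot>\<^bsub>F0 M X\<^esub> ?tr) \<cdot>\<^bsub>F0 M X\<^esub> ar q\<^sub>1 (h t)"
        unfolding d1[symmetric] using tr1 t l s by (simp add: X.assoc)
      also have "\<dots> = ?tr' \<cdot>\<^bsub>F0 M X\<^esub> ar q\<^sub>1 ?\<sigma>k \<cdot>\<^bsub>F0 M X\<^esub> ar q\<^sub>1 (h t)"
        unfolding nat[symmetric] using tr2 t l s by (simp add: X.assoc)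
      also have "\<dots> = (?tr' \<cdot>\<^bsub>F0 M X\<^esub> ar q\<^sub>1 (h t')) \<cdot>\<^bsub>F0 M X\<^esub> ar q\<^sub>1 (g k)"
        unfolding q[symmetric] using tr2 t l s by (simp add: X.assoc)
      also have "\<dots> = ar q\<^sub>2 (h t') \<cdot>\<^bsub>F0 M X\<^esub> tr lam (y t') \<cdot>\<^bsub>F0 M X\<^esub> ar q\<^sub>1 (g k)"
        unfolding d2 using lam2 t l s by (simp add: X.assoc ob_comp)
      finally show "ar q\<^sub>2 (h t') \<cdot>\<^bsub>F0 M X\<^esub> ar q\<^sub>2 (g k) \<cdot>\<^bsub>F0 M X\<^esub> tr lam (y t) =
          ar q\<^sub>2 (h t') \<cdot>\<^bsub>F0 M X\<^esub> tr lam (y t') \<cdot>\<^bsub>F0 M X\<^esub> ar q\<^sub>1 (g k)" .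
    qed (use lam1 lam2 t l in \<open>simp_all add: ob_comp\<close>)
  qed
  define f where "f k = (THE h\<^sub>0. h\<^sub>0 \<in> homs (F0 M K) (y (Dom T k)) (y (Cod T k)) \<and> ar i h\<^sub>0 = g k)" for k
  have f: "f k \<in> homs (F0 M K) (y t) (y t')" "ar i (f k) = g k" if "k \<in> homs T t t'" for k t t'
    using theI'[OF ex[OF that]] that by (auto simp: f_def homs_iff)
  let ?u = "\<lparr>fdom = T, fcod = F0 M K, fob = (\<lambda>t\<in>Obj T. y t), far = (\<lambda>k\<in>Arr T. f k)\<rparr>"
  have u: "is_functor ?u"
  proof (intro is_functor.intro)
    fix k t t' assume "k \<in> homs (fdom ?u) t t'"
    then have k: "k \<in> homs T t t'" by simp
    then show "far ?u k \<in> homs (fcod ?u) (fob ?u t) (fob ?u t')"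
      using f(1)[OF k] T.homs_Obj[OF k] k by (simp add: homs_iff)
  next
    fix t assume "t \<in> Obj (fdom ?u)"
    then have t: "t \<in> Obj T" by simp
    have k: "Ident T t \<in> homs T t t" using t by (rule T.Ident_homs)
    have "f (Ident T t) = Ident (F0 M K) (y t)"
    proof (rule restriction_faithful[OF f(1)[OF k]])
      have "far (ps1 \<sigma> base) (Ident T t) = Ident (F0 M H) (fob (ps1 \<sigma> base) t)"
        using is_functor.far_Ident[OF s0c(1), of t] s0c t by simp
      then show "ar i (f (Ident T t)) = ar i (Ident (F0 M K) (y t))"
        using f(2)[OF k] t s0c inv_arr[OF iso[OF t]] by (simp add: g_def)
    qed (use t in \<open>simp add: MG.Ident_homs\<close>)
    then show "far ?u (Ident (fdom ?u) t) = Ident (fcod ?u) (fob ?u t)" using t by simp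
  next
    fix k l t t' t'' assume "k \<in> homs (fdom ?u) t t'" "l \<in> homs (fdom ?u) t' t''"
    then have k: "k \<in> homs T t t'" and l: "l \<in> homs T t' t''" by simp_all
    have t: "t \<in> Obj T" "t' \<in> Obj T" "t'' \<in> Obj T" using T.homs_Obj[OF k] T.homs_Obj[OF l] by auto
    have kl: "l \<cdot>\<^bsub>T\<^esub> k \<in> homs T t t''" using k l by (rule T.Comp_homs)
    have "f (l \<cdot>\<^bsub>T\<^esub> k) = f l \<cdot>\<^bsub>F0 M K\<^esub> f k"
    proof (rule restriction_faithful[OF f(1)[OF kl]])
      show "f l \<cdot>\<^bsub>F0 M K\<^esub> f k \<in> homs (F0 M K) (y t) (y t'')"
        using f(1)[OF k] f(1)[OF l] by (rule MG.Comp_homs)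
      have "g (l \<cdot>\<^bsub>T\<^esub> k) = g l \<cdot>\<^bsub>F0 M H\<^esub> g k"
      proof (rule MS.iso_mono[OF iso[OF t(3)]])
        have gs: "g k \<in> Arr (F0 M H)" "Dom (F0 M H) (g k) = ob i (y t)" "Cod (F0 M H) (g k) = ob i (y t')"
          "g l \<in> Arr (F0 M H)" "Dom (F0 M H) (g l) = ob i (y t')" "Cod (F0 M H) (g l) = ob i (y t'')"
          "g (l \<cdot>\<^bsub>T\<^esub> k) \<in> Arr (F0 M H)" "Cod (F0 M H) (g (l \<cdot>\<^bsub>T\<^esub> k)) = ob i (y t'')"
          using g(1)[OF k] g(1)[OF l] g(1)[OF kl] by (auto simp: homs_iff)
        then show "g (l \<cdot>\<^bsub>T\<^esub> k) \<in> Arr (F0 M H)" "g l \<cdot>\<^bsub>F0 M H\<^esub> g k \<in> Arr (F0 M H)"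
          "Cod (F0 M H) (g (l \<cdot>\<^bsub>T\<^esub> k)) = Dom (F0 M H) (h t'')"
          "Cod (F0 M H) (g l \<cdot>\<^bsub>F0 M H\<^esub> g k) = Dom (F0 M H) (h t'')"
          using t by simp_all
        have kl': "k \<in> Arr T" "l \<in> Arr T" "Dom T k = t" "Cod T k = t'" "Dom T l = t'" "Cod T l = t''"
          using k l by (auto simp: homs_iff)
        have "far (ps1 \<sigma> base) (l \<cdot>\<^bsub>T\<^esub> k) = far (ps1 \<sigma> base) l \<cdot>\<^bsub>F0 M H\<^esub> far (ps1 \<sigma> base) k"
          using is_functor.far_Comp'[OF s0c(1), of k l] s0c(2,3) kl' by simp
        then have "h t'' \<cdot>\<^bsub>F0 M H\<^esub> g (l \<cdot>\<^bsub>T\<^esub> k) =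
            (far (ps1 \<sigma> base) l \<cdot>\<^bsub>F0 M H\<^esub> far (ps1 \<sigma> base) k) \<cdot>\<^bsub>F0 M H\<^esub> h t"
          using g(2)[OF kl] by simp
        also have "\<dots> = far (ps1 \<sigma> base) l \<cdot>\<^bsub>F0 M H\<^esub> h t' \<cdot>\<^bsub>F0 M H\<^esub> g k"
          unfolding g(2)[OF k] using t kl' s0c(5-7) by (simp add: MS.assoc)
        also have "\<dots> = (h t'' \<cdot>\<^bsub>F0 M H\<^esub> g l) \<cdot>\<^bsub>F0 M H\<^esub> g k"
          unfolding g(2)[OF l] using t kl' s0c(5-7) gs by (simp add: MS.assoc)
        finally show "h t'' \<cdot>\<^bsub>F0 M H\<^esub> g (l \<cdot>\<^bsub>T\<^esub> k) = h t'' \<cdot>\<^bsub>F0 M H\<^esub> g l \<cdot>\<^bsub>F0 M H\<^esub> g k"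
          using t gs by (simp add: MS.assoc)
      qed
      then show "ar i (f (l \<cdot>\<^bsub>T\<^esub> k)) = ar i (f l \<cdot>\<^bsub>F0 M K\<^esub> f k)"
        using f[OF k] f[OF l] f(2)[OF kl] by (simp add: ar_Comp homs_iff)
    qed
    then show "far ?u (l \<cdot>\<^bsub>fdom ?u\<^esub> k) = far ?u l \<cdot>\<^bsub>fcod ?u\<^esub> far ?u k"
      using k l by (simp add: homs_iff)
  qed (auto simp: T)
  note pu = pre_component[OF u, simplified]
  let ?pre = "psnat_pre I Cat2 ?u \<pi>"
  define m where "m A t = ?\<phi> t (leg (snd A)) \<cdot>\<^bsub>F0 M (fst A)\<^esub> ar (snd A) (h t)" for A t
  have leg: "?\<phi> t (leg (snd A)) \<in> Arr (F0 M (fst A))" "Dom (F0 M (fst A)) (?\<phi> t (leg (snd A))) = ob (snd A) (fob (ps1 \<sigma> base) t)"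
    "Cod (F0 M (fst A)) (?\<phi> t (leg (snd A))) = fob (ps1 \<sigma> A) t" "iso_arrow (F0 M (fst A)) (?\<phi> t (leg (snd A)))"
    if A: "A \<in> trans_Ob G S" and t: "t \<in> Obj T" for A t
  proof -
    note AD = trans_ObD[OF A]
    have "(fst A, snd A) = A" by simp
    then show "?\<phi> t (leg (snd A)) \<in> Arr (F0 M (fst A))" "Dom (F0 M (fst A)) (?\<phi> t (leg (snd A))) = ob (snd A) (fob (ps1 \<sigma> base) t)"
      "Cod (F0 M (fst A)) (?\<phi> t (leg (snd A))) = fob (ps1 \<sigma> A) t" "iso_arrow (F0 M (fst A)) (?\<phi> t (leg (snd A)))"
      using \<phi>_leg[OF cone_pointwise[OF \<sigma> t] AD(1,3), unfolded AD(2)] by simp_all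
  qed
  have m: "m A t \<in> homs (F0 M (fst A)) (ob (snd A) (ob i (y t))) (fob (ps1 \<sigma> A) t)" "iso_arrow (F0 M (fst A)) (m A t)"
    if A: "A \<in> trans_Ob G S" and t: "t \<in> Obj T" for A t
  proof -
    note AD = trans_ObD[OF A]
    interpret P: category "F0 M (fst A)" using AD by simp
    show "m A t \<in> homs (F0 M (fst A)) (ob (snd A) (ob i (y t))) (fob (ps1 \<sigma> A) t)"
      using leg[OF A t] AD t by (simp add: m_def homs_iff)
    show "iso_arrow (F0 M (fst A)) (m A t)"
      unfolding m_def using leg[OF A t] AD t ar_iso[OF AD(1,3,2) iso[OF t]] by (intro P.iso_Comp) simp_all
  qed
  let ?mc = "\<lambda>A. \<lparr>ntdom = ps1 ?pre A, ntcod = ps1 \<sigma> A, ntc = (\<lambda>t\<in>Obj T. m A t)\<rparr>"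
  let ?\<Gamma> = "\<lparr>mdom = ?pre, mcod = \<sigma>, mc = (\<lambda>A\<in>trans_Ob G S. ?mc A)\<rparr>"
  have mc: "is_ntrans (?mc A)" if A: "A \<in> trans_Ob G S" for A
  proof (intro is_ntrans.intro)
    note AD = trans_ObD[OF A] and p = cone_component[OF pu(1) A] and c = cone_component[OF \<sigma> A]
    show "is_functor (ntdom (?mc A))" "is_functor (ntcod (?mc A))" "fdom (ntcod (?mc A)) = fdom (ntdom (?mc A))"
      "fcod (ntcod (?mc A)) = fcod (ntdom (?mc A))" "ntc (?mc A) \<in> extensional (Obj (fdom (ntdom (?mc A))))"
      using p c by simp_all
    show "ntc (?mc A) t \<in> homs (fcod (ntdom (?mc A))) (fob (ntdom (?mc A)) t) (fob (ntcod (?mc A)) t)"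
      if "t \<in> Obj (fdom (ntdom (?mc A)))" for t
      using that m(1)[OF A, of t] p A by (simp add: pu)
    fix k t t' assume "k \<in> homs (fdom (ntdom (?mc A))) t t'"
    then have k: "k \<in> homs T t t'" using p by simp
    have t: "t \<in> Obj T" "t' \<in> Obj T" and k': "k \<in> Arr T" "Dom T k = t" "Cod T k = t'"
      using T.homs_Obj[OF k] k by (auto simp: homs_iff)
    interpret P: category "F0 M (fst A)" using AD by simp
    have gk: "g k \<in> Arr (F0 M H)" "Dom (F0 M H) (g k) = ob i (y t)" "Cod (F0 M H) (g k) = ob i (y t')"
      using g(1)[OF k] by (auto simp: homs_iff)
    note s = s0c(5-7)[OF k'(1), unfolded k'(2,3)]
    have "m A t' \<cdot>\<^bsub>F0 M (fst A)\<^esub> ar (snd A) (g k) = ?\<phi> t' (leg (snd A)) \<cdot>\<^bsub>F0 M (fst A)\<^esub> ar (snd A) (h t' \<cdot>\<^bsub>F0 M H\<^esub> g k)"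
      unfolding m_def using leg[OF A t(2)] AD t gk by (simp add: ar_Comp P.assoc)
    also have "\<dots> = (?\<phi> t' (leg (snd A)) \<cdot>\<^bsub>F0 M (fst A)\<^esub> ar (snd A) (far (ps1 \<sigma> base) k)) \<cdot>\<^bsub>F0 M (fst A)\<^esub> ar (snd A) (h t)"
      unfolding g(2)[OF k] using leg[OF A t(2)] AD t s by (simp add: ar_Comp P.assoc)
    also have "?\<phi> t' (leg (snd A)) \<cdot>\<^bsub>F0 M (fst A)\<^esub> ar (snd A) (far (ps1 \<sigma> base) k) =
        far (ps1 \<sigma> A) k \<cdot>\<^bsub>F0 M (fst A)\<^esub> ?\<phi> t (leg (snd A))"
      using cone_cell(8)[OF \<sigma> leg_One[OF AD(1,3)] k] AD by simp
    also have "(far (ps1 \<sigma> A) k \<cdot>\<^bsub>F0 M (fst A)\<^esub> ?\<phi> t (leg (snd A))) \<cdot>\<^bsub>F0 M (fst A)\<^esub> ar (snd A) (h t) =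
        far (ps1 \<sigma> A) k \<cdot>\<^bsub>F0 M (fst A)\<^esub> m A t"
      unfolding m_def using leg[OF A t(1)] AD t c k' by (simp add: P.assoc)
    finally show "ntc (?mc A) t' \<cdot>\<^bsub>fcod (ntdom (?mc A))\<^esub> far (ntdom (?mc A)) k =
        far (ntcod (?mc A)) k \<cdot>\<^bsub>fcod (ntdom (?mc A))\<^esub> ntc (?mc A) t"
      using t k' p A f(2)[OF k] by (simp add: pu)
  qed
  have \<Gamma>: "pseudocone_map I Cat2 MU T ?\<Gamma>"
    unfolding pseudocone_map_def
  proof (intro conjI ballI)
    fix s assume "s \<in> One I"
    then have s: "s \<in> trans_One G S" by simp
    note sD = trans_OneD[OF s]
    note cs = cone_component[OF pu(1) sD(1)] and ct = cone_component[OF pu(1) sD(2)]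
      and ds = cone_component[OF \<sigma> sD(1)] and dt = cone_component[OF \<sigma> sD(2)]
    have w: "is_ntrans (hcomp (id_nt (F1 M (t1_fun s))) (?mc (t1_tgt s)))"
      using mc[OF sD(2)] ct sD pull_functor[OF sD(3)] by (intro hcomp) simp_all
    have "vcomp (ps2 \<sigma> s) (hcomp (id_nt (F1 M (t1_fun s))) (?mc (t1_tgt s))) = vcomp (?mc (t1_src s)) (ps2 ?pre s)"
    proof (rule ntrans_eqI)
      show "is_ntrans (vcomp (ps2 \<sigma> s) (hcomp (id_nt (F1 M (t1_fun s))) (?mc (t1_tgt s))))"
        using cone_cell(1,2)[OF \<sigma> s] w by (intro vcomp) simp_all
      show "is_ntrans (vcomp (?mc (t1_src s)) (ps2 ?pre s))"
        using mc[OF sD(1)] cone_cell(1,3)[OF pu(1) s] by (intro vcomp) simp_all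
      fix t assume "t \<in> Obj (fdom (ntdom (vcomp (ps2 \<sigma> s) (hcomp (id_nt (F1 M (t1_fun s))) (?mc (t1_tgt s))))))"
      then have t: "t \<in> Obj T" using ct by simp
      have "?\<phi> t s \<cdot>\<^bsub>F0 M (fst (t1_src s))\<^esub> ar (t1_fun s) (m (t1_tgt s) t) =
          m (t1_src s) t \<cdot>\<^bsub>F0 M (fst (t1_src s))\<^esub> tr (t1_nat s) (y t)"
        unfolding m_def by (rule leg_compatible[OF cone_pointwise[OF \<sigma> t] h[OF t] y[OF t] desc[OF t] s])
      then show "ntc (vcomp (ps2 \<sigma> s) (hcomp (id_nt (F1 M (t1_fun s))) (?mc (t1_tgt s)))) t =
          ntc (vcomp (?mc (t1_src s)) (ps2 ?pre s)) t"
        using t ct cs ds dt sD mc[OF sD(2)] pull_functor[OF sD(3)] cone_cell(2)[OF pu(1) s] pu(4)[OF s t]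
        by (simp del: hcomp_sel(3))
    qed (use cone_cell(2,3)[OF \<sigma> s] cone_cell(2,3)[OF pu(1) s] in simp_all)
    then show "VComp Cat2 (ps2 (mcod ?\<Gamma>) s) (HComp Cat2 (Id2 Cat2 (F1 MU s)) (mc ?\<Gamma> (Src I s))) =
        VComp Cat2 (mc ?\<Gamma> (Tgt I s)) (ps2 (mdom ?\<Gamma>) s)"
      using sD by simp
  qed (use pu(1) \<sigma> mc in simp_all)
  have "iso2 Cat2 (?mc A)" if A: "A \<in> trans_Ob G S" for A
  proof (rule natural_iso_iso2)
    show "natural_iso (?mc A)"
      using mc[OF A] m(2)[OF A] cone_component[OF pu(1) A] by (simp add: natural_iso_def)
  qed
  then have "iso_arrow (cones.cones T) ?\<Gamma>"
    using T \<Gamma> by (intro cones.iso_cones) simp_all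
  moreover have "?u \<in> Obj (fdom (cones.induced T))"
    using u by (simp add: induced_sel cells1_iff)
  moreover have "fob (cones.induced T) ?u = ?pre" using u by (simp add: cones.induced_def cells1_iff)
  ultimately show "\<exists>u\<in>Obj (fdom (cones.induced T)). \<exists>e\<in>homs (fcod (cones.induced T)) (fob (cones.induced T) u) \<sigma>.
      iso_arrow (fcod (cones.induced T)) e"
    using T \<Gamma> by (intro bexI[of _ ?u] bexI[of _ ?\<Gamma>]) (simp_all add: homs_iff induced_sel)
qed

end

lemma restriction_bilimit: "is_bilimit Cat2 I MU (F0 M K)"
proof -
  have "is_equivalence (cones.induced T)" if "T \<in> Ob Cat2" for T
    using that cones.induced_functor[OF that] induced_fully_faithful[of T] induced_essentially_surjective[of T]
    by (intro equivalenceI) simp_all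
  from cones.bilimitI[OF this] show ?thesis unfolding is_bilimit_def by blast
qed

end

section \<open>Sylow subgroups\<close>

lemma BG_sel [simp]: "Obj (BG G) = {\<one>\<^bsub>G\<^esub>}" "Arr (BG G) = carrier G" "Dom (BG G) x = \<one>\<^bsub>G\<^esub>" "Cod (BG G) x = \<one>\<^bsub>G\<^esub>"
  "Ident (BG G) x = \<one>\<^bsub>G\<^esub>" "Comp (BG G) = monoid.mult G"
  by (simp_all add: BG_def)

lemma finite_groupoid_BG:
  assumes G: "group G" and fin: "finite (carrier G)"
  shows "finite_groupoid (BG G)"
proof -
  interpret group G by fact
  have "category (BG G)"
    by (intro category.intro) (auto simp: homs_iff m_assoc)
  moreover have "iso_arrow (BG G) x" if "x \<in> carrier G" for x
    using that by (intro iso_arrowI[where g = "inv\<^bsub>G\<^esub> x" and x = "\<one>\<^bsub>G\<^esub>" and y = "\<one>\<^bsub>G\<^esub>"]) (auto simp: homs_iff)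
  ultimately show ?thesis using fin by (simp add: finite_groupoid_def groupoid_def)
qed

lemma BG_incl_One:
  assumes G: "group G" and fin: "finite (carrier G)" and S: "subgroup S G"
  shows "BG_incl G S \<in> One gpdf"
proof -
  let ?S = "G\<lparr>carrier := S\<rparr>"
  have sub: "S \<subseteq> carrier G" using S by (rule subgroup.subset)
  have "finite S" using sub fin by (rule finite_subset)
  then have fS: "finite_groupoid (BG ?S)"
    using subgroup.subgroup_is_group[OF S G] by (intro finite_groupoid_BG) simp_all
  note fG = finite_groupoid_BG[OF G fin]
  have sel: "fdom (BG_incl G S) = BG ?S" "fcod (BG_incl G S) = BG G" "fob (BG_incl G S) = (\<lambda>x\<in>{\<one>\<^bsub>G\<^esub>}. x)"
    "far (BG_incl G S) = (\<lambda>x\<in>S. x)"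
    by (simp_all add: BG_incl_def incl_functor_def)
  have "is_functor (BG_incl G S)"
    using fS fG sub subgroup.m_closed[OF S] subgroup.one_closed[OF S]
    by (intro is_functor.intro) (auto simp: sel homs_iff finite_groupoid_category)
  then have "faithful_functor (BG_incl G S)"
    by (rule faithful_functorI) (auto simp: sel)
  then show ?thesis using fS fG by (simp add: gpdf_sel(2) sel)
qed

text \<open>
  The index is the order divided by the full power of \<open>p\<close> in it.
\<close>

lemma sylow_index_coprime:
  assumes p: "prime p" and G: "group G" "finite (carrier G)" and S: "sylow_subgroup p G S"
  shows "coprime (card (rcosets\<^bsub>G\<^esub> S)) p"
proof -
  have sub: "subgroup S G" and card: "card S = p ^ multiplicity p (order G)"
    using S by (auto simp: sylow_subgroup_def)
  have "order G \<noteq> 0" using G by (simp add: order_def group.is_monoid monoid.carrier_not_empty)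
  moreover have "card (rcosets\<^bsub>G\<^esub> S) * p ^ multiplicity p (order G) = order G"
    using group.lagrange[OF G(1) sub] card by simp
  ultimately have "\<not> p dvd card (rcosets\<^bsub>G\<^esub> S)"
    using p multiplicity_decompose[of "order G" p]
    by (metis mult.commute nonzero_mult_div_cancel_left not_prime_unit power_eq_0_iff not_prime_0)
  then show ?thesis using p by (metis coprime_commute prime_imp_coprime)
qed

lemma equivalent_categories_refl:
  assumes "category A"
  shows "equivalent_categories A A"
proof -
  have "\<exists>x\<in>Obj A. \<exists>e\<in>homs A x y. iso_arrow A e" if "y \<in> Obj A" for y
    using that assms by (intro bexI[of _ y] bexI[of _ "Ident A y"]) (auto simp: category.iso_Ident homs_iff cat_simps)
  then have "is_equivalence (id_functor A)"
    using assms by (intro equivalenceI) (auto simp: fully_faithful_def essentially_surjective_def homs_iff)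
  then show ?thesis unfolding equivalent_categories_def by (intro exI[of _ "id_functor A"]) simp
qed

theorem theorem3p9:
  fixes p :: nat
    and M :: "('u::infinite, 'o, 'm) gpd_cat_twofun"
    and G :: "'u monoid"
    and S :: "'u set"
  assumes "prime p"
    and "mackey_2functor M"
    and "p_monadic p M"
    and "group G" and "finite (carrier G)"
    and "sylow_subgroup p G S"
  shows "\<exists>L. is_bilimit Cat2 (op2 (transporter G S)) (twofun_comp M transporter_forget) L \<and>
    equivalent_categories (F0 M (BG G)) L"
proof -
  have S: "subgroup S G" using assms(6) by (simp add: sylow_subgroup_def)
  interpret mackey_2functor M by fact
  have "is_equivalence (em_comparison L (F1 M (BG_incl G S)) \<eta> \<epsilon>)"
    if "adjunction L (F1 M (BG_incl G S)) \<eta> \<epsilon>" for L \<eta> \<epsilon>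
    using assms(3) that assms(4,5) S sylow_index_coprime[OF assms(1,4,5,6)] unfolding p_monadic_def by blast
  then interpret transporter_restriction M G S
    by unfold_locales (use BG_incl_One[OF assms(4,5) S] in auto)
  have "F0 M (BG G) = F0 M (fcod (BG_incl G S))" by (simp add: BG_incl_ends)
  moreover have "category (F0 M (BG G))"
    using finite_groupoid_BG[OF assms(4,5)] by simp
  ultimately show ?thesis
    using restriction_bilimit equivalent_categories_refl by metis
qed

end
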